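(* Let $X=X(\Delta)$ be the topological toric manifold associated with a non-singular topological fan $\Delta=(\Sigma,\beta)$ of dimension $n$. Then the category $\mathrm{TKVB}_X$ of topological Klyachko vector bundles over $X$ is equivalent to the category $\mathrm{TKVS}_X$, and the category $\mathrm{SKVB}_X$ of smooth Klyachko vector bundles over $X$ is equivalent to the category $\mathrm{SKVS}_X$.
   Context: **The ring $\mathcal R$.** Let $\mathcal R=\mathbb C\times\mathbb Z$, with elements written $\mu=(b+\sqrt{-1}c,v)$, $b,c\in\mathbb R$, $v\in\mathbb Z$. It is a ring via the bijection $\mu\mapsto\begin{pmatrix} b&0\\ c&v\end{pmatrix}$ with a ring of real $2\times2$ matrices: addition is componentwise and $\mu_1\mu_2=(b_1b_2+\sqrt{-1}(c_1b_2+v_1c_2),\,v_1v_2)$. Put $\mathbf 1=(1,1)$, $\mathbf 0=(0,0)$. For $g\in\mathbb C^*$ put $g^\mu=|g|^{b+\sqrt{-1}c}(g/|g|)^v$. For $\alpha=(\alpha^1,\dots,\alpha^n)$, $\beta=(\beta^1,\dots,\beta^n)\in\mathcal R^n$ put $\chi^\alpha(g_1,\dots,g_n)=\prod_k g_k^{\alpha^k}$, $\lambda_\beta(g)=(g^{\beta^1},\dots,g^{\beta^n})$ and $\langle\alpha,\beta\rangle=\sum_k\alpha^k\beta^k\in\mathcal R$. Write $\mathbb T=(\mathbb C^* )^n$. **Partial orders on $\mathcal R$.** For $\mu=(b+\sqrt{-1}c,v)$: $\mu\ge_c\mathbf 0$ iff $b>0$ or $b=c=v=0$; $\mu\ge_s\mathbf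 0$ iff $c=0$, $b\in\mathbb N$ and $b\pm v\in2\mathbb N$ (with $0\in\mathbb N$). Put $\mu\ge_\bullet\nu$ iff $\mu-\nu\ge_\bullet\mathbf 0$, for $\bullet\in\{c,s\}$. **Topological fans.** Let $\Sigma$ be a finite abstract simplicial complex of dimension $n-1$ (all simplices have at most $n$ elements and some simplex has exactly $n$ elements), together with $\emptyset$. Its vertex set is $\Sigma^{(1)}=\{1,\dots,m\}$, and $\Sigma^{(k)}$ is the set of $I\in\Sigma$ with $|I|=k$. Let $\beta:\Sigma^{(1)}\to\mathcal R^n=\mathbb C^n\times\mathbb Z^n$, $\beta_i=(b_i+\sqrt{-1}c_i,v_i)$. Write $\angle b_I$ for the cone in $\mathbb R^n$ spanned by $b_i$, $i\in I$. $\Delta=(\Sigma,\beta)$ is a topological fan of dimension $n$ if (1) for each $I\in\Sigma$ the $b_i$, $i\in I$, are linearly independent, and $\angle b_I\cap\angle b_J=\angle b_{I\cap J}$ for all $I,J\in\Sigma$; (2) each $v_i$ is primitive, and for each $I\in\Sigma$ the $v_i$, $i\in I$, are linearly independent over $\mathbb R$. It is non-singular if for each $I\in\Sigma$ the $v_i$, $i\in I$, form part of a $\mathbb Z$-basis of $\mathbb Z^n$. **The manifold $X(\Delta)$.** For $I\in\Sigma$ let $U(I)=\{z\in\mathbb C^m: z_i\ne0\ \forall i\notin I\}$, and $U(\Sigma)=\bigcup_{I\in\Sigma}U(I)$. Let $\lambda:(\mathbb C^* )^m\to\mathbb T$, $\lambda(h_1,\dots,h_m)=\prod_k\lambda_{\beta_k}(h_k)$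 (a surjective homomorphism). Then $X(\Delta)=U(\Sigma)/\mathrm{Ker}\,\lambda$ with the quotient topology and the action of $\mathbb T\cong(\mathbb C^* )^m/\mathrm{Ker}\,\lambda$, and $U_I=U(I)/\mathrm{Ker}\,\lambda$ is an invariant open subset. For $I\in\Sigma^{(n)}$ let $\{\alpha^I_i\}_{i\in I}\subset\mathcal R^n$ be dual to $\{\beta_i\}_{i\in I}$, i.e. $\langle\alpha^I_i,\beta_j\rangle=\delta_{ij}\mathbf 1$. The smooth structure of $X(\Delta)$ is given by the equivariant charts $\varphi_I:U_I\to\mathbb C^I$, $[z]\mapsto(\prod_{k=1}^m z_k^{\langle\alpha^I_i,\beta_k\rangle})_{i\in I}$, where $\mathbb T$ acts on the $i$-th coordinate of $\mathbb C^I$ by $\chi^{\alpha^I_i}$. **Klyachko vector bundles.** A topological (resp. smooth) Klyachko vector bundle of rank $r$ over $X$ is a $\mathbb T$-equivariant topological (resp. $C^\infty$) complex vector bundle $\mathcal E\to X$, with continuous (resp. smooth) action map $\mathbb T\times\mathcal E\to\mathcal E$, such that for every $I\in\Sigma$ the restriction $\mathcal E|_{U_I}$ is equivariantly homeomorphic (resp. diffeomorphic), as a vector bundle over $U_I$, to $U_I\times\mathbb C^r$, where $\mathbb T$ acts on $\mathbb C^r$ through a direct sum of continuous (equivalently smooth) characters of $\mathbb T$ and diagonally on the product. Morphisms in $\mathrm{TKVB}_X$ (resp. $\mathrm{SKVB}_X$) are $\mathbb T$-equivariant continuous (resp. smooth) vector bundle morphisms over $\mathrm{id}_X$, $\mathbb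 C$-linear on fibers. **The categories $\mathrm{TKVS}_X$ and $\mathrm{SKVS}_X$.** For $I\in\Sigma$ put $\beta_I^\perp=\{\alpha\in\mathcal R^n:\langle\alpha,\beta_i\rangle=\mathbf 0\ \forall i\in I\}$. An object of $\mathrm{TKVS}_X$ is a finite-dimensional complex vector space $E$ with a family of subspaces $E^i(\mu)\subset E$, indexed by $i\in\Sigma^{(1)}$, $\mu\in\mathcal R$, such that for every $I\in\Sigma$ there exists a grading $E=\bigoplus_{[\chi]\in\mathcal R^n/\beta_I^\perp}E_{[\chi]}$ with $E^i(\mu)=\sum_{\langle\chi,\beta_i\rangle\ge_c\mu}E_{[\chi]}$ for all $i\in I$ and $\mu\in\mathcal R$. A morphism $(E,\{E^i(\mu)\})\to(F,\{F^i(\mu)\})$ is a $\mathbb C$-linear map $f:E\to F$ with $f(E^i(\mu))\subset F^i(\mu)$ for all $i\in\Sigma^{(1)}$, $\mu\in\mathcal R$. $\mathrm{SKVS}_X$ is defined in the same way with $\ge_c$ replaced by $\ge_s$. *)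

theory Defs
  imports "HOL-Analysis.Analysis" "HOL-Algebra.Module"
begin

section \<open>The ring \<open>\<R> = \<complex> \<times> \<int>\<close>\<close>

text \<open>\<open>RR w v\<close> is the pair \<open>(w, v)\<close>.  It corresponds to the real matrix with rows
  \<open>(Re w, 0)\<close> and \<open>(Im w, v)\<close>, whence the (non-commutative) product.\<close>

datatype rr = RR (cpart: complex) (zpart: int)

instantiation rr :: ring_1
begin

definition zero_rr :: rr where "0 = RR 0 0"
definition one_rr :: rr where "1 = RR 1 1"
definition plus_rr :: "rr \<Rightarrow> rr \<Rightarrow> rr" where
  "x + y = RR (cpart x + cpart y) (zpart x + zpart y)"
definition uminus_rr :: "rr \<Rightarrow> rr" where
  "- x = RR (- cpart x) (- zpart x)"
definition minus_rr :: "rr \<Rightarrow> rr \<Rightarrow> rr" where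
  "x - y = RR (cpart x - cpart y) (zpart x - zpart y)"
definition times_rr :: "rr \<Rightarrow> rr \<Rightarrow> rr" where
  "x * y = RR (Complex (Re (cpart x) * Re (cpart y))
                       (Im (cpart x) * Re (cpart y) + of_int (zpart x) * Im (cpart y)))
              (zpart x * zpart y)"

instance
  by standard
    (auto simp: zero_rr_def one_rr_def plus_rr_def uminus_rr_def minus_rr_def times_rr_def
      complex_eq_iff algebra_simps)

end

definition ge_c :: "rr \<Rightarrow> rr \<Rightarrow> bool" where
  "ge_c \<mu> \<nu> \<longleftrightarrow> Re (cpart (\<mu> - \<nu>)) > 0 \<or> \<mu> - \<nu> = 0"

definition ge_s :: "rr \<Rightarrow> rr \<Rightarrow> bool" where
  "ge_s \<mu> \<nu> \<longleftrightarrow> Im (cpart (\<mu> - \<nu>)) = 0 \<and>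
     (\<exists>b p q :: nat. Re (cpart (\<mu> - \<nu>)) = real b \<and>
        int b + zpart (\<mu> - \<nu>) = 2 * int p \<and> int b - zpart (\<mu> - \<nu>) = 2 * int q)"

text \<open>\<open>rpow g \<mu>\<close> is \<open>g\<^sup>\<mu> = |g|\<^bsup>b+ic\<^esup> (g/|g|)\<^sup>v\<close> for \<open>g \<noteq> 0\<close>.  For \<open>g = 0\<close> the right-hand side below
  gives \<open>0\<^sup>0 = 1\<close> and \<open>0\<^sup>\<mu> = 0\<close> for \<open>\<mu> \<noteq> 0\<close>, as needed in the charts, where a vanishing
  coordinate only ever occurs with exponent \<open>0\<close> or \<open>1\<close>.\<close>

definition rpow :: "complex \<Rightarrow> rr \<Rightarrow> complex" where
  "rpow g \<mu> = (if \<mu> = 0 then 1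
     else complex_of_real (cmod g) powr cpart \<mu> * (g / complex_of_real (cmod g)) powi zpart \<mu>)"

definition pairing :: "rr ^ 'n \<Rightarrow> rr ^ 'n \<Rightarrow> rr" where
  "pairing \<alpha> \<beta> = (\<Sum>k\<in>UNIV. \<alpha> $ k * \<beta> $ k)"

definition torus :: "(complex ^ 'k) set" where
  "torus = {g. \<forall>k. g $ k \<noteq> 0}"

definition lam :: "rr ^ 'n \<Rightarrow> complex \<Rightarrow> complex ^ 'n" where
  "lam \<beta> g = (\<chi> k. rpow g (\<beta> $ k))"


section \<open>Topological fans\<close>

text \<open>The dimension is \<open>CARD('n)\<close> and the vertex set is the finite type \<open>'m\<close>.\<close>

definition bvec :: "rr ^ 'n \<Rightarrow> real ^ 'n" where
  "bvec \<beta> = (\<chi> k. Re (cpart (\<beta> $ k)))"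

definition vvec :: "rr ^ 'n \<Rightarrow> int ^ 'n" where
  "vvec \<beta> = (\<chi> k. zpart (\<beta> $ k))"

definition real_vec :: "int ^ 'n \<Rightarrow> real ^ 'n" where
  "real_vec v = (\<chi> k. of_int (v $ k))"

definition simplicial_complex :: "'m::finite set set \<Rightarrow> nat \<Rightarrow> bool" where
  "simplicial_complex \<Sigma> n \<longleftrightarrow>
     {} \<in> \<Sigma> \<and> (\<forall>i. {i} \<in> \<Sigma>) \<and> (\<forall>I\<in>\<Sigma>. \<forall>J. J \<subseteq> I \<longrightarrow> J \<in> \<Sigma>) \<and>
     (\<forall>I\<in>\<Sigma>. card I \<le> n) \<and> (\<exists>I\<in>\<Sigma>. card I = n)"

definition lin_indep_family :: "('m \<Rightarrow> 'a::real_vector) \<Rightarrow> 'm set \<Rightarrow> bool" where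
  "lin_indep_family w I \<longleftrightarrow> inj_on w I \<and> independent (w ` I)"

definition cone_of :: "('m \<Rightarrow> rr ^ 'n) \<Rightarrow> 'm set \<Rightarrow> (real ^ 'n) set" where
  "cone_of \<beta> I = convex_cone hull ((\<lambda>i. bvec (\<beta> i)) ` I)"

definition primitive :: "int ^ 'n \<Rightarrow> bool" where
  "primitive v \<longleftrightarrow> Gcd (range (\<lambda>k. v $ k)) = 1"

definition topological_fan :: "'m::finite set set \<Rightarrow> ('m \<Rightarrow> rr ^ 'n) \<Rightarrow> bool" where
  "topological_fan \<Sigma> \<beta> \<longleftrightarrow>
     simplicial_complex \<Sigma> CARD('n) \<and>
     (\<forall>I\<in>\<Sigma>. lin_indep_family (\<lambda>i. bvec (\<beta> i)) I) \<and>
     (\<forall>I\<in>\<Sigma>. \<forall>J\<in>\<Sigma>. cone_of \<beta> I \<inter> cone_of \<beta> J = cone_of \<beta> (I \<inter> J)) \<and>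
     (\<forall>i. primitive (vvec (\<beta> i))) \<and>
     (\<forall>I\<in>\<Sigma>. lin_indep_family (\<lambda>i. real_vec (vvec (\<beta> i))) I)"

definition Z_basis :: "('n \<Rightarrow> int ^ 'n) \<Rightarrow> bool" where
  "Z_basis w \<longleftrightarrow> (\<forall>x. \<exists>!c :: 'n \<Rightarrow> int. x = (\<Sum>k\<in>UNIV. c k *s w k))"

definition part_of_Z_basis :: "('m \<Rightarrow> int ^ 'n) \<Rightarrow> 'm set \<Rightarrow> bool" where
  "part_of_Z_basis v I \<longleftrightarrow>
     (\<exists>w \<sigma>. Z_basis w \<and> inj_on \<sigma> I \<and> (\<forall>i\<in>I. v i = w (\<sigma> i)))"

definition nonsingular_fan :: "'m::finite set set \<Rightarrow> ('m \<Rightarrow> rr ^ 'n) \<Rightarrow> bool" where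
  "nonsingular_fan \<Sigma> \<beta> \<longleftrightarrow>
     topological_fan \<Sigma> \<beta> \<and> (\<forall>I\<in>\<Sigma>. part_of_Z_basis (\<lambda>i. vvec (\<beta> i)) I)"


section \<open>The spaces \<open>\<complex>\<^sup>I\<close> and smooth manifolds modelled on them\<close>

definition cspace :: "'i set \<Rightarrow> ('i \<Rightarrow> complex) topology" where
  "cspace I = product_topology (\<lambda>_. euclidean) I"

text \<open>\<open>Ck_on k I S f\<close>: the function \<open>f\<close> is \<open>C\<^sup>k\<close> on the open set \<open>S \<subseteq> \<complex>\<^sup>I\<close> in the real sense, i.e.
  all iterated partial derivatives of order at most \<open>k\<close> with respect to the real and imaginary
  parts (directions \<open>1\<close> and \<open>\<i>\<close>) of the coordinates exist and are continuous.\<close>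

primrec Ck_on :: "nat \<Rightarrow> 'i set \<Rightarrow> ('i \<Rightarrow> complex) set \<Rightarrow> (('i \<Rightarrow> complex) \<Rightarrow> complex) \<Rightarrow> bool" where
  "Ck_on 0 I S f \<longleftrightarrow> continuous_map (subtopology (cspace I) S) euclidean f"
| "Ck_on (Suc k) I S f \<longleftrightarrow>
     continuous_map (subtopology (cspace I) S) euclidean f \<and>
     (\<forall>i\<in>I. \<forall>d\<in>{1, \<i>}. \<exists>f'.
        (\<forall>x\<in>S. ((\<lambda>t::real. f (x(i := x i + of_real t * d))) has_vector_derivative f' x) (at 0)) \<and>
        Ck_on k I S f')"

definition smooth_fun :: "'i set \<Rightarrow> ('i \<Rightarrow> complex) set \<Rightarrow> (('i \<Rightarrow> complex) \<Rightarrow> complex) \<Rightarrow> bool" where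
  "smooth_fun I S f \<longleftrightarrow> (\<forall>k. Ck_on k I S f)"

text \<open>A chart \<open>(I, U, \<phi>)\<close> is a map \<open>\<phi>\<close> from \<open>U\<close> to \<open>\<complex>\<^sup>I\<close>.  All manifolds in question have even real
  dimension, so real coordinates are grouped in pairs.\<close>

type_synonym ('a, 'i) atlas = "('i set \<times> 'a set \<times> ('a \<Rightarrow> 'i \<Rightarrow> complex)) set"

record ('a, 'i) mfd =
  mtop :: "'a topology"
  matlas :: "('a, 'i) atlas"

text \<open>The Hausdorff property and second countability are not part of this definition.  It is only
  applied to total spaces of vector bundles over a toric manifold, which inherit both properties
  from the base by local triviality.\<close>

definition smooth_mfd :: "('a, 'i) mfd \<Rightarrow> bool" where
  "smooth_mfd M \<longleftrightarrow>
     (\<Union>(I, U, \<phi>)\<in>matlas M. U) = topspace (mtop M) \<and>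
     (\<forall>(I, U, \<phi>)\<in>matlas M.
        finite I \<and> openin (mtop M) U \<and> openin (cspace I) (\<phi> ` U) \<and>
        homeomorphic_map (subtopology (mtop M) U) (subtopology (cspace I) (\<phi> ` U)) \<phi>) \<and>
     (\<forall>(I, U, \<phi>)\<in>matlas M. \<forall>(J, V, \<psi>)\<in>matlas M. \<forall>j\<in>J.
        smooth_fun I (\<phi> ` (U \<inter> V)) (\<lambda>w. \<psi> (inv_into U \<phi> w) j))"

definition smooth_map :: "('a, 'i) mfd \<Rightarrow> ('b, 'j) mfd \<Rightarrow> ('a \<Rightarrow> 'b) \<Rightarrow> bool" where
  "smooth_map M N f \<longleftrightarrow>
     continuous_map (mtop M) (mtop N) f \<and>
     (\<forall>(I, U, \<phi>)\<in>matlas M. \<forall>(J, V, \<psi>)\<in>matlas N. \<forall>j\<in>J.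
        smooth_fun I (\<phi> ` (U \<inter> f -` V)) (\<lambda>w. \<psi> (f (inv_into U \<phi> w)) j))"

definition diffeo :: "('a, 'i) mfd \<Rightarrow> ('b, 'j) mfd \<Rightarrow> ('a \<Rightarrow> 'b) \<Rightarrow> bool" where
  "diffeo M N f \<longleftrightarrow>
     bij_betw f (topspace (mtop M)) (topspace (mtop N)) \<and>
     smooth_map M N f \<and> smooth_map N M (inv_into (topspace (mtop M)) f)"

definition open_submfd :: "('a, 'i) mfd \<Rightarrow> 'a set \<Rightarrow> ('a, 'i) mfd" where
  "open_submfd M W =
     \<lparr>mtop = subtopology (mtop M) W, matlas = {(I, U \<inter> W, \<phi>) | I U \<phi>. (I, U, \<phi>) \<in> matlas M}\<rparr>"

text \<open>\<open>\<complex>\<^sup>I \<times> \<complex>\<^sup>J\<close> is identified with \<open>\<complex>\<^sup>K\<close>, where \<open>K\<close> is the disjoint union of \<open>I\<close> and \<open>J\<close>.\<close>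

definition prod_mfd :: "('a, 'i) mfd \<Rightarrow> ('b, 'j) mfd \<Rightarrow> ('a \<times> 'b, 'i + 'j) mfd" where
  "prod_mfd M N =
     \<lparr>mtop = prod_topology (mtop M) (mtop N),
      matlas = {(I <+> J, U \<times> V, \<lambda>(p, q). case_sum (\<phi> p) (\<psi> q)) | I U \<phi> J V \<psi>.
                  (I, U, \<phi>) \<in> matlas M \<and> (J, V, \<psi>) \<in> matlas N}\<rparr>"

definition cspace_mfd :: "'i set \<Rightarrow> ('i \<Rightarrow> complex, 'i) mfd" where
  "cspace_mfd I = \<lparr>mtop = cspace I, matlas = {(I, topspace (cspace I), \<lambda>w. w)}\<rparr>"

definition torus_mfd :: "(complex ^ 'n, 'n) mfd" where
  "torus_mfd = \<lparr>mtop = top_of_set torus, matlas = {(UNIV, torus, \<lambda>g k. g $ k)}\<rparr>"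


section \<open>The manifold \<open>X(\<Delta>)\<close>\<close>

definition U_simplex :: "'m::finite set \<Rightarrow> (complex ^ 'm) set" where
  "U_simplex I = {z. \<forall>i. i \<notin> I \<longrightarrow> z $ i \<noteq> 0}"

definition U_complex :: "'m::finite set set \<Rightarrow> (complex ^ 'm) set" where
  "U_complex \<Sigma> = (\<Union>I\<in>\<Sigma>. U_simplex I)"

definition Lam :: "('m::finite \<Rightarrow> rr ^ 'n) \<Rightarrow> complex ^ 'm \<Rightarrow> complex ^ 'n" where
  "Lam \<beta> h = (\<Prod>k\<in>UNIV. lam (\<beta> k) (h $ k))"

definition Ker_Lam :: "('m::finite \<Rightarrow> rr ^ 'n) \<Rightarrow> (complex ^ 'm) set" where
  "Ker_Lam \<beta> = {h \<in> torus. Lam \<beta> h = 1}"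

text \<open>Points of \<open>X(\<Delta>)\<close> are orbits of \<open>Ker \<lambda>\<close>; multiplication of vectors is componentwise.\<close>

definition ker_orbit :: "('m::finite \<Rightarrow> rr ^ 'n) \<Rightarrow> complex ^ 'm \<Rightarrow> (complex ^ 'm) set" where
  "ker_orbit \<beta> z = (\<lambda>h. h * z) ` Ker_Lam \<beta>"

definition quotient_topology :: "'a topology \<Rightarrow> ('a \<Rightarrow> 'b) \<Rightarrow> 'b topology" where
  "quotient_topology T q =
     topology (\<lambda>W. W \<subseteq> q ` topspace T \<and> openin T {x \<in> topspace T. q x \<in> W})"

lemma openin_quotient_topology:
  "openin (quotient_topology T q) W \<longleftrightarrow>
     W \<subseteq> q ` topspace T \<and> openin T {x \<in> topspace T. q x \<in> W}"
proof -
  have "istopology (\<lambda>W. W \<subseteq> q ` topspace T \<and> openin T {x \<in> topspace T. q x \<in> W})"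
    unfolding istopology_def
  proof (intro conjI allI impI)
    fix V W
    assume "V \<subseteq> q ` topspace T \<and> openin T {x \<in> topspace T. q x \<in> V}"
      "W \<subseteq> q ` topspace T \<and> openin T {x \<in> topspace T. q x \<in> W}"
    then have "openin T ({x \<in> topspace T. q x \<in> V} \<inter> {x \<in> topspace T. q x \<in> W})" by blast
    moreover have "{x \<in> topspace T. q x \<in> V} \<inter> {x \<in> topspace T. q x \<in> W}
        = {x \<in> topspace T. q x \<in> V \<inter> W}" by auto
    ultimately show "openin T {x \<in> topspace T. q x \<in> V \<inter> W}" by simp
  next
    fix \<K>
    assume "\<forall>K\<in>\<K>. K \<subseteq> q ` topspace T \<and> openin T {x \<in> topspace T. q x \<in> K}"
    then have "openin T (\<Union>K\<in>\<K>. {x \<in> topspace T. q x \<in> K})" by blast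
    moreover have "(\<Union>K\<in>\<K>. {x \<in> topspace T. q x \<in> K}) = {x \<in> topspace T. q x \<in> \<Union>\<K>}" by auto
    ultimately show "openin T {x \<in> topspace T. q x \<in> \<Union>\<K>}" by simp
  qed auto
  then show ?thesis by (simp add: quotient_topology_def topology_inverse')
qed

lemma quotient_map_quotient_topology: "quotient_map T (quotient_topology T q) q"
proof -
  have "openin (quotient_topology T q) (q ` topspace T)"
    proof -
    have "{x \<in> topspace T. q x \<in> q ` topspace T} = topspace T" by auto
    then show ?thesis by (simp add: openin_quotient_topology)
  qed
  then have "topspace (quotient_topology T q) = q ` topspace T"
    by (metis openin_quotient_topology openin_subset openin_topspace subset_antisym)
  then show ?thesis by (auto simp: quotient_map_def openin_quotient_topology)
qed

definition toric_top :: "'m::finite set set \<Rightarrow> ('m \<Rightarrow> rr ^ 'n) \<Rightarrow> (complex ^ 'm) set topology" where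
  "toric_top \<Sigma> \<beta> = quotient_topology (top_of_set (U_complex \<Sigma>)) (ker_orbit \<beta>)"

definition toric_open :: "('m::finite \<Rightarrow> rr ^ 'n) \<Rightarrow> 'm set \<Rightarrow> (complex ^ 'm) set set" where
  "toric_open \<beta> I = ker_orbit \<beta> ` U_simplex I"

text \<open>The action of \<open>g \<in> \<T>\<close> on an orbit \<open>p\<close> is by any \<open>h \<in> (\<complex>\<^sup>*)\<^sup>m\<close> with \<open>\<lambda>(h) = g\<close>; the union over
  all such \<open>h\<close> is again a single orbit.\<close>

definition toric_act ::
  "('m::finite \<Rightarrow> rr ^ 'n) \<Rightarrow> complex ^ 'n \<Rightarrow> (complex ^ 'm) set \<Rightarrow> (complex ^ 'm) set" where
  "toric_act \<beta> g p = {h * z | h z. h \<in> torus \<and> Lam \<beta> h = g \<and> z \<in> p}"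

definition dual_on :: "('m \<Rightarrow> rr ^ 'n) \<Rightarrow> ('m \<Rightarrow> rr ^ 'n) \<Rightarrow> 'm set \<Rightarrow> bool" where
  "dual_on \<alpha> \<gamma> J \<longleftrightarrow> (\<forall>i\<in>J. \<forall>j\<in>J. pairing (\<alpha> i) (\<gamma> j) = (if i = j then 1 else 0))"

definition facet :: "'m set set \<Rightarrow> 'm set \<Rightarrow> bool" where
  "facet \<Sigma> I \<longleftrightarrow> I \<in> \<Sigma> \<and> (\<forall>J\<in>\<Sigma>. I \<subseteq> J \<longrightarrow> J = I)"

text \<open>The value does not depend on the chosen representative \<open>z\<close> of \<open>p\<close> when \<open>p\<close> is in the domain
  of the chart.\<close>

definition toric_chart :: "('m::finite \<Rightarrow> rr ^ 'n) \<Rightarrow> 'm set \<Rightarrow> ('m \<Rightarrow> rr ^ 'n) \<Rightarrow>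
    (complex ^ 'm) set \<Rightarrow> 'm \<Rightarrow> complex" where
  "toric_chart \<beta> J \<alpha> p =
     (let z = (SOME z. z \<in> p) in (\<lambda>i\<in>J. \<Prod>k\<in>UNIV. rpow (z $ k) (pairing (\<alpha> i) (\<beta> k))))"

text \<open>If \<open>I\<close> has \<open>n\<close> elements, the condition below forces \<open>J = I\<close> and \<open>\<alpha>\<close> is the family dual to
  \<open>\<beta>\<^sub>i\<close>, \<open>i \<in> I\<close>, so for a pure complex these are the charts \<open>\<phi>\<^sub>I : U\<^sub>I \<rightarrow> \<complex>\<^sup>I\<close>, \<open>I \<in> \<Sigma>\<^bsup>(n)\<^esup>\<close>.  As purity is
  not part of the definition of a topological fan, a facet \<open>I\<close> with fewer than \<open>n\<close> elements gets
  charts as well: \<open>\<beta>\<^sub>i\<close>, \<open>i \<in> I\<close>, is completed to a basis \<open>\<gamma>\<^sub>j\<close> of \<open>\<R>\<^sup>n\<close> indexed by an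
  \<open>n\<close>-element set \<open>J \<supseteq> I\<close> of vertices, and the chart with the same formula identifies \<open>U\<^sub>I\<close> with
  the set of \<open>w \<in> \<complex>\<^sup>J\<close> such that \<open>w\<^sub>j \<noteq> 0\<close> for \<open>j \<notin> I\<close>.\<close>

definition toric_atlas :: "'m::finite set set \<Rightarrow> ('m \<Rightarrow> rr ^ 'n) \<Rightarrow> ((complex ^ 'm) set, 'm) atlas" where
  "toric_atlas \<Sigma> \<beta> =
     {(J, toric_open \<beta> I, toric_chart \<beta> J \<alpha>) | I J \<alpha>.
        facet \<Sigma> I \<and> I \<subseteq> J \<and> card J = CARD('n) \<and>
        (\<exists>\<gamma>. (\<forall>i\<in>I. \<gamma> i = \<beta> i) \<and> dual_on \<alpha> \<gamma> J)}"

definition toric_mfd :: "'m::finite set set \<Rightarrow> ('m \<Rightarrow> rr ^ 'n) \<Rightarrow> ((complex ^ 'm) set, 'm) mfd" where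
  "toric_mfd \<Sigma> \<beta> = \<lparr>mtop = toric_top \<Sigma> \<beta>, matlas = toric_atlas \<Sigma> \<beta>\<rparr>"


section \<open>Complex vector spaces\<close>

text \<open>The fields \<open>mult\<close> and \<open>one\<close> of the \<open>module\<close> record play no role.\<close>

definition C_ring :: "complex ring" where
  "C_ring = \<lparr>carrier = UNIV, mult = (*), one = 1, zero = 0, add = (+)\<rparr>"

lemma cring_C_ring: "cring C_ring"
proof (rule cringI)
  show "abelian_group C_ring"
    by (rule abelian_groupI) (auto simp: C_ring_def intro: exI[of _ "- x" for x] left_minus)
  show "Group.comm_monoid C_ring"
    by (rule comm_monoidI) (auto simp: C_ring_def)
qed (auto simp: C_ring_def algebra_simps)

abbreviation cvector_space :: "(complex, 'v) module \<Rightarrow> bool" where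
  "cvector_space M \<equiv> module C_ring M"

abbreviation csubspace :: "'v set \<Rightarrow> (complex, 'v) module \<Rightarrow> bool" where
  "csubspace W M \<equiv> submodule W C_ring M"

definition finite_dim :: "(complex, 'v) module \<Rightarrow> bool" where
  "finite_dim M \<longleftrightarrow>
     (\<exists>B. finite B \<and> B \<subseteq> carrier M \<and>
        (\<forall>x\<in>carrier M. \<exists>c. x = finsum M (\<lambda>b. c b \<odot>\<^bsub>M\<^esub> b) B))"

definition clinear_map :: "(complex, 'v) module \<Rightarrow> (complex, 'w) module \<Rightarrow> ('v \<Rightarrow> 'w) \<Rightarrow> bool" where
  "clinear_map M N f \<longleftrightarrow>
     f \<in> carrier M \<rightarrow> carrier N \<and>
     (\<forall>x\<in>carrier M. \<forall>y\<in>carrier M. f (x \<oplus>\<^bsub>M\<^esub> y) = f x \<oplus>\<^bsub>N\<^esub> f y) \<and>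
     (\<forall>c. \<forall>x\<in>carrier M. f (c \<odot>\<^bsub>M\<^esub> x) = c \<odot>\<^bsub>N\<^esub> f x)"

definition cvec :: "nat \<Rightarrow> (complex, nat \<Rightarrow> complex) module" where
  "cvec r = \<lparr>carrier = PiE {..<r} (\<lambda>_. UNIV), mult = undefined, one = undefined,
     zero = (\<lambda>k\<in>{..<r}. 0), add = (\<lambda>x y. \<lambda>k\<in>{..<r}. x k + y k),
     smult = (\<lambda>c x. \<lambda>k\<in>{..<r}. c * x k)\<rparr>"

definition sum_of_subspaces :: "(complex, 'v) module \<Rightarrow> ('q \<Rightarrow> 'v set) \<Rightarrow> 'q set \<Rightarrow> 'v set" where
  "sum_of_subspaces M G Q =
     {finsum M g F | g F. finite F \<and> F \<subseteq> Q \<and> (\<forall>q\<in>F. g q \<in> G q)}"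

definition is_grading :: "(complex, 'v) module \<Rightarrow> ('q \<Rightarrow> 'v set) \<Rightarrow> 'q set \<Rightarrow> bool" where
  "is_grading M G Q \<longleftrightarrow>
     (\<forall>q\<in>Q. csubspace (G q) M) \<and>
     sum_of_subspaces M G Q = carrier M \<and>
     (\<forall>g F. finite F \<and> F \<subseteq> Q \<and> (\<forall>q\<in>F. g q \<in> G q) \<and> finsum M g F = \<zero>\<^bsub>M\<^esub> \<longrightarrow>
        (\<forall>q\<in>F. g q = \<zero>\<^bsub>M\<^esub>))"


section \<open>Categories and equivalences\<close>

text \<open>A morphism need not determine its domain and codomain, so composition and functors take
  the objects as additional arguments: \<open>ccomp C A B D g f\<close> is the composite of \<open>f : A \<rightarrow> B\<close>
  and \<open>g : B \<rightarrow> D\<close>.\<close>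

record ('o, 'a) cat =
  cobj :: "'o set"
  chom :: "'o \<Rightarrow> 'o \<Rightarrow> 'a set"
  cid :: "'o \<Rightarrow> 'a"
  ccomp :: "'o \<Rightarrow> 'o \<Rightarrow> 'o \<Rightarrow> 'a \<Rightarrow> 'a \<Rightarrow> 'a"

definition is_category :: "('o, 'a) cat \<Rightarrow> bool" where
  "is_category C \<longleftrightarrow>
     (\<forall>A\<in>cobj C. cid C A \<in> chom C A A) \<and>
     (\<forall>A\<in>cobj C. \<forall>B\<in>cobj C. \<forall>D\<in>cobj C. \<forall>f\<in>chom C A B. \<forall>g\<in>chom C B D.
        ccomp C A B D g f \<in> chom C A D) \<and>
     (\<forall>A\<in>cobj C. \<forall>B\<in>cobj C. \<forall>f\<in>chom C A B.
        ccomp C A A B f (cid C A) = f \<and> ccomp C A B B (cid C B) f = f) \<and>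
     (\<forall>A\<in>cobj C. \<forall>B\<in>cobj C. \<forall>D\<in>cobj C. \<forall>E\<in>cobj C.
        \<forall>f\<in>chom C A B. \<forall>g\<in>chom C B D. \<forall>h\<in>chom C D E.
          ccomp C A D E h (ccomp C A B D g f) = ccomp C A B E (ccomp C B D E h g) f)"

definition is_functor :: "('o, 'a) cat \<Rightarrow> ('p, 'b) cat \<Rightarrow>
    ('o \<Rightarrow> 'p) \<Rightarrow> ('o \<Rightarrow> 'o \<Rightarrow> 'a \<Rightarrow> 'b) \<Rightarrow> bool" where
  "is_functor C D Fo Fm \<longleftrightarrow>
     (\<forall>A\<in>cobj C. Fo A \<in> cobj D) \<and>
     (\<forall>A\<in>cobj C. \<forall>B\<in>cobj C. \<forall>f\<in>chom C A B. Fm A B f \<in> chom D (Fo A) (Fo B)) \<and>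
     (\<forall>A\<in>cobj C. Fm A A (cid C A) = cid D (Fo A)) \<and>
     (\<forall>A\<in>cobj C. \<forall>B\<in>cobj C. \<forall>E\<in>cobj C. \<forall>f\<in>chom C A B. \<forall>g\<in>chom C B E.
        Fm A E (ccomp C A B E g f) = ccomp D (Fo A) (Fo B) (Fo E) (Fm B E g) (Fm A B f))"

definition is_iso :: "('o, 'a) cat \<Rightarrow> 'o \<Rightarrow> 'o \<Rightarrow> 'a \<Rightarrow> bool" where
  "is_iso C A B f \<longleftrightarrow> f \<in> chom C A B \<and>
     (\<exists>g\<in>chom C B A. ccomp C A B A g f = cid C A \<and> ccomp C B A B f g = cid C B)"

definition natural_iso :: "('o, 'a) cat \<Rightarrow> ('p, 'b) cat \<Rightarrow>
    ('o \<Rightarrow> 'p) \<Rightarrow> ('o \<Rightarrow> 'o \<Rightarrow> 'a \<Rightarrow> 'b) \<Rightarrow> ('o \<Rightarrow> 'p) \<Rightarrow> ('o \<Rightarrow> 'o \<Rightarrow> 'a \<Rightarrow> 'b) \<Rightarrow>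
    ('o \<Rightarrow> 'b) \<Rightarrow> bool" where
  "natural_iso C D Fo Fm Go Gm \<eta> \<longleftrightarrow>
     (\<forall>A\<in>cobj C. is_iso D (Fo A) (Go A) (\<eta> A)) \<and>
     (\<forall>A\<in>cobj C. \<forall>B\<in>cobj C. \<forall>f\<in>chom C A B.
        ccomp D (Fo A) (Fo B) (Go B) (\<eta> B) (Fm A B f) =
        ccomp D (Fo A) (Go A) (Go B) (Gm A B f) (\<eta> A))"

definition equivalent_categories :: "('o, 'a) cat \<Rightarrow> ('p, 'b) cat \<Rightarrow> bool" where
  "equivalent_categories C D \<longleftrightarrow>
     is_category C \<and> is_category D \<and>
     (\<exists>Fo Fm Go Gm \<eta> \<epsilon>.
        is_functor C D Fo Fm \<and> is_functor D C Go Gm \<and>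
        natural_iso C C (\<lambda>A. A) (\<lambda>A B f. f)
          (\<lambda>A. Go (Fo A)) (\<lambda>A B f. Gm (Fo A) (Fo B) (Fm A B f)) \<eta> \<and>
        natural_iso D D (\<lambda>A. Fo (Go A)) (\<lambda>A B f. Fm (Go A) (Go B) (Gm A B f))
          (\<lambda>A. A) (\<lambda>A B f. f) \<epsilon>)"


section \<open>Klyachko vector bundles\<close>

text \<open>\<open>'p\<close>: points of the base, \<open>'g\<close>: elements of the group, \<open>'e\<close>: points of the total space.\<close>

record ('p, 'g, 'e) eq_bundle =
  total :: "'e topology"
  proj :: "'e \<Rightarrow> 'p"
  fzero :: "'p \<Rightarrow> 'e"
  fadd :: "'e \<Rightarrow> 'e \<Rightarrow> 'e"
  fscale :: "complex \<Rightarrow> 'e \<Rightarrow> 'e"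
  gact :: "'g \<Rightarrow> 'e \<Rightarrow> 'e"

record ('p, 'g, 'e) smooth_bundle = "('p, 'g, 'e) eq_bundle" +
  batlas :: "('e, nat) atlas"

definition part_over :: "('p, 'g, 'e, 'z) eq_bundle_scheme \<Rightarrow> 'p set \<Rightarrow> 'e set" where
  "part_over E U = {e \<in> topspace (total E). proj E e \<in> U}"

definition fiber :: "('p, 'g, 'e, 'z) eq_bundle_scheme \<Rightarrow> 'p \<Rightarrow> (complex, 'e) module" where
  "fiber E x = \<lparr>carrier = part_over E {x}, mult = undefined, one = undefined,
     zero = fzero E x, add = fadd E, smult = fscale E\<rparr>"

definition total_mfd :: "('p, 'g, 'e) smooth_bundle \<Rightarrow> ('e, nat) mfd" where
  "total_mfd E = \<lparr>mtop = total E, matlas = batlas E\<rparr>"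

definition linear_over :: "('p, 'g, 'e, 'z) eq_bundle_scheme \<Rightarrow> nat \<Rightarrow> 'p set \<Rightarrow>
    ('e \<Rightarrow> 'p \<times> (nat \<Rightarrow> complex)) \<Rightarrow> bool" where
  "linear_over E r U \<Phi> \<longleftrightarrow>
     (\<forall>e\<in>part_over E U. fst (\<Phi> e) = proj E e) \<and>
     (\<forall>x\<in>U. clinear_map (fiber E x) (cvec r) (\<lambda>e. snd (\<Phi> e)))"

definition top_trivialization :: "'p topology \<Rightarrow> ('p, 'g, 'e, 'z) eq_bundle_scheme \<Rightarrow> nat \<Rightarrow> 'p set \<Rightarrow>
    ('e \<Rightarrow> 'p \<times> (nat \<Rightarrow> complex)) \<Rightarrow> bool" where
  "top_trivialization X E r U \<Phi> \<longleftrightarrow>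
     homeomorphic_map (subtopology (total E) (part_over E U))
       (prod_topology (subtopology X U) (cspace {..<r})) \<Phi> \<and>
     linear_over E r U \<Phi>"

definition smooth_trivialization :: "('p, 'i) mfd \<Rightarrow> ('p, 'g, 'e) smooth_bundle \<Rightarrow> nat \<Rightarrow> 'p set \<Rightarrow>
    ('e \<Rightarrow> 'p \<times> (nat \<Rightarrow> complex)) \<Rightarrow> bool" where
  "smooth_trivialization X E r U \<Phi> \<longleftrightarrow>
     diffeo (open_submfd (total_mfd E) (part_over E U))
       (prod_mfd (open_submfd X U) (cspace_mfd {..<r})) \<Phi> \<and>
     linear_over E r U \<Phi>"

definition top_vector_bundle :: "'p topology \<Rightarrow> nat \<Rightarrow> ('p, 'g, 'e, 'z) eq_bundle_scheme \<Rightarrow> bool" where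
  "top_vector_bundle X r E \<longleftrightarrow>
     continuous_map (total E) X (proj E) \<and>
     (\<forall>x\<in>topspace X. cvector_space (fiber E x)) \<and>
     (\<forall>x\<in>topspace X. \<exists>U \<Phi>. openin X U \<and> x \<in> U \<and> top_trivialization X E r U \<Phi>)"

definition smooth_vector_bundle :: "('p, 'i) mfd \<Rightarrow> nat \<Rightarrow> ('p, 'g, 'e) smooth_bundle \<Rightarrow> bool" where
  "smooth_vector_bundle X r E \<longleftrightarrow>
     smooth_mfd (total_mfd E) \<and>
     smooth_map (total_mfd E) X (proj E) \<and>
     (\<forall>x\<in>topspace (mtop X). cvector_space (fiber E x)) \<and>
     (\<forall>x\<in>topspace (mtop X). \<exists>U \<Phi>. openin (mtop X) U \<and> x \<in> U \<and> smooth_trivialization X E r U \<Phi>)"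

text \<open>The algebraic part of the definition of a \<open>\<T>\<close>-equivariant vector bundle, given the action
  \<open>a\<close> on the base.\<close>

definition equivariant :: "(complex ^ 'n \<Rightarrow> 'p \<Rightarrow> 'p) \<Rightarrow>
    ('p, complex ^ 'n, 'e, 'z) eq_bundle_scheme \<Rightarrow> bool" where
  "equivariant a E \<longleftrightarrow>
     (\<forall>g\<in>torus. \<forall>e\<in>topspace (total E). gact E g e \<in> topspace (total E)) \<and>
     (\<forall>e\<in>topspace (total E). gact E 1 e = e) \<and>
     (\<forall>g\<in>torus. \<forall>h\<in>torus. \<forall>e\<in>topspace (total E). gact E (g * h) e = gact E g (gact E h e)) \<and>
     (\<forall>g\<in>torus. \<forall>e\<in>topspace (total E). proj E (gact E g e) = a g (proj E e)) \<and>
     (\<forall>g\<in>torus. \<forall>x\<in>proj E ` topspace (total E).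
        clinear_map (fiber E x) (fiber E (a g x)) (gact E g))"

definition continuous_character :: "(complex ^ 'n \<Rightarrow> complex) \<Rightarrow> bool" where
  "continuous_character c \<longleftrightarrow>
     continuous_on torus c \<and> (\<forall>g\<in>torus. c g \<noteq> 0) \<and>
     (\<forall>g\<in>torus. \<forall>h\<in>torus. c (g * h) = c g * c h)"

text \<open>\<open>\<Phi>\<close> is equivariant when \<open>\<T>\<close> acts on \<open>\<complex>\<^sup>r\<close> through a direct sum of characters.  Compatibility
  on the base component is automatic, since \<open>\<Phi>\<close> lies over the identity.\<close>

definition diagonalizes :: "('p, complex ^ 'n, 'e, 'z) eq_bundle_scheme \<Rightarrow> nat \<Rightarrow> 'p set \<Rightarrow>
    ('e \<Rightarrow> 'p \<times> (nat \<Rightarrow> complex)) \<Rightarrow> bool" where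
  "diagonalizes E r U \<Phi> \<longleftrightarrow>
     (\<exists>c. (\<forall>k<r. continuous_character (c k)) \<and>
        (\<forall>g\<in>torus. \<forall>e\<in>part_over E U. \<forall>k<r. snd (\<Phi> (gact E g e)) k = c k g * snd (\<Phi> e) k))"

type_synonym ('m, 'n, 'e) toric_bundle = "((complex ^ 'm) set, complex ^ 'n, 'e) eq_bundle"
type_synonym ('m, 'n, 'e) smooth_toric_bundle =
  "((complex ^ 'm) set, complex ^ 'n, 'e) smooth_bundle"

definition top_klyachko_bundle :: "'m::finite set set \<Rightarrow> ('m \<Rightarrow> rr ^ 'n) \<Rightarrow> nat \<Rightarrow>
    ('m, 'n, 'e) toric_bundle \<Rightarrow> bool" where
  "top_klyachko_bundle \<Sigma> \<beta> r E \<longleftrightarrow>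
     top_vector_bundle (toric_top \<Sigma> \<beta>) r E \<and>
     equivariant (toric_act \<beta>) E \<and>
     continuous_map (prod_topology (top_of_set torus) (total E)) (total E) (\<lambda>(g, e). gact E g e) \<and>
     (\<forall>I\<in>\<Sigma>. \<exists>\<Phi>. top_trivialization (toric_top \<Sigma> \<beta>) E r (toric_open \<beta> I) \<Phi> \<and>
        diagonalizes E r (toric_open \<beta> I) \<Phi>)"

definition smooth_klyachko_bundle :: "'m::finite set set \<Rightarrow> ('m \<Rightarrow> rr ^ 'n) \<Rightarrow> nat \<Rightarrow>
    ('m, 'n, 'e) smooth_toric_bundle \<Rightarrow> bool" where
  "smooth_klyachko_bundle \<Sigma> \<beta> r E \<longleftrightarrow>
     smooth_vector_bundle (toric_mfd \<Sigma> \<beta>) r E \<and>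
     equivariant (toric_act \<beta>) E \<and>
     smooth_map (prod_mfd torus_mfd (total_mfd E)) (total_mfd E) (\<lambda>(g, e). gact E g e) \<and>
     (\<forall>I\<in>\<Sigma>. \<exists>\<Phi>. smooth_trivialization (toric_mfd \<Sigma> \<beta>) E r (toric_open \<beta> I) \<Phi> \<and>
        diagonalizes E r (toric_open \<beta> I) \<Phi>)"

text \<open>Morphisms are functions on the total space; they are required to be \<open>undefined\<close> elsewhere so
  that equality of morphisms is equality of functions.\<close>

definition equivariant_morphism :: "('p, complex ^ 'n, 'e, 'y) eq_bundle_scheme \<Rightarrow>
    ('p, complex ^ 'n, 'f, 'z) eq_bundle_scheme \<Rightarrow> ('e \<Rightarrow> 'f) \<Rightarrow> bool" where
  "equivariant_morphism E F f \<longleftrightarrow>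
     f \<in> extensional (topspace (total E)) \<and>
     (\<forall>e\<in>topspace (total E). proj F (f e) = proj E e) \<and>
     (\<forall>x\<in>proj E ` topspace (total E). clinear_map (fiber E x) (fiber F x) f) \<and>
     (\<forall>g\<in>torus. \<forall>e\<in>topspace (total E). f (gact E g e) = gact F g (f e))"

definition TKVB :: "'m::finite set set \<Rightarrow> ('m \<Rightarrow> rr ^ 'n) \<Rightarrow>
    (('m, 'n, 'e) toric_bundle, 'e \<Rightarrow> 'e) cat" where
  "TKVB \<Sigma> \<beta> =
     \<lparr>cobj = {E. \<exists>r. top_klyachko_bundle \<Sigma> \<beta> r E},
      chom = (\<lambda>E F. {f. equivariant_morphism E F f \<and> continuous_map (total E) (total F) f}),
      cid = (\<lambda>E. \<lambda>e\<in>topspace (total E). e),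
      ccomp = (\<lambda>E F G g f. compose (topspace (total E)) g f)\<rparr>"

definition SKVB :: "'m::finite set set \<Rightarrow> ('m \<Rightarrow> rr ^ 'n) \<Rightarrow>
    (('m, 'n, 'e) smooth_toric_bundle, 'e \<Rightarrow> 'e) cat" where
  "SKVB \<Sigma> \<beta> =
     \<lparr>cobj = {E. \<exists>r. smooth_klyachko_bundle \<Sigma> \<beta> r E},
      chom = (\<lambda>E F. {f. equivariant_morphism E F f \<and> smooth_map (total_mfd E) (total_mfd F) f}),
      cid = (\<lambda>E. \<lambda>e\<in>topspace (total E). e),
      ccomp = (\<lambda>E F G g f. compose (topspace (total E)) g f)\<rparr>"


section \<open>Klyachko vector spaces\<close>

record ('m, 'v) kvs =
  kspace :: "(complex, 'v) module"
  kfil :: "'m \<Rightarrow> rr \<Rightarrow> 'v set"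

definition perp :: "('m \<Rightarrow> rr ^ 'n) \<Rightarrow> 'm set \<Rightarrow> (rr ^ 'n) set" where
  "perp \<beta> I = {\<alpha>. \<forall>i\<in>I. pairing \<alpha> (\<beta> i) = 0}"

definition perp_class :: "('m \<Rightarrow> rr ^ 'n) \<Rightarrow> 'm set \<Rightarrow> rr ^ 'n \<Rightarrow> (rr ^ 'n) set" where
  "perp_class \<beta> I \<alpha> = (\<lambda>\<gamma>. \<alpha> + \<gamma>) ` perp \<beta> I"

definition klyachko_space :: "(rr \<Rightarrow> rr \<Rightarrow> bool) \<Rightarrow> 'm::finite set set \<Rightarrow> ('m \<Rightarrow> rr ^ 'n) \<Rightarrow>
    ('m, 'v) kvs \<Rightarrow> bool" where
  "klyachko_space ge \<Sigma> \<beta> E \<longleftrightarrow>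
     cvector_space (kspace E) \<and> finite_dim (kspace E) \<and>
     (\<forall>i \<mu>. csubspace (kfil E i \<mu>) (kspace E)) \<and>
     (\<forall>I\<in>\<Sigma>. \<exists>G. is_grading (kspace E) G (range (perp_class \<beta> I)) \<and>
        (\<forall>i\<in>I. \<forall>\<mu>. kfil E i \<mu> =
           sum_of_subspaces (kspace E) G {perp_class \<beta> I \<alpha> | \<alpha>. ge (pairing \<alpha> (\<beta> i)) \<mu>}))"

definition KVS :: "(rr \<Rightarrow> rr \<Rightarrow> bool) \<Rightarrow> 'm::finite set set \<Rightarrow> ('m \<Rightarrow> rr ^ 'n) \<Rightarrow>
    (('m, 'v) kvs, 'v \<Rightarrow> 'v) cat" where
  "KVS ge \<Sigma> \<beta> =
     \<lparr>cobj = {E. klyachko_space ge \<Sigma> \<beta> E},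
      chom = (\<lambda>E F. {f. f \<in> extensional (carrier (kspace E)) \<and>
                clinear_map (kspace E) (kspace F) f \<and>
                (\<forall>i \<mu>. f ` kfil E i \<mu> \<subseteq> kfil F i \<mu>)}),
      cid = (\<lambda>E. \<lambda>x\<in>carrier (kspace E). x),
      ccomp = (\<lambda>E F G g f. compose (carrier (kspace E)) g f)\<rparr>"

definition TKVS :: "'m::finite set set \<Rightarrow> ('m \<Rightarrow> rr ^ 'n) \<Rightarrow> (('m, 'v) kvs, 'v \<Rightarrow> 'v) cat" where
  "TKVS = KVS ge_c"

definition SKVS :: "'m::finite set set \<Rightarrow> ('m \<Rightarrow> rr ^ 'n) \<Rightarrow> (('m, 'v) kvs, 'v \<Rightarrow> 'v) cat" where
  "SKVS = KVS ge_s"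

end

theory Submission
  imports Defs
begin

text \<open>A Klyachko bundle is recovered from its fibre over the base point \<open>x0\<close> of the open orbit,
  filtered by the vectors \<open>e\<close> for which \<open>t\<^bsup>-\<mu>\<^esup> \<lambda>\<^bsub>\<beta>\<^sub>i\<^esub>(t) e\<close> extends regularly to \<open>t = 0\<close>.  In coordinates
  diagonalizing the action over \<open>U\<^sub>I\<close>, with characters \<open>\<alpha>\<^sub>k\<close>, the coordinates of this curve are multiples
  of \<open>t\<^sup>\<nu>\<close> with \<open>\<nu> = \<langle>\<alpha>\<^sub>k, \<beta>\<^sub>i\<rangle> - \<mu>\<close>, and \<open>t\<^sup>\<nu>\<close> extends continuously (smoothly) exactly when \<open>\<nu> \<ge>\<^sub>c 0\<close>
  (\<open>\<nu> \<ge>\<^sub>s 0\<close>).  A linear map of fibres over \<open>x0\<close> with matrix \<open>a\<close> extends equivariantly over the open orbit by the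
  matrix \<open>a\<^sub>k\<^sub>l \<chi>\<^bsup>\<delta>\<^sub>k - \<alpha>\<^sub>l\<^esup>\<close>, and for a map respecting the filtrations all these entries are regular on \<open>U\<^sub>I\<close>.
  This gives morphisms of bundles and also, applied to two sets of coordinates of one filtered space,
  transition functions gluing the products \<open>U\<^sub>I \<times> \<complex>\<^sup>r\<close> to a bundle.\<close>

section \<open>Calculus of \<open>C\<^sup>k\<close> functions\<close>

text \<open>Smoothness is given by iterated partial derivatives in real and imaginary coordinate
  directions, so the smooth theory rests on a chain rule for such functions. After it a flag
  \<open>b\<close> lets the continuous and the smooth statement share every argument, and maps are
  handled through scalar regular functions. Regularity of the matrix entries does not suffice for
  gluing: the cocycle identity must also hold on the divisors, where powers of 0 occur. It does,
  because exponents \<open>\<ge>\<^sub>c 0\<close> cannot cancel, so powers of 0 are multiplicative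
  on them. The filtrations control the exponents only for vertices in \<open>I \<inter> J\<close>,
  which is exactly the simplex of \<open>U\<^sub>I \<inter> U\<^sub>J\<close>. Maximal simplices may
  have fewer than n vertices, so dual families come from completed bases. The functors are not
  written down: a bundle and a filtered space are linked by an isomorphism of the base fibre with
  the space, morphisms on both sides correspond, and choice of links yields the equivalence. Since
  objects live in fixed types, points and vectors have to be re-encoded through injections.\<close>

lemma topspace_cspace [simp]: "topspace (cspace I) = PiE I (\<lambda>_. UNIV)"
 by (simp add: cspace_def)

lemma continuous_map_coord: "i \<in> I ==> continuous_map (cspace I) euclidean (\<lambda>x. x i)"
 unfolding cspace_def by (rule continuous_map_product_projection)

lemma continuous_map_into_cspace:
 "continuous_map X (cspace I) f \<longleftrightarrow>
   f ` topspace X \<subseteq> extensional I \<and> (\<forall>i\<in>I. continuous_map X euclidean (\<lambda>x. f x i))"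
 unfolding cspace_def by (rule continuous_map_componentwise)

abbreviation has_partial :: "'i => complex => (('i => complex) => complex) => ('i => complex) => complex => bool" where
 "has_partial i d f x D \<equiv> ((\<lambda>t::real. f (x(i := x i + of_real t * d))) has_vector_derivative D) (at 0)"

lemma line_continuous_map:
 assumes "x \<in> topspace (cspace I)" "i \<in> I"
 shows "continuous_map euclideanreal (cspace I) (\<lambda>t. x(i := x i + of_real t * d))"
proof -
 have "continuous_map euclideanreal euclidean (\<lambda>t. (x(i := x i + of_real t * d)) j)" for j
 proof (cases "j = i")
  case True
  have "continuous_on UNIV (\<lambda>t. x i + of_real t * d)" by (intro continuous_intros)
  then show ?thesis using True by (simp add: continuous_map_iff_continuous2)
 qed auto
 then show ?thesis
  using assms by (auto simp: continuous_map_into_cspace PiE_def extensional_def)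
qed

lemma line_in_topspace:
 assumes "x \<in> topspace (cspace I)" "i \<in> I" shows "x(i := a) \<in> topspace (cspace I)"
 using assms by (auto simp: PiE_def extensional_def)

lemma line_eventually_in:
 assumes S: "openin (cspace I) S" and x: "x \<in> S" and i: "i \<in> I"
 shows "\<forall>\<^sub>F t in nhds (0::real). x(i := x i + of_real t * d) \<in> S"
proof -
 have x': "x \<in> topspace (cspace I)" using S x openin_subset by blast
 have "openin euclideanreal {t \<in> topspace euclideanreal. x(i := x i + of_real t * d) \<in> S}"
  by (rule openin_continuous_map_preimage[OF line_continuous_map[OF x' i] S])
 then have "open {t::real. x(i := x i + of_real t * d) \<in> S}" by simp
 moreover have "(0::real) \<in> {t::real. x(i := x i + of_real t * d) \<in> S}" using x by simp
 ultimately show ?thesis by (auto simp: eventually_nhds)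
qed

text \<open>With finitely many factors a basic open box contains one of uniform radius; this is the
  metric form of openness used in the estimates below.\<close>

lemma cspace_box:
 assumes S: "openin (cspace I) S" and fin: "finite I" and x: "x \<in> S"
 shows "\<exists>\<delta>>0. \<forall>z\<in>topspace (cspace I). (\<forall>i\<in>I. dist (z i) (x i) < \<delta>) --> z \<in> S"
proof -
 obtain U where U: "\<And>i. i \<in> I ==> open (U i)" "x \<in> PiE I U" "PiE I U \<subseteq> S"
 proof -
  have "\<exists>U. finite {i \<in> I. U i \<noteq> topspace (euclidean :: complex topology)} \<and>
    (\<forall>i\<in>I. openin euclidean (U i)) \<and> x \<in> PiE I U \<and> PiE I U \<subseteq> S"
   using S x unfolding cspace_def openin_product_topology_alt by blast
  then obtain U where "\<forall>i\<in>I. openin euclidean (U i)" "x \<in> PiE I U" "PiE I U \<subseteq> S" by blast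
  then show thesis by (intro that[of U]) auto
 qed
 have "\<forall>i\<in>I. \<exists>e>0. \<forall>y. dist y (x i) < e --> y \<in> U i"
  using U(1,2) by (auto simp: open_dist PiE_def)
 then obtain e where e: "\<And>i. i \<in> I ==> e i > 0" "\<And>i y. i \<in> I ==> dist y (x i) < e i ==> y \<in> U i"
  by metis
 \<comment> \<open>The extra element 1 keeps the minimum defined when \<open>I\<close> is
   empty.\<close>
 define \<delta> where "\<delta> = Min (insert 1 (e ` I))"
 have "\<delta> > 0" "\<And>i. i \<in> I ==> \<delta> \<le> e i"
  using fin e(1) by (auto simp: \<delta>_def)
 moreover have "z \<in> S" if "z \<in> topspace (cspace I)" "\<And>i. i \<in> I ==> dist (z i) (x i) < \<delta>" for z
 proof -
  have "z i \<in> U i" if i: "i \<in> I" for i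
   using \<open>\<And>i. i \<in> I ==> dist (z i) (x i) < \<delta>\<close>[OF i] calculation(2)[OF i] by (intro e(2)[OF i]) linarith
  then have "z \<in> PiE I U" using that(1) by (simp add: PiE_iff)
  then show ?thesis using U(3) by blast
 qed
 ultimately show ?thesis by (intro exI[of _ \<delta>]) simp
qed

lemma Ck_on_continuous: "Ck_on k I S f ==> continuous_map (subtopology (cspace I) S) euclidean f"
 by (cases k) auto

lemma Ck_on_SucE:
 assumes "Ck_on (Suc k) I S f" "i \<in> I" "d \<in> {1, \<i>}"
 obtains f' where
  "\<And>x. x \<in> S ==> has_partial i d f x (f' x)"
  "Ck_on k I S f'"
proof -
 have A: "\<forall>i\<in>I. \<forall>d\<in>{1, \<i>}. \<exists>f'.
   (\<forall>x\<in>S. has_partial i d f x (f' x)) \<and> Ck_on k I S f'"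
  using assms(1)[unfolded Ck_on.simps] by (rule conjunct2)
 obtain f' where f': "\<forall>x\<in>S. has_partial i d f x (f' x)" "Ck_on k I S f'"
  using bspec[OF bspec[OF A assms(2)] assms(3)] by (elim exE conjE)
 show thesis by (rule that[of f']) (use f' in simp_all)
qed

lemma Ck_on_SucI:
 assumes "continuous_map (subtopology (cspace I) S) euclidean f"
  and "\<And>i d. i \<in> I ==> d \<in> {1, \<i>} ==> \<exists>f'.
   (\<forall>x\<in>S. has_partial i d f x (f' x)) \<and> Ck_on k I S f'"
 shows "Ck_on (Suc k) I S f"
 using assms by (simp only: Ck_on.simps) simp

lemma Ck_on_mono: "Ck_on k I S f ==> l \<le> k ==> Ck_on l I S f"
proof (induction k arbitrary: l f)
 case (Suc k)
 show ?case
 proof (cases l)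
  case 0
  then show ?thesis using Suc.prems(1) by simp
 next
  case (Suc l')
  then show ?thesis
   using Suc.prems Suc.IH[of _ l'] Ck_on_SucE[OF Suc.prems(1)] Ck_on_continuous[OF Suc.prems(1)]
   by (simp only:) (rule Ck_on_SucI, assumption, metis Suc_le_mono)
 qed
qed simp

lemma Ck_on_subset: "Ck_on k I S f ==> T \<subseteq> S ==> Ck_on k I T f"
proof (induction k arbitrary: f)
 case 0
 then show ?case by (auto intro: continuous_map_from_subtopology_mono)
next
 case (Suc k)
 show ?case
 proof (rule Ck_on_SucI)
  show "continuous_map (subtopology (cspace I) T) euclidean f"
   using Ck_on_continuous[OF Suc.prems(1)] Suc.prems(2) by (rule continuous_map_from_subtopology_mono)
  show "\<exists>f'. (\<forall>x\<in>T. has_partial i d f x (f' x)) \<and>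
    Ck_on k I T f'" if id: "i \<in> I" "d \<in> {1, \<i>}" for i d
   using Ck_on_SucE[OF Suc.prems(1) id] Suc.IH Suc.prems(2) by (metis subsetD)
 qed
qed

text \<open>The derivative at parameter 0 sees only points near \<open>x\<close>, and near
  \<open>x\<close> the line stays in the open set \<open>S\<close>.\<close>

lemma line_derivative_cong:
 assumes S: "openin (cspace I) S" and x: "x \<in> S" and i: "i \<in> I"
  and eq: "\<And>x. x \<in> S ==> f x = g x"
  and f: "has_partial i d f x D"
 shows "has_partial i d g x D"
proof -
 have ev: "\<forall>\<^sub>F t in nhds 0. f (x(i := x i + of_real t * d)) = g (x(i := x i + of_real t * d))"
  using line_eventually_in[OF S x i] by eventually_elim (rule eq)
 have "f (x(i := x i + of_real 0 * d)) = g (x(i := x i + of_real 0 * d))" using eq x by simp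
 then show ?thesis
  using f has_vector_derivative_cong_ev[of UNIV "\<lambda>t. f (x(i := x i + of_real t * d))"
    "\<lambda>t. g (x(i := x i + of_real t * d))" 0 D] ev by simp
qed

text \<open>On an open set the partial derivatives depend only on values inside the set. This is
  what allows \<open>inv_into\<close> of a chart to be traded for an explicit formula
  throughout.\<close>

lemma Ck_on_cong:
 assumes S: "openin (cspace I) S" and eq: "\<And>x. x \<in> S ==> f x = g x"
 shows "Ck_on k I S f \<longleftrightarrow> Ck_on k I S g"
proof -
 have S': "topspace (subtopology (cspace I) S) = S" using S openin_subset by fastforce
 have "Ck_on k I S g" if "\<And>x. x \<in> S ==> f x = g x" "Ck_on k I S f" for f g
 proof (cases k)
  case 0
  then show ?thesis using that S' by (auto intro: continuous_map_eq)
 next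
  case (Suc l)
  have "continuous_map (subtopology (cspace I) S) euclidean g"
   using that S' Suc by (auto intro: continuous_map_eq)
  moreover have "\<exists>f'. (\<forall>x\<in>S. has_partial i d g x (f' x)) \<and>
    Ck_on l I S f'" if "i \<in> I" "d \<in> {1, \<i>}" for i d
  proof -
   obtain f' where f': "\<forall>x\<in>S. has_partial i d f x (f' x)"
    "Ck_on l I S f'" using Ck_on_SucE[OF \<open>Ck_on k I S f\<close>[unfolded Suc] \<open>i \<in> I\<close> \<open>d \<in> {1, \<i>}\<close>] by metis
   have "has_partial i d g x (f' x)" if "x \<in> S" for x
    by (rule line_derivative_cong[OF S that \<open>i \<in> I\<close>, of f]) (use f' that \<open>\<And>x. x \<in> S ==> f x = g x\<close> in auto)
   then show ?thesis using f'(2) by blast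
  qed
  ultimately show ?thesis unfolding Suc by (intro Ck_on_SucI)
 qed
 then show ?thesis using eq by metis
qed

text \<open>Vector derivatives are unique, so at points of \<open>S\<close> this is the only
  possible value of the witness quantified in \<open>Ck_on\<close>. A canonical witness is needed to
  compare derivatives found on different open sets.\<close>

definition pderiv_at :: "'i => complex => (('i => complex) => complex) => ('i => complex) => complex" where
 "pderiv_at i d f x = vector_derivative (\<lambda>t::real. f (x(i := x i + of_real t * d))) (at 0)"

lemma Ck_on_Suc_iff:
 assumes S: "openin (cspace I) S"
 shows "Ck_on (Suc k) I S f \<longleftrightarrow>
   continuous_map (subtopology (cspace I) S) euclidean f \<and>
   (\<forall>i\<in>I. \<forall>d\<in>{1, \<i>}.
    (\<forall>x\<in>S. has_partial i d f x (pderiv_at i d f x)) \<and>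
    Ck_on k I S (pderiv_at i d f))" (is "?L \<longleftrightarrow> ?R")
proof
 assume L: ?L
 have "(\<forall>x\<in>S. has_partial i d f x (pderiv_at i d f x)) \<and>
    Ck_on k I S (pderiv_at i d f)" if id: "i \<in> I" "d \<in> {1, \<i>}" for i d
 proof -
  obtain f' where f': "\<And>x. x \<in> S ==> has_partial i d f x (f' x)"
   "Ck_on k I S f'" using Ck_on_SucE[OF L id] by metis
  have eq: "pderiv_at i d f x = f' x" if "x \<in> S" for x
   unfolding pderiv_at_def by (rule vector_derivative_at[OF f'(1)[OF that]])
  then show ?thesis using f' Ck_on_cong[OF S, of "pderiv_at i d f" f'] by auto
 qed
 then show ?R using L by simp
next
 assume ?R
 have "\<exists>f'. (\<forall>x\<in>S. has_partial i d f x (f' x)) \<and>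
   Ck_on k I S f'" if "i \<in> I" "d \<in> {1, \<i>}" for i d
  using bspec[OF bspec[OF conjunct2[OF \<open>?R\<close>] that(1)] that(2)] by (intro exI[of _ "pderiv_at i d f"])
 then show ?L using \<open>?R\<close> by (intro Ck_on_SucI) simp_all
qed

lemma continuous_map_locally:
 assumes "\<And>x. x \<in> topspace X ==> \<exists>W. openin X W \<and> x \<in> W \<and> continuous_map (subtopology X W) Y s"
 shows "continuous_map X Y s"
proof -
 obtain W where W: "\<And>x. x \<in> topspace X ==> openin X (W x) \<and> x \<in> W x \<and> continuous_map (subtopology X (W x)) Y s"
  using assms by metis
 show ?thesis
  by (rule pasting_lemma[where I = "topspace X" and T = W and f = "\<lambda>_. s"]) (use W in auto)
qed

lemma continuous_local:
 assumes S: "openin (cspace I) S"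
  and loc: "\<And>x. x \<in> S ==> \<exists>T. openin (cspace I) T \<and> x \<in> T \<and> Ck_on k I (S \<inter> T) f"
 shows "continuous_map (subtopology (cspace I) S) euclidean f"
proof (rule continuous_map_locally)
 fix x assume "x \<in> topspace (subtopology (cspace I) S)"
 then have x: "x \<in> S" by simp
 obtain T where T: "openin (cspace I) T" "x \<in> T" "Ck_on k I (S \<inter> T) f" using loc[OF x] by blast
 have "openin (subtopology (cspace I) S) (S \<inter> T)" using T(1) by (simp add: openin_subtopology_Int2)
 then show "\<exists>W. openin (subtopology (cspace I) S) W \<and> x \<in> W \<and>
   continuous_map (subtopology (subtopology (cspace I) S) W) euclidean f"
  using x T(2) Ck_on_continuous[OF T(3)] by (intro exI[of _ "S \<inter> T"]) (simp add: subtopology_subtopology Int_absorb1)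
qed

text \<open>\<open>pderiv_at\<close> is one global function, so the local hypotheses for
  \<open>f\<close> pass to its derivatives and the induction on \<open>k\<close> goes through
  without gluing witnesses.\<close>

lemma Ck_on_local:
 assumes S: "openin (cspace I) S"
  and loc: "\<And>x. x \<in> S ==> \<exists>T. openin (cspace I) T \<and> x \<in> T \<and> Ck_on k I (S \<inter> T) f"
 shows "Ck_on k I S f"
 using loc
proof (induction k arbitrary: f)
 case 0
 then show ?case using continuous_local[OF S, of 0 f] by simp
next
 case (Suc k)
 have op: "openin (cspace I) (S \<inter> T)" if "openin (cspace I) T" for T using S that by blast
 have "continuous_map (subtopology (cspace I) S) euclidean f"
  by (rule continuous_local[OF S Suc.prems])
 moreover have "(\<forall>x\<in>S. has_partial i d f x (pderiv_at i d f x)) \<and>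
    Ck_on k I S (pderiv_at i d f)" if "i \<in> I" "d \<in> {1, \<i>}" for i d
 proof
  show "\<forall>x\<in>S. has_partial i d f x (pderiv_at i d f x)"
  proof
   fix x assume x: "x \<in> S"
   then obtain T where T: "openin (cspace I) T" "x \<in> T" "Ck_on (Suc k) I (S \<inter> T) f" using Suc.prems by blast
   show "has_partial i d f x (pderiv_at i d f x)"
    using T(3)[unfolded Ck_on_Suc_iff[OF op[OF T(1)]]] that x T(2) by (simp only: Int_iff)
  qed
  have "\<exists>T. openin (cspace I) T \<and> x \<in> T \<and> Ck_on k I (S \<inter> T) (pderiv_at i d f)" if x: "x \<in> S" for x
  proof -
   obtain T where T: "openin (cspace I) T" "x \<in> T" "Ck_on (Suc k) I (S \<inter> T) f" using Suc.prems x by blast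
   show ?thesis
    using bspec[OF bspec[OF conjunct2[OF T(3)[unfolded Ck_on_Suc_iff[OF op[OF T(1)]]]] \<open>i \<in> I\<close>] \<open>d \<in> {1, \<i>}\<close>] T(1,2)
    by (intro exI[of _ T] conjI) simp_all
  qed
  then show "Ck_on k I S (pderiv_at i d f)" by (rule Suc.IH)
 qed
 ultimately show ?case unfolding Ck_on_Suc_iff[OF S] by simp
qed

lemma Ck_on_const: "Ck_on k I S (\<lambda>_. c)"
proof (induction k arbitrary: c)
 case (Suc k)
 have "\<exists>f'. (\<forall>x\<in>S. ((\<lambda>t::real. c) has_vector_derivative f' x) (at 0)) \<and> Ck_on k I S f'"
  using Suc.IH[of 0] by (intro exI[of _ "\<lambda>_. 0"]) auto
 then show ?case by simp
qed simp

lemma Ck_on_coord: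
 assumes "i \<in> I" shows "Ck_on k I S (\<lambda>x. x i)"
proof -
 have c: "continuous_map (subtopology (cspace I) S) euclidean (\<lambda>x. x i)"
  by (rule continuous_map_from_subtopology[OF continuous_map_coord[OF assms]])
 have "\<exists>f'. (\<forall>x\<in>S. ((\<lambda>t::real. (x(j := x j + of_real t * d)) i) has_vector_derivative f' x) (at 0)) \<and> Ck_on l I S f'"
  for j d l
 proof (cases "j = i")
  case True
  have "((\<lambda>t::real. x i + of_real t * d) has_vector_derivative d) (at 0)" for x :: "'a => complex"
   by (auto intro!: derivative_eq_intros simp: has_vector_derivative_def scaleR_conv_of_real)
  then show ?thesis using True Ck_on_const[of l I S d] by (intro exI[of _ "\<lambda>_. d"]) auto
 next
  case False
  then show ?thesis using Ck_on_const[of l I S 0] by (intro exI[of _ "\<lambda>_. 0"]) auto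
 qed
 then show ?thesis using c by (cases k) auto
qed

lemma Ck_on_add: "Ck_on k I S f ==> Ck_on k I S g ==> Ck_on k I S (\<lambda>x. f x + g x)"
proof (induction k arbitrary: f g)
 case 0
 then show ?case by (simp add: continuous_map_add)
next
 case (Suc k)
 have "\<exists>h'. (\<forall>x\<in>S. ((\<lambda>t::real. f (x(i := x i + of_real t * d)) + g (x(i := x i + of_real t * d)))
   has_vector_derivative h' x) (at 0)) \<and> Ck_on k I S h'" if id: "i \<in> I" "d \<in> {1, \<i>}" for i d
 proof -
  obtain f' where f': "\<forall>x\<in>S. has_partial i d f x (f' x)"
   "Ck_on k I S f'" using Ck_on_SucE[OF Suc.prems(1) id] by metis
  obtain g' where g': "\<forall>x\<in>S. has_partial i d g x (g' x)"
   "Ck_on k I S g'" using Ck_on_SucE[OF Suc.prems(2) id] by metis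
  show ?thesis
   using f' g' by (intro exI[of _ "\<lambda>x. f' x + g' x"]) (auto intro: has_vector_derivative_add Suc.IH)
 qed
 moreover have "continuous_map (subtopology (cspace I) S) euclidean (\<lambda>x. f x + g x)"
  using Suc.prems by (intro continuous_map_add Ck_on_continuous)
 ultimately show ?case by (intro Ck_on_SucI)
qed

lemma continuous_map_mult_complex:
 fixes f g :: "'a => complex"
 assumes "continuous_map X euclidean f" "continuous_map X euclidean g"
 shows "continuous_map X euclidean (\<lambda>x. f x * g x)"
 using assms unfolding continuous_map_atin by (auto intro: tendsto_mult)

lemma Ck_on_mult: "Ck_on k I S f ==> Ck_on k I S g ==> Ck_on k I S (\<lambda>x. f x * g x)"
proof (induction k arbitrary: f g)
 case 0
 then show ?case by (simp add: continuous_map_mult_complex)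
next
 case (Suc k)
 have fg: "Ck_on k I S f" "Ck_on k I S g" using Suc.prems Ck_on_mono le_SucI by blast+
 have "\<exists>h'. (\<forall>x\<in>S. ((\<lambda>t::real. f (x(i := x i + of_real t * d)) * g (x(i := x i + of_real t * d)))
   has_vector_derivative h' x) (at 0)) \<and> Ck_on k I S h'" if id: "i \<in> I" "d \<in> {1, \<i>}" for i d
 proof -
  obtain f' where f': "\<And>x. x\<in>S ==> has_partial i d f x (f' x)"
   "Ck_on k I S f'" using Ck_on_SucE[OF Suc.prems(1) id] by metis
  obtain g' where g': "\<And>x. x\<in>S ==> has_partial i d g x (g' x)"
   "Ck_on k I S g'" using Ck_on_SucE[OF Suc.prems(2) id] by metis
  have "((\<lambda>t::real. f (x(i := x i + of_real t * d)) * g (x(i := x i + of_real t * d)))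
   has_vector_derivative (f x * g' x + f' x * g x)) (at 0)" if "x \<in> S" for x
   using has_vector_derivative_mult[OF f'(1)[OF that] g'(1)[OF that]] by simp
  moreover have "Ck_on k I S (\<lambda>x. f x * g' x + f' x * g x)"
   by (intro Ck_on_add Suc.IH fg f' g')
  ultimately show ?thesis by (intro exI[of _ "\<lambda>x. f x * g' x + f' x * g x"]) simp
 qed
 moreover have "continuous_map (subtopology (cspace I) S) euclidean (\<lambda>x. f x * g x)"
  using Suc.prems by (intro continuous_map_mult_complex Ck_on_continuous)
 ultimately show ?case by (intro Ck_on_SucI)
qed

lemma Ck_on_sum: "(\<And>a. a \<in> A ==> Ck_on k I S (f a)) ==> Ck_on k I S (\<lambda>x. \<Sum>a\<in>A. f a x)"
 by (induction A rule: infinite_finite_induct) (auto intro: Ck_on_const Ck_on_add)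

lemma Ck_on_bounded_linear:
 assumes L: "bounded_linear L" shows "Ck_on k I S f ==> Ck_on k I S (\<lambda>x. L (f x))"
proof (induction k arbitrary: f)
 case 0
 have "continuous_map euclidean euclidean L"
  using L by (simp add: continuous_map_iff_continuous2 linear_continuous_on)
 then show ?case using 0 continuous_map_compose[of _ _ f _ L] by (simp add: o_def)
next
 case (Suc k)
 have "Ck_on k I S f" using Suc.prems Ck_on_mono le_SucI by blast
 have "continuous_map euclidean euclidean L"
  using L by (simp add: continuous_map_iff_continuous2 linear_continuous_on)
 then have c: "continuous_map (subtopology (cspace I) S) euclidean (\<lambda>x. L (f x))"
  using Ck_on_continuous[OF Suc.prems] continuous_map_compose[of _ _ f _ L] by (auto simp add: o_def)
 have "\<exists>h'. (\<forall>x\<in>S. ((\<lambda>t::real. L (f (x(i := x i + of_real t * d))))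
   has_vector_derivative h' x) (at 0)) \<and> Ck_on k I S h'" if id: "i \<in> I" "d \<in> {1, \<i>}" for i d
 proof -
  obtain f' where f': "\<And>x. x\<in>S ==> has_partial i d f x (f' x)"
   "Ck_on k I S f'" using Ck_on_SucE[OF Suc.prems(1) id] by metis
  show ?thesis
   using Suc.IH[OF f'(2)] bounded_linear.has_vector_derivative[OF L f'(1)]
   by (intro exI[of _ "\<lambda>x. L (f' x)"]) auto
 qed
 with c show ?case by (intro Ck_on_SucI)
qed

text \<open>\<open>Ck_on\<close> differentiates only at parameter 0. Moving the base point along the
  line gives the derivative at every parameter, as the mean value estimate requires.\<close>

lemma line_derivative_shift:
 assumes "((\<lambda>t::real. f ((x(i := x i + of_real s * d))(i := (x(i := x i + of_real s * d)) i + of_real t * d)))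
      has_vector_derivative D) (at 0)"
 shows "((\<lambda>t::real. f (x(i := x i + of_real t * d))) has_vector_derivative D) (at s)"
proof -
 have "((\<lambda>t::real. t - s) has_vector_derivative 1) (at s)"
  by (auto intro!: derivative_eq_intros)
 from vector_diff_chain_at[OF this, of "\<lambda>t. f (x(i := x i + of_real s * d + of_real t * d))" D]
 show ?thesis using assms by (simp add: o_def algebra_simps)
qed

text \<open>One step of the chain rule along a curve: only the coordinate \<open>j\<close> moves in the direction
 \<open>d\<close>, the base point \<open>y t\<close> of the difference quotient being allowed to move as well.\<close>

lemma partial_increment:
 fixes f :: "('j => complex) => complex"
 assumes S: "openin (cspace J) S" and fin: "finite J" and j: "j \<in> J" and x0: "x0 \<in> S"
  and f: "\<And>x. x \<in> S ==> has_partial j d f x (f' x)"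
  and f': "continuous_map (subtopology (cspace J) S) euclidean f'"
  and yt: "\<And>t. y t \<in> topspace (cspace J)"
  and y: "\<And>i. i \<in> J ==> ((\<lambda>t::real. y t i) \<longlongrightarrow> x0 i) (at 0)"
  and d: "norm d = 1"
  and u: "(u has_real_derivative u') (at 0)" "u 0 = 0"
 shows "((\<lambda>t. (f ((y t)(j := y t j + of_real (u t) * d)) - f (y t)) / of_real t) \<longlongrightarrow> of_real u' * f' x0) (at 0)"
proof -
 \<comment> \<open>The value \<open>f' x0\<close> at zeros of \<open>u\<close> makes the wanted
   quotient equal to \<open>(u t / t) * q t\<close> for every \<open>t\<close>, including those
   where nothing moves.\<close>
 define q where "q t = (if u t = 0 then f' x0
   else (f ((y t)(j := y t j + of_real (u t) * d)) - f (y t)) / of_real (u t))" for t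
 have ut: "(u \<longlongrightarrow> 0) (at 0)" using DERIV_isCont[OF u(1)] u(2) by (simp add: isCont_def)
 have qlim: "(q \<longlongrightarrow> f' x0) (at 0)"
 proof (rule tendstoI)
  fix e :: real assume e: "e > 0"
  have "openin (subtopology (cspace J) S) {x \<in> topspace (subtopology (cspace J) S). f' x \<in> ball (f' x0) (e/2)}"
   by (rule openin_continuous_map_preimage[OF f']) auto
  then have "openin (cspace J) {x \<in> S. f' x \<in> ball (f' x0) (e/2)}"
   using openin_trans_full[OF _ S] unfolding topspace_subtopology_subset[OF openin_subset[OF S]] by blast
  moreover have "x0 \<in> {x \<in> S. f' x \<in> ball (f' x0) (e/2)}" using x0 e by auto
  ultimately obtain \<delta> where \<delta>1: "\<delta> > 0" and
   \<delta>2: "\<forall>z\<in>topspace (cspace J). (\<forall>i\<in>J. dist (z i) (x0 i) < \<delta>) --> z \<in> {x \<in> S. f' x \<in> ball (f' x0) (e/2)}"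
   using cspace_box[OF _ fin] by meson
  have "\<forall>\<^sub>F t in at 0. \<forall>i\<in>J. dist (y t i) (x0 i) < \<delta>/2"
   using fin \<delta>1 by (intro eventually_ball_finite ballI tendstoD[OF y]) auto
  moreover have "\<forall>\<^sub>F t in at 0. dist (u t) 0 < \<delta>/2" using \<delta>1 by (intro tendstoD[OF ut]) auto
  ultimately show "\<forall>\<^sub>F t in at 0. dist (q t) (f' x0) < e"
  proof eventually_elim
   case (elim t)
   show ?case
   proof (cases "u t = 0")
    case False
    define F where "F s = f ((y t)(j := y t j + of_real s * d))" for s :: real
    have box: "(y t)(j := y t j + of_real s * d) \<in> {x \<in> S. f' x \<in> ball (f' x0) (e/2)}"
     if "s \<in> closed_segment 0 (u t)" for s
    proof (rule \<delta>2[THEN bspec, THEN mp])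
     show "(y t)(j := y t j + of_real s * d) \<in> topspace (cspace J)" by (rule line_in_topspace[OF yt j])
     show "\<forall>i\<in>J. dist (((y t)(j := y t j + of_real s * d)) i) (x0 i) < \<delta>"
     proof
     fix i assume i: "i \<in> J"
     have s: "\<bar>s\<bar> < \<delta>/2" using that elim(2)
      by (auto simp: closed_segment_eq_real_ivl split: if_splits)
     have "norm ((y t j - x0 j) + of_real s * d) \<le> norm (y t j - x0 j) + \<bar>s\<bar>"
      using d norm_triangle_ineq[of "y t j - x0 j" "of_real s * d"] by (simp add: norm_mult)
     then have "dist (((y t)(j := y t j + of_real s * d)) i) (x0 i) \<le> dist (y t i) (x0 i) + \<bar>s\<bar>"
      by (cases "i = j") (simp_all add: dist_norm algebra_simps)
     also have "\<dots> < \<delta>" using elim(1) i s by fastforce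
     finally show "dist (((y t)(j := y t j + of_real s * d)) i) (x0 i) < \<delta>" .
     qed
    qed
    \<comment> \<open>Mean value inequality for \<open>F s - s f' x0\<close>: by continuity of
      \<open>f'\<close> its derivative is smaller than \<open>e/2\<close> on the whole
      segment.\<close>
    have "norm (F (u t) - F 0 - (u t - 0) *\<^sub>R f' x0) \<le> norm (u t - 0) * (e/2)"
    proof -
     have "norm ((F (u t) - u t *\<^sub>R f' x0) - (F 0 - 0 *\<^sub>R f' x0)) \<le> (e/2) * norm (u t - 0)"
     proof (rule differentiable_bound)
      fix s assume s: "s \<in> closed_segment 0 (u t)"
      define D where "D = f' ((y t)(j := y t j + of_real s * d)) - f' x0"
      have "(F has_vector_derivative f' ((y t)(j := y t j + of_real s * d))) (at s)"
       unfolding F_def by (rule line_derivative_shift, rule f) (use box[OF s] in auto)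
      moreover have "((\<lambda>s. s *\<^sub>R f' x0) has_vector_derivative f' x0) (at s)"
       by (auto intro!: derivative_eq_intros simp: has_vector_derivative_def)
      ultimately have "((\<lambda>s. F s - s *\<^sub>R f' x0) has_vector_derivative D) (at s)"
       unfolding D_def by (rule has_vector_derivative_diff)
      then show "((\<lambda>s. F s - s *\<^sub>R f' x0) has_derivative (\<lambda>h. h *\<^sub>R D)) (at s within closed_segment 0 (u t))"
       using has_vector_derivative_at_within has_vector_derivative_def by blast
      have "dist (f' x0) (f' ((y t)(j := y t j + of_real s * d))) < e/2" using box[OF s] by auto
      then have "norm D \<le> e / 2" by (simp add: D_def dist_norm norm_minus_commute)
      then show "onorm (\<lambda>h. h *\<^sub>R D) \<le> e / 2"
       using mult_left_mono[of "norm D" "e/2" "\<bar>h\<bar>" for h] by (intro onorm_le) (simp add: mult.commute[of "e/2"] mult.commute[of e])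
     qed auto
     then show ?thesis by (simp add: algebra_simps)
    qed
    moreover have "q t = (F (u t) - F 0) / of_real (u t)" using False by (simp add: q_def F_def)
    then have "q t - f' x0 = (F (u t) - F 0 - (u t - 0) *\<^sub>R f' x0) / of_real (u t)"
     using False by (simp add: field_simps scaleR_conv_of_real)
    ultimately have "norm (q t - f' x0) \<le> e/2" using False
     by (simp add: norm_divide divide_le_eq mult.commute)
    then show ?thesis using e by (simp add: dist_norm)
   qed (use e in \<open>simp add: q_def\<close>)
  qed
 qed
 have "((\<lambda>t. (u t - u 0) / t) \<longlongrightarrow> u') (at 0)"
  using u(1) by (simp add: has_field_derivative_iff)
 then have "((\<lambda>t. complex_of_real (u t / t) * q t) \<longlongrightarrow> of_real u' * f' x0) (at 0)"
  using u(2) qlim by (intro tendsto_intros) auto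
 moreover have "complex_of_real (u t / t) * q t
   = (f ((y t)(j := y t j + of_real (u t) * d)) - f (y t)) / of_real t" for t
  by (simp add: q_def)
 ultimately show ?thesis by (simp only:)
qed

text \<open>The increment of \<open>f\<close> along the curve is telescoped: the real and imaginary
  parts of the coordinates are moved one at a time, and \<open>partial_increment\<close> computes
  each contribution.\<close>

lemma curve_chain_rule:
 fixes f :: "('j => complex) => complex"
 assumes S: "openin (cspace J) S" and fin: "finite J" and c0: "c 0 \<in> S"
  and f: "\<And>x j d. x \<in> S ==> j \<in> J ==> d \<in> {1, \<i>} ==>
    has_partial j d f x (f' j d x)"
  and f': "\<And>j d. j \<in> J ==> d \<in> {1, \<i>} ==> continuous_map (subtopology (cspace J) S) euclidean (f' j d)"
  and ct: "\<forall>\<^sub>F t in at 0. c t \<in> topspace (cspace J)"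
  and c: "\<And>j. j \<in> J ==> ((\<lambda>t::real. c t j) has_vector_derivative c' j) (at 0)"
 shows "((\<lambda>t. f (c t)) has_vector_derivative
   (\<Sum>j\<in>J. f' j 1 (c 0) * of_real (Re (c' j)) + f' j \<i> (c 0) * of_real (Im (c' j)))) (at 0)"
proof -
 define x0 where "x0 = c 0"
 have x0: "x0 \<in> topspace (cspace J)" using c0 S openin_subset x0_def by blast
 define co where "co d z = (if d = (1::complex) then Re z else Im z)" for d z
 \<comment> \<open>An interpolation between \<open>x0\<close> and \<open>c t\<close>: exactly the
   real parts (direction 1) and imaginary parts (direction \<i>) listed in \<open>A\<close> have
   already moved.\<close>
 define m where "m A t = (\<lambda>j. if j \<in> J then x0 j + (if (j, 1) \<in> A then of_real (co 1 (c t j - x0 j)) else 0)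
    + (if (j, \<i>) \<in> A then of_real (co \<i> (c t j - x0 j)) * \<i> else 0) else undefined)" for A t
 have mt: "m A t \<in> topspace (cspace J)" for A t by (auto simp: m_def)
 have cr: "((\<lambda>t. co d (c t j - x0 j)) has_real_derivative co d (c' j)) (at 0)" if "j \<in> J" for j d
 proof -
  have "((\<lambda>t. c t j - x0 j) has_vector_derivative c' j) (at 0)"
   using has_vector_derivative_diff[OF c[OF that] has_vector_derivative_const] by simp
  then have "((\<lambda>t. Re (c t j - x0 j)) has_vector_derivative Re (c' j)) (at 0)"
   "((\<lambda>t. Im (c t j - x0 j)) has_vector_derivative Im (c' j)) (at 0)"
   by (auto intro: bounded_linear.has_vector_derivative bounded_linear_Re bounded_linear_Im simp del: minus_complex.sel)
  then show ?thesis by (simp add: co_def has_real_derivative_iff_has_vector_derivative)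
 qed
 have cl: "((\<lambda>t. co d (c t j - x0 j)) \<longlongrightarrow> 0) (at 0)" if "j \<in> J" for j d
 proof -
  have "co d (c 0 j - x0 j) = 0" by (simp add: x0_def co_def)
  then show ?thesis using DERIV_isCont[OF cr[OF that, of d]] unfolding isCont_def by metis
 qed
 have ml: "((\<lambda>t. m A t i) \<longlongrightarrow> x0 i) (at 0)" if "i \<in> J" for A i
 proof -
  have l: "((\<lambda>t. complex_of_real (co d (c t i - x0 i))) \<longlongrightarrow> 0) (at 0)" for d
   using tendsto_of_real[OF cl[OF that, of d]] by simp
  have "((\<lambda>t. x0 i + (if (i, 1) \<in> A then of_real (co 1 (c t i - x0 i)) else 0)
    + (if (i, \<i>) \<in> A then of_real (co \<i> (c t i - x0 i)) * \<i> else 0)) \<longlongrightarrow> x0 i + 0 + 0) (at 0)"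
  proof (intro tendsto_add tendsto_const)
   show "((\<lambda>t. if (i, 1) \<in> A then complex_of_real (co 1 (c t i - x0 i)) else 0) \<longlongrightarrow> 0) (at 0)"
    using l by (cases "(i, 1) \<in> A") simp_all
   show "((\<lambda>t. if (i, \<i>) \<in> A then complex_of_real (co \<i> (c t i - x0 i)) * \<i> else 0) \<longlongrightarrow> 0) (at 0)"
    using tendsto_mult_left_zero[OF l] by (cases "(i, \<i>) \<in> A") simp_all
  qed
  then show ?thesis using that by (simp add: m_def)
 qed
 have m_ins: "m (insert (j, d) A) t = (m A t)(j := m A t j + of_real (co d (c t j - x0 j)) * d)"
  if "j \<in> J" "d \<in> {1, \<i>}" "(j, d) \<notin> A" for j d A t
  using that by (auto simp: m_def co_def fun_eq_iff)
 have step: "((\<lambda>t. (f (m A t) - f x0) / of_real t) \<longlongrightarrow> (\<Sum>(j, d)\<in>A. of_real (co d (c' j)) * f' j d x0)) (at 0)"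
  if "A \<subseteq> J \<times> {1, \<i>}" for A
 proof -
  have "finite A" using that fin finite_subset by blast
  then show ?thesis using that
  proof (induction A rule: finite_induct)
   case empty
   have "m {} t = x0" for t using x0 by (auto simp: m_def fun_eq_iff PiE_def extensional_def)
   then show ?case by simp
  next
   case (insert a A)
   obtain j d where a: "a = (j, d)" by fastforce
   have jd: "j \<in> J" "d \<in> {1, \<i>}" "(j, d) \<notin> A" using insert.prems insert.hyps a by auto
   have 1: "((\<lambda>t. (f ((m A t)(j := m A t j + of_real (co d (c t j - x0 j)) * d)) - f (m A t)) / of_real t)
     \<longlongrightarrow> of_real (co d (c' j)) * f' j d x0) (at 0)"
    by (rule partial_increment[OF S fin jd(1) c0[folded x0_def] f[OF _ jd(1,2)] f'[OF jd(1,2)] mt ml])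
     (use jd cr in \<open>auto simp: x0_def co_def\<close>)
   have "((\<lambda>t. (f (m (insert a A) t) - f (m A t)) / of_real t + (f (m A t) - f x0) / of_real t)
     \<longlongrightarrow> of_real (co d (c' j)) * f' j d x0 + (\<Sum>(j, d)\<in>A. of_real (co d (c' j)) * f' j d x0)) (at 0)"
    using 1 insert.IH insert.prems by (intro tendsto_add) (auto simp: a m_ins[OF jd])
   then show ?case using insert.hyps by (simp add: a diff_divide_distrib)
  qed
 qed
 have mJ: "m (J \<times> {1, \<i>}) t = c t" if "c t \<in> topspace (cspace J)" for t
  using that by (auto simp: m_def co_def fun_eq_iff complex_eq_iff PiE_def extensional_def)
 have "(\<Sum>(j, d)\<in>J \<times> {1, \<i>}. of_real (co d (c' j)) * f' j d x0)
   = (\<Sum>j\<in>J. f' j 1 (c 0) * of_real (Re (c' j)) + f' j \<i> (c 0) * of_real (Im (c' j)))"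
  using fin by (simp flip: sum.cartesian_product add: x0_def co_def mult.commute)
 moreover have "\<forall>\<^sub>F t in at 0. (f (m (J \<times> {1, \<i>}) t) - f x0) / complex_of_real t = (f (c t) - f (c 0)) / of_real t"
  using ct by eventually_elim (simp add: mJ x0_def)
 ultimately have "((\<lambda>t. (f (c t) - f (c 0)) / of_real t) \<longlongrightarrow>
  (\<Sum>j\<in>J. f' j 1 (c 0) * of_real (Re (c' j)) + f' j \<i> (c 0) * of_real (Im (c' j)))) (at 0)"
  using Lim_transform_eventually[OF step[OF subset_refl]] by (simp only:)
 then have "((\<lambda>t. norm ((f (c t) - f (c 0)) / of_real t -
  (\<Sum>j\<in>J. f' j 1 (c 0) * of_real (Re (c' j)) + f' j \<i> (c 0) * of_real (Im (c' j))))) \<longlongrightarrow> 0) (at 0)"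
  by (simp only: tendsto_norm_zero_iff Lim_null[symmetric])
 moreover have "\<forall>\<^sub>F t in at 0. norm ((f (c t) - f (c 0)) / of_real t - L)
   = norm (f (c t) - f (c 0) - (t - 0) *\<^sub>R L) / norm (t - 0)" for L
  unfolding eventually_at_filter
 proof (intro always_eventually allI impI)
  fix t :: real assume "t \<noteq> 0"
  then have "(f (c t) - f (c 0)) / of_real t - L = (f (c t) - f (c 0) - t *\<^sub>R L) / of_real t"
   by (simp add: diff_divide_distrib scaleR_conv_of_real)
  then show "norm ((f (c t) - f (c 0)) / of_real t - L)
   = norm (f (c t) - f (c 0) - (t - 0) *\<^sub>R L) / norm (t - 0)"
   by (simp add: norm_divide)
 qed
 ultimately show ?thesis
  unfolding has_vector_derivative_def has_derivative_iff_norm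
  by (intro conjI bounded_linear_scaleR_left) (rule Lim_transform_eventually)
qed

text \<open>Induction on \<open>k\<close> with \<open>f\<close> arbitrary: by the chain rule the
  partial derivatives of the composite are sums of products of lower-order composites with
  derivatives of \<open>g\<close>.\<close>

theorem Ck_on_compose:
 assumes S: "openin (cspace J) S" and fin: "finite J" and T: "openin (cspace I) T"
  and g: "\<And>w. w \<in> T ==> g w \<in> S"
  and "Ck_on k J S f" and "\<And>j. j \<in> J ==> Ck_on k I T (\<lambda>w. g w j)"
 shows "Ck_on k I T (\<lambda>w. f (g w))"
 using assms(5,6)
proof (induction k arbitrary: f)
 have T': "topspace (subtopology (cspace I) T) = T" using T openin_subset by fastforce
 have c: "continuous_map (subtopology (cspace I) T) euclidean (\<lambda>w. f (g w))"
  if "Ck_on k J S f" "\<And>j. j \<in> J ==> Ck_on k I T (\<lambda>w. g w j)" for k f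
 proof -
  have "g ` T \<subseteq> extensional J" using g S openin_subset by (fastforce simp: PiE_def)
  then have "continuous_map (subtopology (cspace I) T) (cspace J) g"
   using Ck_on_continuous[OF that(2)] T' by (auto simp: continuous_map_into_cspace)
  then have "continuous_map (subtopology (cspace I) T) (subtopology (cspace J) S) g"
   using g T' by (auto simp: continuous_map_in_subtopology)
  from continuous_map_compose[OF this Ck_on_continuous[OF that(1)]] show ?thesis by (simp add: o_def)
 qed
 {
  case 0
  then show ?case using c[of 0] by simp
 next
  case (Suc k)
  show ?case
  proof (rule Ck_on_SucI)
   show "continuous_map (subtopology (cspace I) T) euclidean (\<lambda>w. f (g w))"
    by (rule c[OF Suc.prems])
   fix i d assume id: "i \<in> I" "d \<in> {1, \<i>}"
   have "\<forall>j\<in>J. \<exists>h. (\<forall>x\<in>T. ((\<lambda>t::real. g (x(i := x i + of_real t * d)) j) has_vector_derivative h x) (at 0)) \<and> Ck_on k I T h"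
    using Ck_on_SucE[OF Suc.prems(2) id] by metis
   then obtain h where h: "\<And>j x. j \<in> J ==> x \<in> T ==>
     ((\<lambda>t::real. g (x(i := x i + of_real t * d)) j) has_vector_derivative h j x) (at 0)"
    "\<And>j. j \<in> J ==> Ck_on k I T (h j)" by metis
   have pf: "has_partial j e f x (pderiv_at j e f x)"
    "Ck_on k J S (pderiv_at j e f)"
    if "j \<in> J" "e \<in> {1, \<i>}" "x \<in> S" for j e x
    using bspec[OF bspec[OF conjunct2[OF Suc.prems(1)[unfolded Ck_on_Suc_iff[OF S]]] that(1)] that(2)] that(3)
    by blast+
   define F where "F x = (\<Sum>j\<in>J. pderiv_at j 1 f (g x) * of_real (Re (h j x)) + pderiv_at j \<i> f (g x) * of_real (Im (h j x)))" for x
   have "((\<lambda>t::real. f (g (x(i := x i + of_real t * d)))) has_vector_derivative F x) (at 0)" if x: "x \<in> T" for x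
   proof -
    have "\<forall>\<^sub>F t in at (0::real). x(i := x i + of_real t * d) \<in> T"
     unfolding eventually_at_filter
     by (rule eventually_mono[OF line_eventually_in[OF T x id(1), where d = d]]) simp
    then have ev: "\<forall>\<^sub>F t in at (0::real). g (x(i := x i + of_real t * d)) \<in> topspace (cspace J)"
     by eventually_elim (use g S openin_subset in blast)
    have "((\<lambda>t::real. f (g (x(i := x i + of_real t * d)))) has_vector_derivative
     (\<Sum>j\<in>J. pderiv_at j 1 f (g (x(i := x i + of_real 0 * d))) * of_real (Re (h j x))
      + pderiv_at j \<i> f (g (x(i := x i + of_real 0 * d))) * of_real (Im (h j x)))) (at 0)"
    proof (rule curve_chain_rule[OF S fin _ _ _ ev h(1)[OF _ x]])
     show "continuous_map (subtopology (cspace J) S) euclidean (pderiv_at j e f)"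
      if "j \<in> J" "e \<in> {1, \<i>}" for j e
      using pf(2)[OF that] g[OF x] by (intro Ck_on_continuous)
     show "has_partial j e f y (pderiv_at j e f y)"
      if "y \<in> S" "j \<in> J" "e \<in> {1, \<i>}" for y j e
      by (rule pf(1)[OF that(2,3,1)])
    qed (use g[OF x] in simp)
    then show ?thesis by (simp add: F_def)
   qed
   moreover have "Ck_on k I T F"
   \<comment> \<open>The regularity of \<open>pderiv_at j e f\<close> in \<open>pf\<close> comes
     with a point of \<open>S\<close>, which only a nonempty \<open>T\<close> supplies.\<close>
   proof (cases "T = {}")
    case False
    then have S_ne: "\<exists>x. x \<in> S" using g by blast
    have "Ck_on k I T (\<lambda>w. g w j)" if "j \<in> J" for j
     using Suc.prems(2)[OF that] Ck_on_mono le_SucI by blast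
    then have "Ck_on k I T (\<lambda>x. pderiv_at j e f (g x))" if "j \<in> J" "e \<in> {1, \<i>}" for j e
    proof -
     obtain y where "y \<in> S" using S_ne by blast
     from pf(2)[OF that this] show ?thesis by (rule Suc.IH) (rule \<open>\<And>j. j \<in> J ==> Ck_on k I T (\<lambda>w. g w j)\<close>)
    qed
    then show ?thesis unfolding F_def
     by (intro Ck_on_sum Ck_on_add Ck_on_mult h(2)
       Ck_on_bounded_linear[of "\<lambda>z. complex_of_real (Re z)"] Ck_on_bounded_linear[of "\<lambda>z. complex_of_real (Im z)"]
       bounded_linear_compose[OF bounded_linear_of_real bounded_linear_Re]
       bounded_linear_compose[OF bounded_linear_of_real bounded_linear_Im]) simp_all
   next
    case True
    then show ?thesis using Ck_on_cong[OF T, of F "\<lambda>_. 0"] Ck_on_const by auto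
   qed
   ultimately show "\<exists>f'. (\<forall>x\<in>T. ((\<lambda>t::real. f (g (x(i := x i + of_real t * d)))) has_vector_derivative f' x) (at 0)) \<and>
     Ck_on k I T f'" by (intro exI[of _ F]) simp
  qed
 }
qed

section \<open>Regular maps\<close>

text \<open>The flag \<open>b\<close> distinguishes the smooth (\<open>b = True\<close>) from the continuous theory.\<close>

abbreviation tspace :: "('a, 'i) mfd => 'a set" where "tspace M \<equiv> topspace (mtop M)"

abbreviation pchart :: "('a => 'i => complex) => ('b => 'j => complex) => 'a \<times> 'b => 'i + 'j => complex" where
 "pchart \<phi> \<psi> \<equiv> \<lambda>(p, q). case_sum (\<phi> p) (\<psi> q)"

definition reg_mfd :: "bool => ('a, 'i) mfd => bool" where
 "reg_mfd b M \<longleftrightarrow> (b --> smooth_mfd M)"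

definition reg_map :: "bool => ('a, 'i) mfd => ('b, 'j) mfd => ('a => 'b) => bool" where
 "reg_map b M N f \<longleftrightarrow> (if b then smooth_map M N f else continuous_map (mtop M) (mtop N) f)"

text \<open>Maps between manifolds are reduced to these scalar functions by
  \<open>reg_map_iff\<close>, so that closure under sums, products and powers has to be established
  only once.\<close>

definition regular :: "bool => ('a, 'i) mfd => 'a set => ('a => complex) => bool" where
 "regular b M W s \<longleftrightarrow> openin (mtop M) W \<and> continuous_map (subtopology (mtop M) W) euclidean s \<and>
   (b --> (\<forall>(I, U, \<phi>)\<in>matlas M. smooth_fun I (\<phi> ` (U \<inter> W)) (\<lambda>w. s (inv_into U \<phi> w))))"

definition preim :: "('a, 'i) mfd => ('a => 'b) => 'b set => 'a set" where
 "preim M f V = {x \<in> tspace M. f x \<in> V}"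

lemma smooth_mfd_chart:
 assumes M: "smooth_mfd M" and c: "(I, U, \<phi>) \<in> matlas M"
 shows "finite I" "openin (mtop M) U" "U \<subseteq> tspace M" "openin (cspace I) (\<phi> ` U)" "inj_on \<phi> U"
  "\<And>x. x \<in> U ==> \<phi> x \<in> topspace (cspace I)"
  "continuous_map (subtopology (mtop M) U) (cspace I) \<phi>"
  "\<And>W. openin (mtop M) W ==> openin (cspace I) (\<phi> ` (U \<inter> W))"
  "continuous_map (subtopology (cspace I) (\<phi> ` U)) (mtop M) (inv_into U \<phi>)"
proof -
 have h: "homeomorphic_map (subtopology (mtop M) U) (subtopology (cspace I) (\<phi> ` U)) \<phi>"
  and f: "finite I" and U: "openin (mtop M) U" and V: "openin (cspace I) (\<phi> ` U)"
  using M c unfolding smooth_mfd_def by blast+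
 show "finite I" "openin (mtop M) U" "openin (cspace I) (\<phi> ` U)" by fact+
 show U': "U \<subseteq> tspace M" using U openin_subset by blast
 have tU: "topspace (subtopology (mtop M) U) = U" using U' by auto
 show inj: "inj_on \<phi> U" using homeomorphic_imp_injective_map[OF h] tU by simp
 show "\<phi> x \<in> topspace (cspace I)" if "x \<in> U" for x using V openin_subset that by blast
 show "continuous_map (subtopology (mtop M) U) (cspace I) \<phi>"
  using homeomorphic_imp_continuous_map[OF h] continuous_map_in_subtopology by blast
 show op: "openin (cspace I) (\<phi> ` (U \<inter> W))" if "openin (mtop M) W" for W
 proof -
  have "openin (subtopology (mtop M) U) (U \<inter> W)"
   using openin_subtopology_Int2[OF that, of U] by (simp add: Int_commute)
  then have "openin (subtopology (cspace I) (\<phi> ` U)) (\<phi> ` (U \<inter> W))"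
   using homeomorphic_imp_open_map[OF h] by (auto simp: open_map_def)
  then show ?thesis using openin_trans_full V by blast
 qed
 show "continuous_map (subtopology (cspace I) (\<phi> ` U)) (mtop M) (inv_into U \<phi>)"
  unfolding continuous_map_def
 proof (intro conjI allI impI)
  have tV: "topspace (subtopology (cspace I) (\<phi> ` U)) = \<phi> ` U" using openin_subset[OF V] by auto
  show "inv_into U \<phi> \<in> topspace (subtopology (cspace I) (\<phi> ` U)) \<rightarrow> tspace M"
   unfolding tV using U' by (auto simp: inv_into_f_f[OF inj])
  fix W assume W: "openin (mtop M) W"
  have "{x \<in> topspace (subtopology (cspace I) (\<phi> ` U)). inv_into U \<phi> x \<in> W} = \<phi> ` (U \<inter> W)"
   unfolding tV by (auto simp: inv_into_f_f[OF inj])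
  then show "openin (subtopology (cspace I) (\<phi> ` U)) {x \<in> topspace (subtopology (cspace I) (\<phi> ` U)). inv_into U \<phi> x \<in> W}"
   using openin_subset_topspace_eq[of] op[OF W] by (metis Int_lower1 image_mono openin_open_subtopology V)
 qed
qed

lemma smooth_mfd_cover: "smooth_mfd M ==> x \<in> tspace M ==> \<exists>I U \<phi>. (I, U, \<phi>) \<in> matlas M \<and> x \<in> U"
 unfolding smooth_mfd_def by blast

lemma regular_open: "regular b M W s ==> openin (mtop M) W" by (simp add: regular_def)

lemma regular_continuous: "regular b M W s ==> continuous_map (subtopology (mtop M) W) euclidean s"
 by (simp add: regular_def)

lemma regular_chart: "regular True M W s ==> (I, U, \<phi>) \<in> matlas M ==> smooth_fun I (\<phi> ` (U \<inter> W)) (\<lambda>w. s (inv_into U \<phi> w))"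
 unfolding regular_def by blast

lemma regular_Ck: "regular b M W s ==> b ==> (I, U, \<phi>) \<in> matlas M ==> Ck_on k I (\<phi> ` (U \<inter> W)) (\<lambda>w. s (inv_into U \<phi> w))"
 unfolding regular_def smooth_fun_def by blast

lemma regularI:
 assumes "openin (mtop M) W" "continuous_map (subtopology (mtop M) W) euclidean s"
  "\<And>I U \<phi> k. b ==> (I, U, \<phi>) \<in> matlas M ==> Ck_on k I (\<phi> ` (U \<inter> W)) (\<lambda>w. s (inv_into U \<phi> w))"
 shows "regular b M W s"
 using assms unfolding regular_def smooth_fun_def by blast

lemma reg_map_continuous: "reg_map b M N f ==> continuous_map (mtop M) (mtop N) f"
 by (simp add: reg_map_def smooth_map_def split: if_splits)

lemma reg_map_in_topspace: "reg_map b M N f ==> x \<in> tspace M ==> f x \<in> tspace N"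
 using reg_map_continuous continuous_map_image_subset_topspace by blast

lemma preim_open: "continuous_map (mtop M) (mtop N) f ==> openin (mtop N) V ==> openin (mtop M) (preim M f V)"
 unfolding preim_def by (rule openin_continuous_map_preimage)

lemma continuous_map_regular_comp:
 assumes "continuous_map (mtop M) (mtop N) f" "continuous_map (subtopology (mtop N) W) Y s"
 shows "continuous_map (subtopology (mtop M) (preim M f W)) Y (\<lambda>x. s (f x))"
proof -
 have "continuous_map (subtopology (mtop M) (preim M f W)) (subtopology (mtop N) W) f"
  using assms(1) by (auto simp: continuous_map_in_subtopology continuous_map_from_subtopology preim_def)
 from continuous_map_compose[OF this assms(2)] show ?thesis by (simp add: o_def)
qed

text \<open>Near a point, \<open>s\<close> after \<open>f\<close> in a chart of \<open>M\<close>
  factors through a chart of \<open>N\<close>, and the chain rule applies to the two factors;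
  regularity is local.\<close>

lemma regular_pullback:
 assumes M: "reg_mfd b M" and N: "reg_mfd b N" and f: "reg_map b M N f" and s: "regular b N W s"
 shows "regular b M (preim M f W) (\<lambda>x. s (f x))"
proof (rule regularI)
 have cf: "continuous_map (mtop M) (mtop N) f" by (rule reg_map_continuous[OF f])
 show "openin (mtop M) (preim M f W)" by (rule preim_open[OF cf regular_open[OF s]])
 show "continuous_map (subtopology (mtop M) (preim M f W)) euclidean (\<lambda>x. s (f x))"
  by (rule continuous_map_regular_comp[OF cf regular_continuous[OF s]])
 fix I U \<phi> k assume b: b and c: "(I, U, \<phi>) \<in> matlas M"
 have M': "smooth_mfd M" and N': "smooth_mfd N" and f': "smooth_map M N f"
  using M N f b by (auto simp: reg_mfd_def reg_map_def)
 note ch = smooth_mfd_chart[OF M' c]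
 have opW: "openin (cspace I) (\<phi> ` (U \<inter> preim M f W'))" if "openin (mtop N) W'" for W'
  by (rule ch(8)[OF preim_open[OF cf that]])
 show "Ck_on k I (\<phi> ` (U \<inter> preim M f W)) (\<lambda>w. s (f (inv_into U \<phi> w)))"
 proof (rule Ck_on_local[OF opW[OF regular_open[OF s]]])
  fix w assume "w \<in> \<phi> ` (U \<inter> preim M f W)"
  then obtain x where x: "x \<in> U" "f x \<in> W" "w = \<phi> x" by (auto simp: preim_def)
  have "f x \<in> tspace N" using reg_map_in_topspace[OF f] x(1) ch(3) by blast
  then obtain J V \<psi> where d: "(J, V, \<psi>) \<in> matlas N" and V: "f x \<in> V" using smooth_mfd_cover[OF N'] by blast
  note dh = smooth_mfd_chart[OF N' d]
  \<comment> \<open>The part of the chart image that \<open>f\<close> carries into the single chart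
    domain \<open>V\<close>.\<close>
  define T where "T = \<phi> ` (U \<inter> preim M f (V \<inter> W))"
  have T: "openin (cspace I) T" unfolding T_def by (rule opW) (use dh(2) regular_open[OF s] in blast)
  have wT: "w \<in> T" using x V ch(3) by (auto simp: T_def preim_def)
  have Tsub: "\<phi> ` (U \<inter> preim M f W) \<inter> T = T" by (auto simp: T_def preim_def)
  have inv: "inv_into U \<phi> v \<in> U \<and> f (inv_into U \<phi> v) \<in> V \<inter> W" if "v \<in> T" for v
   using that by (auto simp: T_def preim_def inv_into_f_f[OF ch(5)])
  have "Ck_on k I T (\<lambda>w. s (inv_into V \<psi> (\<psi> (f (inv_into U \<phi> w)))))"
  proof (rule Ck_on_compose[OF dh(8)[OF regular_open[OF s]] dh(1) T, where g = "\<lambda>w. \<psi> (f (inv_into U \<phi> w))"])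
   show "\<psi> (f (inv_into U \<phi> w)) \<in> \<psi> ` (V \<inter> W)" if "w \<in> T" for w using inv[OF that] by blast
   show "Ck_on k J (\<psi> ` (V \<inter> W)) (\<lambda>v. s (inv_into V \<psi> v))"
    by (rule regular_Ck[OF s b d])
   fix j assume "j \<in> J"
   then have "smooth_fun I (\<phi> ` (U \<inter> f -` V)) (\<lambda>w. \<psi> (f (inv_into U \<phi> w)) j)"
    using f' c d unfolding smooth_map_def by blast
   moreover have "T \<subseteq> \<phi> ` (U \<inter> f -` V)" by (auto simp: T_def preim_def)
   ultimately show "Ck_on k I T (\<lambda>w. \<psi> (f (inv_into U \<phi> w)) j)"
    unfolding smooth_fun_def by (blast intro: Ck_on_subset)
  qed
  then have "Ck_on k I T (\<lambda>w. s (f (inv_into U \<phi> w)))"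
   by (rule Ck_on_cong[OF T, THEN iffD1, rotated]) (use inv in \<open>simp add: inv_into_f_f[OF dh(5)]\<close>)
  then show "\<exists>T. openin (cspace I) T \<and> w \<in> T \<and> Ck_on k I (\<phi> ` (U \<inter> preim M f W) \<inter> T) (\<lambda>w. s (f (inv_into U \<phi> w)))"
   using T wT Tsub by (intro exI[of _ T]) simp
 qed
qed

text \<open>The double quantification over charts in \<open>smooth_map\<close> is split: the charts
  of \<open>M\<close> are hidden in \<open>regular\<close>, and only coordinate functions of
  \<open>N\<close> remain.\<close>

lemma reg_map_iff:
 assumes M: "reg_mfd b M" and N: "reg_mfd b N"
 shows "reg_map b M N f \<longleftrightarrow> continuous_map (mtop M) (mtop N) f \<and>
   (b --> (\<forall>(J, V, \<psi>)\<in>matlas N. \<forall>j\<in>J. regular True M (preim M f V) (\<lambda>x. \<psi> (f x) j)))" (is "?L \<longleftrightarrow> ?R")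
proof (cases b)
 case True
 then have M': "smooth_mfd M" and N': "smooth_mfd N" using M N by (auto simp: reg_mfd_def)
 have eq: "U \<inter> f -` V = U \<inter> preim M f V" if "(I, U, \<phi>) \<in> matlas M" for I U \<phi> V
  using smooth_mfd_chart(3)[OF M' that] by (auto simp: preim_def)
 have reg: "regular True M (preim M f V) (\<lambda>x. \<psi> (f x) j) \<longleftrightarrow>
   (\<forall>(I, U, \<phi>)\<in>matlas M. smooth_fun I (\<phi> ` (U \<inter> f -` V)) (\<lambda>w. \<psi> (f (inv_into U \<phi> w)) j))"
  if f: "continuous_map (mtop M) (mtop N) f" and d: "(J, V, \<psi>) \<in> matlas N" and j: "j \<in> J" for J V \<psi> j
 proof -
  note dh = smooth_mfd_chart[OF N' d]
  have "continuous_map (subtopology (mtop N) V) euclidean (\<lambda>x. \<psi> x j)"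
   using continuous_map_compose[OF dh(7) continuous_map_coord[OF j]] by (simp add: o_def)
  from continuous_map_regular_comp[OF f this] show ?thesis
   unfolding regular_def using preim_open[OF f dh(2)] eq by (simp add: case_prod_unfold) (metis prod.collapse)
 qed
 show ?thesis
 proof
  assume L: ?L
  then have sm: "smooth_map M N f" using True by (simp add: reg_map_def)
  then have f: "continuous_map (mtop M) (mtop N) f" by (simp add: smooth_map_def)
  have "regular True M (preim M f V) (\<lambda>x. \<psi> (f x) j)" if "(J, V, \<psi>) \<in> matlas N" "j \<in> J" for J V \<psi> j
   unfolding reg[OF f that] using sm that unfolding smooth_map_def by blast
  then show ?R using f by blast
 next
  assume R: ?R
  then have f: "continuous_map (mtop M) (mtop N) f" by blast
  have "smooth_fun I (\<phi> ` (U \<inter> f -` V)) (\<lambda>w. \<psi> (f (inv_into U \<phi> w)) j)"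
   if "(I, U, \<phi>) \<in> matlas M" "(J, V, \<psi>) \<in> matlas N" "j \<in> J" for I U \<phi> J V \<psi> j
   using R True reg[OF f that(2,3)] that by blast
  then show ?L using True f unfolding reg_map_def smooth_map_def by auto
 qed
qed (simp add: reg_map_def)

lemma reg_mapI:
 assumes "reg_mfd b M" "reg_mfd b N" "continuous_map (mtop M) (mtop N) f"
  "\<And>J V \<psi> j. b ==> (J, V, \<psi>) \<in> matlas N ==> j \<in> J ==> regular b M (preim M f V) (\<lambda>x. \<psi> (f x) j)"
 shows "reg_map b M N f"
 unfolding reg_map_iff[OF assms(1,2)] using assms(3,4) by (cases b) auto

lemma reg_map_coord:
 assumes "reg_mfd b M" "reg_mfd b N" "reg_map b M N f" b "(J, V, \<psi>) \<in> matlas N" "j \<in> J"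
 shows "regular b M (preim M f V) (\<lambda>x. \<psi> (f x) j)"
 using assms(3)[unfolded reg_map_iff[OF assms(1,2)]] assms(4-6) by auto

lemma chart_regular:
 assumes M: "smooth_mfd M" and d: "(J, V, \<psi>) \<in> matlas M" and j: "j \<in> J"
 shows "regular b M V (\<lambda>x. \<psi> x j)"
proof (rule regularI)
 note dh = smooth_mfd_chart[OF M d]
 show "openin (mtop M) V" by (rule dh(2))
 show "continuous_map (subtopology (mtop M) V) euclidean (\<lambda>x. \<psi> x j)"
  using continuous_map_compose[OF dh(7) continuous_map_coord[OF j]] by (simp add: o_def)
 show "Ck_on k I (\<phi> ` (U \<inter> V)) (\<lambda>w. \<psi> (inv_into U \<phi> w) j)" if "(I, U, \<phi>) \<in> matlas M" for I U \<phi> k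
 proof -
  have "smooth_fun I (\<phi> ` (U \<inter> V)) (\<lambda>w. \<psi> (inv_into U \<phi> w) j)"
   using M that d j unfolding smooth_mfd_def by blast
  then show ?thesis by (simp add: smooth_fun_def)
 qed
qed

lemma reg_map_compose:
 assumes M: "reg_mfd b M" and N: "reg_mfd b N" and P: "reg_mfd b P" and f: "reg_map b M N f" and g: "reg_map b N P g"
 shows "reg_map b M P (\<lambda>x. g (f x))"
proof (rule reg_mapI[OF M P])
 show "continuous_map (mtop M) (mtop P) (\<lambda>x. g (f x))"
  using continuous_map_compose[OF reg_map_continuous[OF f] reg_map_continuous[OF g]] by (simp add: o_def)
 fix J V \<psi> j assume b: b and d: "(J, V, \<psi>) \<in> matlas P" and j: "j \<in> J"
 have "regular b N (preim N g V) (\<lambda>x. \<psi> (g x) j)"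
  by (rule reg_map_coord[OF N P g b d j])
 from regular_pullback[OF M N f this]
 have "regular b M (preim M f (preim N g V)) (\<lambda>x. \<psi> (g (f x)) j)" .
 moreover have "preim M f (preim N g V) = preim M (\<lambda>x. g (f x)) V"
  using reg_map_in_topspace[OF f] by (auto simp: preim_def)
 ultimately show "regular b M (preim M (\<lambda>x. g (f x)) V) (\<lambda>x. \<psi> (g (f x)) j)" by simp
qed

lemma reg_map_id:
 assumes M: "reg_mfd b M" shows "reg_map b M M (\<lambda>x. x)"
proof (rule reg_mapI[OF M M])
 fix J V \<psi> j assume b: b and d: "(J, V, \<psi>) \<in> matlas M" and j: "j \<in> J"
 have M': "smooth_mfd M" using M b by (simp add: reg_mfd_def)
 have "preim M (\<lambda>x. x) V = V" using smooth_mfd_chart(3)[OF M' d] by (auto simp: preim_def)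
 then show "regular b M (preim M (\<lambda>x. x) V) (\<lambda>x. \<psi> x j)" using chart_regular[OF M' d j] by simp
qed simp

lemma reg_map_cong:
 assumes M: "reg_mfd b M" and N: "reg_mfd b N" and f: "reg_map b M N f" and eq: "\<And>x. x \<in> tspace M ==> f x = g x"
 shows "reg_map b M N g"
proof (rule reg_mapI[OF M N])
 show "continuous_map (mtop M) (mtop N) g" using reg_map_continuous[OF f] eq by (rule continuous_map_eq)
 fix J V \<psi> j assume b: b and d: "(J, V, \<psi>) \<in> matlas N" and j: "j \<in> J"
 have r: "regular b M (preim M f V) (\<lambda>x. \<psi> (f x) j)" by (rule reg_map_coord[OF M N f b d j])
 have p: "preim M f V = preim M g V" using eq by (auto simp: preim_def)
 have M': "smooth_mfd M" using M b by (simp add: reg_mfd_def)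
 show "regular b M (preim M g V) (\<lambda>x. \<psi> (g x) j)"
 proof (rule regularI)
  show o: "openin (mtop M) (preim M g V)" using regular_open[OF r] p by simp
  show "continuous_map (subtopology (mtop M) (preim M g V)) euclidean (\<lambda>x. \<psi> (g x) j)"
   using regular_continuous[OF r] unfolding p by (rule continuous_map_eq) (simp add: eq)
  fix I U \<phi> k assume c: "(I, U, \<phi>) \<in> matlas M"
  note ch = smooth_mfd_chart[OF M' c]
  have "Ck_on k I (\<phi> ` (U \<inter> preim M g V)) (\<lambda>w. \<psi> (f (inv_into U \<phi> w)) j)"
   using regular_Ck[OF r b c] p by simp
  then show "Ck_on k I (\<phi> ` (U \<inter> preim M g V)) (\<lambda>w. \<psi> (g (inv_into U \<phi> w)) j)"
   by (rule Ck_on_cong[OF ch(8)[OF o], THEN iffD1, rotated])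
    (use ch(3) in \<open>auto simp: inv_into_f_f[OF ch(5)] eq subset_iff\<close>)
 qed
qed

subsection \<open>Scalar regular functions\<close>

lemma regular_cong:
 assumes M: "reg_mfd b M" and s: "regular b M W s" and eq: "\<And>x. x \<in> W ==> s x = t x"
 shows "regular b M W t"
proof (rule regularI[OF regular_open[OF s]])
 show "continuous_map (subtopology (mtop M) W) euclidean t"
  using regular_continuous[OF s] by (rule continuous_map_eq) (simp add: eq)
 fix I U \<phi> k assume b: b and c: "(I, U, \<phi>) \<in> matlas M"
 have M': "smooth_mfd M" using M b by (simp add: reg_mfd_def)
 note ch = smooth_mfd_chart[OF M' c]
 have "Ck_on k I (\<phi> ` (U \<inter> W)) (\<lambda>w. s (inv_into U \<phi> w))"
  by (rule regular_Ck[OF s b c])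
 then show "Ck_on k I (\<phi> ` (U \<inter> W)) (\<lambda>w. t (inv_into U \<phi> w))"
  by (rule Ck_on_cong[OF ch(8)[OF regular_open[OF s]], THEN iffD1, rotated])
   (auto simp: inv_into_f_f[OF ch(5)] eq)
qed

lemma regular_subset:
 assumes s: "regular b M W s" and "openin (mtop M) W'" "W' \<subseteq> W" shows "regular b M W' s"
proof (rule regularI[OF assms(2)])
 show "continuous_map (subtopology (mtop M) W') euclidean s"
  using regular_continuous[OF s] assms(3) by (rule continuous_map_from_subtopology_mono)
 fix I U \<phi> k assume b: b and c: "(I, U, \<phi>) \<in> matlas M"
 have "Ck_on k I (\<phi> ` (U \<inter> W)) (\<lambda>w. s (inv_into U \<phi> w))"
  by (rule regular_Ck[OF s b c])
 then show "Ck_on k I (\<phi> ` (U \<inter> W')) (\<lambda>w. s (inv_into U \<phi> w))"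
  by (rule Ck_on_subset) (use assms(3) in blast)
qed

lemma regular_const: "openin (mtop M) W ==> regular b M W (\<lambda>_. c)"
 by (rule regularI) (auto intro: Ck_on_const)

lemma regular_add:
 assumes "regular b M W s" "regular b M W t" shows "regular b M W (\<lambda>x. s x + t x)"
 using assms by (intro regularI) (auto simp: regular_def smooth_fun_def intro!: continuous_map_add Ck_on_add)

lemma regular_mult:
 assumes "regular b M W s" "regular b M W t" shows "regular b M W (\<lambda>x. s x * t x)"
 using assms by (intro regularI) (auto simp: regular_def smooth_fun_def intro!: continuous_map_mult_complex Ck_on_mult)

lemma regular_sum:
 "openin (mtop M) W ==> (\<And>a. a \<in> A ==> regular b M W (s a)) ==> regular b M W (\<lambda>x. \<Sum>a\<in>A. s a x)"
 by (induction A rule: infinite_finite_induct) (auto intro: regular_const regular_add)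

lemma regular_prod:
 "openin (mtop M) W ==> (\<And>a. a \<in> A ==> regular b M W (s a)) ==> regular b M W (\<lambda>x. \<Prod>a\<in>A. s a x)"
 by (induction A rule: infinite_finite_induct) (auto intro: regular_const regular_mult)

lemma regular_local:
 assumes M: "reg_mfd b M" and W: "openin (mtop M) W"
  and loc: "\<And>x. x \<in> W ==> \<exists>W'. x \<in> W' \<and> regular b M W' s"
 shows "regular b M W s"
proof (rule regularI[OF W])
 have WM: "topspace (subtopology (mtop M) W) = W" using openin_subset[OF W] by auto
 have loc': "\<exists>W'. x \<in> W' \<and> W' \<subseteq> W \<and> regular b M W' s" if "x \<in> W" for x
 proof -
  obtain W' where W': "x \<in> W'" "regular b M W' s" using loc \<open>x \<in> W\<close> by blast
  then have "regular b M (W \<inter> W') s" using W regular_open[OF W'(2)] by (intro regular_subset[OF W'(2)]) auto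
  then show ?thesis using W'(1) \<open>x \<in> W\<close> by (intro exI[of _ "W \<inter> W'"]) simp
 qed
 show "continuous_map (subtopology (mtop M) W) euclidean s"
 proof (rule continuous_map_locally)
  fix x assume "x \<in> topspace (subtopology (mtop M) W)"
  then obtain W' where W': "x \<in> W'" "W' \<subseteq> W" "regular b M W' s" using loc' WM by blast
  have "openin (subtopology (mtop M) W) W'"
   using W' regular_open W by (simp add: openin_open_subtopology)
  moreover have "continuous_map (subtopology (subtopology (mtop M) W) W') euclidean s"
   using regular_continuous[OF W'(3)] W'(2) by (simp add: subtopology_subtopology Int_absorb1)
  ultimately show "\<exists>Wa. openin (subtopology (mtop M) W) Wa \<and> x \<in> Wa \<and>
     continuous_map (subtopology (subtopology (mtop M) W) Wa) euclidean s" using W'(1) by blast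
 qed
 fix I U \<phi> k assume b: b and c: "(I, U, \<phi>) \<in> matlas M"
 have M': "smooth_mfd M" using M b by (simp add: reg_mfd_def)
 note ch = smooth_mfd_chart[OF M' c]
 show "Ck_on k I (\<phi> ` (U \<inter> W)) (\<lambda>w. s (inv_into U \<phi> w))"
 proof (rule Ck_on_local[OF ch(8)[OF W]])
  fix w assume "w \<in> \<phi> ` (U \<inter> W)"
  then obtain x where x: "x \<in> U" "x \<in> W" "w = \<phi> x" by blast
  obtain W' where W': "x \<in> W'" "W' \<subseteq> W" "regular b M W' s" using loc' x by blast
  have "Ck_on k I (\<phi> ` (U \<inter> W')) (\<lambda>w. s (inv_into U \<phi> w))"
   using regular_chart[OF _ c] W'(3) b by (simp add: smooth_fun_def)
  moreover have "\<phi> ` (U \<inter> W) \<inter> \<phi> ` (U \<inter> W') = \<phi> ` (U \<inter> W')" using W'(2) by blast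
  ultimately show "\<exists>T. openin (cspace I) T \<and> w \<in> T \<and> Ck_on k I (\<phi> ` (U \<inter> W) \<inter> T) (\<lambda>w. s (inv_into U \<phi> w))"
   using ch(8)[OF regular_open[OF W'(3)]] x W' by (intro exI[of _ "\<phi> ` (U \<inter> W')"]) auto
 qed
qed

text \<open>Functions of one complex variable, encoded over the one-point index set so that
  \<open>Ck_on\<close> and its chain rule apply to them.\<close>

definition creg :: "bool => complex set => (complex => complex) => bool" where
 "creg b D g \<longleftrightarrow> open D \<and> continuous_on D g \<and> (b --> smooth_fun {()} {c. c () \<in> D} (\<lambda>c. g (c ())))"

lemma openin_cspace_unit: "open D ==> openin (cspace {()}) {c. c () \<in> D}"
 using openin_continuous_map_preimage[OF continuous_map_coord[of "()" "{()}"], of D]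
 by (simp add: PiE_def extensional_def)

lemma regular_creg:
 assumes M: "reg_mfd b M" and g: "creg b D g" and s: "regular b M W s" and D: "\<And>x. x \<in> W ==> s x \<in> D"
 shows "regular b M W (\<lambda>x. g (s x))"
proof (rule regularI[OF regular_open[OF s]])
 have 1: "continuous_map (subtopology (mtop M) W) (top_of_set D) s"
  using regular_continuous[OF s] D by (auto simp: continuous_map_in_subtopology)
 have 2: "continuous_map (top_of_set D) euclidean g" using g by (simp add: creg_def)
 show "continuous_map (subtopology (mtop M) W) euclidean (\<lambda>x. g (s x))"
  using continuous_map_compose[OF 1 2] by (simp add: o_def)
 fix I U \<phi> k assume b: b and c: "(I, U, \<phi>) \<in> matlas M"
 have M': "smooth_mfd M" using M b by (simp add: reg_mfd_def)
 note ch = smooth_mfd_chart[OF M' c]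
 have oD: "openin (cspace {()}) {c. c () \<in> D}" using g by (intro openin_cspace_unit) (simp add: creg_def)
 show "Ck_on k I (\<phi> ` (U \<inter> W)) (\<lambda>w. g (s (inv_into U \<phi> w)))"
 proof (rule Ck_on_compose[OF oD _ ch(8)[OF regular_open[OF s]], where g = "\<lambda>w _. s (inv_into U \<phi> w)" and f = "\<lambda>c. g (c ())"])
  show "Ck_on k {()} {c. c () \<in> D} (\<lambda>c. g (c ()))" using g b by (simp add: creg_def smooth_fun_def)
  show "Ck_on k I (\<phi> ` (U \<inter> W)) (\<lambda>w. s (inv_into U \<phi> w))"
   by (rule regular_Ck[OF s b c])
 qed (auto simp: inv_into_f_f[OF ch(5)] intro: D)
qed

subsection \<open>Open submanifolds\<close>

lemma mtop_open_submfd [simp]: "mtop (open_submfd M W) = subtopology (mtop M) W"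
 by (simp add: open_submfd_def)

lemma matlas_open_submfd: "(I, U, \<phi>) \<in> matlas (open_submfd M W) \<longleftrightarrow> (\<exists>U'. U = U' \<inter> W \<and> (I, U', \<phi>) \<in> matlas M)"
 by (auto simp: open_submfd_def)

lemma matlas_open_submfd_image: "matlas (open_submfd M W) = (\<lambda>(I, U, \<phi>). (I, U \<inter> W, \<phi>)) ` matlas M"
 by (force simp: open_submfd_def)

lemma chart_homeomorphic:
 assumes U: "U \<subseteq> topspace X" and "continuous_map (subtopology X U) C \<phi>"
  and "continuous_map (subtopology C (\<phi> ` U)) X g" and "\<And>x. x \<in> U ==> g (\<phi> x) = x"
 shows "homeomorphic_map (subtopology X U) (subtopology C (\<phi> ` U)) \<phi>"
proof -
 have "homeomorphic_maps (subtopology X U) (subtopology C (\<phi> ` U)) \<phi> g"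
  using assms by (auto simp: homeomorphic_maps_def continuous_map_in_subtopology)
 then show ?thesis using homeomorphic_map_maps by blast
qed

text \<open>Restricting a chart changes its \<open>inv_into\<close>, but the old and the new inverse
  agree on the image of \<open>V\<close>.\<close>

lemma regular_submfd_iff:
 assumes M: "reg_mfd b M" and W: "openin (mtop M) W" and V: "V \<subseteq> W"
 shows "regular b (open_submfd M W) V s \<longleftrightarrow> regular b M V s"
proof -
 have o: "openin (subtopology (mtop M) W) V \<longleftrightarrow> openin (mtop M) V"
  using W V by (simp add: openin_open_subtopology)
 have t: "subtopology (subtopology (mtop M) W) V = subtopology (mtop M) V"
  using V by (simp add: subtopology_subtopology Int_absorb1)
 have sm: "smooth_fun I (\<phi> ` (U \<inter> W \<inter> V)) (\<lambda>w. s (inv_into (U \<inter> W) \<phi> w)) \<longleftrightarrow>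
   smooth_fun I (\<phi> ` (U \<inter> V)) (\<lambda>w. s (inv_into U \<phi> w))"
  if b and oV: "openin (mtop M) V" and c: "(I, U, \<phi>) \<in> matlas M" for I U \<phi>
 proof -
  have M': "smooth_mfd M" using M that(1) by (simp add: reg_mfd_def)
  note ch = smooth_mfd_chart[OF M' c]
  have i: "inj_on \<phi> (U \<inter> W)" using ch(5) by (rule inj_on_subset) blast
  have "U \<inter> W \<inter> V = U \<inter> V" using V by blast
  moreover have "Ck_on k I (\<phi> ` (U \<inter> V)) (\<lambda>w. s (inv_into (U \<inter> W) \<phi> w)) = Ck_on k I (\<phi> ` (U \<inter> V)) (\<lambda>w. s (inv_into U \<phi> w))" for k
   by (rule Ck_on_cong[OF ch(8)[OF oV]]) (use V in \<open>auto simp: inv_into_f_f[OF ch(5)] inv_into_f_f[OF i]\<close>)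
  ultimately show ?thesis by (simp add: smooth_fun_def)
 qed
 have "(\<forall>(I, U, \<phi>)\<in>matlas (open_submfd M W). smooth_fun I (\<phi> ` (U \<inter> V)) (\<lambda>w. s (inv_into U \<phi> w))) \<longleftrightarrow>
   (\<forall>(I, U, \<phi>)\<in>matlas M. smooth_fun I (\<phi> ` (U \<inter> W \<inter> V)) (\<lambda>w. s (inv_into (U \<inter> W) \<phi> w)))"
  by (simp add: matlas_open_submfd_image case_prod_unfold)
 moreover have "\<dots> \<longleftrightarrow> (\<forall>(I, U, \<phi>)\<in>matlas M. smooth_fun I (\<phi> ` (U \<inter> V)) (\<lambda>w. s (inv_into U \<phi> w)))"
  if b "openin (mtop M) V"
  by (intro ball_cong refl) (use sm that in auto)
 ultimately show ?thesis unfolding regular_def mtop_open_submfd o t by blast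
qed

lemma reg_mfd_open_submfd:
 assumes M: "reg_mfd b M" and W: "openin (mtop M) W" shows "reg_mfd b (open_submfd M W)"
 unfolding reg_mfd_def
proof
 assume b
 then have M': "smooth_mfd M" using M by (simp add: reg_mfd_def)
 have MT: "reg_mfd True M" using M' by (simp add: reg_mfd_def)
 show "smooth_mfd (open_submfd M W)"
  unfolding smooth_mfd_def
 proof (intro conjI ballI, goal_cases)
  case 1
  have "(\<Union>(I, U, \<phi>)\<in>matlas (open_submfd M W). U) = (\<Union>(I, U, \<phi>)\<in>matlas M. U) \<inter> W"
   by (force simp: open_submfd_def)
  then show ?case using M' by (auto simp: smooth_mfd_def)
 next
  case (2 c)
  then obtain I U \<phi> where c: "c = (I, U \<inter> W, \<phi>)" "(I, U, \<phi>) \<in> matlas M" by (auto simp: open_submfd_def)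
  note ch = smooth_mfd_chart[OF M' c(2)]
  have i: "inj_on \<phi> (U \<inter> W)" using ch(5) by (rule inj_on_subset) blast
  have "homeomorphic_map (subtopology (subtopology (mtop M) W) (U \<inter> W)) (subtopology (cspace I) (\<phi> ` (U \<inter> W))) \<phi>"
  proof (rule chart_homeomorphic)
   show "U \<inter> W \<subseteq> topspace (subtopology (mtop M) W)" using ch(3) by auto
   show "continuous_map (subtopology (subtopology (mtop M) W) (U \<inter> W)) (cspace I) \<phi>"
    using continuous_map_from_subtopology_mono[OF ch(7), of "U \<inter> W"]
    by (simp add: subtopology_subtopology Int_absorb1 inf.absorb2)
   have "continuous_map (subtopology (cspace I) (\<phi> ` (U \<inter> W))) (mtop M) (inv_into U \<phi>)"
    using ch(9) by (rule continuous_map_from_subtopology_mono) blast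
   then show "continuous_map (subtopology (cspace I) (\<phi> ` (U \<inter> W))) (subtopology (mtop M) W) (inv_into U \<phi>)"
    by (auto simp: continuous_map_in_subtopology inv_into_f_f[OF ch(5)])
  qed (use inv_into_f_f[OF ch(5)] in auto)
  moreover have "openin (subtopology (mtop M) W) (U \<inter> W)"
   using W ch(2) by (simp add: openin_open_subtopology openin_Int)
  ultimately show ?case using c ch(1) ch(8)[OF W] by simp
 next
  case (3 c)
  then obtain I U \<phi> where c: "c = (I, U \<inter> W, \<phi>)" "(I, U, \<phi>) \<in> matlas M" by (auto simp: open_submfd_def)
  have "smooth_fun I (\<phi> ` (U \<inter> W \<inter> (V \<inter> W))) (\<lambda>w. \<psi> (inv_into (U \<inter> W) \<phi> w) j)"
   if d: "(J, V, \<psi>) \<in> matlas M" and j: "j \<in> J" for J V \<psi> j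
  proof -
   have "regular True M (V \<inter> W) (\<lambda>x. \<psi> x j)"
    using smooth_mfd_chart(2)[OF M' d] W by (intro regular_subset[OF chart_regular[OF M' d j]]) auto
   then have "regular True (open_submfd M W) (V \<inter> W) (\<lambda>x. \<psi> x j)"
    using regular_submfd_iff[OF MT W] by simp
   from regular_chart[OF this, of I "U \<inter> W" \<phi>] show ?thesis
    using c by (simp add: matlas_open_submfd) (metis inf_assoc inf_left_commute)
  qed
  then show ?case unfolding c by (auto simp: matlas_open_submfd)
 qed
qed

lemma reg_map_from_submfd:
 assumes M: "reg_mfd b M" and N: "reg_mfd b N" and W: "openin (mtop M) W" and f: "reg_map b M N f"
 shows "reg_map b (open_submfd M W) N f"
proof (rule reg_mapI[OF reg_mfd_open_submfd[OF M W] N])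
 show "continuous_map (mtop (open_submfd M W)) (mtop N) f"
  using reg_map_continuous[OF f] by (simp add: continuous_map_from_subtopology)
 fix J V \<psi> j assume b: b and d: "(J, V, \<psi>) \<in> matlas N" and j: "j \<in> J"
 have r: "regular b M (preim M f V) (\<lambda>x. \<psi> (f x) j)" by (rule reg_map_coord[OF M N f b d j])
 have "preim (open_submfd M W) f V = preim M f V \<inter> W" by (auto simp: preim_def)
 then show "regular b (open_submfd M W) (preim (open_submfd M W) f V) (\<lambda>x. \<psi> (f x) j)"
  using regular_submfd_iff[OF M W, of "preim M f V \<inter> W"] regular_subset[OF r, of "preim M f V \<inter> W"] regular_open[OF r] W
  by auto
qed

lemma reg_map_into_submfd:
 assumes M: "reg_mfd b M" and N: "reg_mfd b N" and W: "openin (mtop N) W"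
 shows "reg_map b M (open_submfd N W) f \<longleftrightarrow> reg_map b M N f \<and> f ` tspace M \<subseteq> W" (is "?L \<longleftrightarrow> ?R")
proof -
 have NW: "reg_mfd b (open_submfd N W)" by (rule reg_mfd_open_submfd[OF N W])
 have p: "preim M f (V \<inter> W) = preim M f V" if "f ` tspace M \<subseteq> W" for V
  using that by (auto simp: preim_def)
 show ?thesis
 proof
  assume L: ?L
  then have c: "continuous_map (mtop M) (mtop N) f" "f ` tspace M \<subseteq> W"
   using reg_map_continuous[OF L] by (auto simp: continuous_map_in_subtopology)
  have "reg_map b M N f"
  proof (rule reg_mapI[OF M N c(1)])
   fix J V \<psi> j assume b: b and d: "(J, V, \<psi>) \<in> matlas N" and j: "j \<in> J"
   have "(J, V \<inter> W, \<psi>) \<in> matlas (open_submfd N W)" using d by (auto simp: matlas_open_submfd)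
   then have "regular b M (preim M f (V \<inter> W)) (\<lambda>x. \<psi> (f x) j)"
    by (rule reg_map_coord[OF M NW L b _ j])
   then show "regular b M (preim M f V) (\<lambda>x. \<psi> (f x) j)" using p[OF c(2)] by simp
  qed
  then show ?R using c by simp
 next
  assume R: ?R
  show ?L
  proof (rule reg_mapI[OF M NW])
   show "continuous_map (mtop M) (mtop (open_submfd N W)) f"
    using R reg_map_continuous by (auto simp: continuous_map_in_subtopology)
   fix J V \<psi> j assume b: b and d: "(J, V, \<psi>) \<in> matlas (open_submfd N W)" and j: "j \<in> J"
   then obtain V' where V: "V = V' \<inter> W" "(J, V', \<psi>) \<in> matlas N" by (auto simp: matlas_open_submfd)
   then have "regular b M (preim M f V') (\<lambda>x. \<psi> (f x) j)"
    using R reg_map_coord[OF M N _ b _ j] by blast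
   then show "regular b M (preim M f V) (\<lambda>x. \<psi> (f x) j)" using p V R by simp
  qed
 qed
qed

lemma reg_map_local:
 assumes M: "reg_mfd b M" and N: "reg_mfd b N"
  and loc: "\<And>x. x \<in> tspace M ==> \<exists>W. openin (mtop M) W \<and> x \<in> W \<and> reg_map b (open_submfd M W) N f"
 shows "reg_map b M N f"
proof (rule reg_mapI[OF M N])
 show c: "continuous_map (mtop M) (mtop N) f"
  using loc reg_map_continuous by (intro continuous_map_locally) fastforce
 fix J V \<psi> j assume b: b and d: "(J, V, \<psi>) \<in> matlas N" and j: "j \<in> J"
 have N': "smooth_mfd N" using N b by (simp add: reg_mfd_def)
 show "regular b M (preim M f V) (\<lambda>x. \<psi> (f x) j)"
 proof (rule regular_local[OF M preim_open[OF c smooth_mfd_chart(2)[OF N' d]]])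
  fix x assume x: "x \<in> preim M f V"
  then obtain W where W: "openin (mtop M) W" "x \<in> W" "reg_map b (open_submfd M W) N f"
   using loc by (auto simp: preim_def)
  have "regular b (open_submfd M W) (preim (open_submfd M W) f V) (\<lambda>x. \<psi> (f x) j)"
   using W(3)[unfolded reg_map_iff[OF reg_mfd_open_submfd[OF M W(1)] N]] b d j by auto
  moreover have "preim (open_submfd M W) f V \<subseteq> W" by (auto simp: preim_def)
  ultimately have "regular b M (preim (open_submfd M W) f V) (\<lambda>x. \<psi> (f x) j)"
   using regular_submfd_iff[OF M W(1)] by blast
  moreover have "x \<in> preim (open_submfd M W) f V" using x W(2) by (simp add: preim_def)
  ultimately show "\<exists>W'. x \<in> W' \<and> regular b M W' (\<lambda>x. \<psi> (f x) j)" by blast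
 qed
qed

subsection \<open>Products and model spaces\<close>

lemma mtop_prod_mfd [simp]: "mtop (prod_mfd M N) = prod_topology (mtop M) (mtop N)"
 by (simp add: prod_mfd_def)

lemma matlas_prod_mfdE:
 assumes "c \<in> matlas (prod_mfd M N)"
 obtains I U \<phi> J V \<psi> where "c = (I <+> J, U \<times> V, pchart \<phi> \<psi>)"
  "(I, U, \<phi>) \<in> matlas M" "(J, V, \<psi>) \<in> matlas N"
 using assms by (auto simp: prod_mfd_def)

lemma matlas_prod_mfdI:
 "(I, U, \<phi>) \<in> matlas M ==> (J, V, \<psi>) \<in> matlas N ==>
  (I <+> J, U \<times> V, pchart \<phi> \<psi>) \<in> matlas (prod_mfd M N)"
 unfolding prod_mfd_def by simp blast

context
 fixes M :: "('a, 'i) mfd" and N :: "('b, 'j) mfd" and I U \<phi> J V \<psi>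
 assumes M: "smooth_mfd M" and N: "smooth_mfd N"
  and c: "(I, U, \<phi>) \<in> matlas M" and d: "(J, V, \<psi>) \<in> matlas N"
begin

private lemmas ch = smooth_mfd_chart[OF M c]
private lemmas dh = smooth_mfd_chart[OF N d]

lemma prod_chart_image:
 assumes "U0 \<subseteq> U" "V0 \<subseteq> V"
 shows "(pchart \<phi> \<psi>) ` (U0 \<times> V0) =
  {w \<in> topspace (cspace (I <+> J)). (\<lambda>i. w (Inl i)) \<in> \<phi> ` U0 \<and> (\<lambda>j. w (Inr j)) \<in> \<psi> ` V0}" (is "?L = ?R")
proof
 have "case_sum (\<phi> p) (\<psi> q) \<in> extensional (I <+> J)" if "p \<in> U" "q \<in> V" for p q
  using ch(6)[OF that(1)] dh(6)[OF that(2)] by (auto simp: extensional_def PiE_def split: sum.split)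
 then show "?L \<subseteq> ?R" using assms by (auto simp: PiE_def)
 show "?R \<subseteq> ?L"
 proof
  fix w assume "w \<in> ?R"
  then obtain p q where pq: "p \<in> U0" "q \<in> V0" "(\<lambda>i. w (Inl i)) = \<phi> p" "(\<lambda>j. w (Inr j)) = \<psi> q" by auto
  then have "w = case_sum (\<phi> p) (\<psi> q)" by (metis surjective_sum)
  then show "w \<in> ?L" using pq by force
 qed
qed

lemma prod_chart_inv:
 assumes "p \<in> U" "q \<in> V"
 shows "inv_into (U \<times> V) (pchart \<phi> \<psi>) (case_sum (\<phi> p) (\<psi> q)) = (p, q)"
proof -
 have "inj_on (pchart \<phi> \<psi>) (U \<times> V)"
 proof (rule inj_onI, clarify)
  fix p q p' q' assume *: "p \<in> U" "p' \<in> U" "q \<in> V" "q' \<in> V" "case_sum (\<phi> p) (\<psi> q) = case_sum (\<phi> p') (\<psi> q')"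
  from *(5) have "\<phi> p = \<phi> p'" "\<psi> q = \<psi> q'" by (metis case_sum_inject)+
  then show "p = p' \<and> q = q'" using * ch(5) dh(5) by (auto simp: inj_on_def)
 qed
 from inv_into_f_f[OF this, of "(p, q)"] show ?thesis using assms by simp
qed

lemma prod_chart_proj:
 "continuous_map (cspace (I <+> J)) (cspace I) (\<lambda>w i. w (Inl i))"
 "continuous_map (cspace (I <+> J)) (cspace J) (\<lambda>w j. w (Inr j))"
 by (auto simp: continuous_map_into_cspace extensional_def PiE_def intro!: continuous_map_coord)

lemma prod_chart_open:
 assumes "openin (mtop M) U0" "U0 \<subseteq> U" "openin (mtop N) V0" "V0 \<subseteq> V"
 shows "openin (cspace (I <+> J)) ((pchart \<phi> \<psi>) ` (U0 \<times> V0))"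
proof -
 have "openin (cspace (I <+> J)) ({w \<in> topspace (cspace (I <+> J)). (\<lambda>i. w (Inl i)) \<in> \<phi> ` U0} \<inter>
   {w \<in> topspace (cspace (I <+> J)). (\<lambda>j. w (Inr j)) \<in> \<psi> ` V0})"
  using ch(8)[OF assms(1)] dh(8)[OF assms(3)] assms(2,4)
  by (intro openin_Int openin_continuous_map_preimage[OF prod_chart_proj(1)]
    openin_continuous_map_preimage[OF prod_chart_proj(2)]) (simp_all add: Int_absorb1)
 then show ?thesis unfolding prod_chart_image[OF assms(2,4)] by (simp add: Collect_conj_eq[symmetric] conj_ac Int_def)
qed

lemma prod_chart_homeo:
 "homeomorphic_map (subtopology (prod_topology (mtop M) (mtop N)) (U \<times> V))
   (subtopology (cspace (I <+> J)) ((pchart \<phi> \<psi>) ` (U \<times> V)))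
   (pchart \<phi> \<psi>)"
proof (rule chart_homeomorphic)
 let ?P = "prod_topology (subtopology (mtop M) U) (subtopology (mtop N) V)"
 have P: "subtopology (prod_topology (mtop M) (mtop N)) (U \<times> V) = ?P" by (simp add: subtopology_Times)
 show "U \<times> V \<subseteq> topspace (prod_topology (mtop M) (mtop N))" using ch(3) dh(3) by auto
 show "continuous_map (subtopology (prod_topology (mtop M) (mtop N)) (U \<times> V)) (cspace (I <+> J)) (pchart \<phi> \<psi>)"
  unfolding P continuous_map_into_cspace
 proof (intro conjI ballI)
  show "(pchart \<phi> \<psi>) ` topspace ?P \<subseteq> extensional (I <+> J)"
   using ch(6) dh(6) by (fastforce simp: extensional_def PiE_def split: sum.split)
  fix k assume k: "k \<in> I <+> J"
  have 1: "continuous_map ?P (cspace I) (\<lambda>x. \<phi> (fst x))"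
   using continuous_map_compose[OF continuous_map_fst ch(7)] by (simp add: o_def)
  have 2: "continuous_map ?P (cspace J) (\<lambda>x. \<psi> (snd x))"
   using continuous_map_compose[OF continuous_map_snd dh(7)] by (simp add: o_def)
  show "continuous_map ?P euclidean (\<lambda>x. (case x of (p, q) => case_sum (\<phi> p) (\<psi> q)) k)"
   using k 1 2 by (auto simp: case_prod_unfold continuous_map_into_cspace)
 qed
 let ?K = "subtopology (cspace (I <+> J)) ((pchart \<phi> \<psi>) ` (U \<times> V))"
 let ?g = "\<lambda>w. (inv_into U \<phi> (\<lambda>i. w (Inl i)), inv_into V \<psi> (\<lambda>j. w (Inr j)))"
 have "continuous_map ?K (subtopology (cspace I) (\<phi> ` U)) (\<lambda>w i. w (Inl i))"
  "continuous_map ?K (subtopology (cspace J) (\<psi> ` V)) (\<lambda>w j. w (Inr j))"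
  using prod_chart_proj by (auto simp: continuous_map_in_subtopology continuous_map_from_subtopology)
 from continuous_map_compose[OF this(1) ch(9)] continuous_map_compose[OF this(2) dh(9)]
 show "continuous_map ?K (prod_topology (mtop M) (mtop N)) ?g"
  by (simp add: continuous_map_pairwise o_def)
 show "?g ((pchart \<phi> \<psi>) x) = x" if "x \<in> U \<times> V" for x
  using that by (auto simp: inv_into_f_f[OF ch(5)] inv_into_f_f[OF dh(5)])
qed

text \<open>In a product chart a function of the first factor is its chart expression composed with
  the projection to the left coordinates, which is smooth coordinatewise.\<close>

lemma prod_chart_fst:
 assumes "regular True M W s"
 shows "Ck_on k (I <+> J) ((pchart \<phi> \<psi>) ` ((U \<inter> W) \<times> V))
  (\<lambda>w. s (fst (inv_into (U \<times> V) (pchart \<phi> \<psi>) w)))"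
proof -
 let ?T = "(pchart \<phi> \<psi>) ` ((U \<inter> W) \<times> V)"
 have T: "openin (cspace (I <+> J)) ?T"
  using ch(2) dh(2) regular_open[OF assms] by (intro prod_chart_open) auto
 have "Ck_on k (I <+> J) ?T (\<lambda>w. s (inv_into U \<phi> (\<lambda>i. w (Inl i))))"
 proof (rule Ck_on_compose[OF ch(8)[OF regular_open[OF assms]] ch(1) T, where g = "\<lambda>w i. w (Inl i)"])
  show "Ck_on k I (\<phi> ` (U \<inter> W)) (\<lambda>v. s (inv_into U \<phi> v))" by (rule regular_Ck[OF assms _ c]) simp
 qed (auto intro: Ck_on_coord)
 then show ?thesis
  by (rule Ck_on_cong[OF T, THEN iffD1, rotated]) (auto simp: prod_chart_inv inv_into_f_f[OF ch(5)])
qed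

lemma prod_chart_snd:
 assumes "regular True N W s"
 shows "Ck_on k (I <+> J) ((pchart \<phi> \<psi>) ` (U \<times> (V \<inter> W)))
  (\<lambda>w. s (snd (inv_into (U \<times> V) (pchart \<phi> \<psi>) w)))"
proof -
 let ?T = "(pchart \<phi> \<psi>) ` (U \<times> (V \<inter> W))"
 have T: "openin (cspace (I <+> J)) ?T"
  using ch(2) dh(2) regular_open[OF assms] by (intro prod_chart_open) auto
 have "Ck_on k (I <+> J) ?T (\<lambda>w. s (inv_into V \<psi> (\<lambda>i. w (Inr i))))"
 proof (rule Ck_on_compose[OF dh(8)[OF regular_open[OF assms]] dh(1) T, where g = "\<lambda>w i. w (Inr i)"])
  show "Ck_on k J (\<psi> ` (V \<inter> W)) (\<lambda>v. s (inv_into V \<psi> v))" by (rule regular_Ck[OF assms _ d]) simp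
 qed (auto intro: Ck_on_coord)
 then show ?thesis
  by (rule Ck_on_cong[OF T, THEN iffD1, rotated]) (auto simp: prod_chart_inv inv_into_f_f[OF dh(5)])
qed

end

lemma regular_fst:
 assumes M: "reg_mfd b M" and N: "reg_mfd b N" and s: "regular b M W s"
 shows "regular b (prod_mfd M N) (W \<times> tspace N) (\<lambda>x. s (fst x))"
proof (rule regularI)
 show "openin (mtop (prod_mfd M N)) (W \<times> tspace N)"
  using regular_open[OF s] by (simp add: openin_prod_Times_iff)
 have "continuous_map (prod_topology (subtopology (mtop M) W) (mtop N)) euclidean (\<lambda>x. s (fst x))"
  using continuous_map_compose[OF continuous_map_fst regular_continuous[OF s]] by (simp add: o_def)
 then show "continuous_map (subtopology (mtop (prod_mfd M N)) (W \<times> tspace N)) euclidean (\<lambda>x. s (fst x))"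
  by (simp add: subtopology_Times)
 fix K T \<Phi> k assume b: b and "(K, T, \<Phi>) \<in> matlas (prod_mfd M N)"
 then obtain I U \<phi> J V \<psi> where c: "K = I <+> J" "T = U \<times> V" "\<Phi> = (pchart \<phi> \<psi>)"
  "(I, U, \<phi>) \<in> matlas M" "(J, V, \<psi>) \<in> matlas N" by (auto elim: matlas_prod_mfdE)
 have MN: "smooth_mfd M" "smooth_mfd N" using M N b by (auto simp: reg_mfd_def)
 have "U \<times> V \<inter> W \<times> tspace N = (U \<inter> W) \<times> V" using smooth_mfd_chart(3)[OF MN(2) c(5)] by auto
 then show "Ck_on k K (\<Phi> ` (T \<inter> W \<times> tspace N)) (\<lambda>w. s (fst (inv_into T \<Phi> w)))"
  using prod_chart_fst[OF MN c(4,5), of W s k] s b unfolding c(1-3) by simp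
qed

lemma regular_snd:
 assumes M: "reg_mfd b M" and N: "reg_mfd b N" and s: "regular b N W s"
 shows "regular b (prod_mfd M N) (tspace M \<times> W) (\<lambda>x. s (snd x))"
proof (rule regularI)
 show "openin (mtop (prod_mfd M N)) (tspace M \<times> W)"
  using regular_open[OF s] by (simp add: openin_prod_Times_iff)
 have "continuous_map (prod_topology (mtop M) (subtopology (mtop N) W)) euclidean (\<lambda>x. s (snd x))"
  using continuous_map_compose[OF continuous_map_snd regular_continuous[OF s]] by (simp add: o_def)
 then show "continuous_map (subtopology (mtop (prod_mfd M N)) (tspace M \<times> W)) euclidean (\<lambda>x. s (snd x))"
  by (simp add: subtopology_Times)
 fix K T \<Phi> k assume b: b and "(K, T, \<Phi>) \<in> matlas (prod_mfd M N)"
 then obtain I U \<phi> J V \<psi> where c: "K = I <+> J" "T = U \<times> V" "\<Phi> = (pchart \<phi> \<psi>)"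
  "(I, U, \<phi>) \<in> matlas M" "(J, V, \<psi>) \<in> matlas N" by (auto elim: matlas_prod_mfdE)
 have MN: "smooth_mfd M" "smooth_mfd N" using M N b by (auto simp: reg_mfd_def)
 have "U \<times> V \<inter> tspace M \<times> W = U \<times> (V \<inter> W)" using smooth_mfd_chart(3)[OF MN(1) c(4)] by auto
 then show "Ck_on k K (\<Phi> ` (T \<inter> tspace M \<times> W)) (\<lambda>w. s (snd (inv_into T \<Phi> w)))"
  using prod_chart_snd[OF MN c(4,5), of W s k] s b unfolding c(1-3) by simp
qed

lemma smooth_mfd_prod:
 assumes M: "smooth_mfd M" and N: "smooth_mfd N" shows "smooth_mfd (prod_mfd M N)"
 unfolding smooth_mfd_def
proof (intro conjI ballI, goal_cases)
 case 1
 show ?case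
 proof
  show "(\<Union>(I, U, \<phi>)\<in>matlas (prod_mfd M N). U) \<subseteq> tspace (prod_mfd M N)"
   using smooth_mfd_chart(3)[OF M] smooth_mfd_chart(3)[OF N] by (fastforce elim: matlas_prod_mfdE)
  show "tspace (prod_mfd M N) \<subseteq> (\<Union>(I, U, \<phi>)\<in>matlas (prod_mfd M N). U)"
  proof (clarsimp)
   fix x y assume "x \<in> tspace M" "y \<in> tspace N"
   then obtain I U \<phi> J V \<psi> where "(I, U, \<phi>) \<in> matlas M" "x \<in> U" "(J, V, \<psi>) \<in> matlas N" "y \<in> V"
    using smooth_mfd_cover M N by metis
   then show "\<exists>c\<in>matlas (prod_mfd M N). (x, y) \<in> (case c of (I, U, \<phi>) => U)"
    by (intro bexI[OF _ matlas_prod_mfdI]) auto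
  qed
 qed
next
 case (2 c)
 from 2(1) obtain I U \<phi> J V \<psi> where c: "c = (I <+> J, U \<times> V, pchart \<phi> \<psi>)"
  "(I, U, \<phi>) \<in> matlas M" "(J, V, \<psi>) \<in> matlas N" by (elim matlas_prod_mfdE)
 note ch = smooth_mfd_chart[OF M c(2)] and dh = smooth_mfd_chart[OF N c(3)]
 show ?case
  using ch(1,2) dh(1,2) prod_chart_open[OF M N c(2,3) ch(2) _ dh(2)] prod_chart_homeo[OF M N c(2,3)]
  by (simp add: c(1) openin_prod_Times_iff)
next
 case (3 c)
 from 3(1) obtain I U \<phi> J V \<psi> where c: "c = (I <+> J, U \<times> V, pchart \<phi> \<psi>)"
  "(I, U, \<phi>) \<in> matlas M" "(J, V, \<psi>) \<in> matlas N" by (elim matlas_prod_mfdE)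
 have "smooth_fun (I <+> J) ((pchart \<phi> \<psi>) ` ((U \<times> V) \<inter> (U' \<times> V')))
   (\<lambda>w. (\<lambda>(p, q). case_sum (\<phi>' p) (\<psi>' q)) (inv_into (U \<times> V) (pchart \<phi> \<psi>) w) j)"
  if d: "(I', U', \<phi>') \<in> matlas M" "(J', V', \<psi>') \<in> matlas N" and j: "j \<in> I' <+> J'" for I' U' \<phi>' J' V' \<psi>' j
 proof (cases j)
  case (Inl i)
  then have "regular True M U' (\<lambda>x. \<phi>' x i)" using j by (intro chart_regular[OF M d(1)]) auto
  from Ck_on_subset[OF prod_chart_fst[OF M N c(2,3) this],
    of "(pchart \<phi> \<psi>) ` ((U \<times> V) \<inter> (U' \<times> V'))"]
  show ?thesis by (auto simp: smooth_fun_def case_prod_unfold Inl)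
 next
  case (Inr i)
  then have "regular True N V' (\<lambda>x. \<psi>' x i)" using j by (intro chart_regular[OF N d(2)]) auto
  from Ck_on_subset[OF prod_chart_snd[OF M N c(2,3) this],
    of "(pchart \<phi> \<psi>) ` ((U \<times> V) \<inter> (U' \<times> V'))"]
  show ?thesis by (auto simp: smooth_fun_def case_prod_unfold Inr)
 qed
 note sm = this
 show ?case
  unfolding c(1) prod.case
 proof (rule ballI)
  fix e assume "e \<in> matlas (prod_mfd M N)"
  then obtain I' U' \<phi>' J' V' \<psi>' where e: "e = (I' <+> J', U' \<times> V', \<lambda>(p, q). case_sum (\<phi>' p) (\<psi>' q))"
   "(I', U', \<phi>') \<in> matlas M" "(J', V', \<psi>') \<in> matlas N" by (elim matlas_prod_mfdE)
  show "case e of (K', T', \<Psi>) => \<forall>j\<in>K'. smooth_fun (I <+> J) ((pchart \<phi> \<psi>) ` (U \<times> V \<inter> T'))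
    (\<lambda>w. \<Psi> (inv_into (U \<times> V) (pchart \<phi> \<psi>) w) j)"
   unfolding e(1) prod.case by (intro ballI sm[OF e(2,3)])
 qed
qed

lemma reg_mfd_prod: "reg_mfd b M ==> reg_mfd b N ==> reg_mfd b (prod_mfd M N)"
 by (simp add: reg_mfd_def smooth_mfd_prod)

lemma reg_map_fst:
 assumes M: "reg_mfd b M" and N: "reg_mfd b N" shows "reg_map b (prod_mfd M N) M fst"
proof (rule reg_mapI[OF reg_mfd_prod[OF M N] M])
 show "continuous_map (mtop (prod_mfd M N)) (mtop M) fst" by (simp add: continuous_map_fst)
 fix J V \<psi> j assume b: b and d: "(J, V, \<psi>) \<in> matlas M" and j: "j \<in> J"
 have M': "smooth_mfd M" using M b by (simp add: reg_mfd_def)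
 have "preim (prod_mfd M N) fst V = V \<times> tspace N"
  using smooth_mfd_chart(3)[OF M' d] by (auto simp: preim_def)
 then show "regular b (prod_mfd M N) (preim (prod_mfd M N) fst V) (\<lambda>x. \<psi> (fst x) j)"
  using regular_fst[OF M N chart_regular[OF M' d j]] by simp
qed

lemma reg_map_snd:
 assumes M: "reg_mfd b M" and N: "reg_mfd b N" shows "reg_map b (prod_mfd M N) N snd"
proof (rule reg_mapI[OF reg_mfd_prod[OF M N] N])
 show "continuous_map (mtop (prod_mfd M N)) (mtop N) snd" by (simp add: continuous_map_snd)
 fix J V \<psi> j assume b: b and d: "(J, V, \<psi>) \<in> matlas N" and j: "j \<in> J"
 have N': "smooth_mfd N" using N b by (simp add: reg_mfd_def)
 have "preim (prod_mfd M N) snd V = tspace M \<times> V"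
  using smooth_mfd_chart(3)[OF N' d] by (auto simp: preim_def)
 then show "regular b (prod_mfd M N) (preim (prod_mfd M N) snd V) (\<lambda>x. \<psi> (snd x) j)"
  using regular_snd[OF M N chart_regular[OF N' d j]] by simp
qed

lemma reg_map_pair:
 assumes P: "reg_mfd b P" and M: "reg_mfd b M" and N: "reg_mfd b N"
  and f: "reg_map b P M f" and g: "reg_map b P N g"
 shows "reg_map b P (prod_mfd M N) (\<lambda>x. (f x, g x))"
proof (rule reg_mapI[OF P reg_mfd_prod[OF M N]])
 show "continuous_map (mtop P) (mtop (prod_mfd M N)) (\<lambda>x. (f x, g x))"
  using reg_map_continuous[OF f] reg_map_continuous[OF g] by (simp add: continuous_map_pairedI)
 fix K T \<Phi> k assume b: b and "(K, T, \<Phi>) \<in> matlas (prod_mfd M N)" and k: "k \<in> K"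
 then obtain I U \<phi> J V \<psi> where c: "K = I <+> J" "T = U \<times> V" "\<Phi> = (pchart \<phi> \<psi>)"
  "(I, U, \<phi>) \<in> matlas M" "(J, V, \<psi>) \<in> matlas N" by (auto elim: matlas_prod_mfdE)
 have MN: "smooth_mfd M" "smooth_mfd N" using M N b by (auto simp: reg_mfd_def)
 have p: "preim P (\<lambda>x. (f x, g x)) T = preim P f U \<inter> preim P g V" by (auto simp: preim_def c)
 have o: "openin (mtop P) (preim P f U)" "openin (mtop P) (preim P g V)"
  using preim_open[OF reg_map_continuous[OF f] smooth_mfd_chart(2)[OF MN(1) c(4)]]
   preim_open[OF reg_map_continuous[OF g] smooth_mfd_chart(2)[OF MN(2) c(5)]] .
 show "regular b P (preim P (\<lambda>x. (f x, g x)) T) (\<lambda>x. \<Phi> (f x, g x) k)"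
 proof (cases k)
  case (Inl i)
  then have "regular b P (preim P f U) (\<lambda>x. \<phi> (f x) i)" using reg_map_coord[OF P M f b c(4)] k c(1) by auto
  then show ?thesis unfolding p using o by (auto simp: c(3) Inl intro: regular_subset)
 next
  case (Inr i)
  then have "regular b P (preim P g V) (\<lambda>x. \<psi> (g x) i)" using reg_map_coord[OF P N g b c(5)] k c(1) by auto
  then show ?thesis unfolding p using o by (auto simp: c(3) Inr intro: regular_subset)
 qed
qed

lemma smooth_mfd_cspace: "finite I ==> smooth_mfd (cspace_mfd I)"
proof -
 assume I: "finite I"
 have inv: "inv_into (topspace (cspace I)) (\<lambda>w. w) w = w" if "w \<in> topspace (cspace I)" for w
  using inv_into_f_f[of "\<lambda>w. w" "topspace (cspace I)" w] that by simp
 have o: "openin (cspace I) (topspace (cspace I))" by (rule openin_topspace)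
 have "smooth_fun I (topspace (cspace I)) (\<lambda>w. inv_into (topspace (cspace I)) (\<lambda>w. w) w i)" if "i \<in> I" for i
  unfolding smooth_fun_def
 proof
  fix k
  show "Ck_on k I (topspace (cspace I)) (\<lambda>w. inv_into (topspace (cspace I)) (\<lambda>w. w) w i)"
   by (rule Ck_on_cong[OF o, THEN iffD1, OF _ Ck_on_coord[OF that]]) (simp only: inv)
 qed
 moreover have "homeomorphic_map (cspace I) (cspace I) (\<lambda>w. w)"
  using homeomorphic_map_id[of "cspace I" "cspace I"] by (simp add: id_def)
 ultimately show ?thesis using I o
  by (simp add: smooth_mfd_def cspace_mfd_def del: topspace_cspace)
qed

lemma reg_mfd_cspace: "finite I ==> reg_mfd b (cspace_mfd I)"
 by (simp add: reg_mfd_def smooth_mfd_cspace)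

lemma mtop_cspace_mfd [simp]: "mtop (cspace_mfd I) = cspace I" by (simp add: cspace_mfd_def)

lemma regular_cspace_coord: "finite I ==> i \<in> I ==> regular b (cspace_mfd I) (topspace (cspace I)) (\<lambda>w. w i)"
 using chart_regular[OF smooth_mfd_cspace, of I I "topspace (cspace I)" "\<lambda>w. w" i]
 by (simp add: cspace_mfd_def)

lemma reg_map_into_cspace:
 assumes M: "reg_mfd b M" and I: "finite I"
 shows "reg_map b M (cspace_mfd I) f \<longleftrightarrow> f ` tspace M \<subseteq> topspace (cspace I) \<and>
   (\<forall>i\<in>I. regular b M (tspace M) (\<lambda>x. f x i))" (is "?L \<longleftrightarrow> ?R")
proof
 assume L: ?L
 have "preim M f (topspace (cspace I)) = tspace M"
  using reg_map_in_topspace[OF L] by (auto simp: preim_def)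
 then show ?R
  using regular_pullback[OF M reg_mfd_cspace[OF I] L regular_cspace_coord[OF I]]
   continuous_map_image_subset_topspace[OF reg_map_continuous[OF L]] by (simp del: topspace_cspace)
next
 assume R: ?R
 then have p: "preim M f (topspace (cspace I)) = tspace M" by (auto simp: preim_def)
 show ?L
 proof (rule reg_mapI[OF M reg_mfd_cspace[OF I]])
  show "continuous_map (mtop M) (mtop (cspace_mfd I)) f"
   using R regular_continuous[of b M "tspace M"] by (auto simp: continuous_map_into_cspace PiE_def)
  fix J V \<psi> j assume "(J, V, \<psi>) \<in> matlas (cspace_mfd I)" "j \<in> J"
  then show "regular b M (preim M f V) (\<lambda>x. \<psi> (f x) j)" using R p by (auto simp: cspace_mfd_def)
 qed
qed

text \<open>Besides the torus this covers \<open>U_complex \<Sigma>\<close>, the source of the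
  quotient map onto the toric manifold.\<close>

definition vec_mfd :: "(complex ^ 'k) set => (complex ^ 'k, 'k) mfd" where
 "vec_mfd S = \<lparr>mtop = top_of_set S, matlas = {(UNIV, S, \<lambda>g k. g $ k)}\<rparr>"

lemma mtop_vec_mfd [simp]: "mtop (vec_mfd S) = top_of_set S" by (simp add: vec_mfd_def)

lemma torus_mfd_vec: "torus_mfd = vec_mfd torus" by (simp add: torus_mfd_def vec_mfd_def)

lemma continuous_map_vec:
 fixes f :: "'a => complex ^ 'k"
 shows "continuous_map X euclidean f \<longleftrightarrow> (\<forall>k. continuous_map X euclidean (\<lambda>x. f x $ k))"
 unfolding continuous_map_atin by (auto intro: vec_tendstoI tendsto_vec_nth)

lemma smooth_mfd_vec:
 fixes S :: "(complex ^ 'k) set"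
 assumes S: "open S" shows "smooth_mfd (vec_mfd S)"
proof -
 let ?\<phi> = "\<lambda>(g :: complex ^ 'k) k. g $ k" and ?\<psi> = "\<lambda>w. (\<chi> k. w k) :: complex ^ 'k"
 have inj: "inj_on ?\<phi> S" by (simp add: inj_on_def vec_eq_iff fun_eq_iff)
 have \<psi>: "continuous_map (cspace (UNIV :: 'k set)) euclidean ?\<psi>"
  by (simp add: continuous_map_vec continuous_map_coord)
 have "openin (cspace UNIV) {w \<in> topspace (cspace UNIV). ?\<psi> w \<in> S}"
  using openin_continuous_map_preimage[OF \<psi>] S by simp
 moreover have "{w \<in> topspace (cspace UNIV). ?\<psi> w \<in> S} = ?\<phi> ` S"
  by (auto simp: image_iff fun_eq_iff intro!: bexI[of _ "?\<psi> w" for w])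
 ultimately have o: "openin (cspace UNIV) (?\<phi> ` S)" by simp
 have h: "homeomorphic_map (subtopology (top_of_set S) S) (subtopology (cspace UNIV) (?\<phi> ` S)) ?\<phi>"
 proof (rule chart_homeomorphic)
  show "continuous_map (subtopology (top_of_set S) S) (cspace UNIV) ?\<phi>"
   by (auto simp: continuous_map_into_cspace intro!: continuous_map_from_subtopology continuous_intros)
  show "continuous_map (subtopology (cspace UNIV) (?\<phi> ` S)) (top_of_set S) ?\<psi>"
   using \<psi> by (auto simp: continuous_map_in_subtopology continuous_map_from_subtopology)
 qed auto
 have "Ck_on k UNIV (?\<phi> ` S) (\<lambda>w. inv_into S ?\<phi> w $ j)" for k j
  by (rule Ck_on_cong[OF o, THEN iffD1, OF _ Ck_on_coord[of j]]) (auto simp: inv_into_f_f[OF inj])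
 then show ?thesis using o h by (simp add: smooth_mfd_def vec_mfd_def smooth_fun_def)
qed

lemma reg_mfd_vec: "open S ==> reg_mfd b (vec_mfd S)"
 by (simp add: reg_mfd_def smooth_mfd_vec)

lemma regular_vec_coord: "open S ==> regular b (vec_mfd S) S (\<lambda>z. z $ k)"
 using chart_regular[OF smooth_mfd_vec, of S UNIV S "\<lambda>g k. g $ k" k] by (simp add: vec_mfd_def)

lemma reg_map_into_vec:
 assumes M: "reg_mfd b M" and S: "open S"
 shows "reg_map b M (vec_mfd S) f \<longleftrightarrow> f ` tspace M \<subseteq> S \<and>
   (\<forall>k. regular b M (tspace M) (\<lambda>x. f x $ k))" (is "?L \<longleftrightarrow> ?R")
proof
 assume L: ?L
 have "preim M f S = tspace M"
  using reg_map_in_topspace[OF L] by (auto simp: preim_def)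
 then show ?R
  using regular_pullback[OF M reg_mfd_vec[OF S] L regular_vec_coord[OF S]] reg_map_in_topspace[OF L] by auto
next
 assume R: ?R
 then have p: "preim M f S = tspace M" by (auto simp: preim_def)
 show ?L
 proof (rule reg_mapI[OF M reg_mfd_vec[OF S]])
  have "continuous_map (mtop M) euclidean f"
   unfolding continuous_map_vec using R regular_continuous[of b M "tspace M"] by auto
  then show "continuous_map (mtop M) (mtop (vec_mfd S)) f"
   using R by (auto simp: continuous_map_in_subtopology)
  fix J V \<psi> j assume "(J, V, \<psi>) \<in> matlas (vec_mfd S)" "j \<in> J"
  then show "regular b M (preim M f V) (\<lambda>x. \<psi> (f x) j)" using R p by (auto simp: vec_mfd_def)
 qed
qed

definition reg_diffeo :: "bool => ('a, 'i) mfd => ('b, 'j) mfd => ('a => 'b) => bool" where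
 "reg_diffeo b M N f \<longleftrightarrow> bij_betw f (tspace M) (tspace N) \<and>
   reg_map b M N f \<and> reg_map b N M (inv_into (tspace M) f)"

lemma reg_diffeo_True: "reg_diffeo True M N f \<longleftrightarrow> diffeo M N f"
 by (simp add: reg_diffeo_def diffeo_def reg_map_def)

lemma reg_diffeo_False: "reg_diffeo False M N f \<longleftrightarrow> homeomorphic_map (mtop M) (mtop N) f"
proof
 assume R: "reg_diffeo False M N f"
 let ?g = "inv_into (tspace M) f"
 have "homeomorphic_maps (mtop M) (mtop N) f ?g"
  using R by (auto simp: reg_diffeo_def reg_map_def homeomorphic_maps_def bij_betw_def f_inv_into_f)
 then show "homeomorphic_map (mtop M) (mtop N) f" using homeomorphic_map_maps by blast
next
 assume h: "homeomorphic_map (mtop M) (mtop N) f"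
 then obtain g where g: "homeomorphic_maps (mtop M) (mtop N) f g" using homeomorphic_map_maps by blast
 have b: "bij_betw f (tspace M) (tspace N)"
  using h homeomorphic_imp_injective_map homeomorphic_imp_surjective_map unfolding bij_betw_def by blast
 have "continuous_map (mtop N) (mtop M) (inv_into (tspace M) f)"
 proof (rule continuous_map_eq)
  show "continuous_map (mtop N) (mtop M) g" using g by (simp add: homeomorphic_maps_def)
  fix y assume y: "y \<in> tspace N"
  then have "g y \<in> tspace M" "f (g y) = y"
   using g continuous_map_image_subset_topspace by (fastforce simp: homeomorphic_maps_def)+
  then show "g y = inv_into (tspace M) f y"
   using b by (metis bij_betw_inv_into_left)
 qed
 then show "reg_diffeo False M N f"
  using b h homeomorphic_imp_continuous_map by (auto simp: reg_diffeo_def reg_map_def)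
qed

section \<open>Dual families in \<open>\<R>\<^sup>n\<close>\<close>

lemma rr_zero_sel [simp]: "cpart 0 = 0" "zpart 0 = 0" by (simp_all add: zero_rr_def)
lemma rr_one_sel [simp]: "cpart 1 = 1" "zpart 1 = 1" by (simp_all add: one_rr_def)
lemma rr_plus_sel [simp]: "cpart (a + b) = cpart a + cpart b" "zpart (a + b) = zpart a + zpart b"
 by (simp_all add: plus_rr_def)
lemma rr_minus_sel [simp]: "cpart (a - b) = cpart a - cpart b" "zpart (a - b) = zpart a - zpart b"
 by (simp_all add: minus_rr_def)
lemma rr_uminus_sel [simp]: "cpart (- a) = - cpart a" "zpart (- a) = - zpart a"
 by (simp_all add: uminus_rr_def)
lemma rr_times_sel:
 "Re (cpart (a * b)) = Re (cpart a) * Re (cpart b)"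
 "Im (cpart (a * b)) = Im (cpart a) * Re (cpart b) + of_int (zpart a) * Im (cpart b)"
 "zpart (a * b) = zpart a * zpart b"
 by (simp_all add: times_rr_def)
lemma rr_sum_sel [simp]: "cpart (sum f A) = (\<Sum>x\<in>A. cpart (f x))" "zpart (sum f A) = (\<Sum>x\<in>A. zpart (f x))"
 by (induction A rule: infinite_finite_induct) simp_all

lemma rr_eq_iff: "a = b \<longleftrightarrow> Re (cpart a) = Re (cpart b) \<and> Im (cpart a) = Im (cpart b) \<and> zpart a = zpart b"
 by (cases a; cases b) (auto simp: complex_eq_iff)

lemma pairing_add_left: "pairing (\<alpha> + \<alpha>') \<beta> = pairing \<alpha> \<beta> + pairing \<alpha>' \<beta>"
 by (simp add: pairing_def algebra_simps sum.distrib)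
lemma pairing_diff_left: "pairing (\<alpha> - \<alpha>') \<beta> = pairing \<alpha> \<beta> - pairing \<alpha>' \<beta>"
 by (simp add: pairing_def algebra_simps sum_subtractf)
lemma pairing_zero_left [simp]: "pairing 0 \<beta> = 0"
 by (simp add: pairing_def)

lemma mat_nth: "mat c $ i $ j = (if i = j then c else 0)" by (simp add: mat_def)

text \<open>For the triangular matrix ring \<open>\<R>\<close> a one-sided inverse of a square matrix is two-sided,
 since this holds for the two diagonal parts.\<close>

lemma dual_two_sided:
 fixes \<alpha> \<gamma> :: "'m::finite => rr ^ 'n"
 assumes dual: "dual_on \<alpha> \<gamma> J" and card: "card J = CARD('n)"
 shows "(\<Sum>s\<in>J. \<gamma> s $ k * \<alpha> s $ l) = (if k = l then 1 else 0)"
proof -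
 obtain \<sigma> :: "'n => 'm" where \<sigma>: "bij_betw \<sigma> UNIV J"
  using card finite_same_card_bij[of "UNIV :: 'n set" J] by auto
 define A :: "real^'n^'n" where "A = (\<chi> s k. Re (cpart (\<alpha> (\<sigma> s) $ k)))"
 define B :: "real^'n^'n" where "B = (\<chi> k s. Re (cpart (\<gamma> (\<sigma> s) $ k)))"
 define V :: "real^'n^'n" where "V = (\<chi> s k. of_int (zpart (\<alpha> (\<sigma> s) $ k)))"
 define W :: "real^'n^'n" where "W = (\<chi> k s. of_int (zpart (\<gamma> (\<sigma> s) $ k)))"
 define C :: "real^'n^'n" where "C = (\<chi> s k. Im (cpart (\<alpha> (\<sigma> s) $ k)))"
 define D :: "real^'n^'n" where "D = (\<chi> k s. Im (cpart (\<gamma> (\<sigma> s) $ k)))"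
 have p: "pairing (\<alpha> (\<sigma> s)) (\<gamma> (\<sigma> t)) = (if s = t then 1 else 0)" for s t
  using dual \<sigma> by (auto simp: dual_on_def bij_betw_def inj_on_def)
 have 1: "A ** B = mat 1"
 proof -
  have "(A ** B) $ s $ t = Re (cpart (pairing (\<alpha> (\<sigma> s)) (\<gamma> (\<sigma> t))))" for s t
   by (simp add: A_def B_def matrix_matrix_mult_def pairing_def rr_times_sel)
  then show ?thesis by (simp add: vec_eq_iff mat_nth p)
 qed
 have 2: "V ** W = mat 1"
 proof -
  have "(V ** W) $ s $ t = of_int (zpart (pairing (\<alpha> (\<sigma> s)) (\<gamma> (\<sigma> t))))" for s t
   by (simp add: V_def W_def matrix_matrix_mult_def pairing_def rr_times_sel)
  then show ?thesis by (simp add: vec_eq_iff mat_nth p)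
 qed
 have 3: "C ** B + V ** D = 0"
 proof -
  have "(C ** B + V ** D) $ s $ t = Im (cpart (pairing (\<alpha> (\<sigma> s)) (\<gamma> (\<sigma> t))))" for s t
   by (simp add: C_def B_def V_def D_def matrix_matrix_mult_def pairing_def rr_times_sel sum.distrib)
  then show ?thesis by (simp add: vec_eq_iff p)
 qed
 have BA: "B ** A = mat 1" and WV: "W ** V = mat 1"
  using 1 2 matrix_left_right_inverse by blast+
 \<comment> \<open>Multiplying the vanishing lower left block by the inverse diagonal blocks on both
   sides produces the lower left block of the reversed product.\<close>
 have "W ** (C ** B + V ** D) ** A = W ** C ** (B ** A) + W ** V ** (D ** A)"
  by (simp add: matrix_add_ldistrib matrix_mul_assoc)
   (simp add: matrix_matrix_mult_def vec_eq_iff distrib_right sum.distrib)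
 then have DA: "W ** C + D ** A = 0" using 3 by (simp add: BA WV)
 have reidx: "(\<Sum>s\<in>J. g s) = (\<Sum>s\<in>UNIV. g (\<sigma> s))" for g :: "'m => rr"
  using sum.reindex_bij_betw[OF \<sigma>] by metis
 define S where "S = (\<Sum>s\<in>UNIV. \<gamma> (\<sigma> s) $ k * \<alpha> (\<sigma> s) $ l)"
 have "Re (cpart S) = (B ** A) $ k $ l"
  by (simp add: S_def A_def B_def matrix_matrix_mult_def rr_times_sel)
 moreover have "real_of_int (zpart S) = (W ** V) $ k $ l"
  by (simp add: S_def V_def W_def matrix_matrix_mult_def rr_times_sel)
 moreover have "Im (cpart S) = (W ** C + D ** A) $ k $ l"
  by (simp add: S_def A_def W_def C_def D_def matrix_matrix_mult_def rr_times_sel sum.distrib)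
 ultimately show ?thesis
  unfolding reidx S_def[symmetric] by (simp add: rr_eq_iff BA WV DA mat_nth split: if_splits)
qed

text \<open>The dual basis consists of the coordinate functionals of \<open>w\<close>, which are
  integral because coordinates with respect to a Z-basis are integers.\<close>

lemma Z_basis_dual:
 fixes w :: "'n => int ^ 'n"
 assumes "Z_basis w"
 shows "\<exists>w'. \<forall>s t. (\<Sum>k\<in>UNIV. w' s $ k * w t $ k) = (if s = t then 1 else 0)"
proof -
 have ex: "\<exists>!c. x = (\<Sum>k\<in>UNIV. c k *s w k)" for x using assms by (simp add: Z_basis_def)
 define c where "c x = (THE c. x = (\<Sum>k\<in>UNIV. c k *s w k))" for x
 have c: "x = (\<Sum>k\<in>UNIV. c x k *s w k)" for x unfolding c_def by (rule theI'[OF ex])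
 have uniq: "d = c x" if "x = (\<Sum>k\<in>UNIV. d k *s w k)" for d x using ex[of x] that c[of x] by blast
 have ct: "c (w t) s = (if s = t then 1 else 0)" for s t
 proof -
  have "w t = (\<Sum>k\<in>UNIV. (if k = t then 1 else 0) *s w k)"
   by (simp add: vec_eq_iff if_distrib if_distribR cong: if_cong)
  from fun_cong[OF uniq[OF this], of s] show ?thesis by simp
 qed
 \<comment> \<open>Additivity of the coordinates is not assumed; it follows from uniqueness, since
   combining the coordinates of the unit vectors also expresses \<open>x\<close>.\<close>
 have "(\<Sum>k\<in>UNIV. x $ k * c (axis k 1) s) = c x s" for x s
 proof -
  have "x $ i = (\<Sum>s\<in>UNIV. (\<Sum>k\<in>UNIV. x $ k * c (axis k 1) s) *s w s) $ i" for i
  proof -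
   have "(\<Sum>s\<in>UNIV. (\<Sum>k\<in>UNIV. x $ k * c (axis k 1) s) *s w s) $ i
     = (\<Sum>k\<in>UNIV. x $ k * (\<Sum>s\<in>UNIV. c (axis k 1) s *s w s) $ i)"
    by (simp add: sum_distrib_left sum_distrib_right mult.assoc) (rule sum.swap)
   also have "\<dots> = (\<Sum>k\<in>UNIV. x $ k * axis k 1 $ i)" unfolding c[symmetric] ..
   also have "\<dots> = x $ i" by (simp add: axis_def if_distrib cong: if_cong)
   finally show ?thesis by simp
  qed
  then have "x = (\<Sum>s\<in>UNIV. (\<Sum>k\<in>UNIV. x $ k * c (axis k 1) s) *s w s)"
   by (rule vec_eq_iff[THEN iffD2, OF allI])
  from fun_cong[OF uniq[OF this], of s] show ?thesis .
 qed
 then have "\<forall>s t. (\<Sum>k\<in>UNIV. (\<chi> k. c (axis k 1) s) $ k * w t $ k) = (if s = t then 1 else 0)"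
  by (simp add: ct mult.commute)
 then show ?thesis by (intro exI[of _ "\<lambda>s. \<chi> k. c (axis k 1) s"])
qed

lemma bij_betw_extend:
 assumes fin: "finite J" "finite K" and "card J = card K" "I \<subseteq> J" "inj_on f I" "f ` I \<subseteq> K"
 shows "\<exists>g. bij_betw g J K \<and> (\<forall>i\<in>I. g i = f i)"
proof -
 have "card (J - I) = card (K - f ` I)"
  using assms by (simp add: card_Diff_subset finite_subset card_image)
 then obtain h where h: "bij_betw h (J - I) (K - f ` I)"
  using finite_same_card_bij[OF finite_Diff[OF fin(1)] finite_Diff[OF fin(2)]] by blast
 define g where "g j = (if j \<in> I then f j else h j)" for j
 have "bij_betw g I (f ` I)" using assms(5) by (auto simp: bij_betw_def g_def inj_on_def image_iff)
 moreover have "bij_betw g (J - I) (K - f ` I)"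
  using h by (rule bij_betw_cong[THEN iffD1, rotated]) (simp add: g_def)
 ultimately have "bij_betw g (I \<union> (J - I)) (f ` I \<union> (K - f ` I))"
  by (rule bij_betw_combine) blast
 then have "bij_betw g J K" using assms(4,6) by (simp add: Un_absorb1)
 then show ?thesis by (intro exI[of _ g]) (simp add: g_def)
qed

text \<open>The equations are triangular: the real parts are found by inverting a real matrix, the
  integral parts by dualizing a Z-basis, and the imaginary parts then solve a linear system with the
  same real matrix.\<close>

lemma dual_exists:
 fixes \<gamma> :: "'m::finite => rr ^ 'n" and \<tau> :: "'m => 'n"
 assumes \<tau>: "bij_betw \<tau> J UNIV" and w: "Z_basis w" "\<And>j. j \<in> J ==> vvec (\<gamma> j) = w (\<tau> j)"
  and b: "inj_on (\<lambda>j. bvec (\<gamma> j)) J" "independent ((\<lambda>j. bvec (\<gamma> j)) ` J)"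
 shows "\<exists>\<alpha>. dual_on \<alpha> \<gamma> J"
proof -
 define \<sigma> where "\<sigma> = inv_into J \<tau>"
 have \<sigma>J: "\<sigma> s \<in> J" "\<tau> (\<sigma> s) = s" for s
  using \<tau> by (simp_all add: \<sigma>_def bij_betw_def inv_into_into f_inv_into_f)
 have \<sigma>\<tau>: "\<sigma> (\<tau> j) = j" if "j \<in> J" for j using \<tau> that by (simp add: \<sigma>_def bij_betw_def)
 obtain w' where w': "\<And>s t. (\<Sum>k\<in>UNIV. w' s $ k * w t $ k) = (if s = t then 1 else 0)"
  using Z_basis_dual[OF w(1)] by blast
 define B :: "real^'n^'n" where "B = (\<chi> t k. bvec (\<gamma> (\<sigma> t)) $ k)"
 have "\<forall>c. (\<Sum>i\<in>UNIV. c i *s row i B) = 0 --> (\<forall>i. c i = 0)"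
 proof (intro allI impI)
  fix c i assume c: "(\<Sum>i\<in>UNIV. c i *s row i B) = 0"
  have r: "row i B = bvec (\<gamma> (\<sigma> i))" for i by (simp add: row_def B_def)
  have inj: "inj (\<lambda>i. bvec (\<gamma> (\<sigma> i)))"
   using b(1) \<sigma>J by (metis (mono_tags, lifting) inj_on_def)
  let ?h = "\<lambda>i. bvec (\<gamma> (\<sigma> i))"
  have "(\<Sum>v\<in>range ?h. c (inv_into UNIV ?h v) *\<^sub>R v) = (\<Sum>i\<in>UNIV. c i *\<^sub>R ?h i)"
   by (subst sum.reindex[OF inj]) (simp add: inv_f_f[OF inj])
  also have "\<dots> = 0" using c by (simp add: r scalar_mult_eq_scaleR)
  finally have s: "(\<Sum>v\<in>range ?h. c (inv_into UNIV ?h v) *\<^sub>R v) = 0" .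
  have "range ?h \<subseteq> (\<lambda>j. bvec (\<gamma> j)) ` J" using \<sigma>J by auto
  then have "c (inv_into UNIV ?h (?h i)) = 0"
   using independentD[OF b(2) _ _ s, of "?h i"] by simp
  then show "c i = 0" by (simp add: inv_f_f[OF inj])
 qed
 then obtain R where R: "B ** R = mat 1" using matrix_right_invertible_independent_rows by blast
 define a where "a = transpose R"
 have aB: "(\<Sum>k\<in>UNIV. a $ s $ k * bvec (\<gamma> (\<sigma> t)) $ k) = (if s = t then 1 else 0)" for s t
  using arg_cong[OF R, of "\<lambda>M. M $ t $ s"]
  by (simp add: a_def B_def transpose_def matrix_matrix_mult_def mat_nth mult.commute)
 \<comment> \<open>The integral part of the dual vector contributes \<open>e\<close> to the lower
   left entry of the pairing; \<open>c\<close> is chosen to cancel this contribution.\<close>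
 define e where "e s t = (\<Sum>k\<in>UNIV. of_int (w' s $ k) * Im (cpart (\<gamma> (\<sigma> t) $ k)))" for s t
 define c where "c s k = - (\<Sum>t\<in>UNIV. e s t * a $ t $ k)" for s k
 have cB: "(\<Sum>k\<in>UNIV. c s k * bvec (\<gamma> (\<sigma> t)) $ k) = - e s t" for s t
 proof -
  have "(\<Sum>k\<in>UNIV. c s k * bvec (\<gamma> (\<sigma> t)) $ k)
    = - (\<Sum>k\<in>UNIV. \<Sum>u\<in>UNIV. e s u * (a $ u $ k * bvec (\<gamma> (\<sigma> t)) $ k))"
   by (simp add: c_def sum_distrib_right sum_negf mult.assoc)
  also have "\<dots> = - (\<Sum>u\<in>UNIV. e s u * (\<Sum>k\<in>UNIV. a $ u $ k * bvec (\<gamma> (\<sigma> t)) $ k))"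
   by (subst sum.swap) (simp add: sum_distrib_left)
  also have "\<dots> = - e s t" by (simp add: aB if_distrib cong: if_cong)
  finally show ?thesis .
 qed
 define \<alpha> where "\<alpha> j = (\<chi> k. RR (Complex (a $ \<tau> j $ k) (c (\<tau> j) k)) (w' (\<tau> j) $ k))" for j
 have "dual_on \<alpha> \<gamma> J"
  unfolding dual_on_def
 proof (intro ballI)
  fix i j assume ij: "i \<in> J" "j \<in> J"
  have eq: "(i = j) = (\<tau> i = \<tau> j)" using \<tau> ij by (auto simp: bij_betw_def inj_on_def)
  have v: "zpart (\<gamma> j $ k) = w (\<tau> j) $ k" for k
   using w(2)[OF ij(2)] by (metis vec_lambda_beta vvec_def)
  have "Re (cpart (pairing (\<alpha> i) (\<gamma> j))) = (if i = j then 1 else 0)"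
   using aB[of "\<tau> i" "\<tau> j"] by (simp add: pairing_def rr_times_sel \<alpha>_def \<sigma>\<tau>[OF ij(2)] bvec_def eq)
  moreover have "zpart (pairing (\<alpha> i) (\<gamma> j)) = (if i = j then 1 else 0)"
   using w'[of "\<tau> i" "\<tau> j"] by (simp add: pairing_def rr_times_sel \<alpha>_def v eq)
  moreover have "Im (cpart (pairing (\<alpha> i) (\<gamma> j))) = 0"
   using cB[of "\<tau> i" "\<tau> j"] by (simp add: pairing_def rr_times_sel \<alpha>_def \<sigma>\<tau>[OF ij(2)] bvec_def e_def sum.distrib)
  ultimately show "pairing (\<alpha> i) (\<gamma> j) = (if i = j then 1 else 0)"
   by (simp add: rr_eq_iff)
 qed
 then show ?thesis by blast
qed

text \<open>This supplies the charts at simplices with fewer than n vertices, where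
  \<open>\<beta>\<close> restricted to \<open>I\<close> is only part of a basis of the free
  module.\<close>

lemma dual_completion:
 fixes \<beta> :: "'m::finite => rr ^ 'n"
 assumes fan: "nonsingular_fan \<Sigma> \<beta>" and I: "I \<in> \<Sigma>"
 shows "\<exists>J \<alpha> \<gamma>. I \<subseteq> J \<and> card J = CARD('n) \<and> (\<forall>i\<in>I. \<gamma> i = \<beta> i) \<and> dual_on \<alpha> \<gamma> J"
proof -
 have tf: "topological_fan \<Sigma> \<beta>" and ns: "part_of_Z_basis (\<lambda>i. vvec (\<beta> i)) I"
  using fan I by (auto simp: nonsingular_fan_def)
 have sc: "simplicial_complex \<Sigma> CARD('n)" and bI: "lin_indep_family (\<lambda>i. bvec (\<beta> i)) I"
  using tf I by (auto simp: topological_fan_def)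
 obtain I0 where I0: "I0 \<in> \<Sigma>" "card I0 = CARD('n)" using sc by (auto simp: simplicial_complex_def)
 have cI: "card I \<le> CARD('n)" using sc I by (auto simp: simplicial_complex_def)
 \<comment> \<open>Some simplex has n vertices, so there are enough vertices to label a completed
   family.\<close>
 have "CARD('n) \<le> CARD('m)" using I0(2) card_mono[of UNIV I0] by simp
 then obtain J where J: "I \<subseteq> J" "card J = CARD('n)"
  using exists_subset_between[of I "CARD('n)" UNIV] cI by auto
 obtain w \<sigma> where w: "Z_basis w" "inj_on \<sigma> I" "\<And>i. i \<in> I ==> vvec (\<beta> i) = w (\<sigma> i)"
  using ns by (auto simp: part_of_Z_basis_def)
 obtain \<tau> where \<tau>: "bij_betw \<tau> J UNIV" "\<And>i. i \<in> I ==> \<tau> i = \<sigma> i"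
  using bij_betw_extend[of J "UNIV :: 'n set" I \<sigma>] J w(2) by auto
 obtain B where B: "(\<lambda>i. bvec (\<beta> i)) ` I \<subseteq> B" "independent B" "UNIV \<subseteq> span B"
  using maximal_independent_subset_extend[of "(\<lambda>i. bvec (\<beta> i)) ` I" UNIV] bI
  by (auto simp: lin_indep_family_def)
 have finB: "finite B" using B(2) independent_imp_finite by blast
 have "card B = CARD('n)" using basis_card_eq_dim[of B UNIV] B by simp
 then obtain f where f: "bij_betw f J B" "\<And>i. i \<in> I ==> f i = bvec (\<beta> i)"
  using bij_betw_extend[of J B I "\<lambda>i. bvec (\<beta> i)"] J B(1) bI finB by (auto simp: lin_indep_family_def)
 \<comment> \<open>Outside \<open>I\<close> the elements of \<open>J\<close> are mere labels: the
   real parts extend a basis, the integral parts come from the Z-basis, and the imaginary parts are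
   0, whatever \<open>\<beta>\<close> is there.\<close>
 define \<gamma> where "\<gamma> j = (if j \<in> I then \<beta> j else (\<chi> k. RR (Complex (f j $ k) 0) (w (\<tau> j) $ k)))" for j
 have bv: "bvec (\<gamma> j) = f j" if "j \<in> J" for j
  using f(2) by (simp add: \<gamma>_def) (simp add: bvec_def)
 have vv: "vvec (\<gamma> j) = w (\<tau> j)" if "j \<in> J" for j
  using w(3) \<tau>(2) by (simp add: \<gamma>_def) (simp add: vvec_def)
 have "\<exists>\<alpha>. dual_on \<alpha> \<gamma> J"
 proof (rule dual_exists[OF \<tau>(1) w(1) vv])
  show "inj_on (\<lambda>j. bvec (\<gamma> j)) J" using f(1) bv by (simp add: bij_betw_def inj_on_def)
  have "(\<lambda>j. bvec (\<gamma> j)) ` J = B" using f(1) bv by (simp add: bij_betw_def)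
  then show "independent ((\<lambda>j. bvec (\<gamma> j)) ` J)" using B(2) by simp
 qed
 moreover have "\<forall>i\<in>I. \<gamma> i = \<beta> i" by (simp add: \<gamma>_def)
 ultimately show ?thesis using J by blast
qed

section \<open>Powers with exponents in \<open>\<R>\<close>\<close>

lemma rpow_zero [simp]: "rpow g 0 = 1" by (simp add: rpow_def)

lemma rpow_at_0: "rpow 0 \<mu> = (if \<mu> = 0 then 1 else 0)" by (simp add: rpow_def)

text \<open>Any logarithm \<open>L\<close> of the base gives the same value, because the exponent of the phase is an
 integer.\<close>

lemma rpow_exp: "rpow (exp L) \<mu> = exp (cpart \<mu> * of_real (Re L) + of_int (zpart \<mu>) * (\<i> * of_real (Im L)))"
proof (cases "\<mu> = 0")
 case False
 have "exp L / complex_of_real (cmod (exp L)) = exp (\<i> * of_real (Im L))"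
  by (subst exp_eq_polar) (simp add: cis_conv_exp)
 moreover have "complex_of_real (cmod (exp L)) powr cpart \<mu> = exp (cpart \<mu> * of_real (Re L))"
  by (simp add: powr_def Ln_of_real)
 moreover have "exp (\<i> * complex_of_real (Im L)) powi zpart \<mu> = exp (of_int (zpart \<mu>) * (\<i> * of_real (Im L)))"
  by (simp add: exp_power_int)
 ultimately show ?thesis using False by (simp add: rpow_def exp_add)
qed simp

lemma exp_surj: "g \<noteq> 0 ==> \<exists>L. g = exp (L :: complex)"
 by (metis exp_Ln)

lemma rpow_nonzero: "g \<noteq> 0 ==> rpow g \<mu> \<noteq> 0"
 using exp_surj[of g] by (auto simp: rpow_exp)

lemma rpow_add: "g \<noteq> 0 ==> rpow g (\<mu> + \<nu>) = rpow g \<mu> * rpow g \<nu>"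
 using exp_surj[of g] by (auto simp: rpow_exp exp_add[symmetric] algebra_simps)

lemma rpow_one [simp]: "rpow g 1 = g"
proof (cases "g = 0")
 case True
 then show ?thesis by (simp add: rpow_def rr_eq_iff)
next
 case False
 then obtain L where "g = exp L" using exp_surj by blast
 moreover have "of_real (Re L) + \<i> * of_real (Im L) = L" by (rule complex_eq[symmetric])
 ultimately show ?thesis by (simp add: rpow_exp)
qed

lemma rpow_base_one [simp]: "rpow 1 \<mu> = 1"
 using rpow_exp[of 0 \<mu>] by simp

lemma rpow_mult: "rpow (g * h) \<mu> = rpow g \<mu> * rpow h \<mu>"
proof (cases "g = 0 \<or> h = 0")
 case True
 then show ?thesis by (auto simp: rpow_at_0)
next
 case False
 then obtain L K where "g = exp L" "h = exp K" using exp_surj by metis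
 then have "rpow (g * h) \<mu> = rpow (exp (L + K)) \<mu>" by (simp add: exp_add)
 also have "\<dots> = rpow g \<mu> * rpow h \<mu>"
  unfolding \<open>g = exp L\<close> \<open>h = exp K\<close> rpow_exp by (simp add: exp_add[symmetric] algebra_simps)
 finally show ?thesis .
qed

text \<open>On logarithms \<open>g\<^sup>\<mu>\<close> acts as the matrix of \<open>\<mu>\<close>,
  so iterated powers multiply matrices. The outer exponent stands on the left, which matters in the
  non-commutative ring.\<close>

lemma rpow_rpow: "g \<noteq> 0 ==> rpow (rpow g \<mu>) \<nu> = rpow g (\<nu> * \<mu>)"
proof -
 assume "g \<noteq> 0"
 then obtain L where L: "g = exp L" using exp_surj by blast
 let ?E = "cpart \<mu> * of_real (Re L) + of_int (zpart \<mu>) * (\<i> * of_real (Im L))"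
 have "rpow (rpow g \<mu>) \<nu> = exp (cpart \<nu> * of_real (Re ?E) + of_int (zpart \<nu>) * (\<i> * of_real (Im ?E)))"
  unfolding L rpow_exp[of L] by (rule rpow_exp)
 also have "cpart \<nu> * of_real (Re ?E) + of_int (zpart \<nu>) * (\<i> * of_real (Im ?E))
   = cpart (\<nu> * \<mu>) * of_real (Re L) + of_int (zpart (\<nu> * \<mu>)) * (\<i> * of_real (Im L))"
  by (simp add: complex_eq_iff rr_times_sel algebra_simps)
 finally show ?thesis by (simp add: L rpow_exp)
qed

lemma rpow_sum: "g \<noteq> 0 ==> rpow g (sum \<mu> A) = (\<Prod>a\<in>A. rpow g (\<mu> a))"
 by (induction A rule: infinite_finite_induct) (auto simp: rpow_add)

lemma rpow_prod: "rpow (prod g A) \<mu> = (\<Prod>a\<in>A. rpow (g a) \<mu>)"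
 by (induction A rule: infinite_finite_induct) (auto simp: rpow_mult)

definition ge_reg :: "bool => rr => rr => bool" where
 "ge_reg b = (if b then ge_s else ge_c)"

lemma ge_reg_diff: "ge_reg b \<mu> \<nu> \<longleftrightarrow> ge_reg b (\<mu> - \<nu>) 0"
 by (simp add: ge_reg_def ge_s_def ge_c_def)

text \<open>With \<open>p = (b + v)/2\<close> and \<open>q = (b - v)/2\<close> the smooth order says
  that the power is \<open>z\<^sup>p\<close> times the \<open>q\<close>-th power of the conjugate;
  \<open>rpow_nat\<close> makes this explicit.\<close>

lemma ge_sI: "cpart \<mu> = of_nat (p + q) ==> zpart \<mu> = int p - int q ==> ge_s \<mu> 0"
 unfolding ge_s_def by (intro conjI, simp, rule exI[of _ "p + q"], rule exI[of _ p], rule exI[of _ q], simp)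

lemma ge_sE:
 assumes "ge_s \<mu> 0"
 obtains p q where "cpart \<mu> = of_nat (p + q)" "zpart \<mu> = int p - int q"
proof -
 obtain b p q where b: "Im (cpart \<mu>) = 0" "Re (cpart \<mu>) = real b" "int b + zpart \<mu> = 2 * int p" "int b - zpart \<mu> = 2 * int q"
  using assms by (auto simp: ge_s_def)
 then have "b = p + q" "zpart \<mu> = int p - int q" by linarith+
 then show thesis using b by (intro that[of p q]) (simp_all add: complex_eq_iff)
qed

lemma ge_s_imp_ge_c: "ge_s \<mu> 0 ==> ge_c \<mu> 0"
 by (elim ge_sE) (auto simp: ge_c_def rr_eq_iff)

lemma ge_reg_imp_ge_c: "ge_reg b \<mu> 0 ==> ge_c \<mu> 0"
 using ge_s_imp_ge_c by (auto simp: ge_reg_def split: if_splits)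

lemma ge_reg_zero [simp]: "ge_reg b 0 0"
 using ge_sI[of 0 0 0] by (simp add: ge_reg_def ge_c_def)

lemma ge_reg_refl [simp]: "ge_reg b \<mu> \<mu>"
 by (subst ge_reg_diff) simp

lemma ge_reg_one [simp]: "ge_reg b 1 0"
 using ge_sI[of 1 1 0] by (simp add: ge_reg_def ge_c_def)

text \<open>The only case beyond \<open>rpow_add\<close> is the base 0: two exponents that are
  \<open>\<ge>\<^sub>c 0\<close> add up to 0 only if both vanish. This keeps the cocycle identity
  valid on the divisors.\<close>

lemma rpow_add_ge:
 assumes "ge_reg b \<mu> 0" "ge_reg b \<nu> 0" shows "rpow g (\<mu> + \<nu>) = rpow g \<mu> * rpow g \<nu>"
proof (cases "g = 0")
 case True
 have "ge_c \<mu> 0" "ge_c \<nu> 0" using assms ge_reg_imp_ge_c by blast+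
 then have "\<mu> + \<nu> = 0 \<longleftrightarrow> \<mu> = 0 \<and> \<nu> = 0" by (auto simp: ge_c_def rr_eq_iff)
 then show ?thesis using True by (simp add: rpow_at_0)
qed (simp add: rpow_add)

subsection \<open>Regularity of powers\<close>

lemma cmod_rpow: "cmod (rpow g \<mu>) = (if \<mu> = 0 then 1 else cmod g powr Re (cpart \<mu>))"
proof (cases "g = 0")
 case False
 then obtain L where "g = exp L" using exp_surj by blast
 then show ?thesis by (auto simp: rpow_exp norm_exp_eq_Re powr_def)
qed (simp add: rpow_at_0)

lemma continuous_on_rpow: "continuous_on (- {0}) (\<lambda>g. rpow g \<mu>)"
proof (cases "\<mu> = 0")
 case False
 have "continuous_on (- {0}) (\<lambda>g. exp (cpart \<mu> * of_real (ln (cmod g))) * (g / of_real (cmod g)) powi zpart \<mu>)"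
  by (intro continuous_intros) auto
 moreover have "exp (cpart \<mu> * of_real (ln (cmod g))) * (g / of_real (cmod g)) powi zpart \<mu> = rpow g \<mu>" if "g \<in> - {0}" for g
  using that False by (simp add: rpow_def powr_def Ln_of_real)
 ultimately show ?thesis by (rule continuous_on_eq)
qed simp

text \<open>For a nonzero exponent the modulus is a positive power of \<open>cmod g\<close>, so the
  value 0 at the origin is the limit, however the phase behaves.\<close>

lemma continuous_on_rpow_ge:
 assumes "ge_c \<mu> 0" shows "continuous_on UNIV (\<lambda>g. rpow g \<mu>)"
proof (cases "\<mu> = 0")
 case False
 then have Re: "Re (cpart \<mu>) > 0" using assms by (simp add: ge_c_def)
 have "isCont (\<lambda>g. rpow g \<mu>) g" for g
 proof (cases "g = 0")
  case True
  have "((\<lambda>g. cmod g powr Re (cpart \<mu>)) \<longlongrightarrow> 0) (at 0)"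
   by (rule tendsto_zero_powrI[where b = "Re (cpart \<mu>)"]) (use Re in \<open>auto intro!: tendsto_eq_intros\<close>)
  then have "((\<lambda>g. rpow g \<mu>) \<longlongrightarrow> 0) (at 0)"
   by (subst tendsto_norm_zero_iff[symmetric]) (simp add: cmod_rpow False)
  then show ?thesis using True False by (simp add: isCont_def rpow_at_0)
 next
  case False
  then show ?thesis using continuous_on_rpow[of \<mu>] by (simp add: continuous_on_eq_continuous_at open_Compl)
 qed
 then show ?thesis by (simp add: continuous_at_imp_continuous_on)
qed simp

definition wirt1 :: "rr => complex" where "wirt1 \<mu> = (cpart \<mu> + of_int (zpart \<mu>)) / 2"
definition wirt2 :: "rr => complex" where "wirt2 \<mu> = (cpart \<mu> - of_int (zpart \<mu>)) / 2"

lemma rpow_11: "rpow g (RR 1 1) = g"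
 using rpow_one[of g] by (simp add: one_rr_def)

lemma rpow_1m1: "rpow g (RR 1 (- 1)) = cnj g"
proof (cases "g = 0")
 case True
 then show ?thesis by (simp add: rpow_def rr_eq_iff)
next
 case False
 then obtain L where L: "g = exp L" using exp_surj by blast
 have "of_real (Re L) - \<i> * of_real (Im L) = cnj L" by (simp add: complex_eq_iff)
 then show ?thesis by (simp add: L rpow_exp exp_cnj)
qed

text \<open>\<open>wirt1 \<mu>\<close> and \<open>wirt2 \<mu>\<close> are the exponents of \<open>g\<close> and of \<open>cnj g\<close> in \<open>g\<^sup>\<mu>\<close>, so this
 formula contains the two Wirtinger derivatives.\<close>

lemma rpow_derivative:
 assumes g: "g \<noteq> 0"
 shows "((\<lambda>t::real. rpow (g + of_real t * d) \<mu>) has_vector_derivative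
  wirt1 \<mu> * d * rpow g (\<mu> - RR 1 1) + wirt2 \<mu> * cnj d * rpow g (\<mu> - RR 1 (- 1))) (at 0)"
proof -
 obtain L where L: "g = exp L" using exp_surj[OF g] by blast
 \<comment> \<open>A logarithm of \<open>g + t d\<close> for small \<open>t\<close>: the argument of
   \<open>Ln\<close> stays near 1, away from the branch cut, wherever \<open>g\<close> lies.\<close>
 define E where "E t = L + Ln (1 + of_real t * (d / g))" for t :: real
 define w where "w = d / g"
 have "((\<lambda>t::real. 1 + of_real t * w) has_vector_derivative w) (at 0)"
  by (auto intro!: derivative_eq_intros simp: has_vector_derivative_def scaleR_conv_of_real)
 moreover have "(Ln has_field_derivative 1) (at (1 + of_real 0 * w))"
  using has_field_derivative_Ln[of 1] by simp
 ultimately have "((\<lambda>t::real. Ln (1 + of_real t * w)) has_vector_derivative w * 1) (at 0)"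
  using field_vector_diff_chain_at[of "\<lambda>t. 1 + of_real t * w" w 0 Ln 1] by (simp add: o_def)
 then have E': "(E has_vector_derivative w) (at 0)"
  unfolding E_def w_def[symmetric] by (auto intro!: derivative_eq_intros)
 have Lin: "bounded_linear (\<lambda>z. cpart \<mu> * of_real (Re z) + of_int (zpart \<mu>) * (\<i> * of_real (Im z)))"
  by (intro bounded_linear_add bounded_linear_const_mult
    bounded_linear_compose[OF bounded_linear_of_real bounded_linear_Re]
    bounded_linear_compose[OF bounded_linear_of_real bounded_linear_Im])
 have "((\<lambda>t. cpart \<mu> * of_real (Re (E t)) + of_int (zpart \<mu>) * (\<i> * of_real (Im (E t)))) has_vector_derivative
   cpart \<mu> * of_real (Re w) + of_int (zpart \<mu>) * (\<i> * of_real (Im w))) (at 0)"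
  by (rule bounded_linear.has_vector_derivative[OF Lin E'])
 from field_vector_diff_chain_at[OF this DERIV_exp]
 have D: "((\<lambda>t. rpow (exp (E t)) \<mu>) has_vector_derivative
   (cpart \<mu> * of_real (Re w) + of_int (zpart \<mu>) * (\<i> * of_real (Im w))) * rpow (exp (E 0)) \<mu>) (at 0)"
  by (simp add: o_def rpow_exp)
 have E0: "exp (E 0) = g" by (simp add: E_def L)
 have 1: "rpow g (\<mu> - RR 1 1) = rpow g \<mu> / g"
  using rpow_add[OF g, of "\<mu> - RR 1 1" "RR 1 1"] g by (simp add: rpow_11)
 have 2: "rpow g (\<mu> - RR 1 (- 1)) = rpow g \<mu> / cnj g"
  using rpow_add[OF g, of "\<mu> - RR 1 (- 1)" "RR 1 (- 1)"] g by (simp add: rpow_1m1)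
 have c: "cnj w = cnj d / cnj g" by (simp add: w_def)
 have "cpart \<mu> * of_real (Re w) + of_int (zpart \<mu>) * (\<i> * of_real (Im w)) = wirt1 \<mu> * w + wirt2 \<mu> * cnj w"
  by (simp add: complex_eq_iff wirt1_def wirt2_def field_simps)
 then have eq: "(cpart \<mu> * of_real (Re w) + of_int (zpart \<mu>) * (\<i> * of_real (Im w))) * rpow (exp (E 0)) \<mu>
   = wirt1 \<mu> * d * rpow g (\<mu> - RR 1 1) + wirt2 \<mu> * cnj d * rpow g (\<mu> - RR 1 (- 1))"
  unfolding E0 1 2 by (simp add: c w_def[symmetric] distrib_right) (simp add: w_def)
 have "((\<lambda>t. 1 + of_real t * w) \<longlongrightarrow> 1) (at (0::real))" by (auto intro!: tendsto_eq_intros)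
 then have "\<forall>\<^sub>F t in at (0::real). 1 + of_real t * w \<noteq> 0" by (rule tendsto_imp_eventually_ne) simp
 then have "\<forall>\<^sub>F t in nhds (0::real). 1 + of_real t * w \<noteq> 0"
  unfolding eventually_at_filter
 proof (rule eventually_mono)
  show "1 + of_real s * w \<noteq> 0" if "s \<noteq> 0 --> s \<in> UNIV --> 1 + of_real s * w \<noteq> 0" for s :: real
   using that by (cases "s = 0") simp_all
 qed
 then have "\<forall>\<^sub>F t in nhds (0::real). exp (E t) = g + of_real t * d"
  by eventually_elim (simp add: E_def exp_add L[symmetric] w_def g distrib_left)
 then have ev: "\<forall>\<^sub>F t in nhds (0::real). rpow (exp (E t)) \<mu> = rpow (g + of_real t * d) \<mu>"
  by eventually_elim simp
 show ?thesis
  using D[unfolded eq] has_vector_derivative_cong_ev[of UNIV "\<lambda>t. rpow (exp (E t)) \<mu>" "\<lambda>t. rpow (g + of_real t * d) \<mu>" 0]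
   ev E0 by simp
qed

lemma continuous_map_unit:
 assumes "open D" "continuous_on D g"
 shows "continuous_map (subtopology (cspace {()}) {c. c () \<in> D}) euclidean (\<lambda>c. g (c ()))"
proof -
 have 1: "continuous_map (subtopology (cspace {()}) {c. c () \<in> D}) (top_of_set D) (\<lambda>c. c ())"
  by (auto simp: continuous_map_in_subtopology intro: continuous_map_from_subtopology continuous_map_coord)
 show ?thesis using continuous_map_compose[OF 1, of euclidean g] assms by (simp add: o_def)
qed

text \<open>The exponent is generalized because the derivatives of a power are combinations of
  powers with the exponents \<open>\<mu> - RR 1 1\<close> and
  \<open>\<mu> - RR 1 (- 1)\<close>.\<close>

lemma Ck_on_rpow: "Ck_on k {()} {c. c () \<noteq> 0} (\<lambda>c. rpow (c ()) \<mu>)"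
proof (induction k arbitrary: \<mu>)
 have cont: "continuous_map (subtopology (cspace {()}) {c. c () \<noteq> 0}) euclidean (\<lambda>c. rpow (c ()) \<mu>)" for \<mu>
  using continuous_map_unit[OF _ continuous_on_rpow, of \<mu>] by (simp add: open_Compl)
 {
  case 0
  then show ?case using cont by simp
 next
  case (Suc k)
  show ?case
  proof (rule Ck_on_SucI[OF cont])
   fix i :: unit and d :: complex
   let ?D = "\<lambda>c. wirt1 \<mu> * d * rpow (c ()) (\<mu> - RR 1 1) + wirt2 \<mu> * cnj d * rpow (c ()) (\<mu> - RR 1 (- 1))"
   have "Ck_on k {()} {c. c () \<noteq> 0} ?D"
    by (intro Ck_on_add Ck_on_mult Ck_on_const Suc)
   then show "\<exists>f'. (\<forall>c\<in>{c. c () \<noteq> 0}. ((\<lambda>t. rpow ((c(i := c i + of_real t * d)) ()) \<mu>) has_vector_derivative f' c) (at 0)) \<and>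
     Ck_on k {()} {c. c () \<noteq> 0} f'"
    using rpow_derivative by (intro exI[of _ ?D]) auto
  qed
 }
qed

lemma creg_rpow: "creg b (- {0}) (\<lambda>g. rpow g \<mu>)"
 using Ck_on_rpow continuous_on_rpow by (auto simp: creg_def smooth_fun_def open_Compl)

lemma Ck_on_power: "Ck_on k I S f ==> Ck_on k I S (\<lambda>x. f x ^ n)"
 by (induction n) (auto intro: Ck_on_const Ck_on_mult)

lemma rpow_nat:
 assumes "cpart \<mu> = of_nat (p + q)" "zpart \<mu> = int p - int q"
 shows "rpow g \<mu> = g ^ p * cnj g ^ q"
proof (cases "g = 0")
 case True
 have "\<mu> = 0 \<longleftrightarrow> p = 0 \<and> q = 0" using assms by (auto simp: rr_eq_iff complex_eq_iff)
 then show ?thesis using True by (auto simp: rpow_at_0)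
next
 case False
 then obtain L where L: "g = exp L" using exp_surj by blast
 have "g ^ p * cnj g ^ q = exp (of_nat p * L + of_nat q * cnj L)"
  by (simp add: L exp_add exp_of_nat_mult exp_cnj)
 also have "of_nat p * L + of_nat q * cnj L = cpart \<mu> * of_real (Re L) + of_int (zpart \<mu>) * (\<i> * of_real (Im L))"
  by (simp add: assms complex_eq_iff algebra_simps)
 finally show ?thesis by (simp add: L rpow_exp)
qed

lemma creg_rpow_ge:
 assumes "ge_reg b \<mu> 0" shows "creg b UNIV (\<lambda>g. rpow g \<mu>)"
proof -
 have "smooth_fun {()} {c. c () \<in> UNIV} (\<lambda>c. rpow (c ()) \<mu>)" if b
 proof -
  obtain p q where "cpart \<mu> = of_nat (p + q)" "zpart \<mu> = int p - int q"
   using assms \<open>b\<close> by (auto simp: ge_reg_def elim: ge_sE)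
  then show ?thesis
   by (auto simp: smooth_fun_def rpow_nat intro!: Ck_on_mult Ck_on_power Ck_on_coord
     Ck_on_bounded_linear[OF bounded_linear_cnj])
 qed
 then show ?thesis
  using continuous_on_rpow_ge[OF ge_reg_imp_ge_c[OF assms]] by (simp add: creg_def)
qed

text \<open>Bases with logarithms 1, \<open>pi / Im (cpart \<mu>)\<close> and
  \<open>\<i> pi / zpart \<mu>\<close> isolate the three components; in the last two cases a nonzero
  component would give the value -1.\<close>

lemma rpow_eq_1_imp:
 assumes "\<And>s. s \<noteq> 0 ==> rpow s \<mu> = 1" shows "\<mu> = 0"
proof -
 have e: "exp (cpart \<mu> * of_real (Re L) + of_int (zpart \<mu>) * (\<i> * of_real (Im L))) = 1" for L
  using assms[of "exp L"] by (simp add: rpow_exp)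
 have "cmod (exp (cpart \<mu>)) = 1" using e[of 1] by simp
 then have Re: "Re (cpart \<mu>) = 0" by (simp add: norm_exp_eq_Re)
 have Im: "Im (cpart \<mu>) = 0"
 proof (rule ccontr)
  assume c: "Im (cpart \<mu>) \<noteq> 0"
  have "cpart \<mu> * of_real (pi / Im (cpart \<mu>)) = \<i> * of_real pi"
   using c by (simp add: complex_eq_iff Re)
  then show False using e[of "of_real (pi / Im (cpart \<mu>))"] by simp
 qed
 have "zpart \<mu> = 0"
 proof (rule ccontr)
  assume c: "zpart \<mu> \<noteq> 0"
  then have "of_int (zpart \<mu>) * (\<i> * of_real (pi / of_int (zpart \<mu>))) = \<i> * of_real pi"
   by simp
  then show False using e[of "\<i> * of_real (pi / of_int (zpart \<mu>))"] by simp
 qed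
 then show ?thesis using Re Im by (simp add: rr_eq_iff)
qed

text \<open>If \<open>h 0 = 0\<close>, boundedness of \<open>cmod t\<close> to the real part of
  \<open>\<mu>\<close> away from 0 must fail, so that real part is positive. If \<open>h 0\<close>
  is nonzero, letting \<open>t\<close> tend to 0 in \<open>h (s t) = s\<^sup>\<mu> h t\<close> gives
  \<open>s\<^sup>\<mu> = 1\<close> for all \<open>s\<close>.\<close>

lemma continuous_extension_imp_ge:
 assumes h: "continuous_on UNIV h" and a: "a \<noteq> 0" and eq: "\<And>t. t \<noteq> 0 ==> h t = a * rpow t \<mu>"
 shows "ge_c \<mu> 0"
proof (cases "h 0 = 0")
 case True
 have "Re (cpart \<mu>) > 0"
 proof (rule ccontr)
  assume n: "\<not> Re (cpart \<mu>) > 0"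
  have "(h \<longlongrightarrow> 0) (at 0)" using h True by (metis continuous_on_def UNIV_I)
  then have "\<forall>\<^sub>F t in at 0. dist (h t) 0 < cmod a" using a by (intro tendstoD) auto
  then obtain d where d: "d > 0" "\<And>t. t \<noteq> 0 ==> dist t 0 < d ==> cmod (h t) < cmod a"
   by (auto simp: eventually_at)
  define t where "t = min (d / 2) 1"
  have t: "t > 0" "t < d" "t \<le> 1" using d(1) by (auto simp: t_def)
  have "t powr Re (cpart \<mu>) \<ge> t powr 0" using t n by (intro powr_mono') auto
  then have "cmod (rpow (of_real t) \<mu>) \<ge> 1" using t by (simp add: cmod_rpow)
  then have "cmod (h (of_real t)) \<ge> cmod a" using t a eq[of "of_real t"] by (simp add: norm_mult)
  then show False using d(2)[of "of_real t"] t by simp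
 qed
 then show ?thesis by (simp add: ge_c_def)
next
 case False
 have "rpow s \<mu> = 1" if s: "s \<noteq> 0" for s
 proof -
  have l: "(h \<longlongrightarrow> h 0) (at 0)" using h by (metis continuous_on_def UNIV_I)
  have "isCont (\<lambda>t. h (s * t)) 0"
   using h by (intro continuous_at_compose[of 0 "\<lambda>t. s * t" h, unfolded o_def] continuous_intros)
    (simp add: continuous_on_eq_continuous_at)
  then have 1: "((\<lambda>t. h (s * t)) \<longlongrightarrow> h 0) (at 0)" by (simp add: isCont_def)
  have 2: "((\<lambda>t. rpow s \<mu> * h t) \<longlongrightarrow> rpow s \<mu> * h 0) (at 0)" using l by (intro tendsto_intros)
  have "\<forall>\<^sub>F t in at 0. rpow s \<mu> * h t = h (s * t)"
   using s by (auto simp: eventually_at_filter eq rpow_mult)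
  then have "((\<lambda>t. h (s * t)) \<longlongrightarrow> rpow s \<mu> * h 0) (at 0)" using 2 by (rule Lim_transform_eventually[rotated])
  then have "rpow s \<mu> * h 0 = h 0" using 1 by (rule LIM_unique)
  then show ?thesis using False by simp
 qed
 then have "\<mu> = 0" by (rule rpow_eq_1_imp)
 then show ?thesis by (simp add: ge_c_def)
qed

lemma continuous_on_unit:
 assumes "continuous_map (cspace {()}) euclidean (\<lambda>c. h (c ()))" shows "continuous_on UNIV h"
proof -
 have "continuous_map euclidean (cspace {()}) (\<lambda>z. (\<lambda>_. z))"
  by (auto simp: continuous_map_into_cspace extensional_def)
 from continuous_map_compose[OF this assms] show ?thesis by (simp add: o_def)
qed

text \<open>Each Wirtinger derivative lowers the real part of the exponent by one, until continuity at
 \<open>0\<close> forces the exponent to vanish.\<close>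

lemma smooth_extension_imp_ge:
 assumes "a \<noteq> 0" "\<And>t. t \<noteq> 0 ==> h t = a * rpow t \<mu>" "\<And>k. Ck_on k {()} UNIV (\<lambda>c. h (c ()))" "Re (cpart \<mu>) \<le> real N"
 shows "ge_s \<mu> 0"
 using assms
proof (induction N arbitrary: a h \<mu>)
 have gec: "ge_c \<mu> 0" if "a \<noteq> 0" "\<And>t. t \<noteq> 0 ==> h t = a * rpow t \<mu>" "\<And>k. Ck_on k {()} UNIV (\<lambda>c. h (c ()))" for a h \<mu>
  using that(1,2) continuous_on_unit[of h] that(3)[of 0] by (intro continuous_extension_imp_ge[of h a]) auto
 have z: "ge_s 0 0" using ge_reg_zero[of True] by (simp add: ge_reg_def)
 {
  case 0
  then have "ge_c \<mu> 0" by (intro gec)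
  \<comment> \<open>A continuous extension requires a positive real part or
    \<open>\<mu> = 0\<close>, and the bound \<open>N = 0\<close> leaves only the latter.\<close>
  then show ?case using 0 z by (auto simp: ge_c_def)
 next
  case (Suc N)
  show ?case
  proof (cases "\<mu> = 0")
   case False
   have "ge_c \<mu> 0" using Suc.prems by (intro gec)
   then have Re: "Re (cpart \<mu>) > 0" using False by (simp add: ge_c_def)
   have oU: "openin (cspace {()}) (UNIV :: (unit => complex) set)" using openin_cspace_unit[of UNIV] by simp
   define D where "D d z = pderiv_at () d (\<lambda>c. h (c ())) (\<lambda>_. z)" for d z
   have D: "Ck_on k {()} UNIV (\<lambda>c. D d (c ()))" if "d \<in> {1, \<i>}" for k d
   proof -
    have "Ck_on k {()} UNIV (pderiv_at () d (\<lambda>c. h (c ())))"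
     using bspec[OF bspec[OF conjunct2[OF Suc.prems(3)[of "Suc k", unfolded Ck_on_Suc_iff[OF oU]]], of "()"] that] by simp
    moreover have "(\<lambda>_. c ()) = c" for c :: "unit => complex" by (simp add: fun_eq_iff)
    ultimately show ?thesis by (simp add: D_def)
   qed
   have Dv: "D d t = a * (wirt1 \<mu> * d * rpow t (\<mu> - RR 1 1) + wirt2 \<mu> * cnj d * rpow t (\<mu> - RR 1 (- 1)))"
    if t: "t \<noteq> 0" for d t
    unfolding D_def pderiv_at_def
   proof (rule vector_derivative_at)
    have "((\<lambda>s::real. t + of_real s * d) \<longlongrightarrow> t) (at 0)" by (auto intro!: tendsto_eq_intros)
    then have "\<forall>\<^sub>F s in at (0::real). t + of_real s * d \<noteq> 0" using t by (rule tendsto_imp_eventually_ne)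
    then have "\<forall>\<^sub>F s in nhds (0::real). t + of_real s * d \<noteq> 0"
     unfolding eventually_at_filter
    proof (rule eventually_mono)
     show "t + of_real s * d \<noteq> 0" if "s \<noteq> 0 --> s \<in> UNIV --> t + of_real s * d \<noteq> 0" for s :: real
      using that t by (cases "s = 0") simp_all
    qed
    then have ev: "\<forall>\<^sub>F s in nhds (0::real). a * rpow (t + of_real s * d) \<mu> = h (t + of_real s * d)"
     by eventually_elim (simp add: Suc.prems(2))
    have "((\<lambda>s::real. a * rpow (t + of_real s * d) \<mu>) has_vector_derivative
      a * (wirt1 \<mu> * d * rpow t (\<mu> - RR 1 1) + wirt2 \<mu> * cnj d * rpow t (\<mu> - RR 1 (- 1)))) (at 0)"
     by (rule bounded_linear.has_vector_derivative[OF bounded_linear_mult_right rpow_derivative[OF t]])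
    then have "((\<lambda>s::real. h (t + of_real s * d)) has_vector_derivative
      a * (wirt1 \<mu> * d * rpow t (\<mu> - RR 1 1) + wirt2 \<mu> * cnj d * rpow t (\<mu> - RR 1 (- 1)))) (at 0)"
     using has_vector_derivative_cong_ev[of UNIV "\<lambda>s. a * rpow (t + of_real s * d) \<mu>" "\<lambda>s. h (t + of_real s * d)" 0]
      ev t Suc.prems(2)[OF t] by simp
    then show "((\<lambda>s. h (((\<lambda>_. t)(() := t + of_real s * d)) ())) has_vector_derivative
      a * (wirt1 \<mu> * d * rpow t (\<mu> - RR 1 1) + wirt2 \<mu> * cnj d * rpow t (\<mu> - RR 1 (- 1)))) (at 0)"
     by simp
   qed
   have "wirt1 \<mu> + wirt2 \<mu> = cpart \<mu>" by (simp add: wirt1_def wirt2_def field_simps)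
   then have "wirt1 \<mu> \<noteq> 0 \<or> wirt2 \<mu> \<noteq> 0" using Re by auto
   then show ?thesis
   proof
    assume w: "wirt1 \<mu> \<noteq> 0"
    have "ge_s (\<mu> - RR 1 1) 0"
    \<comment> \<open>This combination of the two real partials is the derivative in the variable
      itself; it removes the term with the conjugate and leaves a pure power. The other case uses
      the opposite sign.\<close>
    proof (rule Suc.IH[of "a * wirt1 \<mu>" "\<lambda>t. (1/2) * (D 1 t + (- \<i>) * D \<i> t)"])
     show "a * wirt1 \<mu> \<noteq> 0" using w Suc.prems by simp
     show "(1/2) * (D 1 t + (- \<i>) * D \<i> t) = a * wirt1 \<mu> * rpow t (\<mu> - RR 1 1)" if "t \<noteq> 0" for t
      by (simp add: Dv[OF that] algebra_simps)
     show "Ck_on k {()} UNIV (\<lambda>c. (1/2) * (D 1 (c ()) + (- \<i>) * D \<i> (c ())))" for k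
      by (intro Ck_on_mult Ck_on_add Ck_on_const D) auto
     show "Re (cpart (\<mu> - RR 1 1)) \<le> real N" using Suc.prems(4) by simp
    qed
    then obtain p q where pq: "cpart (\<mu> - RR 1 1) = of_nat (p + q)" "zpart (\<mu> - RR 1 1) = int p - int q" by (elim ge_sE)
    have "cpart \<mu> = of_nat (Suc p + q)" "zpart \<mu> = int (Suc p) - int q" using pq by (auto simp: algebra_simps)
    then show ?thesis by (rule ge_sI)
   next
    assume w: "wirt2 \<mu> \<noteq> 0"
    have "ge_s (\<mu> - RR 1 (- 1)) 0"
    proof (rule Suc.IH[of "a * wirt2 \<mu>" "\<lambda>t. (1/2) * (D 1 t + \<i> * D \<i> t)"])
     show "a * wirt2 \<mu> \<noteq> 0" using w Suc.prems by simp
     show "(1/2) * (D 1 t + \<i> * D \<i> t) = a * wirt2 \<mu> * rpow t (\<mu> - RR 1 (- 1))" if "t \<noteq> 0" for t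
      by (simp add: Dv[OF that] algebra_simps)
     show "Ck_on k {()} UNIV (\<lambda>c. (1/2) * (D 1 (c ()) + \<i> * D \<i> (c ())))" for k
      by (intro Ck_on_mult Ck_on_add Ck_on_const D) auto
     show "Re (cpart (\<mu> - RR 1 (- 1))) \<le> real N" using Suc.prems(4) by simp
    qed
    then obtain p q where pq: "cpart (\<mu> - RR 1 (- 1)) = of_nat (p + q)" "zpart (\<mu> - RR 1 (- 1)) = int p - int q" by (elim ge_sE)
    have "cpart \<mu> = of_nat (p + Suc q)" "zpart \<mu> = int p - int (Suc q)" using pq by (auto simp: algebra_simps)
    then show ?thesis by (rule ge_sI)
   qed
  qed (use z in simp)
 }
qed

lemma extension_imp_ge:
 assumes h: "regular b (cspace_mfd {()}) UNIV (\<lambda>c. h (c ()))" and a: "a \<noteq> 0" and eq: "\<And>t. t \<noteq> 0 ==> h t = a * rpow t \<mu>"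
 shows "ge_reg b \<mu> 0"
proof (cases b)
 case True
 have i: "inv_into UNIV (\<lambda>w. w) w = w" for w :: "unit => complex"
  by (simp add: inv_into_f_f[of "\<lambda>w. w" UNIV, simplified])
 have c: "({()}, UNIV, \<lambda>w. w) \<in> matlas (cspace_mfd {()})"
  by (auto simp: cspace_mfd_def PiE_def extensional_def)
 obtain N where "Re (cpart \<mu>) \<le> real N" using real_arch_simple by blast
 moreover have "Ck_on k {()} UNIV (\<lambda>c. h (c ()))" for k
  using regular_Ck[OF h True c, of k] by (simp add: i)
 ultimately have "ge_s \<mu> 0" using a eq by (intro smooth_extension_imp_ge[of a h \<mu> N])
 then show ?thesis using True by (simp add: ge_reg_def)
next
 case False
 have "continuous_on UNIV h" using regular_continuous[OF h] by (intro continuous_on_unit) simp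
 then show ?thesis using False a eq continuous_extension_imp_ge by (auto simp: ge_reg_def)
qed

section \<open>Continuous characters of the torus\<close>

definition chi :: "rr ^ 'n => complex ^ 'n => complex" where
 "chi \<alpha> g = (\<Prod>k\<in>UNIV. rpow (g $ k) (\<alpha> $ k))"

lemma torus_mult: "g \<in> torus ==> h \<in> torus ==> g * h \<in> torus" by (simp add: torus_def)
lemma torus_one [simp]: "1 \<in> torus" by (simp add: torus_def)
lemma open_torus: "open (torus :: (complex ^ 'k) set)"
proof -
 have "open ((\<lambda>g :: complex ^ 'k. g $ k) -` (- {0}))" for k
  by (rule open_vimage_vec_nth) (simp add: open_Compl)
 moreover have "torus = (\<Inter>k. (\<lambda>g :: complex ^ 'k. g $ k) -` (- {0}))" by (auto simp: torus_def)
 ultimately show ?thesis by (metis (no_types, lifting) open_INT finite)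
qed

lemma chi_nonzero: "g \<in> torus ==> chi \<alpha> g \<noteq> 0"
 by (simp add: chi_def torus_def rpow_nonzero)
lemma chi_mult: "chi \<alpha> (g * h) = chi \<alpha> g * chi \<alpha> h"
 by (simp add: chi_def rpow_mult prod.distrib)
lemma chi_one [simp]: "chi \<alpha> 1 = 1" by (simp add: chi_def)
lemma chi_add: "g \<in> torus ==> chi (\<alpha> + \<beta>) g = chi \<alpha> g * chi \<beta> g"
 by (simp add: chi_def torus_def rpow_add prod.distrib)
lemma chi_zero [simp]: "chi 0 g = 1" by (simp add: chi_def)
lemma chi_diff: "g \<in> torus ==> chi (\<alpha> - \<beta>) g = chi \<alpha> g / chi \<beta> g"
 using chi_add[of g "\<alpha> - \<beta>" \<beta>] chi_nonzero[of g \<beta>] by (simp add: field_simps)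

text \<open>The Cauchy functional equation: additivity gives homogeneity over the rationals, and
  continuity extends it to the reals by density.\<close>

lemma additive_continuous_complex:
 fixes F :: "complex => complex"
 assumes add: "\<And>z w. F (z + w) = F z + F w" and cont: "continuous_on UNIV F"
 shows "F z = F 1 * of_real (Re z) + F \<i> * of_real (Im z)"
proof -
 have s: "F (of_real t * w) = of_real t * F w" for t :: real and w
 proof -
  define f where "f t = F (of_real t * w)" for t :: real
  have fadd: "f (x + y) = f x + f y" for x y by (simp add: f_def distrib_right add)
  have f0: "f 0 = 0" using fadd[of 0 0] by simp
  have fneg: "f (- x) = - f x" for x using fadd[of x "- x"] f0 by (simp add: eq_neg_iff_add_eq_0 add.commute)
  have fn: "f (of_nat n * x) = of_nat n * f x" for n x
   by (induction n) (simp_all add: f0 fadd distrib_right)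
  have fi: "f (of_int i * x) = of_int i * f x" for i x
   using fn[of "nat i" x] fn[of "nat (- i)" x] fneg[of "of_nat (nat (- i)) * x"]
   by (cases "i \<ge> 0") simp_all
  have fq: "f q = of_real q * f 1" if qr: "q \<in> \<rat>" for q
  proof -
   obtain i n :: int where q: "n > 0" "q = of_int i / of_int n" by (rule Rats_cases'[OF qr])
   have "of_int n * f q = f (of_int n * q)" by (simp only: fi)
   also have "\<dots> = of_int i * f 1" using q fi[of i 1] by simp
   finally have "f q = of_int i * f 1 / of_int n" using q(1) by (simp add: field_simps)
   then show ?thesis using q by simp
  qed
  have "continuous_on UNIV (\<lambda>t. f t - of_real t * f 1)"
   unfolding f_def by (intro continuous_on_compose2[OF cont] continuous_intros) auto
  note fc = this
  have "f t - of_real t * f 1 = 0"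
  proof (rule continuous_constant_on_closure[of \<rat> "\<lambda>t. f t - of_real t * f 1"])
   show "f q - of_real q * f 1 = 0" if "q \<in> \<rat>" for q
    by (subst fq[OF that]) simp
  qed (use fc in \<open>simp_all add: Rats_closure_real\<close>)
  then show ?thesis by (simp add: f_def)
 qed
 have "z = of_real (Re z) * 1 + of_real (Im z) * \<i>" by (simp add: complex_eq_iff)
 then have "F z = F (of_real (Re z) * 1 + of_real (Im z) * \<i>)" by (rule arg_cong)
 also have "\<dots> = of_real (Re z) * F 1 + of_real (Im z) * F \<i>" by (simp only: add s)
 finally show ?thesis by (simp add: mult.commute)
qed

text \<open>The character composed with \<open>exp\<close> lifts through \<open>exp\<close> to a
  continuous map of the plane. Normalized at 0 the lift is additive, hence real linear, and the
  period of \<open>exp\<close> makes its slope in the direction \<i> an integer multiple of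
  \<i>.\<close>

lemma character_C_star:
 assumes cont: "continuous_on (- {0}) c" and nz: "\<And>g. g \<noteq> 0 ==> c g \<noteq> 0"
  and mult: "\<And>g h. g \<noteq> 0 ==> h \<noteq> 0 ==> c (g * h) = c g * c h"
 shows "\<exists>\<mu>. \<forall>g. g \<noteq> 0 --> c g = rpow g \<mu>"
proof -
 have "continuous_on UNIV (\<lambda>z::complex. c (exp z))"
  by (intro continuous_on_compose2[OF cont] continuous_intros) auto
 then obtain L where L: "continuous_on UNIV L" "\<And>z. c (exp z) = exp (L z)"
  using continuous_logarithm_on_contractible[of UNIV "\<lambda>z. c (exp z)"] nz by (metis contractible_UNIV exp_not_eq_zero UNIV_I)
 have c1: "c 1 = 1" using mult[of 1 1] nz[of 1] by simp
 define F where "F z = L z - L 0" for z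
 have F: "c (exp z) = exp (F z)" for z
 proof -
  have "exp (L 0) = 1" using L(2)[of 0] c1 by simp
  then show ?thesis by (simp add: L(2) F_def exp_diff)
 qed
 have Fc: "continuous_on UNIV F" unfolding F_def using L(1) by (intro continuous_intros)
 have add: "F (z + w) = F z + F w" for z w
 proof -
  \<comment> \<open>The defect of additivity in units of \<open>2 pi \<i>\<close>: continuous and
    integer valued, hence constant in \<open>z\<close>, and zero at \<open>z = 0\<close>.\<close>
  define G where "G z = (F (z + w) - F z - F w) / (2 * of_real pi * \<i>)" for z
  have "exp (F (z + w) - F z - F w) = 1" for z
   using mult[of "exp z" "exp w"] by (simp add: exp_diff F[symmetric] exp_add nz)
  note e1 = this
  have Gint: "G z \<in> \<int>" for z
  proof -
   obtain n :: int where n: "Re (F (z + w) - F z - F w) = 0" "Im (F (z + w) - F z - F w) = of_int (2 * n) * pi"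
    using e1[of z] exp_eq_1[of "F (z + w) - F z - F w"] by auto
   have "F (z + w) - F z - F w = of_int n * (2 * of_real pi * \<i>)"
    by (rule complex_eqI) (use n in simp_all)
   then have "G z = of_int n" by (simp add: G_def)
   then show ?thesis by simp
  qed
  have Gc: "continuous_on UNIV G"
   unfolding G_def by (intro continuous_intros continuous_on_compose2[OF Fc]) auto
  have "G constant_on UNIV"
  proof (rule continuous_discrete_range_constant[OF connected_UNIV Gc])
   fix x :: complex
   show "\<exists>e>0. \<forall>y. y \<in> UNIV \<and> G y \<noteq> G x --> e \<le> norm (G y - G x)"
   proof (intro exI[of _ 1] conjI allI impI)
    fix y assume "y \<in> UNIV \<and> G y \<noteq> G x"
    moreover obtain i j where "G y = of_int i" "G x = of_int j" using Gint by (metis Ints_cases)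
    ultimately have "norm (G y - G x) = real_of_int \<bar>i - j\<bar>" "i \<noteq> j"
     by (auto simp flip: of_int_diff)
    then show "1 \<le> norm (G y - G x)" by linarith
   qed simp
  qed
  then have "G z = G 0" by (auto simp: constant_on_def)
  moreover have "G 0 = 0" by (simp add: G_def F_def)
  ultimately show ?thesis by (simp add: G_def algebra_simps)
 qed
 have Flin: "F z = F 1 * of_real (Re z) + F \<i> * of_real (Im z)" for z
  by (rule additive_continuous_complex[OF add Fc])
 \<comment> \<open>Periodicity restricts only \<open>F \<i>\<close>, which yields the integer
   component of the exponent; \<open>F 1\<close> is an arbitrary complex number and becomes the
   other component.\<close>
 have "exp (F (2 * of_real pi * \<i>)) = 1" using F[of "2 * of_real pi * \<i>"] c1 by simp
 moreover have "F (2 * of_real pi * \<i>) = F \<i> * (2 * of_real pi)"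
  using Flin[of "2 * of_real pi * \<i>"] by simp
 ultimately obtain v :: int where v: "Re (F \<i> * (2 * of_real pi)) = 0" "Im (F \<i> * (2 * of_real pi)) = of_int (2 * v) * pi"
  using exp_eq_1[of "F \<i> * (2 * of_real pi)"] by auto
 have Fi: "F \<i> = of_int v * \<i>" using v by (simp add: complex_eq_iff)
 have "c g = rpow g (RR (F 1) v)" if "g \<noteq> 0" for g
 proof -
  obtain z where z: "g = exp z" using exp_surj[OF \<open>g \<noteq> 0\<close>] by blast
  show ?thesis unfolding z F rpow_exp Flin[of z] by (simp add: Fi mult.commute mult.left_commute)
 qed
 then show ?thesis by blast
qed

theorem continuous_character_chi:
 fixes c :: "complex ^ 'n => complex"
 assumes "continuous_character c"
 shows "\<exists>\<alpha>. \<forall>g\<in>torus. c g = chi \<alpha> g"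
proof -
 have cont: "continuous_on torus c" and nz: "\<And>g. g \<in> torus ==> c g \<noteq> 0"
  and mult: "\<And>g h. g \<in> torus ==> h \<in> torus ==> c (g * h) = c g * c h"
  using assms by (auto simp: continuous_character_def)
 define e :: "'n => complex => complex ^ 'n" where "e k z = (\<chi> j. if j = k then z else 1)" for k z
 have eT: "e k z \<in> torus" if "z \<noteq> 0" for k z using that by (simp add: torus_def e_def)
 have "\<exists>\<mu>. \<forall>g. g \<noteq> 0 --> c (e k g) = rpow g \<mu>" for k
 proof (rule character_C_star)
  show "continuous_on (- {0}) (\<lambda>g. c (e k g))"
  proof (rule continuous_on_compose2[OF cont])
   have "continuous_on (- {0}) (\<lambda>g. if j = k then g else (1::complex))" for j
    by (cases "j = k") (auto intro: continuous_intros)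
   then show "continuous_on (- {0}) (e k)"
    unfolding e_def by (intro continuous_on_vec_lambda)
  qed (use eT in auto)
  show "c (e k g) \<noteq> 0" if "g \<noteq> 0" for g by (rule nz[OF eT[OF that]])
  have "e k (g * h) = e k g * e k h" for g h by (simp add: e_def vec_eq_iff)
  then show "c (e k (g * h)) = c (e k g) * c (e k h)" if "g \<noteq> 0" "h \<noteq> 0" for g h
   using mult[OF eT[OF that(1)] eT[OF that(2)]] by simp
 qed
 then obtain \<mu> where \<mu>: "\<And>k g. g \<noteq> 0 ==> c (e k g) = rpow g (\<mu> k)" by metis
 have c1: "c 1 = 1" using mult[of 1 1] nz[of 1] by simp
 have "c g = chi (\<chi> k. \<mu> k) g" if g: "g \<in> torus" for g
 proof -
  have pT: "(\<Prod>k\<in>A. e k (g $ k)) \<in> torus" for A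
  proof -
   have "e k (g $ k) \<in> torus" for k using g by (intro eT) (simp add: torus_def)
   then show ?thesis by (induction A rule: infinite_finite_induct) (auto intro: torus_mult)
  qed
  have "c (\<Prod>k\<in>A. e k (g $ k)) = (\<Prod>k\<in>A. c (e k (g $ k)))" for A
  proof (induction A rule: infinite_finite_induct)
   case (insert k A)
   have "e k (g $ k) \<in> torus" using g by (intro eT) (simp add: torus_def)
   then show ?case using insert mult[OF _ pT[of A]] by simp
  qed (simp_all add: c1)
  moreover have "(\<Prod>k\<in>UNIV. e k (g $ k)) = g"
  proof -
   have "(\<Prod>k\<in>A. e k (g $ k)) $ j = (\<Prod>k\<in>A. e k (g $ k) $ j)" for A j
    by (induction A rule: infinite_finite_induct) simp_all
   moreover have "(\<Prod>k\<in>UNIV. e k (g $ k) $ j) = g $ j" for j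
    by (simp add: e_def)
   ultimately show ?thesis by (simp add: vec_eq_iff)
  qed
  ultimately have "c g = (\<Prod>k\<in>UNIV. c (e k (g $ k)))" by metis
  also have "\<dots> = chi (\<chi> k. \<mu> k) g" using g by (simp add: \<mu> chi_def torus_def)
  finally show ?thesis .
 qed
 then show ?thesis by blast
qed

section \<open>The toric manifold\<close>

lemma vec_prod_nth: "(\<Prod>k\<in>A. f k :: complex ^ 'n) $ j = (\<Prod>k\<in>A. f k $ j)"
 by (induction A rule: infinite_finite_induct) simp_all

lemma lam_torus: "t \<noteq> 0 ==> lam \<beta> t \<in> torus"
 by (simp add: lam_def torus_def rpow_nonzero)

lemma lam_mult: "lam \<beta> (s * t) = lam \<beta> s * lam \<beta> t"
 by (simp add: lam_def vec_eq_iff rpow_mult)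

lemma lam_one [simp]: "lam \<beta> 1 = 1"
 by (simp add: lam_def vec_eq_iff)

lemma torus_prod: "(\<And>k. k \<in> A ==> f k \<in> torus) ==> (\<Prod>k\<in>A. f k) \<in> torus"
 by (induction A rule: infinite_finite_induct) (auto intro: torus_mult)

lemma chi_prod: "chi \<alpha> (\<Prod>k\<in>A. f k) = (\<Prod>k\<in>A. chi \<alpha> (f k))"
 by (induction A rule: infinite_finite_induct) (simp_all add: chi_mult)

lemma chi_lam: "t \<noteq> 0 ==> chi \<alpha> (lam \<beta> t) = rpow t (pairing \<alpha> \<beta>)"
 by (simp add: chi_def lam_def rpow_rpow pairing_def rpow_sum)

lemma torus_inverse: "h \<in> torus ==> (\<chi> k. inverse (h $ k)) \<in> torus" "h \<in> torus ==> (\<chi> k. inverse (h $ k)) * h = 1"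
 by (simp_all add: torus_def vec_eq_iff)

text \<open>Exchanging the two products leaves the exponents
  \<open>\<Sum> \<gamma> \<alpha>\<close>, so here duality is needed in the order opposite to its
  definition, as given by \<open>dual_two_sided\<close>.\<close>

lemma torus_recover:
 fixes \<alpha> \<gamma> :: "'m::finite => rr ^ 'n"
 assumes g: "g \<in> torus" and dual: "dual_on \<alpha> \<gamma> J" and card: "card J = CARD('n)"
 shows "(\<Prod>j\<in>J. rpow (chi (\<alpha> j) g) (\<gamma> j $ l)) = g $ l"
proof -
 have g0: "g $ k \<noteq> 0" for k using g by (simp add: torus_def)
 have "(\<Prod>j\<in>J. rpow (chi (\<alpha> j) g) (\<gamma> j $ l)) = (\<Prod>j\<in>J. \<Prod>k\<in>UNIV. rpow (g $ k) (\<gamma> j $ l * \<alpha> j $ k))"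
  by (simp add: chi_def rpow_prod rpow_rpow g0)
 also have "\<dots> = (\<Prod>k\<in>UNIV. rpow (g $ k) (\<Sum>j\<in>J. \<gamma> j $ l * \<alpha> j $ k))"
  by (subst prod.swap) (simp add: rpow_sum g0)
 also have "\<dots> = (\<Prod>k\<in>UNIV. if l = k then g $ k else 1)"
  by (rule prod.cong) (simp_all add: dual_two_sided[OF dual card])
 also have "\<dots> = g $ l" by simp
 finally show ?thesis .
qed

text \<open>On the torus this is the character of exponent \<open>\<nu>\<close> pulled back along
  \<open>Lam \<beta>\<close>; the convention for powers of 0 extends the formula to all homogeneous
  coordinates.\<close>

definition monomial :: "('m::finite => rr ^ 'n) => rr ^ 'n => complex ^ 'm => complex" where
 "monomial \<beta> \<nu> z = (\<Prod>k\<in>UNIV. rpow (z $ k) (pairing \<nu> (\<beta> k)))"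

text \<open>The extension of the character \<open>\<chi>\<^sup>\<nu>\<close> from the open orbit, as far as it exists.\<close>

definition Xi :: "('m::finite => rr ^ 'n) => rr ^ 'n => (complex ^ 'm) set => complex" where
 "Xi \<beta> \<nu> p = monomial \<beta> \<nu> (SOME z. z \<in> p)"

lemma Lam_torus: "h \<in> torus ==> Lam \<beta> h \<in> torus"
 unfolding Lam_def by (intro torus_prod lam_torus) (simp add: torus_def)

lemma Lam_mult: "Lam \<beta> (h * h') = Lam \<beta> h * Lam \<beta> h'"
 by (simp add: Lam_def lam_mult prod.distrib)

lemma Lam_one [simp]: "Lam \<beta> 1 = 1"
 by (simp add: Lam_def)

lemma monomial_mult: "monomial \<beta> \<nu> (h * z) = monomial \<beta> \<nu> h * monomial \<beta> \<nu> z"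
 by (simp add: monomial_def rpow_mult prod.distrib)

lemma monomial_torus: "h \<in> torus ==> monomial \<beta> \<nu> h = chi \<nu> (Lam \<beta> h)"
 by (simp add: monomial_def Lam_def chi_prod chi_lam torus_def)

lemma monomial_Ker: "h \<in> Ker_Lam \<beta> ==> monomial \<beta> \<nu> h = 1"
 by (simp add: Ker_Lam_def monomial_torus)

lemma monomial_zero [simp]: "monomial \<beta> 0 z = 1" by (simp add: monomial_def)

lemma monomial_add_ge:
 assumes "z \<in> U_simplex I" "\<And>i. i \<in> I ==> ge_reg b (pairing \<nu> (\<beta> i)) 0" "\<And>i. i \<in> I ==> ge_reg b (pairing \<nu>' (\<beta> i)) 0"
 shows "monomial \<beta> (\<nu> + \<nu>') z = monomial \<beta> \<nu> z * monomial \<beta> \<nu>' z"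
proof -
 have "rpow (z $ k) (pairing \<nu> (\<beta> k) + pairing \<nu>' (\<beta> k)) = rpow (z $ k) (pairing \<nu> (\<beta> k)) * rpow (z $ k) (pairing \<nu>' (\<beta> k))" for k
  using assms by (cases "k \<in> I") (auto simp: rpow_add_ge[of b] U_simplex_def rpow_add)
 then show ?thesis by (simp add: monomial_def pairing_add_left prod.distrib)
qed

lemma ker_one [simp]: "1 \<in> Ker_Lam \<beta>" by (simp add: Ker_Lam_def)

lemma ker_mult: "h \<in> Ker_Lam \<beta> ==> h' \<in> Ker_Lam \<beta> ==> h * h' \<in> Ker_Lam \<beta>"
 by (simp add: Ker_Lam_def torus_mult Lam_mult)

lemma ker_inverse:
 assumes "h \<in> Ker_Lam \<beta>" shows "(\<chi> k. inverse (h $ k)) \<in> Ker_Lam \<beta>"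
proof -
 have "Lam \<beta> (\<chi> k. inverse (h $ k)) * Lam \<beta> h = 1"
  unfolding Lam_mult[symmetric] using assms by (simp add: torus_inverse Ker_Lam_def)
 then show ?thesis using assms by (simp add: Ker_Lam_def torus_inverse)
qed

lemma ker_orbit_self: "z \<in> ker_orbit \<beta> z"
 unfolding ker_orbit_def by (rule image_eqI[of _ _ 1]) simp_all

lemma ker_orbit_mult:
 assumes h: "h \<in> Ker_Lam \<beta>" shows "ker_orbit \<beta> (h * z) = ker_orbit \<beta> z"
proof -
 have sub: "ker_orbit \<beta> (h * z) \<subseteq> ker_orbit \<beta> z" if "h \<in> Ker_Lam \<beta>" for h z
  using that by (auto simp: ker_orbit_def mult.assoc[symmetric] intro!: imageI ker_mult)
 have "(\<chi> k. inverse (h $ k)) * (h * z) = z"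
  using torus_inverse(2)[of h] h by (simp add: mult.assoc[symmetric] Ker_Lam_def)
 then show ?thesis using sub[OF h, of z] sub[OF ker_inverse[OF h], of "h * z"] by auto
qed

lemma ker_orbit_eq_iff: "ker_orbit \<beta> z = ker_orbit \<beta> z' \<longleftrightarrow> (\<exists>h\<in>Ker_Lam \<beta>. z' = h * z)"
 using ker_orbit_self[of z' \<beta>] ker_orbit_mult[of _ \<beta> z] by (auto simp: ker_orbit_def)

lemma ker_orbit_mem: "w \<in> ker_orbit \<beta> z ==> ker_orbit \<beta> w = ker_orbit \<beta> z"
 using ker_orbit_mult by (metis (no_types, lifting) imageE ker_orbit_def)

text \<open>The representative chosen in \<open>Xi\<close> does not matter, because monomials are 1
  on the kernel of \<open>Lam \<beta>\<close>.\<close>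

lemma Xi_orbit: "Xi \<beta> \<nu> (ker_orbit \<beta> z) = monomial \<beta> \<nu> z"
proof -
 have "(SOME w. w \<in> ker_orbit \<beta> z) \<in> ker_orbit \<beta> z" using ker_orbit_self someI by metis
 then obtain h where "h \<in> Ker_Lam \<beta>" "(SOME w. w \<in> ker_orbit \<beta> z) = h * z" by (auto simp: ker_orbit_def)
 then show ?thesis by (simp add: Xi_def monomial_mult monomial_Ker)
qed

text \<open>Two lifts of \<open>g\<close> differ by an element of the kernel, which the orbit
  absorbs.\<close>

lemma toric_act_orbit:
 assumes h: "h \<in> torus" "Lam \<beta> h = g" shows "toric_act \<beta> g (ker_orbit \<beta> z) = ker_orbit \<beta> (h * z)"
proof
 show "toric_act \<beta> g (ker_orbit \<beta> z) \<subseteq> ker_orbit \<beta> (h * z)"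
 proof
  fix x assume "x \<in> toric_act \<beta> g (ker_orbit \<beta> z)"
  then obtain h' k where x: "x = h' * (k * z)" "h' \<in> torus" "Lam \<beta> h' = g" "k \<in> Ker_Lam \<beta>"
   by (auto simp: toric_act_def ker_orbit_def)
  let ?i = "\<chi> k. inverse (h $ k)"
  have hi: "?i * h = 1" "?i \<in> torus" using torus_inverse[OF h(1)] by auto
  have "Lam \<beta> (?i * h') = Lam \<beta> ?i * Lam \<beta> h" by (simp add: Lam_mult x(3) h(2))
  also have "\<dots> = 1" by (simp add: Lam_mult[symmetric] hi)
  finally have "?i * h' \<in> Ker_Lam \<beta>" using hi x(2) by (simp add: Ker_Lam_def torus_mult)
  then have k: "?i * h' * k \<in> Ker_Lam \<beta>" using x(4) by (rule ker_mult)
  have "x = (?i * h) * x" by (simp add: hi(1))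
  also have "\<dots> = (?i * h' * k) * (h * z)" by (simp add: x(1) ac_simps)
  finally show "x \<in> ker_orbit \<beta> (h * z)" using k unfolding ker_orbit_def by blast
 qed
 show "ker_orbit \<beta> (h * z) \<subseteq> toric_act \<beta> g (ker_orbit \<beta> z)"
 proof
  fix x assume "x \<in> ker_orbit \<beta> (h * z)"
  then obtain k where k: "x = k * (h * z)" "k \<in> Ker_Lam \<beta>" by (auto simp: ker_orbit_def)
  then have "x = h * (k * z)" by (simp add: ac_simps)
  then show "x \<in> toric_act \<beta> g (ker_orbit \<beta> z)"
   using h k(2) unfolding toric_act_def ker_orbit_def by blast
 qed
qed

lemma U_simplex_mult: "h \<in> torus ==> h * z \<in> U_simplex I \<longleftrightarrow> z \<in> U_simplex I"
 by (auto simp: U_simplex_def torus_def)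

lemma toric_open_iff: "ker_orbit \<beta> z \<in> toric_open \<beta> I \<longleftrightarrow> z \<in> U_simplex I"
proof
 assume "ker_orbit \<beta> z \<in> toric_open \<beta> I"
 then obtain w where w: "w \<in> U_simplex I" "ker_orbit \<beta> z = ker_orbit \<beta> w" by (auto simp: toric_open_def)
 then obtain h where "h \<in> Ker_Lam \<beta>" "w = h * z" using ker_orbit_eq_iff by metis
 then show "z \<in> U_simplex I" using w U_simplex_mult[of h z I] by (auto simp: Ker_Lam_def)
qed (simp add: toric_open_def)

lemma U_simplex_Int: "U_simplex I \<inter> U_simplex J = U_simplex (I \<inter> J)"
 by (auto simp: U_simplex_def)

lemma toric_open_Int: "toric_open \<beta> I \<inter> toric_open \<beta> J = toric_open \<beta> (I \<inter> J)"
proof -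
 have "x \<in> toric_open \<beta> I \<inter> toric_open \<beta> J \<longleftrightarrow> x \<in> toric_open \<beta> (I \<inter> J)" for x
 proof (cases "x \<in> range (ker_orbit \<beta>)")
  case True
  then obtain z where "x = ker_orbit \<beta> z" by blast
  then show ?thesis using U_simplex_Int[of I J] by (auto simp: toric_open_iff)
 qed (auto simp: toric_open_def)
 then show ?thesis by blast
qed

lemma toric_open_mono: "I \<subseteq> J ==> toric_open \<beta> I \<subseteq> toric_open \<beta> J"
 by (auto simp: toric_open_def U_simplex_def)

lemma open_U_simplex: "open (U_simplex I :: (complex ^ 'm::finite) set)"
proof -
 have "open ((\<lambda>g :: complex ^ 'm. g $ k) -` (- {0}))" for k
  by (rule open_vimage_vec_nth) (simp add: open_Compl)
 moreover have "U_simplex I = (\<Inter>k\<in>-I. (\<lambda>g :: complex ^ 'm. g $ k) -` (- {0}))" by (auto simp: U_simplex_def)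
 ultimately show ?thesis by (metis (no_types, lifting) open_INT finite)
qed

lemma open_U_complex: "open (U_complex \<Sigma> :: (complex ^ 'm::finite) set)"
 unfolding U_complex_def by (intro open_UN ballI open_U_simplex)

lemma regular_monomial:
 assumes M: "reg_mfd b M" and W: "openin (mtop M) W" and G: "\<And>k. regular b M W (\<lambda>x. G x $ k)" "\<And>x. x \<in> W ==> G x \<in> U_simplex I"
  and ge: "\<And>i. i \<in> I ==> ge_reg b (pairing \<nu> (\<beta> i)) 0"
 shows "regular b M W (\<lambda>x. monomial \<beta> \<nu> (G x))"
 unfolding monomial_def
proof (rule regular_prod[OF W])
 fix k
 show "regular b M W (\<lambda>x. rpow (G x $ k) (pairing \<nu> (\<beta> k)))"
 proof (cases "k \<in> I")
  case True
  show ?thesis by (rule regular_creg[OF M creg_rpow_ge[OF ge[OF True]] G(1)]) simp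
 next
  case False
  show ?thesis by (rule regular_creg[OF M creg_rpow G(1)]) (use G(2) False in \<open>auto simp: U_simplex_def\<close>)
 qed
qed

lemma topspace_toric_top: "topspace (toric_top \<Sigma> \<beta>) = ker_orbit \<beta> ` U_complex \<Sigma>"
 using quotient_imp_surjective_map[OF quotient_map_quotient_topology[of "top_of_set (U_complex \<Sigma>)" "ker_orbit \<beta>"]]
 by (simp add: toric_top_def)

lemma topspace_toric_top': "topspace (toric_top \<Sigma> \<beta>) = (\<Union>I\<in>\<Sigma>. toric_open \<beta> I)"
 by (auto simp: topspace_toric_top toric_open_def U_complex_def)

lemma openin_toric_top:
 "openin (toric_top \<Sigma> \<beta>) W \<longleftrightarrow> W \<subseteq> ker_orbit \<beta> ` U_complex \<Sigma> \<and> open {z \<in> U_complex \<Sigma>. ker_orbit \<beta> z \<in> W}"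
proof -
 have "openin (top_of_set (U_complex \<Sigma>)) {z \<in> U_complex \<Sigma>. ker_orbit \<beta> z \<in> W} \<longleftrightarrow> open {z \<in> U_complex \<Sigma>. ker_orbit \<beta> z \<in> W}"
  using open_U_complex by (subst openin_open_eq) auto
 then show ?thesis by (simp add: toric_top_def openin_quotient_topology)
qed

lemma openin_toric_open:
 assumes "I \<in> \<Sigma>" shows "openin (toric_top \<Sigma> \<beta>) (toric_open \<beta> I)"
proof -
 have "{z \<in> U_complex \<Sigma>. ker_orbit \<beta> z \<in> toric_open \<beta> I} = U_simplex I"
  using assms by (auto simp: toric_open_iff U_complex_def)
 then show ?thesis
  using assms open_U_simplex by (auto simp: openin_toric_top toric_open_def U_complex_def)
qed

lemma continuous_map_ker_orbit: "continuous_map (top_of_set (U_complex \<Sigma>)) (toric_top \<Sigma> \<beta>) (ker_orbit \<beta>)"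
 using quotient_imp_continuous_map[OF quotient_map_quotient_topology] by (simp add: toric_top_def)

text \<open>\<open>U_simplex I\<close> is open and a union of kernel orbits, so the universal
  property of the quotient restricts to it.\<close>

lemma continuous_map_from_toric:
 assumes I: "I \<in> \<Sigma>" and F: "continuous_map (top_of_set (U_simplex I)) Y (\<lambda>z. F (ker_orbit \<beta> z))"
 shows "continuous_map (subtopology (toric_top \<Sigma> \<beta>) (toric_open \<beta> I)) Y F"
 unfolding continuous_map_def
proof (intro conjI allI impI)
 have t: "topspace (subtopology (toric_top \<Sigma> \<beta>) (toric_open \<beta> I)) = toric_open \<beta> I"
  using openin_subset[OF openin_toric_open[OF I]] by auto
 show "F \<in> topspace (subtopology (toric_top \<Sigma> \<beta>) (toric_open \<beta> I)) \<rightarrow> topspace Y"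
  unfolding t using continuous_map_image_subset_topspace[OF F] by (auto simp: toric_open_def)
 fix V assume V: "openin Y V"
 let ?W = "{p \<in> toric_open \<beta> I. F p \<in> V}"
 have "{z \<in> U_complex \<Sigma>. ker_orbit \<beta> z \<in> ?W} = {z \<in> U_simplex I. F (ker_orbit \<beta> z) \<in> V}"
  using I by (auto simp: toric_open_iff U_complex_def)
 moreover have "open {z \<in> U_simplex I. F (ker_orbit \<beta> z) \<in> V}"
  using openin_continuous_map_preimage[OF F V] openin_open_eq[OF open_U_simplex] by auto
 moreover have "?W \<subseteq> ker_orbit \<beta> ` U_complex \<Sigma>" using I by (auto simp: toric_open_def U_complex_def)
 ultimately have "openin (toric_top \<Sigma> \<beta>) ?W" by (simp add: openin_toric_top)
 then show "openin (subtopology (toric_top \<Sigma> \<beta>) (toric_open \<beta> I))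
   {p \<in> topspace (subtopology (toric_top \<Sigma> \<beta>) (toric_open \<beta> I)). F p \<in> V}"
  unfolding t using openin_subtopology_Int2[of "toric_top \<Sigma> \<beta>" ?W "toric_open \<beta> I"] by (simp add: Int_absorb1 Collect_mono_iff subset_iff)
qed

text \<open>A function on \<open>U\<^sub>I\<close> is determined by its restriction to the open orbit: move the vanishing
 coordinates off \<open>0\<close>.\<close>

lemma toric_dense:
 fixes F :: "(complex ^ 'm::finite) set => complex"
 assumes I: "I \<in> \<Sigma>" and F: "continuous_map (subtopology (toric_top \<Sigma> \<beta>) (toric_open \<beta> I)) euclidean F"
  and z: "\<And>p. p \<in> toric_open \<beta> {} ==> F p = 0" and p: "p \<in> toric_open \<beta> I"
 shows "F p = 0"
proof -
 obtain w where w: "w \<in> U_simplex I" "p = ker_orbit \<beta> w" using p by (auto simp: toric_open_def)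
 define c :: "real => complex ^ 'm" where "c t = (\<chi> k. if w $ k = 0 then of_real t else w $ k)" for t
 have cU: "c t \<in> U_simplex I" for t using w by (auto simp: c_def U_simplex_def)
 have "continuous_on UNIV c"
  unfolding c_def
 proof (intro continuous_on_vec_lambda)
  show "continuous_on UNIV (\<lambda>t::real. if w $ k = 0 then of_real t else w $ k)" for k
   by (cases "w $ k = 0") (auto intro: continuous_intros)
 qed
 then have 1: "continuous_map euclideanreal (top_of_set (U_complex \<Sigma>)) c"
  using cU I by (auto simp: continuous_map_in_subtopology U_complex_def)
 have "continuous_map euclideanreal (toric_top \<Sigma> \<beta>) (\<lambda>t. ker_orbit \<beta> (c t))"
  using continuous_map_compose[OF 1 continuous_map_ker_orbit] by (simp add: o_def)
 then have 2: "continuous_map euclideanreal (subtopology (toric_top \<Sigma> \<beta>) (toric_open \<beta> I)) (\<lambda>t. ker_orbit \<beta> (c t))"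
  using cU by (auto simp: continuous_map_in_subtopology toric_open_iff)
 have "continuous_map euclideanreal euclidean (\<lambda>t. F (ker_orbit \<beta> (c t)))"
  using continuous_map_compose[OF 2 F] by (simp add: o_def)
 then have "isCont (\<lambda>t. F (ker_orbit \<beta> (c t))) 0" by (simp add: continuous_on_eq_continuous_at)
 then have "((\<lambda>t. F (ker_orbit \<beta> (c t))) \<longlongrightarrow> F (ker_orbit \<beta> (c 0))) (at 0)" by (simp add: isCont_def)
 moreover have "\<forall>\<^sub>F t in at (0::real). F (ker_orbit \<beta> (c t)) = 0"
  unfolding eventually_at_filter
  by (intro always_eventually allI impI z) (simp add: toric_open_iff U_simplex_def c_def)
 then have "((\<lambda>t. F (ker_orbit \<beta> (c t))) \<longlongrightarrow> 0) (at (0::real))" by (rule tendsto_eventually)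
 ultimately have "F (ker_orbit \<beta> (c 0)) = 0" using LIM_unique by blast
 moreover have "c 0 = w" by (simp add: c_def vec_eq_iff)
 ultimately show ?thesis using w by simp
qed

section \<open>Section of the homomorphism onto the torus, base point and action\<close>

locale toric =
 fixes \<Sigma> :: "'m::finite set set" and \<beta> :: "'m => rr ^ 'n"
 assumes fan: "nonsingular_fan \<Sigma> \<beta>"
begin

lemma simplicial: "simplicial_complex \<Sigma> CARD('n)"
 using fan by (simp add: nonsingular_fan_def topological_fan_def)

lemma empty_in: "{} \<in> \<Sigma>" and vertex_in: "{i} \<in> \<Sigma>"
 and subset_in: "I \<in> \<Sigma> ==> J \<subseteq> I ==> J \<in> \<Sigma>"
 using simplicial by (auto simp: simplicial_complex_def)

lemma ex_facet:
 assumes "I \<in> \<Sigma>" shows "\<exists>J. facet \<Sigma> J \<and> I \<subseteq> J"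
proof -
 obtain J where "J \<in> \<Sigma>" "I \<subseteq> J" "\<forall>K\<in>\<Sigma>. J \<subseteq> K --> J = K"
  using finite_has_maximal2[of \<Sigma> I] assms by auto
 then show ?thesis unfolding facet_def by blast
qed

text \<open>The completion of a simplex that already has n vertices adds nothing, so the dual family
  is dual to \<open>\<beta>\<close> itself.\<close>

lemma ex_full: "\<exists>I0 \<alpha>. I0 \<in> \<Sigma> \<and> card I0 = CARD('n) \<and> dual_on \<alpha> \<beta> I0"
proof -
 obtain I0 where I0: "I0 \<in> \<Sigma>" "card I0 = CARD('n)" using simplicial by (auto simp: simplicial_complex_def)
 obtain J \<alpha> \<gamma> where J: "I0 \<subseteq> J" "card J = CARD('n)" "\<forall>i\<in>I0. \<gamma> i = \<beta> i" "dual_on \<alpha> \<gamma> J"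
  using dual_completion[OF fan I0(1)] by blast
 have "J = I0" using card_subset_eq[of J I0] J I0 by simp
 then have "dual_on \<alpha> \<beta> I0" using J by (simp add: dual_on_def)
 then show ?thesis using I0 by blast
qed

definition full :: "'m set" where "full = (SOME I0. \<exists>\<alpha>. I0 \<in> \<Sigma> \<and> card I0 = CARD('n) \<and> dual_on \<alpha> \<beta> I0)"
definition fdual :: "'m => rr ^ 'n" where "fdual = (SOME \<alpha>. dual_on \<alpha> \<beta> full)"

lemma full: "full \<in> \<Sigma>" "card full = CARD('n)" "dual_on fdual \<beta> full"
proof -
 have "\<exists>\<alpha>. full \<in> \<Sigma> \<and> card full = CARD('n) \<and> dual_on \<alpha> \<beta> full"
  unfolding full_def by (rule someI_ex[OF ex_full])
 then show "full \<in> \<Sigma>" "card full = CARD('n)" "dual_on fdual \<beta> full"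
  unfolding fdual_def using someI_ex[of "\<lambda>\<alpha>. dual_on \<alpha> \<beta> full"] by blast+
qed

text \<open>A right inverse of \<open>Lam \<beta>\<close> given by characters dual to a simplex with
  n vertices. It proves surjectivity and, being built from characters, also the regularity of the
  action.\<close>

definition hsec :: "complex ^ 'n => complex ^ 'm" where
 "hsec g = (\<chi> k. if k \<in> full then chi (fdual k) g else 1)"

lemma hsec_torus: "g \<in> torus ==> hsec g \<in> torus"
 by (simp add: torus_def[where 'k = 'm] hsec_def chi_nonzero)

lemma Lam_hsec: "g \<in> torus ==> Lam \<beta> (hsec g) = g"
proof -
 assume g: "g \<in> torus"
 have "Lam \<beta> (hsec g) $ l = g $ l" for l
 proof -
  have "Lam \<beta> (hsec g) $ l = (\<Prod>k\<in>UNIV. rpow (if k \<in> full then chi (fdual k) g else 1) (\<beta> k $ l))"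
   by (simp add: Lam_def vec_prod_nth lam_def hsec_def)
  also have "\<dots> = (\<Prod>k\<in>full. rpow (chi (fdual k) g) (\<beta> k $ l))"
   by (rule prod.mono_neutral_cong_right) auto
  also have "\<dots> = g $ l" by (rule torus_recover[OF g full(3,2)])
  finally show ?thesis .
 qed
 then show ?thesis by (simp add: vec_eq_iff)
qed

abbreviation "Xtop \<equiv> toric_top \<Sigma> \<beta>"
abbreviation "Xm \<equiv> toric_mfd \<Sigma> \<beta>"
abbreviation "UI \<equiv> toric_open \<beta>"
abbreviation "act \<equiv> toric_act \<beta>"
abbreviation "chart \<equiv> toric_chart \<beta>"
definition x0 :: "(complex ^ 'm) set" where "x0 = ker_orbit \<beta> 1"

lemma mtop_Xm [simp]: "mtop Xm = Xtop" by (simp add: toric_mfd_def)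

lemma act_orbit: "g \<in> torus ==> act g (ker_orbit \<beta> z) = ker_orbit \<beta> (hsec g * z)"
 by (rule toric_act_orbit[OF hsec_torus Lam_hsec])

lemma Xi_x0 [simp]: "Xi \<beta> \<nu> x0 = 1"
 by (simp add: x0_def Xi_orbit monomial_torus)

lemma Xi_zero [simp]: "Xi \<beta> 0 p = 1"
 by (simp add: Xi_def)

lemma x0_open: "x0 \<in> UI I" by (simp add: x0_def toric_open_iff U_simplex_def)

lemma Xi_act: "g \<in> torus ==> p \<in> range (ker_orbit \<beta>) ==> Xi \<beta> \<nu> (act g p) = chi \<nu> g * Xi \<beta> \<nu> p"
 by (auto simp: act_orbit Xi_orbit monomial_mult monomial_torus hsec_torus Lam_hsec)

lemma UI_range: "p \<in> UI I ==> p \<in> range (ker_orbit \<beta>)" by (auto simp: toric_open_def)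

lemma act_UI: "g \<in> torus ==> p \<in> UI I ==> act g p \<in> UI I"
 by (auto simp: toric_open_def act_orbit U_simplex_mult hsec_torus intro!: imageI)

lemma act_one: "p \<in> range (ker_orbit \<beta>) ==> act 1 p = p"
 using toric_act_orbit[of 1 \<beta> 1] by auto

lemma act_mult: "g \<in> torus ==> h \<in> torus ==> p \<in> range (ker_orbit \<beta>) ==> act (g * h) p = act g (act h p)"
proof -
 assume gh: "g \<in> torus" "h \<in> torus" and "p \<in> range (ker_orbit \<beta>)"
 then obtain z where z: "p = ker_orbit \<beta> z" by blast
 have "act (g * h) p = ker_orbit \<beta> ((hsec g * hsec h) * z)"
  unfolding z using gh by (intro toric_act_orbit) (simp_all add: torus_mult hsec_torus Lam_mult Lam_hsec)
 then show ?thesis using gh by (simp add: z act_orbit mult.assoc)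
qed

lemma open_orbit: "p \<in> UI {} ==> \<exists>g\<in>torus. p = act g x0"
proof -
 assume "p \<in> UI {}"
 then obtain h where h: "p = ker_orbit \<beta> h" "h \<in> torus" by (auto simp: toric_open_def U_simplex_def torus_def)
 then have "p = act (Lam \<beta> h) x0" unfolding x0_def using toric_act_orbit[of h \<beta> "Lam \<beta> h" 1] by simp
 then show ?thesis using Lam_torus[OF h(2)] by blast
qed

lemma Xi_add_ge:
 assumes "p \<in> UI I" "\<And>i. i \<in> I ==> ge_reg b (pairing \<nu> (\<beta> i)) 0" "\<And>i. i \<in> I ==> ge_reg b (pairing \<nu>' (\<beta> i)) 0"
 shows "Xi \<beta> (\<nu> + \<nu>') p = Xi \<beta> \<nu> p * Xi \<beta> \<nu>' p"
 using assms by (auto simp: toric_open_def Xi_orbit intro!: monomial_add_ge)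

lemma regular_chi: "regular b (vec_mfd torus) torus (chi \<alpha>)"
 unfolding chi_def[abs_def]
proof (rule regular_prod)
 show "openin (mtop (vec_mfd torus)) torus" by simp
 show "regular b (vec_mfd torus) torus (\<lambda>g. rpow (g $ k) (\<alpha> $ k))" for k
  by (rule regular_creg[OF reg_mfd_vec[OF open_torus] creg_rpow regular_vec_coord[OF open_torus]]) (simp add: torus_def)
qed

text \<open>The completion \<open>\<gamma>\<close>, only quantified in \<open>toric_atlas\<close>,
  becomes a parameter here because the inverse of the chart is written in terms of it.\<close>

definition chart_data :: "'m set => 'm set => ('m => rr ^ 'n) => ('m => rr ^ 'n) => bool" where
 "chart_data I J \<alpha> \<gamma> \<longleftrightarrow> I \<in> \<Sigma> \<and> I \<subseteq> J \<and> card J = CARD('n) \<and> (\<forall>i\<in>I. \<gamma> i = \<beta> i) \<and> dual_on \<alpha> \<gamma> J"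

lemma chart_data_I: "chart_data I J \<alpha> \<gamma> ==> I \<in> \<Sigma>" by (simp add: chart_data_def)

context
 fixes I J :: "'m set" and \<alpha> \<gamma> :: "'m => rr ^ 'n"
 assumes cd: "chart_data I J \<alpha> \<gamma>"
begin

private lemma I: "I \<in> \<Sigma>" and IJ: "I \<subseteq> J" and card: "card J = CARD('n)"
 and \<gamma>: "i \<in> I ==> \<gamma> i = \<beta> i" and dual: "dual_on \<alpha> \<gamma> J"
 using cd by (auto simp: chart_data_def)

definition chart_dom :: "('m => complex) set" where
 "chart_dom = {w \<in> topspace (cspace J). \<forall>j\<in>J - I. w j \<noteq> 0}"

definition chart_tor :: "('m => complex) => complex ^ 'n" where
 "chart_tor w = (\<Prod>j\<in>J - I. lam (\<gamma> j) (w j))"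

text \<open>A lift of the inverse chart to homogeneous coordinates. Coordinates in \<open>I\<close>
  are inserted as they are, zeros included; those in \<open>J - I\<close> are nonzero and enter as a
  torus element, acting through \<open>hsec\<close>.\<close>

definition chart_sec :: "('m => complex) => complex ^ 'm" where
 "chart_sec w = hsec (chart_tor w) * (\<chi> k. if k \<in> I then w k else 1)"

lemma toric_chart_Xi: "chart J \<alpha> p = (\<lambda>j\<in>J. Xi \<beta> (\<alpha> j) p)"
 by (simp add: toric_chart_def Xi_def monomial_def Let_def)

lemma dual_I: "j \<in> J ==> i \<in> I ==> pairing (\<alpha> j) (\<beta> i) = (if j = i then 1 else 0)"
 using dual IJ \<gamma>[of i] unfolding dual_on_def by (metis subsetD)

lemma dual_ge: "j \<in> J ==> i \<in> I ==> ge_reg b (pairing (\<alpha> j) (\<beta> i)) 0"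
 by (simp add: dual_I)

lemma chart_tor: "w \<in> chart_dom ==> chart_tor w \<in> torus"
 unfolding chart_tor_def by (intro torus_prod lam_torus) (simp add: chart_dom_def)

lemma chart_sec_U: "w \<in> chart_dom ==> chart_sec w \<in> U_simplex I"
 unfolding chart_sec_def using hsec_torus[OF chart_tor] by (simp add: U_simplex_mult) (simp add: U_simplex_def)

lemma monomial_chart_sec:
 assumes w: "w \<in> chart_dom"
 shows "monomial \<beta> \<nu> (chart_sec w) = (\<Prod>j\<in>J. rpow (w j) (pairing \<nu> (\<gamma> j)))"
proof -
 have "monomial \<beta> \<nu> (\<chi> k. if k \<in> I then w k else 1) = (\<Prod>k\<in>I. rpow (w k) (pairing \<nu> (\<gamma> k)))"
  unfolding monomial_def by (rule prod.mono_neutral_cong_right) (auto simp: \<gamma>)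
 moreover have "monomial \<beta> \<nu> (hsec (chart_tor w)) = (\<Prod>j\<in>J - I. rpow (w j) (pairing \<nu> (\<gamma> j)))"
  using w chart_tor[OF w]
  by (simp add: monomial_torus hsec_torus Lam_hsec) (simp add: chart_tor_def chi_prod chi_lam chart_dom_def)
 moreover have "(\<Prod>j\<in>J. rpow (w j) (pairing \<nu> (\<gamma> j)))
   = (\<Prod>j\<in>J - I. rpow (w j) (pairing \<nu> (\<gamma> j))) * (\<Prod>k\<in>I. rpow (w k) (pairing \<nu> (\<gamma> k)))"
  using IJ by (simp add: prod.subset_diff)
 ultimately show ?thesis by (simp add: chart_sec_def monomial_mult)
qed

lemma chart_sec_chart:
 assumes w: "w \<in> chart_dom" shows "chart J \<alpha> (ker_orbit \<beta> (chart_sec w)) = w"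
proof -
 have "monomial \<beta> (\<alpha> j) (chart_sec w) = w j" if j: "j \<in> J" for j
 proof -
  have "monomial \<beta> (\<alpha> j) (chart_sec w) = (\<Prod>i\<in>J. if j = i then w i else 1)"
   unfolding monomial_chart_sec[OF w] by (rule prod.cong) (use dual j in \<open>auto simp: dual_on_def\<close>)
  also have "\<dots> = w j" using j by simp
  finally show ?thesis .
 qed
 then show ?thesis
  using w by (auto simp: toric_chart_Xi Xi_orbit fun_eq_iff chart_dom_def PiE_def extensional_def)
qed

lemma monomial_dual:
 assumes j: "j \<in> J"
 shows "monomial \<beta> (\<alpha> j) z = (if j \<in> I then z $ j else 1) * (\<Prod>k\<in>- I. rpow (z $ k) (pairing (\<alpha> j) (\<beta> k)))"
proof -
 have "monomial \<beta> (\<alpha> j) z = (\<Prod>k\<in>I. rpow (z $ k) (pairing (\<alpha> j) (\<beta> k))) * (\<Prod>k\<in>- I. rpow (z $ k) (pairing (\<alpha> j) (\<beta> k)))"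
  unfolding monomial_def by (subst prod.union_disjoint[symmetric]) (auto simp: Un_commute intro: prod.cong)
 moreover have "(\<Prod>k\<in>I. rpow (z $ k) (pairing (\<alpha> j) (\<beta> k))) = (\<Prod>k\<in>I. if j = k then z $ k else 1)"
  using j by (intro prod.cong) (auto simp: dual_I)
 ultimately show ?thesis by simp
qed

lemma chart_in_dom: "p \<in> UI I ==> chart J \<alpha> p \<in> chart_dom"
proof -
 assume "p \<in> UI I"
 then obtain z where z: "z \<in> U_simplex I" "p = ker_orbit \<beta> z" by (auto simp: toric_open_def)
 have "monomial \<beta> (\<alpha> j) z \<noteq> 0" if "j \<in> J - I" for j
  using z(1) that by (auto simp: monomial_dual U_simplex_def rpow_nonzero)
 then show ?thesis by (auto simp: toric_chart_Xi z(2) Xi_orbit chart_dom_def)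
qed

text \<open>An element \<open>h\<close> of the kernel with \<open>h * z = z'\<close> is constructed.
  Where \<open>z\<close> vanishes the equation leaves \<open>h\<close> free, and this freedom is
  used to make the characters dual to \<open>\<gamma>\<close> trivial on
  \<open>Lam \<beta> h\<close>.\<close>

lemma chart_inj:
 assumes p: "p \<in> UI I" and p': "p' \<in> UI I" and eq: "chart J \<alpha> p = chart J \<alpha> p'"
 shows "p = p'"
proof -
 obtain z z' where z: "z \<in> U_simplex I" "p = ker_orbit \<beta> z" "z' \<in> U_simplex I" "p' = ker_orbit \<beta> z'"
  using p p' by (auto simp: toric_open_def)
 have m: "monomial \<beta> (\<alpha> j) z = monomial \<beta> (\<alpha> j) z'" if "j \<in> J" for j
  using fun_cong[OF eq, of j] that by (simp add: toric_chart_Xi z Xi_orbit)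
 have nz: "z $ k \<noteq> 0" "z' $ k \<noteq> 0" if "k \<notin> I" for k using z that by (auto simp: U_simplex_def)
 define P where "P j u = (\<Prod>k\<in>- I. rpow (u $ k) (pairing (\<alpha> j) (\<beta> k)))" for j and u :: "complex ^ 'm"
 have md: "monomial \<beta> (\<alpha> j) u = (if j \<in> I then u $ j else 1) * P j u" if "j \<in> J" for j u
  unfolding P_def by (rule monomial_dual[OF that])
 have Pnz: "P j z \<noteq> 0" "P j z' \<noteq> 0" for j using nz by (auto simp: P_def rpow_nonzero)
 have zero: "z $ i = 0 \<longleftrightarrow> z' $ i = 0" if "i \<in> I" for i
  using m[of i] md[of i z] md[of i z'] that IJ Pnz[of i] by auto
 have z0: "z $ k = 0 \<longleftrightarrow> z' $ k = 0" for k using zero nz by (cases "k \<in> I") auto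
 define h0 :: "complex ^ 'm" where "h0 = (\<chi> k. if z $ k = 0 then 1 else z' $ k / z $ k)"
 \<comment> \<open>There is no circularity: \<open>z\<close> vanishes only at vertices of
   \<open>I\<close>, while \<open>P\<close> involves only vertices outside \<open>I\<close>, where
   \<open>h\<close> and \<open>h0\<close> coincide.\<close>
 define h :: "complex ^ 'm" where "h = (\<chi> k. if z $ k = 0 then inverse (P k h0) else z' $ k / z $ k)"
 have h0z: "h0 * z = z'" using z0 by (auto simp: h0_def vec_eq_iff)
 have Ph: "P j h = P j h0" for j unfolding P_def using nz by (intro prod.cong) (auto simp: h_def h0_def)
 have h0nz: "h0 $ k \<noteq> 0" for k using z0 by (auto simp: h0_def)
 have Ph0: "P j h0 \<noteq> 0" for j using h0nz by (auto simp: P_def rpow_nonzero)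
 have hz: "h * z = z'" using z0 by (auto simp: h_def vec_eq_iff)
 have hT: "h \<in> torus" using z0 Ph0 by (auto simp: h_def torus_def)
 \<comment> \<open>At a vanishing coordinate this is the choice of \<open>h\<close>; otherwise the
   monomials of \<open>z\<close> and \<open>z'\<close> agree and are nonzero, so the factor coming
   from \<open>h\<close> is 1.\<close>
 have "chi (\<alpha> j) (Lam \<beta> h) = 1" if j: "j \<in> J" for j
 proof (cases "j \<in> I \<and> z $ j = 0")
  case True
  then show ?thesis using md[OF j, of h] Ph0[of j] by (simp add: monomial_torus[OF hT, symmetric] Ph) (simp add: h_def)
 next
  case False
  have "monomial \<beta> (\<alpha> j) h * monomial \<beta> (\<alpha> j) z = monomial \<beta> (\<alpha> j) z" using monomial_mult[of \<beta> "\<alpha> j" h z] hz m[OF j] by simp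
  moreover have "monomial \<beta> (\<alpha> j) z \<noteq> 0" using False Pnz by (auto simp: md[OF j])
  ultimately show ?thesis by (simp add: monomial_torus[OF hT, symmetric])
 qed
 then have "Lam \<beta> h $ l = 1" for l
  using torus_recover[OF Lam_torus[OF hT] dual card, of \<beta> l] by simp
 then have "h \<in> Ker_Lam \<beta>" using hT by (simp add: Ker_Lam_def vec_eq_iff)
 then show ?thesis using hz z ker_orbit_mult by metis
qed

lemma chart_sec_orbit:
 assumes "p \<in> UI I" shows "ker_orbit \<beta> (chart_sec (chart J \<alpha> p)) = p"
proof (rule chart_inj[OF _ assms])
 show "ker_orbit \<beta> (chart_sec (chart J \<alpha> p)) \<in> UI I"
  using chart_sec_U[OF chart_in_dom[OF assms]] by (simp add: toric_open_iff)
qed (rule chart_sec_chart[OF chart_in_dom[OF assms]])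

lemma chart_image: "chart J \<alpha> ` UI I = chart_dom"
proof
 show "chart_dom \<subseteq> chart J \<alpha> ` UI I"
 proof
  fix w assume w: "w \<in> chart_dom"
  have "ker_orbit \<beta> (chart_sec w) \<in> UI I" using chart_sec_U[OF w] by (simp add: toric_open_iff)
  then show "w \<in> chart J \<alpha> ` UI I" using chart_sec_chart[OF w] by (metis imageI)
 qed
qed (use chart_in_dom in blast)

lemma finJ: "finite J" by simp

lemma openin_chart_dom: "openin (cspace J) chart_dom"
proof -
 have "openin (cspace J) {w \<in> topspace (cspace J). w j \<in> - {0}}" if "j \<in> J" for j
  by (rule openin_continuous_map_preimage[OF continuous_map_coord[OF that]]) (simp add: open_Compl)
 then have "openin (cspace J) (topspace (cspace J) \<inter> (\<Inter>j\<in>J - I. {w \<in> topspace (cspace J). w j \<in> - {0}}))"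
 proof (cases "J - I = {}")
  case True
  show ?thesis unfolding True using openin_topspace[of "cspace J"] by (simp del: topspace_cspace)
 qed (intro openin_Int openin_topspace openin_INT2, auto)
 moreover have "chart_dom = topspace (cspace J) \<inter> (\<Inter>j\<in>J - I. {w \<in> topspace (cspace J). w j \<in> - {0}})"
  by (auto simp: chart_dom_def)
 ultimately show ?thesis by simp
qed

lemma regular_chart_sec: "regular b (cspace_mfd J) chart_dom (\<lambda>w. chart_sec w $ k)"
proof -
 have o: "openin (mtop (cspace_mfd J)) chart_dom" using openin_chart_dom by simp
 have sub: "chart_dom \<subseteq> topspace (cspace J)" by (auto simp: chart_dom_def)
 have C: "reg_mfd b (cspace_mfd J)" by (rule reg_mfd_cspace[OF finJ])
 have co: "regular b (cspace_mfd J) chart_dom (\<lambda>w. w j)" if "j \<in> J" for j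
  by (rule regular_subset[OF regular_cspace_coord[OF finJ that] o sub])
 have 1: "regular b (cspace_mfd J) chart_dom (\<lambda>w. if k \<in> I then w k else 1)"
  using co IJ regular_const[OF o] by (cases "k \<in> I") auto
 have "regular b (cspace_mfd J) chart_dom (\<lambda>w. \<Prod>j\<in>J - I. rpow (w j) (pairing (fdual k) (\<gamma> j)))"
 proof (rule regular_prod[OF o])
  fix j assume j: "j \<in> J - I"
  show "regular b (cspace_mfd J) chart_dom (\<lambda>w. rpow (w j) (pairing (fdual k) (\<gamma> j)))"
   by (rule regular_creg[OF C creg_rpow co]) (use j in \<open>auto simp: chart_dom_def\<close>)
 qed
 then have "regular b (cspace_mfd J) chart_dom (\<lambda>w. chi (fdual k) (chart_tor w))"
  by (rule regular_cong[OF C]) (simp add: chart_tor_def chi_prod chi_lam chart_dom_def)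
 then have 2: "regular b (cspace_mfd J) chart_dom (\<lambda>w. if k \<in> full then chi (fdual k) (chart_tor w) else 1)"
  using regular_const[OF o] by (cases "k \<in> full") auto
 show ?thesis
  using regular_mult[OF 2 1] by (simp add: chart_sec_def hsec_def)
qed

lemma reg_map_chart_sec:
 "reg_map b (open_submfd (cspace_mfd J) chart_dom) (vec_mfd (U_complex \<Sigma>)) chart_sec"
proof -
 have C: "reg_mfd b (cspace_mfd J)" by (rule reg_mfd_cspace[OF finJ])
 have o: "openin (mtop (cspace_mfd J)) chart_dom" using openin_chart_dom by simp
 have t: "tspace (open_submfd (cspace_mfd J) chart_dom) = chart_dom"
  by (auto simp: chart_dom_def)
 show ?thesis
  unfolding reg_map_into_vec[OF reg_mfd_open_submfd[OF C o] open_U_complex] t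
  using regular_submfd_iff[OF C o subset_refl] regular_chart_sec chart_sec_U I
  by (auto simp: U_complex_def)
qed

lemma chart_homeo:
 "homeomorphic_map (subtopology Xtop (UI I)) (subtopology (cspace J) (chart J \<alpha> ` UI I)) (chart J \<alpha>)"
proof (rule chart_homeomorphic)
 show "UI I \<subseteq> topspace Xtop" using openin_subset[OF openin_toric_open[OF I]] .
 show "continuous_map (subtopology Xtop (UI I)) (cspace J) (chart J \<alpha>)"
 proof (rule continuous_map_from_toric[OF I], unfold continuous_map_into_cspace, intro conjI ballI)
  show "(\<lambda>z. chart J \<alpha> (ker_orbit \<beta> z)) ` topspace (top_of_set (U_simplex I)) \<subseteq> extensional J"
   by (auto simp: toric_chart_Xi)
  fix j assume j: "j \<in> J"
  have "regular False (vec_mfd (U_simplex I)) (U_simplex I) (\<lambda>z. monomial \<beta> (\<alpha> j) z)"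
   by (rule regular_monomial[OF reg_mfd_vec[OF open_U_simplex] _ regular_vec_coord[OF open_U_simplex]])
    (use dual_ge[OF j] in auto)
  then show "continuous_map (top_of_set (U_simplex I)) euclidean (\<lambda>z. chart J \<alpha> (ker_orbit \<beta> z) j)"
   using j regular_continuous by (fastforce simp: toric_chart_Xi Xi_orbit subtopology_subtopology)
 qed
 have "continuous_map (subtopology (cspace J) chart_dom) (top_of_set (U_complex \<Sigma>)) chart_sec"
  using reg_map_continuous[OF reg_map_chart_sec[of False]] by simp
 from continuous_map_compose[OF this continuous_map_ker_orbit]
 show "continuous_map (subtopology (cspace J) (chart J \<alpha> ` UI I)) Xtop (\<lambda>w. ker_orbit \<beta> (chart_sec w))"
  unfolding chart_image by (simp add: o_def)
qed (rule chart_sec_orbit)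

lemma chart_inv:
 assumes "w \<in> chart_dom" shows "inv_into (UI I) (chart J \<alpha>) w = ker_orbit \<beta> (chart_sec w)"
proof (rule inv_into_f_eq)
 show "inj_on (chart J \<alpha>) (UI I)" using chart_inj by (auto simp: inj_on_def)
 show "ker_orbit \<beta> (chart_sec w) \<in> UI I" using chart_sec_U[OF assms] by (simp add: toric_open_iff)
qed (rule chart_sec_chart[OF assms])

lemma regular_Xi_chart:
 assumes "openin (cspace J) W" "W \<subseteq> chart_dom" and W: "\<And>w. w \<in> W ==> chart_sec w \<in> U_simplex I'"
  and ge: "\<And>i. i \<in> I' ==> ge_reg b (pairing \<nu> (\<beta> i)) 0" and b: b
 shows "Ck_on k J W (\<lambda>w. Xi \<beta> \<nu> (inv_into (UI I) (chart J \<alpha>) w))"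
proof -
 have C: "reg_mfd b (cspace_mfd J)" by (rule reg_mfd_cspace[OF finJ])
 have o: "openin (mtop (cspace_mfd J)) W" using assms(1) by simp
 have r: "regular b (cspace_mfd J) W (\<lambda>w. monomial \<beta> \<nu> (chart_sec w))"
  by (rule regular_monomial[OF C o regular_subset[OF regular_chart_sec o assms(2)] W ge])
 have "(J, topspace (cspace J), \<lambda>w. w) \<in> matlas (cspace_mfd J)" by (simp add: cspace_mfd_def)
 from regular_Ck[OF r b this, of k]
 have c: "Ck_on k J W (\<lambda>w. monomial \<beta> \<nu> (chart_sec (inv_into (topspace (cspace J)) (\<lambda>w. w) w)))"
  using openin_subset[OF assms(1)] by (simp add: Int_absorb1 del: topspace_cspace)
 show ?thesis
 proof (rule Ck_on_cong[OF assms(1), THEN iffD1, OF _ c])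
  fix w assume w: "w \<in> W"
  have "inv_into (topspace (cspace J)) (\<lambda>w. w) w = w"
   using inv_into_f_f[of "\<lambda>w. w" "topspace (cspace J)" w] openin_subset[OF assms(1)] w by auto
  then show "monomial \<beta> \<nu> (chart_sec (inv_into (topspace (cspace J)) (\<lambda>w. w) w))
    = Xi \<beta> \<nu> (inv_into (UI I) (chart J \<alpha>) w)"
   using w assms(2) by (subst chart_inv) (auto simp: Xi_orbit simp del: topspace_cspace)
 qed
qed

end

lemma atlasE:
 assumes "c \<in> matlas Xm"
 obtains I J \<alpha> \<gamma> where "c = (J, UI I, chart J \<alpha>)" "chart_data I J \<alpha> \<gamma>"
proof -
 obtain I J \<alpha> \<gamma> where "c = (J, UI I, chart J \<alpha>)" "facet \<Sigma> I" "I \<subseteq> J" "card J = CARD('n)"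
  "\<forall>i\<in>I. \<gamma> i = \<beta> i" "dual_on \<alpha> \<gamma> J"
  using assms by (auto simp: toric_mfd_def toric_atlas_def)
 then show thesis by (intro that[of J I \<alpha> \<gamma>]) (auto simp: facet_def chart_data_def)
qed

lemma ex_chart:
 assumes "I \<in> \<Sigma>"
 obtains I' J \<alpha> \<gamma> where "I \<subseteq> I'" "(J, UI I', chart J \<alpha>) \<in> matlas Xm" "chart_data I' J \<alpha> \<gamma>"
proof -
 obtain I' where I': "facet \<Sigma> I'" "I \<subseteq> I'" using ex_facet[OF assms] by blast
 then have "I' \<in> \<Sigma>" by (simp add: facet_def)
 then obtain J \<alpha> \<gamma> where J: "I' \<subseteq> J" "card J = CARD('n)" "\<forall>i\<in>I'. \<gamma> i = \<beta> i" "dual_on \<alpha> \<gamma> J"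
  using dual_completion[OF fan] by blast
 have "(J, UI I', chart J \<alpha>) \<in> matlas Xm"
  unfolding toric_mfd_def toric_atlas_def using I' J by auto
 then show thesis using that[of I' J \<alpha> \<gamma>] I' J \<open>I' \<in> \<Sigma>\<close> by (simp add: chart_data_def)
qed

lemma chart_Int_open:
 assumes c: "chart_data I J \<alpha> \<gamma>" and I': "I' \<in> \<Sigma>"
 shows "openin (cspace J) (chart J \<alpha> ` (UI I \<inter> UI I'))"
proof -
 have "openin (subtopology Xtop (UI I)) (UI I \<inter> UI I')"
  using openin_toric_open[OF I', of \<beta>] by (rule openin_subtopology_Int2)
 then have "openin (subtopology (cspace J) (chart J \<alpha> ` UI I)) (chart J \<alpha> ` (UI I \<inter> UI I'))"
  using homeomorphic_imp_open_map[OF chart_homeo[OF c]] by (simp add: open_map_def)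
 then show ?thesis
  using openin_chart_dom[OF c] unfolding chart_image[OF c] by (rule openin_trans_full)
qed

text \<open>Transition functions are monomials \<open>Xi\<close> whose exponents pair with the rays
  of the target simplex to 0 or 1 by duality, so no irregular power of a vanishing coordinate
  occurs.\<close>

lemma smooth_mfd_X: "smooth_mfd Xm"
 unfolding smooth_mfd_def
proof (intro conjI ballI, goal_cases)
 case 1
 show ?case
 proof
  show "(\<Union>(I, U, \<phi>)\<in>matlas Xm. U) \<subseteq> tspace Xm"
   by (auto elim!: atlasE simp: topspace_toric_top' dest: chart_data_I)
  show "tspace Xm \<subseteq> (\<Union>(I, U, \<phi>)\<in>matlas Xm. U)"
  proof
   fix p assume "p \<in> tspace Xm"
   then obtain I where I: "I \<in> \<Sigma>" "p \<in> UI I" by (auto simp: topspace_toric_top')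
   obtain I' J \<alpha> \<gamma> where "I \<subseteq> I'" "(J, UI I', chart J \<alpha>) \<in> matlas Xm" by (rule ex_chart[OF I(1)])
   then show "p \<in> (\<Union>(I, U, \<phi>)\<in>matlas Xm. U)" using I toric_open_mono[of I I' \<beta>] by blast
  qed
 qed
next
 case (2 c)
 then obtain I J \<alpha> \<gamma> where c: "c = (J, UI I, chart J \<alpha>)" and d: "chart_data I J \<alpha> \<gamma>" by (elim atlasE)
 show ?case
  unfolding c prod.case using chart_homeo[OF d] openin_toric_open[OF chart_data_I[OF d]] openin_chart_dom[OF d]
  by (simp add: chart_image[OF d])
next
 case (3 c)
 then obtain I J \<alpha> \<gamma> where c: "c = (J, UI I, chart J \<alpha>)" and d: "chart_data I J \<alpha> \<gamma>" by (elim atlasE)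
 show ?case
  unfolding c prod.case
 proof (rule ballI)
  fix e assume "e \<in> matlas Xm"
  then obtain I' J' \<alpha>' \<gamma>' where e: "e = (J', UI I', chart J' \<alpha>')" and d': "chart_data I' J' \<alpha>' \<gamma>'" by (elim atlasE)
  let ?W = "chart J \<alpha> ` (UI I \<inter> UI I')"
  have W: "openin (cspace J) ?W" by (rule chart_Int_open[OF d chart_data_I[OF d']])
  have sub: "?W \<subseteq> chart_dom I J" using chart_image[OF d] by blast
  have sU: "chart_sec I J \<gamma> w \<in> U_simplex I'" if w: "w \<in> ?W" for w
  proof -
   obtain p where p: "p \<in> UI I" "p \<in> UI I'" "w = chart J \<alpha> p" using w by blast
   then have "ker_orbit \<beta> (chart_sec I J \<gamma> w) \<in> UI I'" using chart_sec_orbit[OF d p(1)] by simp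
   then show ?thesis by (simp add: toric_open_iff)
  qed
  have "smooth_fun J ?W (\<lambda>w. chart J' \<alpha>' (inv_into (UI I) (chart J \<alpha>) w) j)" if j: "j \<in> J'" for j
   unfolding smooth_fun_def
  proof
   fix k
   have "Ck_on k J ?W (\<lambda>w. Xi \<beta> (\<alpha>' j) (inv_into (UI I) (chart J \<alpha>) w))"
    by (rule regular_Xi_chart[OF d W sub sU dual_ge[OF d' j, of _ True]]) auto
   then show "Ck_on k J ?W (\<lambda>w. chart J' \<alpha>' (inv_into (UI I) (chart J \<alpha>) w) j)"
    using j by (simp add: toric_chart_Xi[OF d'])
  qed
  then show "case e of (K', V, \<psi>) => \<forall>j\<in>K'. smooth_fun J (chart J \<alpha> ` (UI I \<inter> V))
    (\<lambda>w. \<psi> (inv_into (UI I) (chart J \<alpha>) w) j)"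
   unfolding e prod.case by blast
 qed
qed

section \<open>Regular functions and maps on the toric manifold\<close>

lemma reg_mfd_X: "reg_mfd b Xm" by (simp add: reg_mfd_def smooth_mfd_X)

lemma reg_mfd_U: "reg_mfd b (vec_mfd (U_complex \<Sigma>))" by (rule reg_mfd_vec[OF open_U_complex])

lemma reg_map_ker_orbit: "reg_map b (vec_mfd (U_complex \<Sigma>)) Xm (ker_orbit \<beta>)"
proof (rule reg_mapI[OF reg_mfd_U reg_mfd_X])
 show "continuous_map (mtop (vec_mfd (U_complex \<Sigma>))) (mtop Xm) (ker_orbit \<beta>)"
  using continuous_map_ker_orbit by simp
 fix K V \<psi> j assume b: b and c: "(K, V, \<psi>) \<in> matlas Xm" and j: "j \<in> K"
 from c obtain I J \<alpha> \<gamma> where c: "(K, V, \<psi>) = (J, UI I, chart J \<alpha>)" and d: "chart_data I J \<alpha> \<gamma>" by (elim atlasE)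
 have p: "preim (vec_mfd (U_complex \<Sigma>)) (ker_orbit \<beta>) V = U_simplex I"
  using c chart_data_I[OF d] by (auto simp: preim_def toric_open_iff U_complex_def)
 have o: "openin (mtop (vec_mfd (U_complex \<Sigma>))) (U_simplex I)"
  using chart_data_I[OF d] open_U_simplex by (auto simp: U_complex_def intro!: open_subset)
 have "regular b (vec_mfd (U_complex \<Sigma>)) (U_simplex I) (\<lambda>z. monomial \<beta> (\<alpha> j) z)"
  by (rule regular_monomial[OF reg_mfd_U o regular_subset[OF regular_vec_coord[OF open_U_complex] o]])
   (use dual_ge[OF d] c j chart_data_I[OF d] in \<open>auto simp: U_complex_def\<close>)
 then show "regular b (vec_mfd (U_complex \<Sigma>)) (preim (vec_mfd (U_complex \<Sigma>)) (ker_orbit \<beta>) V) (\<lambda>x. \<psi> (ker_orbit \<beta> x) j)"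
  unfolding p using c j by (simp add: toric_chart_Xi[OF d] Xi_orbit)
qed

text \<open>Together with \<open>reg_map_ker_orbit\<close> this reduces regularity on the quotient
  to regularity in homogeneous coordinates.\<close>

lemma local_section:
 assumes I: "I \<in> \<Sigma>"
 obtains s where "reg_map b (open_submfd Xm (UI I)) (vec_mfd (U_complex \<Sigma>)) s"
  "\<And>p. p \<in> UI I ==> ker_orbit \<beta> (s p) = p" "\<And>p. p \<in> UI I ==> s p \<in> U_simplex I"
proof -
 obtain I' J \<alpha> \<gamma> where II: "I \<subseteq> I'" and a: "(J, UI I', chart J \<alpha>) \<in> matlas Xm" and d: "chart_data I' J \<alpha> \<gamma>" by (rule ex_chart[OF I])
 have sub: "UI I \<subseteq> UI I'" by (rule toric_open_mono[OF II])
 have o: "openin (mtop Xm) (UI I)" using openin_toric_open[OF I] by simp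
 have t: "tspace (open_submfd Xm (UI I)) = UI I" using openin_subset[OF o] by auto
 have XU: "reg_mfd b (open_submfd Xm (UI I))" by (rule reg_mfd_open_submfd[OF reg_mfd_X o])
 have finJ: "finite J" by simp
 have oD: "openin (mtop (cspace_mfd J)) (chart_dom I' J)" using openin_chart_dom[OF d] by simp
 have CD: "reg_mfd b (open_submfd (cspace_mfd J) (chart_dom I' J))" by (rule reg_mfd_open_submfd[OF reg_mfd_cspace[OF finJ] oD])
 have "regular b (open_submfd Xm (UI I)) (UI I) (\<lambda>p. chart J \<alpha> p j)" if "j \<in> J" for j
  using regular_subset[OF chart_regular[OF smooth_mfd_X a that] o sub] regular_submfd_iff[OF reg_mfd_X o subset_refl] by blast
 moreover have "chart J \<alpha> ` UI I \<subseteq> chart_dom I' J" using chart_image[OF d] sub by blast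
 moreover have "chart_dom I' J \<subseteq> topspace (cspace J)" by (auto simp: chart_dom_def[OF d])
 ultimately have "reg_map b (open_submfd Xm (UI I)) (open_submfd (cspace_mfd J) (chart_dom I' J)) (chart J \<alpha>)"
  unfolding reg_map_into_submfd[OF XU reg_mfd_cspace[OF finJ] oD] reg_map_into_cspace[OF XU finJ] t by blast
 from reg_map_compose[OF XU CD reg_mfd_U this reg_map_chart_sec[OF d]]
 have 1: "reg_map b (open_submfd Xm (UI I)) (vec_mfd (U_complex \<Sigma>)) (\<lambda>p. chart_sec I' J \<gamma> (chart J \<alpha> p))" .
 have 2: "ker_orbit \<beta> (chart_sec I' J \<gamma> (chart J \<alpha> p)) = p" if "p \<in> UI I" for p
  using chart_sec_orbit[OF d] sub that by blast
 have 3: "chart_sec I' J \<gamma> (chart J \<alpha> p) \<in> U_simplex I" if "p \<in> UI I" for p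
  using 2[OF that] that toric_open_iff by metis
 show thesis by (rule that[OF 1 2 3])
qed

lemma regular_Xi:
 assumes I: "I \<in> \<Sigma>" and ge: "\<And>i. i \<in> I ==> ge_reg b (pairing \<nu> (\<beta> i)) 0"
 shows "regular b Xm (UI I) (Xi \<beta> \<nu>)"
proof -
 obtain s where s: "reg_map b (open_submfd Xm (UI I)) (vec_mfd (U_complex \<Sigma>)) s"
  "\<And>p. p \<in> UI I ==> ker_orbit \<beta> (s p) = p" "\<And>p. p \<in> UI I ==> s p \<in> U_simplex I"
  using local_section[OF I] by blast
 have o: "openin (mtop Xm) (UI I)" using openin_toric_open[OF I] by simp
 have t: "tspace (open_submfd Xm (UI I)) = UI I" using openin_subset[OF o] by auto
 have XU: "reg_mfd b (open_submfd Xm (UI I))" by (rule reg_mfd_open_submfd[OF reg_mfd_X o])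
 have o': "openin (mtop (open_submfd Xm (UI I))) (UI I)" using openin_topspace[of "mtop (open_submfd Xm (UI I))"] t by simp
 have c: "regular b (open_submfd Xm (UI I)) (UI I) (\<lambda>p. s p $ k)" for k
  using s(1) unfolding reg_map_into_vec[OF XU open_U_complex] t by blast
 have "regular b (open_submfd Xm (UI I)) (UI I) (\<lambda>p. monomial \<beta> \<nu> (s p))"
  by (rule regular_monomial[OF XU o' c s(3) ge])
 then have "regular b (open_submfd Xm (UI I)) (UI I) (Xi \<beta> \<nu>)"
  by (rule regular_cong[OF XU]) (metis Xi_orbit s(2))
 then show ?thesis using regular_submfd_iff[OF reg_mfd_X o subset_refl] by blast
qed

text \<open>Locally the action lifts to multiplication of a regular section by
  \<open>hsec g\<close>, followed by the quotient map.\<close>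

lemma reg_map_act: "reg_map b (prod_mfd (vec_mfd torus) Xm) Xm (\<lambda>x. act (fst x) (snd x))"
proof -
 have T: "reg_mfd b (vec_mfd (torus :: (complex ^ 'n) set))" by (rule reg_mfd_vec[OF open_torus])
 have P: "reg_mfd b (prod_mfd (vec_mfd (torus :: (complex ^ 'n) set)) Xm)" by (rule reg_mfd_prod[OF T reg_mfd_X])
 show ?thesis
 proof (rule reg_map_local[OF P reg_mfd_X])
  fix x :: "(complex ^ 'n) \<times> (complex ^ 'm) set" assume "x \<in> tspace (prod_mfd (vec_mfd torus) Xm)"
  then obtain I where I: "I \<in> \<Sigma>" "snd x \<in> UI I" "fst x \<in> torus" by (auto simp: topspace_toric_top')
  obtain s where s: "reg_map b (open_submfd Xm (UI I)) (vec_mfd (U_complex \<Sigma>)) s"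
   "\<And>p. p \<in> UI I ==> ker_orbit \<beta> (s p) = p" "\<And>p. p \<in> UI I ==> s p \<in> U_simplex I"
   using local_section[OF I(1)] by blast
  let ?W = "(torus :: (complex ^ 'n) set) \<times> UI I"
  let ?N = "open_submfd (prod_mfd (vec_mfd (torus :: (complex ^ 'n) set)) Xm) ?W"
  have o: "openin (mtop Xm) (UI I)" using openin_toric_open[OF I(1)] by simp
  have oW: "openin (mtop (prod_mfd (vec_mfd torus) Xm)) ?W"
   using o by (simp add: openin_prod_Times_iff)
  have N: "reg_mfd b ?N" by (rule reg_mfd_open_submfd[OF P oW])
  have tN: "tspace ?N = ?W" using openin_subset[OF oW] by auto
  have XU: "reg_mfd b (open_submfd Xm (UI I))" by (rule reg_mfd_open_submfd[OF reg_mfd_X o])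
  have f: "reg_map b ?N (vec_mfd torus) fst"
   by (rule reg_map_from_submfd[OF P T oW reg_map_fst[OF T reg_mfd_X]])
  have "reg_map b ?N Xm snd"
   by (rule reg_map_from_submfd[OF P reg_mfd_X oW reg_map_snd[OF T reg_mfd_X]])
  then have "reg_map b ?N (open_submfd Xm (UI I)) snd"
   unfolding reg_map_into_submfd[OF N reg_mfd_X o] tN by auto
  from reg_map_compose[OF N XU reg_mfd_U this s(1)]
  have s': "regular b ?N ?W (\<lambda>x. s (snd x) $ k)" for k
   unfolding reg_map_into_vec[OF N open_U_complex] tN by blast
  have "preim ?N fst torus = ?W" using tN by (auto simp: preim_def)
  then have chi': "regular b ?N ?W (\<lambda>x. chi \<alpha> (fst x))" for \<alpha>
   using regular_pullback[OF N T f regular_chi] by metis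
  have oN: "openin (mtop ?N) ?W" using openin_topspace[of "mtop ?N"] unfolding tN .
  have h': "regular b ?N ?W (\<lambda>x. hsec (fst x) $ k)" for k
   using chi' regular_const[OF oN] by (cases "k \<in> full") (auto simp: hsec_def)
  have "reg_map b ?N (vec_mfd (U_complex \<Sigma>)) (\<lambda>x. hsec (fst x) * s (snd x))"
   unfolding reg_map_into_vec[OF N open_U_complex] tN
  proof (intro conjI allI)
   show "(\<lambda>x. hsec (fst x) * s (snd x)) ` ?W \<subseteq> U_complex \<Sigma>"
    using s(3) I(1) hsec_torus by (auto simp: U_complex_def U_simplex_mult)
   show "regular b ?N ?W (\<lambda>x. (hsec (fst x) * s (snd x)) $ k)" for k
    using regular_mult[OF h' s'] by simp
  qed
  note rm = reg_map_compose[OF N reg_mfd_U reg_mfd_X this reg_map_ker_orbit]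
  have "reg_map b ?N Xm (\<lambda>x. act (fst x) (snd x))"
  proof (rule reg_map_cong[OF N reg_mfd_X rm])
   fix y assume "y \<in> tspace ?N"
   then have y: "fst y \<in> torus" "snd y \<in> UI I" unfolding tN by auto
   show "ker_orbit \<beta> (hsec (fst y) * s (snd y)) = act (fst y) (snd y)"
    using act_orbit[OF y(1), of "s (snd y)"] s(2)[OF y(2)] by simp
  qed
  then show "\<exists>W. openin (mtop (prod_mfd (vec_mfd torus) Xm)) W \<and> x \<in> W \<and>
    reg_map b (open_submfd (prod_mfd (vec_mfd torus) Xm) W) Xm (\<lambda>x. act (fst x) (snd x))"
   using oW I by (intro exI[of _ ?W]) (auto simp: mem_Times_iff)
 qed
qed

text \<open>The curve through \<open>x0\<close> along the one-parameter group \<open>\<lambda>\<^bsub>\<beta>\<^sub>i\<^esub>\<close>, which reaches the \<open>i\<close>-th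
 divisor at \<open>0\<close>.\<close>

definition pcurve :: "'m => complex => (complex ^ 'm) set" where
 "pcurve i t = ker_orbit \<beta> (\<chi> k. if k = i then t else 1)"

lemma pcurve_UI: "i \<in> I ==> pcurve i t \<in> UI I"
 by (auto simp: pcurve_def toric_open_iff U_simplex_def)

lemma pcurve_act: "t \<noteq> 0 ==> pcurve i t = act (lam (\<beta> i) t) x0"
proof -
 assume t: "t \<noteq> 0"
 define h :: "complex ^ 'm" where "h = (\<chi> k. if k = i then t else 1)"
 have "Lam \<beta> h = (\<Prod>k\<in>UNIV. if k = i then lam (\<beta> k) t else 1)"
  unfolding Lam_def by (rule prod.cong) (auto simp: h_def)
 then have "Lam \<beta> h = lam (\<beta> i) t" by simp
 moreover have "h \<in> torus" using t by (simp add: h_def torus_def)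
 ultimately show ?thesis using toric_act_orbit[of h \<beta> _ 1] by (simp add: x0_def pcurve_def h_def)
qed

lemma reg_map_pcurve: "reg_map b (cspace_mfd {()}) Xm (\<lambda>c. pcurve i (c ()))"
proof -
 have C: "reg_mfd b (cspace_mfd {()})" by (rule reg_mfd_cspace) simp
 have "reg_map b (cspace_mfd {()}) (vec_mfd (U_complex \<Sigma>)) (\<lambda>c. \<chi> k. if k = i then c () else 1)"
  unfolding reg_map_into_vec[OF C open_U_complex]
 proof (intro conjI allI)
  have "(\<chi> k. if k = i then t else 1) \<in> U_simplex {i}" for t :: complex by (simp add: U_simplex_def)
  then show "(\<lambda>c. \<chi> k. if k = i then c () else 1) ` tspace (cspace_mfd {()}) \<subseteq> U_complex \<Sigma>"
   using vertex_in[of i] unfolding U_complex_def by blast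
  show "regular b (cspace_mfd {()}) (tspace (cspace_mfd {()})) (\<lambda>c. (\<chi> k. if k = i then c () else 1) $ k)" for k
   using regular_cspace_coord[of "{()}" "()" b] regular_const[of "cspace_mfd {()}" "topspace (cspace {()})"]
    openin_topspace[of "cspace {()}"]
   by (cases "k = i") (simp_all del: topspace_cspace)
 qed
 from reg_map_compose[OF C reg_mfd_U reg_mfd_X this reg_map_ker_orbit]
 show ?thesis by (simp add: pcurve_def)
qed

end

section \<open>Gluing manifolds\<close>

text \<open>The charts of the glued manifold are indexed by sets of natural numbers; \<open>unrel K\<close> translates
 back to the index set \<open>K\<close>.\<close>

definition unrel :: "'k::countable set => (nat => complex) => 'k => complex" where
 "unrel K w = (\<lambda>k\<in>K. w (to_nat k))"

definition rel :: "'k::countable set => ('k => complex) => nat => complex" where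
 "rel K x = (\<lambda>n\<in>to_nat ` K. x (from_nat n))"

lemma unrel_rel: "x \<in> topspace (cspace K) ==> unrel K (rel K x) = x"
 by (auto simp: unrel_def rel_def fun_eq_iff PiE_def extensional_def)

lemma rel_unrel: "w \<in> topspace (cspace (to_nat ` K)) ==> rel K (unrel K w) = w"
 by (auto simp: unrel_def rel_def fun_eq_iff PiE_def extensional_def)

lemma continuous_map_unrel: "continuous_map (cspace (to_nat ` K)) (cspace K) (unrel K)"
 by (auto simp: continuous_map_into_cspace unrel_def intro: continuous_map_coord)

lemma continuous_map_rel: "continuous_map (cspace K) (cspace (to_nat ` K)) (rel K)"
 by (auto simp: continuous_map_into_cspace rel_def intro: continuous_map_coord)

text \<open>\<open>T\<close> is a bare set; topology and atlas are both transported from the models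
  \<open>Y i\<close>, and \<open>trans\<close> makes the transported structures agree on
  overlaps.\<close>

locale gluing =
 fixes b :: bool and Ind :: "'s set" and T :: "'e set" and TI :: "'s => 'e set" and \<Phi> :: "'s => 'e => 'y"
  and Y :: "'s => ('y, 'k::countable) mfd"
 assumes cover: "T = (\<Union>i\<in>Ind. TI i)"
  and inj: "\<And>i. i \<in> Ind ==> inj_on (\<Phi> i) (TI i)"
  and image: "\<And>i. i \<in> Ind ==> \<Phi> i ` TI i = tspace (Y i)"
  and overlap: "\<And>i j. i \<in> Ind ==> j \<in> Ind ==> openin (mtop (Y i)) (\<Phi> i ` (TI i \<inter> TI j))"
  and Y: "\<And>i. i \<in> Ind ==> reg_mfd b (Y i)"
  and trans: "\<And>i j. i \<in> Ind ==> j \<in> Ind ==>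
    reg_map b (open_submfd (Y i) (\<Phi> i ` (TI i \<inter> TI j))) (Y j) (\<lambda>y. \<Phi> j (inv_into (TI i) (\<Phi> i) y))"
begin

definition gtop :: "'e topology" where
 "gtop = topology (\<lambda>W. W \<subseteq> T \<and> (\<forall>i\<in>Ind. openin (mtop (Y i)) (\<Phi> i ` (W \<inter> TI i))))"

definition gatlas :: "('e, nat) atlas" where
 "gatlas = {(to_nat ` K, {e \<in> TI i. \<Phi> i e \<in> U}, \<lambda>e. rel K (\<phi> (\<Phi> i e))) | i K U \<phi>. i \<in> Ind \<and> (K, U, \<phi>) \<in> matlas (Y i)}"

text \<open>The empty atlas in the continuous case matches the convention \<open>tm_mk\<close>
  below, so that \<open>tm_E\<close> becomes an equation of records.\<close>

definition G :: "('e, nat) mfd" where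
 "G = \<lparr>mtop = gtop, matlas = (if b then gatlas else {})\<rparr>"

lemma openin_gtop: "openin gtop W \<longleftrightarrow> W \<subseteq> T \<and> (\<forall>i\<in>Ind. openin (mtop (Y i)) (\<Phi> i ` (W \<inter> TI i)))"
proof -
 have "istopology (\<lambda>W. W \<subseteq> T \<and> (\<forall>i\<in>Ind. openin (mtop (Y i)) (\<Phi> i ` (W \<inter> TI i))))"
  unfolding istopology_def
 proof (rule conjI; intro allI impI conjI ballI)
  fix V W i
  assume V: "V \<subseteq> T \<and> (\<forall>i\<in>Ind. openin (mtop (Y i)) (\<Phi> i ` (V \<inter> TI i)))"
   and W: "W \<subseteq> T \<and> (\<forall>i\<in>Ind. openin (mtop (Y i)) (\<Phi> i ` (W \<inter> TI i)))"
  show "V \<inter> W \<subseteq> T" using V by blast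
  assume i: "i \<in> Ind"
  have "\<Phi> i ` (V \<inter> W \<inter> TI i) = \<Phi> i ` (V \<inter> TI i) \<inter> \<Phi> i ` (W \<inter> TI i)"
   using inj_on_image_Int[OF inj[OF i], of "V \<inter> TI i" "W \<inter> TI i"] by (simp add: Int_ac)
  then show "openin (mtop (Y i)) (\<Phi> i ` (V \<inter> W \<inter> TI i))" using V W i by auto
 next
  fix \<K> i
  assume K: "\<forall>W\<in>\<K>. W \<subseteq> T \<and> (\<forall>i\<in>Ind. openin (mtop (Y i)) (\<Phi> i ` (W \<inter> TI i)))"
  show "\<Union>\<K> \<subseteq> T" using K by blast
  assume i: "i \<in> Ind"
  have "\<Phi> i ` (\<Union>\<K> \<inter> TI i) = (\<Union>W\<in>\<K>. \<Phi> i ` (W \<inter> TI i))" by blast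
  then show "openin (mtop (Y i)) (\<Phi> i ` (\<Union>\<K> \<inter> TI i))" using K i by auto
 qed
 then show ?thesis by (simp add: gtop_def topology_inverse')
qed

lemma TI_open: "i \<in> Ind ==> openin gtop (TI i)"
 unfolding openin_gtop
proof (intro conjI ballI)
 assume i: "i \<in> Ind"
 show "TI i \<subseteq> T" using cover i by blast
 show "openin (mtop (Y j)) (\<Phi> j ` (TI i \<inter> TI j))" if j: "j \<in> Ind" for j
  using overlap[OF j i] by (simp add: Int_commute)
qed

lemma topspace_gtop: "topspace gtop = T"
proof
 show "topspace gtop \<subseteq> T" using openin_topspace[of gtop] unfolding openin_gtop by blast
 show "T \<subseteq> topspace gtop" using openin_subset[OF TI_open] cover by blast
qed

lemma T_I: "e \<in> topspace gtop \<longleftrightarrow> (\<exists>i\<in>Ind. e \<in> TI i)"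
 unfolding topspace_gtop using cover by blast

lemma inv_\<Phi>: "i \<in> Ind ==> e \<in> TI i ==> inv_into (TI i) (\<Phi> i) (\<Phi> i e) = e"
 using inj by simp

lemma \<Phi>_in: "i \<in> Ind ==> e \<in> TI i ==> \<Phi> i e \<in> tspace (Y i)"
 using image by blast

lemma open_pullback:
 assumes i: "i \<in> Ind" and V: "openin (mtop (Y i)) V"
 shows "openin gtop {e \<in> TI i. \<Phi> i e \<in> V}"
 unfolding openin_gtop
proof (intro conjI ballI)
 show "{e \<in> TI i. \<Phi> i e \<in> V} \<subseteq> T" using cover i by blast
 fix j assume j: "j \<in> Ind"
 let ?O = "\<Phi> j ` (TI j \<inter> TI i)"
 let ?f = "\<lambda>y. \<Phi> i (inv_into (TI j) (\<Phi> j) y)"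
 have c: "continuous_map (subtopology (mtop (Y j)) ?O) (mtop (Y i)) ?f"
  using reg_map_continuous[OF trans[OF j i]] by simp
 have t: "topspace (subtopology (mtop (Y j)) ?O) = ?O" using openin_subset[OF overlap[OF j i]] by auto
 have "\<Phi> j ` ({e \<in> TI i. \<Phi> i e \<in> V} \<inter> TI j) = {y \<in> topspace (subtopology (mtop (Y j)) ?O). ?f y \<in> V}"
  unfolding t by (auto simp: inv_\<Phi>[OF j])
 then have "openin (subtopology (mtop (Y j)) ?O) (\<Phi> j ` ({e \<in> TI i. \<Phi> i e \<in> V} \<inter> TI j))"
  using openin_continuous_map_preimage[OF c V] by simp
 then show "openin (mtop (Y j)) (\<Phi> j ` ({e \<in> TI i. \<Phi> i e \<in> V} \<inter> TI j))"
  using openin_trans_full overlap[OF j i] by blast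
qed

lemma continuous_\<Phi>: "i \<in> Ind ==> continuous_map (subtopology gtop (TI i)) (mtop (Y i)) (\<Phi> i)"
proof -
 assume i: "i \<in> Ind"
 have t: "topspace (subtopology gtop (TI i)) = TI i" using openin_subset[OF TI_open[OF i]] by auto
 have "openin (subtopology gtop (TI i)) {e \<in> TI i. \<Phi> i e \<in> V}" if "openin (mtop (Y i)) V" for V
  using open_pullback[OF i that] TI_open[OF i] by (auto simp: openin_open_subtopology)
 then show ?thesis unfolding continuous_map_def t using \<Phi>_in[OF i] by auto
qed

lemma continuous_inv_\<Phi>: "i \<in> Ind ==> continuous_map (mtop (Y i)) gtop (inv_into (TI i) (\<Phi> i))"
 unfolding continuous_map_def
proof (intro conjI allI impI)
 assume i: "i \<in> Ind"
 show "inv_into (TI i) (\<Phi> i) \<in> tspace (Y i) \<rightarrow> topspace gtop"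
  unfolding image[OF i, symmetric] topspace_gtop using cover i by (auto simp: inv_\<Phi>)
 fix W assume W: "openin gtop W"
 have "{y \<in> tspace (Y i). inv_into (TI i) (\<Phi> i) y \<in> W} = \<Phi> i ` (W \<inter> TI i)"
  unfolding image[OF i, symmetric] using i by (auto simp: inv_\<Phi>)
 then show "openin (mtop (Y i)) {y \<in> tspace (Y i). inv_into (TI i) (\<Phi> i) y \<in> W}"
  using W i by (simp add: openin_gtop)
qed

lemma mtop_G [simp]: "mtop G = gtop" by (simp add: G_def)

lemma matlas_G: "b ==> c \<in> matlas G \<longleftrightarrow>
  (\<exists>i K U \<phi>. c = (to_nat ` K, {e \<in> TI i. \<Phi> i e \<in> U}, \<lambda>e. rel K (\<phi> (\<Phi> i e))) \<and> i \<in> Ind \<and> (K, U, \<phi>) \<in> matlas (Y i))"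
 unfolding G_def gatlas_def mfd.select_convs if_P mem_Collect_eq by (rule refl)

context
 fixes i K U \<phi>
 assumes b: b and i: "i \<in> Ind" and c: "(K, U, \<phi>) \<in> matlas (Y i)"
begin

private lemma Yi: "smooth_mfd (Y i)" using Y[OF i] b by (simp add: reg_mfd_def)
private lemmas ch = smooth_mfd_chart[OF Yi c]
private abbreviation "D \<equiv> {e \<in> TI i. \<Phi> i e \<in> U}"
private abbreviation "ps \<equiv> \<lambda>e. rel K (\<phi> (\<Phi> i e))"
private abbreviation "th \<equiv> \<lambda>w. inv_into (TI i) (\<Phi> i) (inv_into U \<phi> (unrel K w))"

lemma gchart_inv1: "e \<in> D ==> th (ps e) = e"
 using i by (auto simp: unrel_rel[OF ch(6)] inv_into_f_f[OF ch(5)] inv_\<Phi> simp del: topspace_cspace)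

lemma gchart_inj: "inj_on ps D"
 by (rule inj_on_inverseI[where g = th]) (rule gchart_inv1)

lemma gchart_inv: "e \<in> D ==> inv_into D ps (ps e) = e"
 by (rule inv_into_f_f[OF gchart_inj])

lemma gchart_image:
 assumes V: "V \<subseteq> tspace (Y i)"
 shows "ps ` {e \<in> TI i. \<Phi> i e \<in> U \<inter> V} = {w \<in> topspace (cspace (to_nat ` K)). unrel K w \<in> \<phi> ` (U \<inter> V)}"
proof
 show "ps ` {e \<in> TI i. \<Phi> i e \<in> U \<inter> V} \<subseteq> {w \<in> topspace (cspace (to_nat ` K)). unrel K w \<in> \<phi> ` (U \<inter> V)}"
  using unrel_rel[OF ch(6)] by (auto simp: rel_def)
 show "{w \<in> topspace (cspace (to_nat ` K)). unrel K w \<in> \<phi> ` (U \<inter> V)} \<subseteq> ps ` {e \<in> TI i. \<Phi> i e \<in> U \<inter> V}"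
 proof
  fix w assume "w \<in> {w \<in> topspace (cspace (to_nat ` K)). unrel K w \<in> \<phi> ` (U \<inter> V)}"
  then obtain y where y: "y \<in> U" "y \<in> V" "unrel K w = \<phi> y" and w: "w \<in> topspace (cspace (to_nat ` K))" by blast
  obtain e where e: "e \<in> TI i" "y = \<Phi> i e" using y(2) V image[OF i] by blast
  have "w = ps e" using rel_unrel[OF w] y e by simp
  then show "w \<in> ps ` {e \<in> TI i. \<Phi> i e \<in> U \<inter> V}" using e y by blast
 qed
qed

lemma gchart_open:
 assumes V: "openin (mtop (Y i)) V"
 shows "openin (cspace (to_nat ` K)) (ps ` {e \<in> TI i. \<Phi> i e \<in> U \<inter> V})"
 unfolding gchart_image[OF openin_subset[OF V]]
 by (rule openin_continuous_map_preimage[OF continuous_map_unrel ch(8)[OF V]])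

lemma gchart_Ck:
 assumes r: "regular b (Y i) V r"
 shows "Ck_on k (to_nat ` K) (ps ` {e \<in> TI i. \<Phi> i e \<in> U \<inter> V}) (\<lambda>w. r (\<Phi> i (inv_into D ps w)))"
proof -
 note oV = regular_open[OF r]
 let ?S = "ps ` {e \<in> TI i. \<Phi> i e \<in> U \<inter> V}"
 have S: "openin (cspace (to_nat ` K)) ?S" by (rule gchart_open[OF oV])
 have sub: "unrel K w \<in> \<phi> ` (U \<inter> V)" if "w \<in> ?S" for w
  using that unfolding gchart_image[OF openin_subset[OF oV]] by blast
 have "Ck_on k (to_nat ` K) ?S (\<lambda>w. r (inv_into U \<phi> (unrel K w)))"
  by (rule Ck_on_compose[OF ch(8)[OF oV] ch(1) S sub regular_Ck[OF r b c]])
   (auto simp: unrel_def intro: Ck_on_coord)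
 then show ?thesis
  by (rule Ck_on_cong[OF S, THEN iffD1, rotated])
   (auto simp: gchart_inv unrel_rel[OF ch(6)] inv_into_f_f[OF ch(5)] simp del: topspace_cspace)
qed

lemma gchart_homeo: "homeomorphic_map (subtopology gtop D) (subtopology (cspace (to_nat ` K)) (ps ` D)) ps"
proof (rule chart_homeomorphic)
 show "D \<subseteq> topspace gtop" using topspace_gtop cover i by blast
 have 1: "continuous_map (subtopology gtop D) (subtopology (mtop (Y i)) U) (\<Phi> i)"
  using continuous_map_from_subtopology_mono[OF continuous_\<Phi>[OF i], of D] by (auto simp: continuous_map_in_subtopology)
 from continuous_map_compose[OF continuous_map_compose[OF 1 ch(7)] continuous_map_rel]
 show "continuous_map (subtopology gtop D) (cspace (to_nat ` K)) ps" by (simp add: o_def)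
 have "unrel K w \<in> \<phi> ` U" if "w \<in> ps ` D" for w
  using that unrel_rel[OF ch(6)] by auto
 then have 2: "continuous_map (subtopology (cspace (to_nat ` K)) (ps ` D)) (subtopology (cspace K) (\<phi> ` U)) (unrel K)"
  using continuous_map_from_subtopology[OF continuous_map_unrel] by (auto simp: continuous_map_in_subtopology)
 from continuous_map_compose[OF continuous_map_compose[OF 2 ch(9)] continuous_inv_\<Phi>[OF i]]
 show "continuous_map (subtopology (cspace (to_nat ` K)) (ps ` D)) gtop th" by (simp add: o_def)
qed (rule gchart_inv1)

end

text \<open>In a chart of another piece \<open>j\<close> the function is the pullback of
  \<open>r\<close> along the transition map from \<open>Y j\<close> to \<open>Y i\<close>, so its
  regularity is read off on the model \<open>Y j\<close>.\<close>

lemma regular_glued: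
 assumes i: "i \<in> Ind" and r: "regular b (Y i) V r"
 shows "regular b G {e \<in> TI i. \<Phi> i e \<in> V} (\<lambda>e. r (\<Phi> i e))"
proof (rule regularI)
 show "openin (mtop G) {e \<in> TI i. \<Phi> i e \<in> V}" using open_pullback[OF i regular_open[OF r]] by simp
 have "continuous_map (subtopology gtop {e \<in> TI i. \<Phi> i e \<in> V}) (subtopology (mtop (Y i)) V) (\<Phi> i)"
  using continuous_map_from_subtopology_mono[OF continuous_\<Phi>[OF i], of "{e \<in> TI i. \<Phi> i e \<in> V}"]
  by (auto simp: continuous_map_in_subtopology)
 from continuous_map_compose[OF this regular_continuous[OF r]]
 show "continuous_map (subtopology (mtop G) {e \<in> TI i. \<Phi> i e \<in> V}) euclidean (\<lambda>e. r (\<Phi> i e))" by (simp add: o_def)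
 fix N W \<psi> k assume b: b and "(N, W, \<psi>) \<in> matlas G"
 then obtain j K U \<phi> where j: "j \<in> Ind" "(K, U, \<phi>) \<in> matlas (Y j)" and
  c: "N = to_nat ` K" "W = {e \<in> TI j. \<Phi> j e \<in> U}" "\<psi> = (\<lambda>e. rel K (\<phi> (\<Phi> j e)))"
  unfolding matlas_G[OF b] prod.inject by blast
 let ?O = "\<Phi> j ` (TI j \<inter> TI i)" and ?f = "\<lambda>y. \<Phi> i (inv_into (TI j) (\<Phi> j) y)"
 have YO: "reg_mfd b (open_submfd (Y j) ?O)" by (rule reg_mfd_open_submfd[OF Y[OF j(1)] overlap[OF j(1) i]])
 let ?V = "preim (open_submfd (Y j) ?O) ?f V"
 have "regular b (open_submfd (Y j) ?O) ?V (\<lambda>y. r (?f y))"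
  by (rule regular_pullback[OF YO Y[OF i] trans[OF j(1) i] r])
 then have rV: "regular b (Y j) ?V (\<lambda>y. r (?f y))"
  using regular_submfd_iff[OF Y[OF j(1)] overlap[OF j(1) i], of ?V] by (auto simp: preim_def)
 have sets: "{e \<in> TI j. \<Phi> j e \<in> U \<inter> ?V} = W \<inter> {e \<in> TI i. \<Phi> i e \<in> V}"
 proof -
  have "\<Phi> j e \<in> ?V \<longleftrightarrow> e \<in> TI i \<and> \<Phi> i e \<in> V" if e: "e \<in> TI j" for e
  proof -
   have "\<Phi> j e \<in> ?O \<longleftrightarrow> e \<in> TI i" using inj[OF j(1)] e by (auto simp: inj_on_def)
   then show ?thesis using openin_subset[OF overlap[OF j(1) i]] inv_\<Phi>[OF j(1) e] by (auto simp: preim_def)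
  qed
  then show ?thesis by (auto simp: c)
 qed
 have c1: "Ck_on k N (\<psi> ` (W \<inter> {e \<in> TI i. \<Phi> i e \<in> V})) (\<lambda>w. r (?f (\<Phi> j (inv_into W \<psi> w))))"
  using gchart_Ck[OF b j rV, of k] unfolding sets by (simp add: c)
 have c2: "openin (cspace N) (\<psi> ` (W \<inter> {e \<in> TI i. \<Phi> i e \<in> V}))"
  using gchart_open[OF b j regular_open[OF rV]] unfolding sets by (simp add: c)
 have c3: "r (?f (\<Phi> j (inv_into W \<psi> w))) = r (\<Phi> i (inv_into W \<psi> w))" if h: "w \<in> \<psi> ` (W \<inter> {e \<in> TI i. \<Phi> i e \<in> V})" for w
 proof -
  obtain e where e: "e \<in> W" "w = \<psi> e" using h by blast
  have "inv_into W \<psi> w = e" using gchart_inv[OF b j, of e] e by (simp add: c)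
  then show ?thesis using e inv_\<Phi>[OF j(1), of e] by (simp add: c)
 qed
 show "Ck_on k N (\<psi> ` (W \<inter> {e \<in> TI i. \<Phi> i e \<in> V})) (\<lambda>w. r (\<Phi> i (inv_into W \<psi> w)))"
  by (rule iffD1[OF Ck_on_cong[OF c2 c3] c1])
qed

lemma gcoord_regular:
 assumes b: b and i: "i \<in> Ind" and c: "(K, U, \<phi>) \<in> matlas (Y i)" and n: "n \<in> to_nat ` K"
 shows "regular b G {e \<in> TI i. \<Phi> i e \<in> U} (\<lambda>e. rel K (\<phi> (\<Phi> i e)) n)"
proof -
 obtain k where k: "k \<in> K" "n = to_nat k" using n by blast
 have "smooth_mfd (Y i)" using Y[OF i] b by (simp add: reg_mfd_def)
 from regular_glued[OF i chart_regular[OF this c k(1)]] show ?thesis using k by (simp add: rel_def)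
qed

lemma reg_mfd_G: "reg_mfd b G"
 unfolding reg_mfd_def
proof
 assume b: b
 note mG = matlas_G[OF b]
 have sY: "smooth_mfd (Y i)" if "i \<in> Ind" for i using Y[OF that] b by (simp add: reg_mfd_def)
 show "smooth_mfd G"
  unfolding smooth_mfd_def
 proof (intro conjI ballI, goal_cases)
  case 1
  show ?case
  proof
   show "(\<Union>(I, U, \<phi>)\<in>matlas G. U) \<subseteq> tspace G"
   proof
    fix e assume "e \<in> (\<Union>(I, U, \<phi>)\<in>matlas G. U)"
    then obtain c where c: "c \<in> matlas G" "e \<in> fst (snd c)" by (auto simp: case_prod_beta)
    obtain i K U \<phi> where "c = (to_nat ` K, {e \<in> TI i. \<Phi> i e \<in> U}, \<lambda>e. rel K (\<phi> (\<Phi> i e)))" "i \<in> Ind" "(K, U, \<phi>) \<in> matlas (Y i)"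
     using c(1) unfolding mG by blast
    then have "i \<in> Ind" "e \<in> TI i" using c(2) by simp_all
    then show "e \<in> tspace G" unfolding mtop_G T_I by blast
   qed
   show "tspace G \<subseteq> (\<Union>(I, U, \<phi>)\<in>matlas G. U)"
   proof
    fix e assume "e \<in> tspace G"
    then obtain i where i: "i \<in> Ind" "e \<in> TI i" using T_I by auto
    obtain K U \<phi> where c: "(K, U, \<phi>) \<in> matlas (Y i)" "\<Phi> i e \<in> U"
     using smooth_mfd_cover[OF sY[OF i(1)] \<Phi>_in[OF i]] by blast
    have "(to_nat ` K, {e \<in> TI i. \<Phi> i e \<in> U}, \<lambda>e. rel K (\<phi> (\<Phi> i e))) \<in> matlas G" using mG i c by blast
    then show "e \<in> (\<Union>(I, U, \<phi>)\<in>matlas G. U)" using i(2) c(2) by (intro UN_I) auto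
   qed
  qed
 next
  case (2 c)
  then obtain i K U \<phi> where c: "c = (to_nat ` K, {e \<in> TI i. \<Phi> i e \<in> U}, \<lambda>e. rel K (\<phi> (\<Phi> i e)))"
   "i \<in> Ind" "(K, U, \<phi>) \<in> matlas (Y i)" using mG by blast
  note ch = smooth_mfd_chart[OF sY[OF c(2)] c(3)]
  have "openin (cspace (to_nat ` K)) ((\<lambda>e. rel K (\<phi> (\<Phi> i e))) ` {e \<in> TI i. \<Phi> i e \<in> U})"
   using gchart_open[OF b c(2,3) ch(2)] by simp
  then show ?case
   unfolding c(1) prod.case mtop_G using ch(1) open_pullback[OF c(2) ch(2)] gchart_homeo[OF b c(2,3)] by blast
 next
  case (3 c)
  then obtain i K U \<phi> where c: "c = (to_nat ` K, {e \<in> TI i. \<Phi> i e \<in> U}, \<lambda>e. rel K (\<phi> (\<Phi> i e)))"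
   "i \<in> Ind" "(K, U, \<phi>) \<in> matlas (Y i)" using mG by blast
  have cG: "c \<in> matlas G" by (rule 3)
  show ?case
   unfolding c(1) prod.case
  proof (rule ballI)
   fix d assume "d \<in> matlas G"
   then obtain j L V \<psi> where d: "d = (to_nat ` L, {e \<in> TI j. \<Phi> j e \<in> V}, \<lambda>e. rel L (\<psi> (\<Phi> j e)))"
    "j \<in> Ind" "(L, V, \<psi>) \<in> matlas (Y j)" using mG by blast
   have "smooth_fun (to_nat ` K) ((\<lambda>e. rel K (\<phi> (\<Phi> i e))) ` ({e \<in> TI i. \<Phi> i e \<in> U} \<inter> {e \<in> TI j. \<Phi> j e \<in> V}))
     (\<lambda>w. rel L (\<psi> (\<Phi> j (inv_into {e \<in> TI i. \<Phi> i e \<in> U} (\<lambda>e. rel K (\<phi> (\<Phi> i e))) w))) n)" if "n \<in> to_nat ` L" for n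
   proof -
    have "regular True G {e \<in> TI j. \<Phi> j e \<in> V} (\<lambda>e. rel L (\<psi> (\<Phi> j e)) n)"
     using gcoord_regular[OF b d(2,3) that] b by simp
    from regular_chart[OF this cG[unfolded c(1)]] show ?thesis .
   qed
   then show "case d of (J, V, \<psi>) => \<forall>j\<in>J. smooth_fun (to_nat ` K) ((\<lambda>e. rel K (\<phi> (\<Phi> i e))) ` ({e \<in> TI i. \<Phi> i e \<in> U} \<inter> V))
     (\<lambda>w. \<psi> (inv_into {e \<in> TI i. \<Phi> i e \<in> U} (\<lambda>e. rel K (\<phi> (\<Phi> i e))) w) j)"
    unfolding d(1) prod.case by blast
  qed
 qed
qed

lemma reg_diffeo_\<Phi>:
 assumes i: "i \<in> Ind" shows "reg_diffeo b (open_submfd G (TI i)) (Y i) (\<Phi> i)"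
proof -
 have o: "openin (mtop G) (TI i)" using TI_open[OF i] by simp
 have GT: "reg_mfd b (open_submfd G (TI i))" by (rule reg_mfd_open_submfd[OF reg_mfd_G o])
 have t: "tspace (open_submfd G (TI i)) = TI i" using openin_subset[OF o] by auto
 have "reg_map b (open_submfd G (TI i)) (Y i) (\<Phi> i)"
 proof (rule reg_mapI[OF GT Y[OF i]])
  show "continuous_map (mtop (open_submfd G (TI i))) (mtop (Y i)) (\<Phi> i)" using continuous_\<Phi>[OF i] by simp
  fix J V \<psi> j assume b: b and d: "(J, V, \<psi>) \<in> matlas (Y i)" and j: "j \<in> J"
  have "smooth_mfd (Y i)" using Y[OF i] b by (simp add: reg_mfd_def)
  from regular_glued[OF i chart_regular[OF this d j]]
  have "regular b G {e \<in> TI i. \<Phi> i e \<in> V} (\<lambda>e. \<psi> (\<Phi> i e) j)" .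
  then have "regular b (open_submfd G (TI i)) {e \<in> TI i. \<Phi> i e \<in> V} (\<lambda>e. \<psi> (\<Phi> i e) j)"
   using regular_submfd_iff[OF reg_mfd_G o, of "{e \<in> TI i. \<Phi> i e \<in> V}"] by auto
  then show "regular b (open_submfd G (TI i)) (preim (open_submfd G (TI i)) (\<Phi> i) V) (\<lambda>e. \<psi> (\<Phi> i e) j)"
   unfolding preim_def t .
 qed
 moreover have "reg_map b (Y i) (open_submfd G (TI i)) (inv_into (TI i) (\<Phi> i))"
  unfolding reg_map_into_submfd[OF Y[OF i] reg_mfd_G o]
 proof
  show "inv_into (TI i) (\<Phi> i) ` tspace (Y i) \<subseteq> TI i"
   unfolding image[OF i, symmetric] using inv_\<Phi>[OF i] by auto
  show "reg_map b (Y i) G (inv_into (TI i) (\<Phi> i))"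
  proof (rule reg_mapI[OF Y[OF i] reg_mfd_G])
   show "continuous_map (mtop (Y i)) (mtop G) (inv_into (TI i) (\<Phi> i))" using continuous_inv_\<Phi>[OF i] by simp
   fix N W \<psi> n assume b: b and "(N, W, \<psi>) \<in> matlas G" and n: "n \<in> N"
   then obtain j K U \<phi> where j: "j \<in> Ind" "(K, U, \<phi>) \<in> matlas (Y j)" and
    c: "N = to_nat ` K" "W = {e \<in> TI j. \<Phi> j e \<in> U}" "\<psi> = (\<lambda>e. rel K (\<phi> (\<Phi> j e)))"
    unfolding matlas_G[OF b] prod.inject by blast
   obtain k where k: "k \<in> K" "n = to_nat k" using n c(1) by blast
   let ?O = "\<Phi> i ` (TI i \<inter> TI j)" and ?f = "\<lambda>y. \<Phi> j (inv_into (TI i) (\<Phi> i) y)"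
   have YO: "reg_mfd b (open_submfd (Y i) ?O)" by (rule reg_mfd_open_submfd[OF Y[OF i] overlap[OF i j(1)]])
   have "regular b (open_submfd (Y i) ?O) (preim (open_submfd (Y i) ?O) ?f U) (\<lambda>y. \<phi> (?f y) k)"
    by (rule reg_map_coord[OF YO Y[OF j(1)] trans[OF i j(1)] b j(2) k(1)])
   then have r: "regular b (Y i) (preim (open_submfd (Y i) ?O) ?f U) (\<lambda>y. \<phi> (?f y) k)"
    using regular_submfd_iff[OF Y[OF i] overlap[OF i j(1)], of "preim (open_submfd (Y i) ?O) ?f U"] by (auto simp: preim_def)
   have "preim (open_submfd (Y i) ?O) ?f U = preim (Y i) (inv_into (TI i) (\<Phi> i)) W"
   proof -
    have "y \<in> ?O \<longleftrightarrow> inv_into (TI i) (\<Phi> i) y \<in> TI j" if y: "y \<in> tspace (Y i)" for y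
    proof -
     obtain e where e: "e \<in> TI i" "y = \<Phi> i e" using y image[OF i] by blast
     have "\<Phi> i e \<in> ?O \<longleftrightarrow> e \<in> TI j" using inj[OF i] e by (auto simp: inj_on_def)
     then show ?thesis using e inv_\<Phi>[OF i e(1)] by simp
    qed
    then show ?thesis using openin_subset[OF overlap[OF i j(1)]] by (auto simp: preim_def c(2))
   qed
   then show "regular b (Y i) (preim (Y i) (inv_into (TI i) (\<Phi> i)) W) (\<lambda>y. \<psi> (inv_into (TI i) (\<Phi> i) y) n)"
    using r k by (simp add: c(3) rel_def)
  qed
 qed
 ultimately show ?thesis
  unfolding reg_diffeo_def t bij_betw_def using inj[OF i] image[OF i] by blast
qed

end

section \<open>Finite-dimensional spaces and gradings in coordinates\<close>

lemma C_ring_sel [simp]: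
 "carrier C_ring = UNIV" "\<one>\<^bsub>C_ring\<^esub> = 1" "\<zero>\<^bsub>C_ring\<^esub> = 0" "x \<oplus>\<^bsub>C_ring\<^esub> y = x + y" "x \<otimes>\<^bsub>C_ring\<^esub> y = x * y"
 by (simp_all add: C_ring_def)

lemma cvec_sel [simp]:
 "carrier (cvec r) = PiE {..<r} (\<lambda>_. UNIV)" "\<zero>\<^bsub>cvec r\<^esub> = (\<lambda>k\<in>{..<r}. 0)"
 "x \<oplus>\<^bsub>cvec r\<^esub> y = (\<lambda>k\<in>{..<r}. x k + y k)" "c \<odot>\<^bsub>cvec r\<^esub> x = (\<lambda>k\<in>{..<r}. c * x k)"
 by (simp_all add: cvec_def)

lemma cvec_eqI:
 assumes "x \<in> carrier (cvec r)" "y \<in> carrier (cvec r)" "\<And>k. k < r ==> x k = y k"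
 shows "x = y"
 using assms by (auto intro: PiE_ext)

text \<open>The scalar field is only implicit in the last two hypotheses: \<open>f\<close> transports the vector
 space structure of \<open>\<complex>\<^sup>r\<close> to \<open>M\<close>.\<close>

lemma cvector_space_by_coords:
 fixes M :: "(complex, 'v) module"
 assumes bij: "bij_betw f (carrier M) (carrier (cvec r))"
  and zero: "\<zero>\<^bsub>M\<^esub> \<in> carrier M" "\<And>k. k < r ==> f \<zero>\<^bsub>M\<^esub> k = 0"
  and add: "\<And>x y. x \<in> carrier M ==> y \<in> carrier M ==> x \<oplus>\<^bsub>M\<^esub> y \<in> carrier M"
   "\<And>x y k. x \<in> carrier M ==> y \<in> carrier M ==> k < r ==> f (x \<oplus>\<^bsub>M\<^esub> y) k = f x k + f y k"
  and scale: "\<And>c x. x \<in> carrier M ==> c \<odot>\<^bsub>M\<^esub> x \<in> carrier M"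
   "\<And>c x k. x \<in> carrier M ==> k < r ==> f (c \<odot>\<^bsub>M\<^esub> x) k = c * f x k"
 shows "cvector_space M"
proof -
 have fc: "f x \<in> carrier (cvec r)" if "x \<in> carrier M" for x using bij that by (auto simp: bij_betw_def)
 have eq: "x = y" if "x \<in> carrier M" "y \<in> carrier M" "\<And>k. k < r ==> f x k = f y k" for x y
 proof -
  have "f x = f y" using that fc by (intro cvec_eqI[of _ r]) auto
  then show ?thesis using bij that by (auto simp: bij_betw_def inj_on_def)
 qed
 have "abelian_group M"
 proof (rule abelian_groupI)
  fix x assume x: "x \<in> carrier M"
  show "\<exists>y\<in>carrier M. y \<oplus>\<^bsub>M\<^esub> x = \<zero>\<^bsub>M\<^esub>"
   using x by (intro bexI[of _ "(-1) \<odot>\<^bsub>M\<^esub> x"] eq) (auto simp: zero add scale)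
 qed (auto simp: zero add scale intro!: eq)
 then show ?thesis
  by (intro moduleI cring_C_ring) (auto simp: zero add scale algebra_simps intro!: eq)
qed

lemma cvec_module: "cvector_space (cvec r)"
 by (rule cvector_space_by_coords[where f = "\<lambda>x. x" and r = r]) (auto simp: bij_betw_def)

lemma clinear_map_zero:
 assumes "cvector_space M" "cvector_space N" "clinear_map M N f"
 shows "f \<zero>\<^bsub>M\<^esub> = \<zero>\<^bsub>N\<^esub>"
proof -
 have z: "\<zero>\<^bsub>M\<^esub> \<in> carrier M" "0 \<odot>\<^bsub>M\<^esub> \<zero>\<^bsub>M\<^esub> = \<zero>\<^bsub>M\<^esub>"
  using module.smult_l_null[OF assms(1)] assms(1) by (auto simp: module_def abelian_group_def abelian_monoid.zero_closed)
 have "f (0 \<odot>\<^bsub>M\<^esub> \<zero>\<^bsub>M\<^esub>) = 0 \<odot>\<^bsub>N\<^esub> f \<zero>\<^bsub>M\<^esub>" "f \<zero>\<^bsub>M\<^esub> \<in> carrier N"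
  using assms(3) z(1) by (auto simp: clinear_map_def)
 then show ?thesis using z(2) module.smult_l_null[OF assms(2)] by simp
qed

lemma clinear_map_finsum:
 assumes M: "cvector_space M" and u: "clinear_map M (cvec r) u" and "finite F" "g \<in> F \<rightarrow> carrier M" and k: "k < r"
 shows "u (finsum M g F) k = (\<Sum>p\<in>F. u (g p) k)"
 using assms(3,4)
proof (induction F rule: finite_induct)
 interpret M: module C_ring M by (rule M)
 {
  case empty
  show ?case using clinear_map_zero[OF M cvec_module u] k by simp
 next
  case (insert p F)
  have g: "g p \<in> carrier M" "g \<in> F \<rightarrow> carrier M" using insert.prems by auto
  then have "u (finsum M g (insert p F)) = u (g p) \<oplus>\<^bsub>cvec r\<^esub> u (finsum M g F)"
   using u insert.hyps by (simp add: clinear_map_def)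
  then show ?case using insert k g by simp
 }
qed

definition cunit :: "nat => nat => nat => complex" where
 "cunit r l = (\<lambda>k\<in>{..<r}. if k = l then 1 else 0)"

lemma cunit_carrier [simp]: "cunit r l \<in> carrier (cvec r)"
 by (simp add: cunit_def)

lemma cunit_nth: "k < r ==> cunit r l k = (if k = l then 1 else 0)"
 by (simp add: cunit_def)

lemma clinear_map_expand:
 assumes L: "clinear_map (cvec r) (cvec s) L" and x: "x \<in> carrier (cvec r)" and i: "i < s"
 shows "L x i = (\<Sum>k<r. L (cunit r k) i * x k)"
proof -
 interpret M: module C_ring "cvec r" by (rule cvec_module)
 have s: "x k \<odot>\<^bsub>cvec r\<^esub> cunit r k \<in> carrier (cvec r)" for k by auto
 have "finsum (cvec r) (\<lambda>k. x k \<odot>\<^bsub>cvec r\<^esub> cunit r k) {..<r} = x"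
 proof (rule cvec_eqI[OF _ x])
  show "finsum (cvec r) (\<lambda>k. x k \<odot>\<^bsub>cvec r\<^esub> cunit r k) {..<r} \<in> carrier (cvec r)"
   by (rule M.finsum_closed) (use s in auto)
  have id: "clinear_map (cvec r) (cvec r) (\<lambda>x. x)" by (auto simp: clinear_map_def)
  fix l assume l: "l < r"
  have "finsum (cvec r) (\<lambda>k. x k \<odot>\<^bsub>cvec r\<^esub> cunit r k) {..<r} l = (\<Sum>k<r. (x k \<odot>\<^bsub>cvec r\<^esub> cunit r k) l)"
   by (rule clinear_map_finsum[OF cvec_module id _ _ l]) (use s in auto)
  also have "\<dots> = x l" using l by (simp add: cunit_nth mult_delta_right)
  finally show "finsum (cvec r) (\<lambda>k. x k \<odot>\<^bsub>cvec r\<^esub> cunit r k) {..<r} l = x l" .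
 qed
 then have "L x i = L (finsum (cvec r) (\<lambda>k. x k \<odot>\<^bsub>cvec r\<^esub> cunit r k) {..<r}) i" by simp
 also have "\<dots> = (\<Sum>k<r. L (x k \<odot>\<^bsub>cvec r\<^esub> cunit r k) i)"
  by (rule clinear_map_finsum[OF cvec_module L _ _ i]) (use s in auto)
 also have "\<dots> = (\<Sum>k<r. L (cunit r k) i * x k)"
 proof (rule sum.cong[OF refl])
  fix k
  have "L (x k \<odot>\<^bsub>cvec r\<^esub> cunit r k) = x k \<odot>\<^bsub>cvec s\<^esub> L (cunit r k)"
   using L cunit_carrier[of r k] unfolding clinear_map_def by blast
  then show "L (x k \<odot>\<^bsub>cvec r\<^esub> cunit r k) i = L (cunit r k) i * x k" using i by simp
 qed
 finally show ?thesis .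
qed

lemma clinear_map_compose:
 "clinear_map M N f ==> clinear_map N P g ==> clinear_map M P (\<lambda>x. g (f x))"
 by (auto simp: clinear_map_def Pi_iff)

lemma clinear_map_cong:
 assumes "cvector_space M" "clinear_map M N f" "\<And>x. x \<in> carrier M ==> f x = g x"
 shows "clinear_map M N g"
proof -
 interpret M: module C_ring M by (rule assms(1))
 have "c \<odot>\<^bsub>M\<^esub> x \<in> carrier M" if "x \<in> carrier M" for c x using M.smult_closed that by simp
 then show ?thesis using assms(2,3) by (auto simp: clinear_map_def Pi_iff)
qed

lemma clinear_map_inverse:
 assumes M: "cvector_space M" and u: "clinear_map M N u" and bij: "bij_betw u (carrier M) (carrier N)"
 shows "clinear_map N M (inv_into (carrier M) u)"
proof -
 interpret M: module C_ring M by (rule M)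
 let ?v = "inv_into (carrier M) u"
 have v: "?v y \<in> carrier M" "u (?v y) = y" if "y \<in> carrier N" for y
  using that bij by (auto simp: bij_betw_def inv_into_into f_inv_into_f)
 have vu: "?v (u x) = x" if "x \<in> carrier M" for x
  using that bij by (simp add: bij_betw_def)
 have sc: "c \<odot>\<^bsub>M\<^esub> x \<in> carrier M" if "x \<in> carrier M" for c x using M.smult_closed that by simp
 have "?v (x \<oplus>\<^bsub>N\<^esub> y) = ?v x \<oplus>\<^bsub>M\<^esub> ?v y" if "x \<in> carrier N" "y \<in> carrier N" for x y
  using vu[of "?v x \<oplus>\<^bsub>M\<^esub> ?v y"] u v that by (simp add: clinear_map_def)
 moreover have "?v (c \<odot>\<^bsub>N\<^esub> x) = c \<odot>\<^bsub>M\<^esub> ?v x" if "x \<in> carrier N" for x c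
  using vu[of "c \<odot>\<^bsub>M\<^esub> ?v x"] u v sc that by (simp add: clinear_map_def)
 ultimately show ?thesis using v by (auto simp: clinear_map_def)
qed

text \<open>Both products of two mutually inverse matrices have the same trace.\<close>

lemma cvec_iso_rank:
 assumes L: "clinear_map (cvec r) (cvec s) L" and K: "clinear_map (cvec s) (cvec r) K"
  and KL: "\<And>x. x \<in> carrier (cvec r) ==> K (L x) = x" and LK: "\<And>x. x \<in> carrier (cvec s) ==> L (K x) = x"
 shows "r = s"
proof -
 have Lc: "L (cunit r k) \<in> carrier (cvec s)" for k using L cunit_carrier[of r k] unfolding clinear_map_def by blast
 have Kc: "K (cunit s k) \<in> carrier (cvec r)" for k using K cunit_carrier[of s k] unfolding clinear_map_def by blast
 have "(\<Sum>i<s. K (cunit s i) k * L (cunit r k) i) = 1" if "k < r" for k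
  using clinear_map_expand[OF K Lc that, of k] KL[OF cunit_carrier, of k] that by (simp add: cunit_def[of r])
 then have "of_nat r = (\<Sum>k<r. \<Sum>i<s. K (cunit s i) k * L (cunit r k) i)" by simp
 also have "\<dots> = (\<Sum>i<s. \<Sum>k<r. L (cunit r k) i * K (cunit s i) k)"
  by (subst sum.swap) (simp add: mult.commute)
 also have "\<dots> = of_nat s"
 proof -
  have "(\<Sum>k<r. L (cunit r k) i * K (cunit s i) k) = 1" if "i < s" for i
   using clinear_map_expand[OF L Kc that, of i] LK[OF cunit_carrier, of i] that by (simp add: cunit_def[of s])
  then show ?thesis by simp
 qed
 finally show ?thesis by simp
qed

locale coordinates =
 fixes M :: "(complex, 'v) module" and r :: nat and u :: "'v => nat => complex"
 assumes M: "cvector_space M" and u: "clinear_map M (cvec r) u" and bij: "bij_betw u (carrier M) (carrier (cvec r))"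
begin

sublocale M: module C_ring M by (rule M)

lemma u_inv: "x \<in> carrier (cvec r) ==> inv_into (carrier M) u x \<in> carrier M \<and> u (inv_into (carrier M) u x) = x"
 using bij by (simp add: bij_betw_def inv_into_into f_inv_into_f)

lemma inv_u: "x \<in> carrier M ==> inv_into (carrier M) u (u x) = x"
 using bij by (simp add: bij_betw_def)

lemma u_carrier: "x \<in> carrier M ==> u x \<in> carrier (cvec r)"
 using u by (auto simp: clinear_map_def)

lemma eqI: "x \<in> carrier M ==> y \<in> carrier M ==> (\<And>k. k < r ==> u x k = u y k) ==> x = y"
 using cvec_eqI[of "u x" r "u y"] u_carrier inv_u by metis

lemma u_add: "x \<in> carrier M ==> y \<in> carrier M ==> k < r ==> u (x \<oplus>\<^bsub>M\<^esub> y) k = u x k + u y k"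
 using u by (simp add: clinear_map_def)

lemma u_scale: "x \<in> carrier M ==> k < r ==> u (c \<odot>\<^bsub>M\<^esub> x) k = c * u x k"
 using u by (simp add: clinear_map_def)

lemma u_zero: "k < r ==> u \<zero>\<^bsub>M\<^esub> k = 0"
 using clinear_map_zero[OF M cvec_module u] by simp

lemmas u_finsum = clinear_map_finsum[OF M u]

lemma scale_closed: "x \<in> carrier M ==> c \<odot>\<^bsub>M\<^esub> x \<in> carrier M"
 using M.smult_closed by simp

lemma finite_dim: "finite_dim M"
proof -
 define b where "b k = inv_into (carrier M) u (cunit r k)" for k
 have b: "b k \<in> carrier M" "u (b k) = cunit r k" for k
  using u_inv[OF cunit_carrier] by (simp_all add: b_def)
 \<comment> \<open>\<open>finite_dim\<close> attaches coefficients to vectors rather than to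
   indices, so different indices have to give different vectors.\<close>
 have inj: "inj_on b {..<r}"
 proof (rule inj_onI)
  fix k l assume kl: "k \<in> {..<r}" "l \<in> {..<r}" "b k = b l"
  then have "cunit r k k = cunit r l k" by (simp only: b(2)[symmetric])
  then show "k = l" using kl by (simp add: cunit_def split: if_splits)
 qed
 have "\<exists>c. x = finsum M (\<lambda>b. c b \<odot>\<^bsub>M\<^esub> b) (b ` {..<r})" if x: "x \<in> carrier M" for x
 proof (intro exI eqI[OF x])
  let ?c = "\<lambda>y. u x (inv_into {..<r} b y)"
  show "finsum M (\<lambda>b. ?c b \<odot>\<^bsub>M\<^esub> b) (b ` {..<r}) \<in> carrier M"
   using b(1) scale_closed by (intro M.finsum_closed) auto
  fix k assume k: "k < r"
  have "u (finsum M (\<lambda>b. ?c b \<odot>\<^bsub>M\<^esub> b) (b ` {..<r})) k = (\<Sum>y\<in>b ` {..<r}. u (?c y \<odot>\<^bsub>M\<^esub> y) k)"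
   using b(1) scale_closed k by (intro u_finsum) auto
  also have "\<dots> = (\<Sum>l<r. u (u x l \<odot>\<^bsub>M\<^esub> b l) k)"
   by (subst sum.reindex[OF inj]) (simp add: inv_into_f_f[OF inj])
  also have "\<dots> = u x k" using k by (simp add: u_scale b cunit_nth mult_delta_right)
  finally show "u x k = u (finsum M (\<lambda>b. ?c b \<odot>\<^bsub>M\<^esub> b) (b ` {..<r})) k" by simp
 qed
 moreover have "b ` {..<r} \<subseteq> carrier M" using b by auto
 ultimately show ?thesis unfolding finite_dim_def by (intro exI[of _ "b ` {..<r}"]) simp
qed

text \<open>In a homogeneous basis graded pieces and filtration steps are all coordinate subspaces
  of this form, which turns statements about them into predicates on indices.\<close>

definition labelled :: "(nat => bool) => 'v set" where
 "labelled P = {x \<in> carrier M. \<forall>k<r. u x k \<noteq> 0 --> P k}"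

lemma labelled_submodule: "csubspace (labelled P) M"
proof -
 have m: "\<ominus>\<^bsub>M\<^esub> x = (-1) \<odot>\<^bsub>M\<^esub> x" if "x \<in> carrier M" for x
 proof -
  have "(-1) \<odot>\<^bsub>M\<^esub> x \<oplus>\<^bsub>M\<^esub> x = \<zero>\<^bsub>M\<^esub>"
   by (rule eqI) (use that in \<open>auto simp: u_add u_scale u_zero scale_closed\<close>)
  then show ?thesis using M.minus_equality[OF _ that scale_closed[OF that]] by simp
 qed
 show ?thesis
  by (rule M.submoduleI) (auto simp: labelled_def m u_add u_scale u_zero scale_closed)
qed

lemma sum_of_labelled:
 assumes q: "\<And>k. k < r ==> q k \<in> Q" and P: "P \<subseteq> Q" 
  and G: "\<And>p. p \<in> P ==> G p = labelled (\<lambda>k. q k = p)"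
 shows "sum_of_subspaces M G P = labelled (\<lambda>k. q k \<in> P)"
proof (intro equalityI subsetI)
 fix x assume "x \<in> sum_of_subspaces M G P"
 then obtain g F where x: "x = finsum M g F" and F: "finite F" "F \<subseteq> P" "\<forall>p\<in>F. g p \<in> G p"
  by (auto simp: sum_of_subspaces_def)
 have g: "g p \<in> labelled (\<lambda>k. q k = p)" if "p \<in> F" for p using F that G by blast
 then have gc: "g \<in> F \<rightarrow> carrier M" by (auto simp: labelled_def)
 show "x \<in> labelled (\<lambda>k. q k \<in> P)"
  unfolding labelled_def
 proof (intro CollectI conjI allI impI)
  show "x \<in> carrier M" using gc x by simp
  fix k assume k: "k < r" "u x k \<noteq> 0"
  then have "(\<Sum>p\<in>F. u (g p) k) \<noteq> 0" using u_finsum[OF F(1) gc k(1)] x by simp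
  then obtain p where "p \<in> F" "u (g p) k \<noteq> 0" by (meson sum.neutral)
  then show "q k \<in> P" using g k F(2) by (fastforce simp: labelled_def)
 qed
next
 fix x assume x: "x \<in> labelled (\<lambda>k. q k \<in> P)"
 then have xc: "x \<in> carrier M" by (simp add: labelled_def)
 define F where "F = q ` {k. k < r \<and> u x k \<noteq> 0}"
 define g where "g p = inv_into (carrier M) u (\<lambda>k\<in>{..<r}. if q k = p then u x k else 0)" for p
 have g: "g p \<in> carrier M" "u (g p) = (\<lambda>k\<in>{..<r}. if q k = p then u x k else 0)" for p
  using u_inv by (auto simp: g_def)
 have F: "finite F" "F \<subseteq> P" using x by (auto simp: F_def labelled_def)
 have "g p \<in> G p" if "p \<in> F" for p
  using g that F(2) G by (auto simp: labelled_def)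
 moreover have "finsum M g F = x"
 proof (rule eqI[OF _ xc])
  show "finsum M g F \<in> carrier M" using g by (intro M.finsum_closed) auto
  fix k assume k: "k < r"
  have "u (finsum M g F) k = (\<Sum>p\<in>F. if q k = p then u x k else 0)"
   using u_finsum[OF F(1) _ k, of g] g k by simp
  also have "\<dots> = u x k" using F(1) k by (auto simp: F_def)
  finally show "u (finsum M g F) k = u x k" .
 qed
 ultimately show "x \<in> sum_of_subspaces M G P"
  unfolding sum_of_subspaces_def using F by (intro CollectI exI[of _ g] exI[of _ F]) auto
qed

lemma grading_by_labels:
 assumes q: "\<And>k. k < r ==> q k \<in> Q"
 shows "is_grading M (\<lambda>p. labelled (\<lambda>k. q k = p)) Q"
 unfolding is_grading_def
proof (intro conjI ballI allI impI)
 show "csubspace (labelled (\<lambda>k. q k = p)) M" for p by (rule labelled_submodule)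
 have "sum_of_subspaces M (\<lambda>p. labelled (\<lambda>k. q k = p)) Q = labelled (\<lambda>k. q k \<in> Q)"
  by (rule sum_of_labelled) (use q in auto)
 also have "\<dots> = carrier M" using q by (auto simp: labelled_def)
 finally show "sum_of_subspaces M (\<lambda>p. labelled (\<lambda>k. q k = p)) Q = carrier M" .
 fix g F p
 assume F: "finite F \<and> F \<subseteq> Q \<and> (\<forall>p\<in>F. g p \<in> labelled (\<lambda>k. q k = p)) \<and> finsum M g F = \<zero>\<^bsub>M\<^esub>" and p: "p \<in> F"
 have g: "g \<in> F \<rightarrow> carrier M" using F by (auto simp: labelled_def)
 show "g p = \<zero>\<^bsub>M\<^esub>"
 proof (rule eqI)
  show "g p \<in> carrier M" using g p by auto
  fix k assume k: "k < r"
  show "u (g p) k = u \<zero>\<^bsub>M\<^esub> k"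
  proof (cases "q k = p")
   case True
   have "(\<Sum>p'\<in>F. u (g p') k) = u (g p) k"
   proof (rule sum.remove[THEN trans, of F p])
    have "(\<Sum>p'\<in>F - {p}. u (g p') k) = 0"
     using F k True by (intro sum.neutral) (auto simp: labelled_def)
    then show "u (g p) k + (\<Sum>p'\<in>F - {p}. u (g p') k) = u (g p) k" by simp
   qed (use F p in auto)
   then show ?thesis using u_finsum[of F g k] F g k by simp
  next
   case False
   then have "u (g p) k = 0" using F p k by (auto simp: labelled_def)
   then show ?thesis using k by (simp add: u_zero)
  qed
 qed simp
qed

end

section \<open>Homogeneous bases\<close>

definition spanned :: "(complex, 'v) module => 'v set => 'v set" where
 "spanned M H = {x. \<exists>c. x = finsum M (\<lambda>b. c b \<odot>\<^bsub>M\<^esub> b) H}"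

context
 fixes M :: "(complex, 'v) module"
 assumes M: "cvector_space M"
begin

interpretation M: module C_ring M by (rule M)

lemma smult_closed': "x \<in> carrier M ==> c \<odot>\<^bsub>M\<^esub> x \<in> carrier M"
 using M.smult_closed by simp

lemma finsum_smult': "finite H ==> g \<in> H \<rightarrow> carrier M ==> c \<odot>\<^bsub>M\<^esub> finsum M g H = finsum M (\<lambda>b. c \<odot>\<^bsub>M\<^esub> g b) H"
 using M.finsum_smult_ldistr[of H c g] by simp

lemma a_inv_scale: "x \<in> carrier M ==> \<ominus>\<^bsub>M\<^esub> x = (-1) \<odot>\<^bsub>M\<^esub> x"
 using M.smult_l_minus[of 1 x] M.smult_one[of x] cring.cring_simprules(18)[OF cring_C_ring, of 1]
  ring.ring_simprules(9)[OF cring.axioms(1)[OF cring_C_ring], of "-1"]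
 by (metis C_ring_sel(1,2,3,4) M.R.minus_equality UNIV_I add.left_inverse)

lemma spanned_submodule:
 assumes H: "finite H" "H \<subseteq> carrier M"
 shows "csubspace (spanned M H) M"
proof (rule M.submoduleI)
 have sc: "c b \<odot>\<^bsub>M\<^esub> b \<in> carrier M" if "b \<in> H" for c :: "'v => complex" and b using that H smult_closed' by auto
 show sub: "spanned M H \<subseteq> carrier M"
  using sc by (auto simp: spanned_def intro!: M.finsum_closed)
 have "finsum M (\<lambda>b. 0 \<odot>\<^bsub>M\<^esub> b) H = \<zero>\<^bsub>M\<^esub>"
  using M.finsum_cong'[of H H "\<lambda>_. \<zero>\<^bsub>M\<^esub>" "\<lambda>b. 0 \<odot>\<^bsub>M\<^esub> b"] H M.smult_l_null by auto
 then show "\<zero>\<^bsub>M\<^esub> \<in> spanned M H"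
  unfolding spanned_def by (intro CollectI exI[of _ "\<lambda>_. 0"]) (rule sym)
 show sm: "a \<odot>\<^bsub>M\<^esub> x \<in> spanned M H" if x: "x \<in> spanned M H" for a x
 proof -
  obtain c where c: "x = finsum M (\<lambda>b. c b \<odot>\<^bsub>M\<^esub> b) H" using x by (auto simp: spanned_def)
  have "a \<odot>\<^bsub>M\<^esub> x = finsum M (\<lambda>b. a \<odot>\<^bsub>M\<^esub> (c b \<odot>\<^bsub>M\<^esub> b)) H"
   unfolding c using sc by (intro finsum_smult' H) auto
  also have "\<dots> = finsum M (\<lambda>b. (a * c b) \<odot>\<^bsub>M\<^esub> b) H"
   using sc H M.smult_assoc1 by (intro M.finsum_cong') (auto intro: smult_closed')
  finally show ?thesis by (auto simp: spanned_def)
 qed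
 show "\<ominus>\<^bsub>M\<^esub> x \<in> spanned M H" if "x \<in> spanned M H" for x
  using sm[OF that] sub that by (auto simp: a_inv_scale)
 show "x \<oplus>\<^bsub>M\<^esub> y \<in> spanned M H" if xy: "x \<in> spanned M H" "y \<in> spanned M H" for x y
 proof -
  obtain c d where c: "x = finsum M (\<lambda>b. c b \<odot>\<^bsub>M\<^esub> b) H" "y = finsum M (\<lambda>b. d b \<odot>\<^bsub>M\<^esub> b) H"
   using xy unfolding spanned_def by blast
  have "x \<oplus>\<^bsub>M\<^esub> y = finsum M (\<lambda>b. c b \<odot>\<^bsub>M\<^esub> b \<oplus>\<^bsub>M\<^esub> d b \<odot>\<^bsub>M\<^esub> b) H"
   unfolding c using sc by (intro M.finsum_addf[symmetric]) auto
  also have "\<dots> = finsum M (\<lambda>b. (c b + d b) \<odot>\<^bsub>M\<^esub> b) H"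
   using H M.smult_l_distr by (intro M.finsum_cong') (auto intro: smult_closed')
  finally show ?thesis by (auto simp: spanned_def)
 qed
qed

lemma spanned_base:
 assumes H: "finite H" "H \<subseteq> carrier M" and b: "b \<in> H" shows "b \<in> spanned M H"
proof -
 have "finsum M (\<lambda>h. (if h = b then 1 else 0) \<odot>\<^bsub>M\<^esub> h) H = finsum M (\<lambda>h. if b = h then h else \<zero>\<^bsub>M\<^esub>) H"
  using H M.smult_l_null M.smult_one by (intro M.finsum_cong') auto
 also have "\<dots> = b" using H b by (intro M.finsum_singleton) auto
 finally show ?thesis
  unfolding spanned_def by (intro CollectI exI[of _ "\<lambda>h. if h = b then 1 else 0"]) (rule sym)
qed

lemma submodule_finsum:
 assumes W: "csubspace W M" and "finite F" "\<And>p. p \<in> F ==> g p \<in> W" shows "finsum M g F \<in> W"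
 using assms(2,3)
proof (induction F rule: finite_induct)
 case empty
 have "\<zero>\<^bsub>M\<^esub> \<in> W" using W M.submoduleE(2)[OF W] M.submoduleE(1,4)[OF W]
  by (metis C_ring_sel(1,3) M.smult_l_null UNIV_I all_not_in_conv subsetD)
 then show ?case by simp
next
 case (insert p F)
 then have "g \<in> F \<rightarrow> carrier M" "g p \<in> carrier M" using M.submoduleE(1)[OF W] by auto
 then show ?case using insert M.submoduleE(5)[OF W] by simp
qed

lemma spanned_least:
 assumes W: "csubspace W M" and H: "finite H" "H \<subseteq> W" shows "spanned M H \<subseteq> W"
proof
 fix x assume "x \<in> spanned M H"
 then obtain c where "x = finsum M (\<lambda>b. c b \<odot>\<^bsub>M\<^esub> b) H" unfolding spanned_def by blast
 moreover have "finsum M (\<lambda>b. c b \<odot>\<^bsub>M\<^esub> b) H \<in> W"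
  by (rule submodule_finsum[OF W H(1)]) (use H(2) M.submoduleE(4)[OF W] in auto)
 ultimately show "x \<in> W" by simp
qed

text \<open>The homogeneous components of finitely many spanning vectors are again finite in number
  and span.\<close>

lemma homogeneous_spanning_set:
 assumes fd: "finite_dim M" and G: "is_grading M G Q"
 shows "\<exists>H. finite H \<and> (\<forall>h\<in>H. \<exists>q\<in>Q. h \<in> G q) \<and> spanned M H = carrier M"
proof -
 obtain B where B: "finite B" "B \<subseteq> carrier M" "\<And>x. x \<in> carrier M ==> x \<in> spanned M B"
  using fd by (auto simp: finite_dim_def spanned_def)
 have GM: "G q \<subseteq> carrier M" if "q \<in> Q" for q
  using G that M.submoduleE(1) by (auto simp: is_grading_def)
 have "\<exists>g F. b = finsum M g F \<and> finite F \<and> F \<subseteq> Q \<and> (\<forall>q\<in>F. g q \<in> G q)" if "b \<in> B" for b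
 proof -
  have "b \<in> sum_of_subspaces M G Q" using that B(2) G by (auto simp: is_grading_def)
  then show ?thesis by (auto simp: sum_of_subspaces_def)
 qed
 then obtain g F where gF: "\<And>b. b \<in> B ==> b = finsum M (g b) (F b) \<and> finite (F b) \<and> F b \<subseteq> Q \<and> (\<forall>q\<in>F b. g b q \<in> G q)"
  by metis
 define H where "H = (\<Union>b\<in>B. g b ` F b)"
 have H: "finite H" "\<forall>h\<in>H. \<exists>q\<in>Q. h \<in> G q" using B(1) gF by (simp_all add: H_def) blast
 then have HM: "H \<subseteq> carrier M" using GM by blast
 have "B \<subseteq> spanned M H"
 proof
  fix b assume b: "b \<in> B"
  have "finsum M (g b) (F b) \<in> spanned M H"
   using b gF[OF b] by (intro submodule_finsum spanned_submodule H(1) HM spanned_base) (auto simp: H_def)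
  then show "b \<in> spanned M H" using gF[OF b] by simp
 qed
 then have "spanned M B \<subseteq> spanned M H" by (intro spanned_least spanned_submodule H(1) HM B(1))
 then have "spanned M H = carrier M"
  using B(3) M.submoduleE(1)[OF spanned_submodule[OF H(1) HM]] by blast
 then show ?thesis using H by blast
qed

text \<open>A nonzero coefficient would allow \<open>h\<close> to be expressed by the other vectors,
  so that a proper subset would still span.\<close>

lemma minimal_spanning_independent:
 assumes H: "finite H" "H \<subseteq> carrier M" "spanned M H = carrier M"
  and min: "\<And>H'. H' \<subset> H ==> spanned M H' \<noteq> carrier M"
  and c: "finsum M (\<lambda>b. c b \<odot>\<^bsub>M\<^esub> b) H = \<zero>\<^bsub>M\<^esub>" and h: "h \<in> H"
 shows "c h = 0"
proof (rule ccontr)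
 assume ch: "c h \<noteq> 0"
 let ?H = "H - {h}"
 have H': "finite ?H" "?H \<subseteq> carrier M" and hM: "h \<in> carrier M" using H h by auto
 have sc: "(\<lambda>b. d b \<odot>\<^bsub>M\<^esub> b) \<in> ?H \<rightarrow> carrier M" for d :: "'v => complex" using H' smult_closed' by auto
 let ?y = "finsum M (\<lambda>b. c b \<odot>\<^bsub>M\<^esub> b) ?H"
 have yW: "?y \<in> spanned M ?H" by (auto simp: spanned_def)
 have yM: "?y \<in> carrier M" using sc by simp
 have "finsum M (\<lambda>b. c b \<odot>\<^bsub>M\<^esub> b) (insert h ?H) = c h \<odot>\<^bsub>M\<^esub> h \<oplus>\<^bsub>M\<^esub> ?y"
  using H' sc hM smult_closed' by (intro M.finsum_insert) auto
 then have "c h \<odot>\<^bsub>M\<^esub> h \<oplus>\<^bsub>M\<^esub> ?y = \<zero>\<^bsub>M\<^esub>" using c h by (simp add: insert_absorb)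
 then have "c h \<odot>\<^bsub>M\<^esub> h = \<ominus>\<^bsub>M\<^esub> ?y" using M.minus_equality[OF _ yM smult_closed'[OF hM]] by simp
 then have "(1 / c h) \<odot>\<^bsub>M\<^esub> (c h \<odot>\<^bsub>M\<^esub> h) = (1 / c h) \<odot>\<^bsub>M\<^esub> (\<ominus>\<^bsub>M\<^esub> ?y)" by simp
 moreover have "(1 / c h) \<odot>\<^bsub>M\<^esub> (c h \<odot>\<^bsub>M\<^esub> h) = h"
  using M.smult_assoc1[of "1 / c h" "c h" h] hM ch M.smult_one by simp
 moreover have "(1 / c h) \<odot>\<^bsub>M\<^esub> (\<ominus>\<^bsub>M\<^esub> ?y) \<in> spanned M ?H"
  using M.submoduleE(3,4)[OF spanned_submodule[OF H']] yW by auto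
 ultimately have "h \<in> spanned M ?H" by simp
 then have "H \<subseteq> spanned M ?H" using spanned_base[OF H'] by auto
 then have "carrier M \<subseteq> spanned M ?H"
  using spanned_least[OF spanned_submodule[OF H'] H(1)] H(3) by simp
 then have "spanned M ?H = carrier M" using M.submoduleE(1)[OF spanned_submodule[OF H']] by blast
 then show False using min[of ?H] h by blast
qed

text \<open>A homogeneous spanning set of least cardinality is a basis, and its degrees serve as
  labels. Directness of the grading then makes each \<open>G p\<close> no larger than the span of
  the basis vectors labelled \<open>p\<close>.\<close>

lemma homogeneous_coordinates:
 assumes fd: "finite_dim M" and G: "is_grading M G Q"
 shows "\<exists>r u q. coordinates M r u \<and> (\<forall>k<r. q k \<in> Q) \<and>
   (\<forall>P\<subseteq>Q. sum_of_subspaces M G P = coordinates.labelled M r u (\<lambda>k. q k \<in> P))"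
proof -
 define good where "good H \<longleftrightarrow> finite H \<and> (\<forall>h\<in>H. \<exists>q\<in>Q. h \<in> G q) \<and> spanned M H = carrier M" for H
 have Gs: "csubspace (G p) M" if "p \<in> Q" for p using G that by (auto simp: is_grading_def)
 have GM: "G q \<subseteq> carrier M" if "q \<in> Q" for q using M.submoduleE(1)[OF Gs[OF that]] .
 obtain H where H: "good H" "\<And>H'. good H' ==> card H \<le> card H'"
 proof -
  obtain H0 where "good H0" using homogeneous_spanning_set[OF fd G] unfolding good_def by blast
  then show thesis using that ex_has_least_nat[of good H0 card] by blast
 qed
 have fin: "finite H" and hom: "\<And>h. h \<in> H ==> \<exists>q\<in>Q. h \<in> G q" and span: "spanned M H = carrier M"
  using H(1) by (auto simp: good_def)
 have HM: "H \<subseteq> carrier M" using hom GM by blast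
 have min: "spanned M H' \<noteq> carrier M" if "H' \<subset> H" for H'
 proof
  assume "spanned M H' = carrier M"
  then have "good H'" using that fin hom finite_subset unfolding good_def by blast
  then have "card H \<le> card H'" by (rule H(2))
  then show False using psubset_card_mono[OF fin that] by simp
 qed
 define r where "r = card H"
 obtain h where h: "bij_betw h {..<r} H"
  using ex_bij_betw_nat_finite[OF fin] by (auto simp: r_def atLeast0LessThan)
 have hH: "h k \<in> H" "h k \<in> carrier M" if "k < r" for k using h that HM by (auto simp: bij_betw_def)
 have "\<forall>k<r. \<exists>q\<in>Q. h k \<in> G q" using hom hH by blast
 then obtain q where q: "\<And>k. k < r ==> q k \<in> Q" "\<And>k. k < r ==> h k \<in> G (q k)" by metis
 \<comment> \<open>Linear combinations of the basis; the coordinate map \<open>u\<close> is built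
   below as the inverse of \<open>w\<close>.\<close>
 define w where "w c = finsum M (\<lambda>k. c k \<odot>\<^bsub>M\<^esub> h k) {..<r}" for c :: "nat => complex"
 have wc: "w c \<in> carrier M" for c using hH smult_closed' by (auto simp: w_def)
 have w_reidx: "finsum M (\<lambda>b. d b \<odot>\<^bsub>M\<^esub> b) H = w (\<lambda>k. d (h k))" for d
 proof -
  have "finsum M (\<lambda>b. d b \<odot>\<^bsub>M\<^esub> b) (h ` {..<r}) = finsum M (\<lambda>k. d (h k) \<odot>\<^bsub>M\<^esub> h k) {..<r}"
   using h hH smult_closed' by (intro M.finsum_reindex) (auto simp: bij_betw_def)
  then show ?thesis using h by (simp add: w_def bij_betw_def)
 qed
 have w_lin: "w (\<lambda>k. c k + a * d k) = w c \<oplus>\<^bsub>M\<^esub> a \<odot>\<^bsub>M\<^esub> w d" for c d a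
 proof -
  have "a \<odot>\<^bsub>M\<^esub> w d = finsum M (\<lambda>k. a \<odot>\<^bsub>M\<^esub> (d k \<odot>\<^bsub>M\<^esub> h k)) {..<r}"
   unfolding w_def using hH smult_closed' by (intro finsum_smult') auto
  then have "w c \<oplus>\<^bsub>M\<^esub> a \<odot>\<^bsub>M\<^esub> w d = finsum M (\<lambda>k. c k \<odot>\<^bsub>M\<^esub> h k \<oplus>\<^bsub>M\<^esub> a \<odot>\<^bsub>M\<^esub> (d k \<odot>\<^bsub>M\<^esub> h k)) {..<r}"
   unfolding w_def using hH smult_closed' by (subst M.finsum_addf) auto
  also have "\<dots> = w (\<lambda>k. c k + a * d k)"
   unfolding w_def using hH smult_closed' M.smult_l_distr M.smult_assoc1
   by (intro M.finsum_cong') auto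
  finally show ?thesis by simp
 qed
 have w_cong: "w c = w d" if "\<And>k. k < r ==> c k = d k" for c d
  unfolding w_def using that hH smult_closed' by (intro M.finsum_cong') auto
 have w_zero: "c k = 0" if "w c = \<zero>\<^bsub>M\<^esub>" "k < r" for c k
 proof -
  let ?d = "\<lambda>b. c (inv_into {..<r} h b)"
  have inv: "inv_into {..<r} h (h k) = k" if "k < r" for k using h that by (simp add: bij_betw_def)
  have "finsum M (\<lambda>b. ?d b \<odot>\<^bsub>M\<^esub> b) H = w c"
   unfolding w_reidx by (rule w_cong) (simp add: inv)
  then have "?d (h k) = 0"
   using minimal_spanning_independent[OF fin HM span min _ hH(1)[OF that(2)], of ?d] that(1) by simp
  then show ?thesis by (simp add: inv[OF that(2)])
 qed
 have w_inj: "c k = d k" if "w c = w d" "k < r" for c d k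
 proof -
  have "w (\<lambda>k. c k + (-1) * d k) = w d \<oplus>\<^bsub>M\<^esub> (-1) \<odot>\<^bsub>M\<^esub> w d" unfolding w_lin that(1) ..
  also have "\<dots> = \<zero>\<^bsub>M\<^esub>" using M.r_neg[OF wc[of d]] a_inv_scale[OF wc[of d]] by simp
  finally show ?thesis using w_zero[OF _ that(2)] by force
 qed
 have w_surj: "\<exists>c. x = w c" if "x \<in> carrier M" for x
 proof -
  have "x \<in> spanned M H" using that span by simp
  then show ?thesis unfolding spanned_def w_reidx by blast
 qed
 define u where "u x = (\<lambda>k\<in>{..<r}. (SOME c. x = w c) k)" for x
 have wu: "w (u x) = x" if "x \<in> carrier M" for x
 proof -
  have "x = w (SOME c. x = w c)" by (rule someI_ex[OF w_surj[OF that]])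
  also have "\<dots> = w (u x)" by (rule w_cong) (simp add: u_def)
  finally show ?thesis by simp
 qed
 have uw: "u (w c) k = c k" if "k < r" for c k using w_inj[OF wu[OF wc] that] .
 have uC: "u x \<in> carrier (cvec r)" for x by (simp add: u_def)
 have ulin: "u (x \<oplus>\<^bsub>M\<^esub> a \<odot>\<^bsub>M\<^esub> y) k = u x k + a * u y k" if "x \<in> carrier M" "y \<in> carrier M" "k < r" for x y a k
  using uw[OF that(3), of "\<lambda>k. u x k + a * u y k"] w_lin[of "u x" a "u y"] wu[OF that(1)] wu[OF that(2)] by simp
 have "coordinates M r u"
 proof (rule coordinates.intro)
  show "cvector_space M" by (rule M)
  have z: "\<zero>\<^bsub>M\<^esub> \<in> carrier M" by simp
  have u0: "u \<zero>\<^bsub>M\<^esub> k = 0" if "k < r" for k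
   using w_zero[of "u \<zero>\<^bsub>M\<^esub>"] wu[OF z] that by simp
  have "u (x \<oplus>\<^bsub>M\<^esub> y) = u x \<oplus>\<^bsub>cvec r\<^esub> u y" if "x \<in> carrier M" "y \<in> carrier M" for x y
  proof (rule cvec_eqI[OF uC])
   show "u (x \<oplus>\<^bsub>M\<^esub> y) k = (u x \<oplus>\<^bsub>cvec r\<^esub> u y) k" if k: "k < r" for k
    using ulin[OF \<open>x \<in> carrier M\<close> \<open>y \<in> carrier M\<close> k, of 1] M.smult_one[OF \<open>y \<in> carrier M\<close>] k by simp
  qed simp
  moreover have "u (c \<odot>\<^bsub>M\<^esub> x) = c \<odot>\<^bsub>cvec r\<^esub> u x" if "x \<in> carrier M" for x c
  proof (rule cvec_eqI[OF uC])
   show "u (c \<odot>\<^bsub>M\<^esub> x) k = (c \<odot>\<^bsub>cvec r\<^esub> u x) k" if k: "k < r" for k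
    using ulin[OF z \<open>x \<in> carrier M\<close> k, of c] M.l_zero[OF smult_closed'[OF \<open>x \<in> carrier M\<close>]] u0[OF k] k by simp
  qed simp
  ultimately show "clinear_map M (cvec r) u" using uC by (simp add: clinear_map_def)
  have "inj_on u (carrier M)" by (rule inj_onI) (metis wu)
  moreover have "c \<in> u ` carrier M" if c: "c \<in> carrier (cvec r)" for c
  proof -
   have "c = u (w c)" by (rule cvec_eqI[OF c uC]) (simp add: uw)
   then show ?thesis using wc by blast
  qed
  ultimately show "bij_betw u (carrier M) (carrier (cvec r))" using uC by (auto simp: bij_betw_def)
 qed
 then interpret co: coordinates M r u .
 have sub: "co.labelled (\<lambda>k. q k = p) \<subseteq> G p" if p: "p \<in> Q" for p
 proof
  fix x assume x: "x \<in> co.labelled (\<lambda>k. q k = p)"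
  have "u x k \<odot>\<^bsub>M\<^esub> h k \<in> G p" if k: "k < r" for k
  proof (cases "u x k = 0")
   case True
   then have "u x k \<odot>\<^bsub>M\<^esub> h k = \<zero>\<^bsub>M\<^esub>" using M.smult_l_null hH[OF k] by simp
   then show ?thesis using submodule_finsum[OF Gs[OF p], of "{}"] by simp
  next
   case False
   then have "q k = p" using x k by (simp add: co.labelled_def)
   then show ?thesis using q(2)[OF k] M.submoduleE(4)[OF Gs[OF p]] by auto
  qed
  then have "w (u x) \<in> G p" unfolding w_def by (intro submodule_finsum Gs p) auto
  then show "x \<in> G p" using wu x by (simp add: co.labelled_def)
 qed
 have eq: "G p = co.labelled (\<lambda>k. q k = p)" if p: "p \<in> Q" for p
 proof
  show "co.labelled (\<lambda>k. q k = p) \<subseteq> G p" by (rule sub[OF p])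
  show "G p \<subseteq> co.labelled (\<lambda>k. q k = p)"
  proof
   fix x assume x: "x \<in> G p"
   then have xM: "x \<in> carrier M" using GM[OF p] by blast
   then have "x \<in> co.labelled (\<lambda>k. q k \<in> Q)" using q(1) by (simp add: co.labelled_def)
   then have "x \<in> sum_of_subspaces M (\<lambda>p. co.labelled (\<lambda>k. q k = p)) Q"
    using co.sum_of_labelled[of q Q Q "\<lambda>p. co.labelled (\<lambda>k. q k = p)"] q(1) by simp
   then obtain g F where xg: "x = finsum M g F" and F: "finite F" "F \<subseteq> Q" "\<forall>p\<in>F. g p \<in> co.labelled (\<lambda>k. q k = p)"
    by (auto simp: sum_of_subspaces_def)
   \<comment> \<open>The component of degree \<open>p\<close> of \<open>x\<close> in the basis.
     Replacing it by \<open>y - x\<close> gives homogeneous vectors with sum 0, so by directness all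
     other components of \<open>x\<close> vanish.\<close>
   define y where "y = (if p \<in> F then g p else \<zero>\<^bsub>M\<^esub>)"
   define d where "d p' = (if p' = p then y \<oplus>\<^bsub>M\<^esub> (-1) \<odot>\<^bsub>M\<^esub> x else g p')" for p'
   have gM: "g p' \<in> carrier M" if "p' \<in> F" for p' using F that by (auto simp: co.labelled_def)
   have yM: "y \<in> carrier M" using gM by (simp add: y_def)
   have "g p' \<in> G p'" if "p' \<in> F" for p' using F sub that by blast
   moreover have "\<zero>\<^bsub>M\<^esub> \<in> G p" using submodule_finsum[OF Gs[OF p], of "{}"] by simp
   ultimately have "y \<in> G p" by (simp add: y_def)
   then have "y \<oplus>\<^bsub>M\<^esub> (-1) \<odot>\<^bsub>M\<^esub> x \<in> G p"
    using x M.submoduleE(4,5)[OF Gs[OF p]] by auto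
   then have dG: "d p' \<in> G p'" if "p' \<in> insert p F" for p'
    using that \<open>\<And>p'. p' \<in> F ==> g p' \<in> G p'\<close> by (auto simp: d_def)
   have dM: "d p' \<in> carrier M" if "p' \<in> insert p F" for p'
    using that gM yM xM smult_closed' by (auto simp: d_def)
   have "finsum M d (insert p (F - {p})) = d p \<oplus>\<^bsub>M\<^esub> finsum M d (F - {p})"
    using F(1) dM by (intro M.finsum_insert) auto
   also have "finsum M d (F - {p}) = finsum M g (F - {p})"
    using gM by (intro M.finsum_cong') (auto simp: d_def)
   also have "d p \<oplus>\<^bsub>M\<^esub> finsum M g (F - {p}) = (y \<oplus>\<^bsub>M\<^esub> finsum M g (F - {p})) \<oplus>\<^bsub>M\<^esub> (-1) \<odot>\<^bsub>M\<^esub> x"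
   proof -
    have fM: "finsum M g (F - {p}) \<in> carrier M" using gM by (intro M.finsum_closed) auto
    show ?thesis using yM fM smult_closed'[OF xM, of "-1"] by (simp add: d_def M.a_ac)
   qed
   also have "y \<oplus>\<^bsub>M\<^esub> finsum M g (F - {p}) = x"
   proof (cases "p \<in> F")
    case True
    have "finsum M g (insert p (F - {p})) = g p \<oplus>\<^bsub>M\<^esub> finsum M g (F - {p})"
     using F(1) gM True by (intro M.finsum_insert) auto
    then show ?thesis using True xg by (simp add: y_def insert_absorb)
   next
    case False
    then show ?thesis using xg xM by (simp add: y_def)
   qed
   also have "x \<oplus>\<^bsub>M\<^esub> (-1) \<odot>\<^bsub>M\<^esub> x = \<zero>\<^bsub>M\<^esub>" using M.r_neg[OF xM] a_inv_scale[OF xM] by simp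
   finally have "finsum M d (insert p F) = \<zero>\<^bsub>M\<^esub>" by simp
   then have d0: "d p' = \<zero>\<^bsub>M\<^esub>" if "p' \<in> insert p F" for p'
    using G F(1,2) p dG that unfolding is_grading_def by blast
   have g0: "g p' = \<zero>\<^bsub>M\<^esub>" if "p' \<in> F" "p' \<noteq> p" for p' using d0[of p'] that by (simp add: d_def)
   show "x \<in> co.labelled (\<lambda>k. q k = p)"
    unfolding co.labelled_def
   proof (intro CollectI conjI allI impI xM)
    fix k assume k: "k < r" "u x k \<noteq> 0"
    have "u x k = (\<Sum>p'\<in>F. u (g p') k)" unfolding xg using gM k by (intro co.u_finsum F(1)) auto
    then obtain p' where p': "p' \<in> F" "u (g p') k \<noteq> 0" using k by (metis (no_types, lifting) sum.neutral)
    then have "p' = p" using g0 co.u_zero[OF k(1)] by metis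
    then show "q k = p" using p' F(3) k(1) by (auto simp: co.labelled_def)
   qed
  qed
 qed
 have "sum_of_subspaces M G P = co.labelled (\<lambda>k. q k \<in> P)" if "P \<subseteq> Q" for P
  by (rule co.sum_of_labelled[of q Q P G]) (use q that eq in auto)
 then show ?thesis using \<open>coordinates M r u\<close> q(1) by blast
qed

end

section \<open>Klyachko bundles\<close>

lemma coordinates_compose:
 assumes w: "coordinates M r w" and N: "cvector_space N" and t: "clinear_map N M t" "bij_betw t (carrier N) (carrier M)"
 shows "coordinates N r (\<lambda>x. w (t x))"
proof (rule coordinates.intro[OF N])
 interpret w: coordinates M r w by (rule w)
 show "clinear_map N (cvec r) (\<lambda>x. w (t x))" by (rule clinear_map_compose[OF t(1) w.u])
 show "bij_betw (\<lambda>x. w (t x)) (carrier N) (carrier (cvec r))"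
  using bij_betw_trans[OF t(2) w.bij] by (simp add: o_def)
qed

lemma fiber_sel [simp]:
 "carrier (fiber E x) = part_over E {x}" "\<zero>\<^bsub>fiber E x\<^esub> = fzero E x"
 "e \<oplus>\<^bsub>fiber E x\<^esub> e' = fadd E e e'" "c \<odot>\<^bsub>fiber E x\<^esub> e = fscale E c e"
 by (simp_all add: fiber_def)

type_synonym ('m, 'n, 'e, 'z) toric_scheme = "((complex ^ 'm) set, complex ^ 'n, 'e, 'z) eq_bundle_scheme"

text \<open>\<open>tm\<close> equips the total space of a bundle with an atlas; in the topological case the atlas is
 irrelevant.\<close>

locale toric_bundles = toric \<Sigma> \<beta>
 for \<Sigma> :: "'m::finite set set" and \<beta> :: "'m => rr ^ 'n" +
 fixes b :: bool and tm :: "('m, 'n, 'e, 'z) toric_scheme => ('e, nat) mfd"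
 assumes mtop_tm [simp]: "mtop (tm E) = total E"
begin

definition triv :: "('m, 'n, 'e, 'z) toric_scheme => nat => (complex ^ 'm) set set =>
  ('e => (complex ^ 'm) set \<times> (nat => complex)) => bool" where
 "triv E r U \<Phi> \<longleftrightarrow>
   reg_diffeo b (open_submfd (tm E) (part_over E U)) (prod_mfd (open_submfd Xm U) (cspace_mfd {..<r})) \<Phi> \<and>
   linear_over E r U \<Phi>"

definition kly :: "nat => ('m, 'n, 'e, 'z) toric_scheme => bool" where
 "kly r E \<longleftrightarrow> reg_mfd b (tm E) \<and> reg_map b (tm E) Xm (proj E) \<and>
   (\<forall>x\<in>topspace Xtop. cvector_space (fiber E x)) \<and>
   (\<forall>x\<in>topspace Xtop. \<exists>U \<Phi>. openin Xtop U \<and> x \<in> U \<and> triv E r U \<Phi>) \<and>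
   equivariant act E \<and>
   reg_map b (prod_mfd (vec_mfd torus) (tm E)) (tm E) (\<lambda>(g, e). gact E g e) \<and>
   (\<forall>I\<in>\<Sigma>. \<exists>\<Phi>. triv E r (UI I) \<Phi> \<and> diagonalizes E r (UI I) \<Phi>)"

text \<open>The abstract characters of \<open>diagonalizes\<close> are replaced by exponents
  \<open>\<alpha> k\<close>, available through the classification of continuous characters; these
  weights determine the filtrations.\<close>

definition ctriv :: "('m, 'n, 'e, 'z) toric_scheme => nat => 'm set =>
  ('e => (complex ^ 'm) set \<times> (nat => complex)) => (nat => rr ^ 'n) => bool" where
 "ctriv E r I \<Phi> \<alpha> \<longleftrightarrow> triv E r (UI I) \<Phi> \<and>
   (\<forall>k<r. \<forall>g\<in>torus. \<forall>e\<in>part_over E (UI I). snd (\<Phi> (gact E g e)) k = chi (\<alpha> k) g * snd (\<Phi> e) k)"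

definition inv_triv :: "('m, 'n, 'e, 'z) toric_scheme => 'm set =>
  ('e => (complex ^ 'm) set \<times> (nat => complex)) => (complex ^ 'm) set \<times> (nat => complex) => 'e" where
 "inv_triv E I \<Phi> = inv_into (part_over E (UI I)) \<Phi>"

text \<open>No trivialization enters, so morphisms preserve the filtration by composing
  \<open>S\<close> with them. Requiring \<open>S\<close> to lie over \<open>pcurve i\<close> places
  its value at 0 over the \<open>i\<close>-th divisor.\<close>

definition fil :: "('m, 'n, 'e, 'z) toric_scheme => 'm => rr => 'e set" where
 "fil E i \<mu> = {e \<in> part_over E {x0}. \<exists>S. reg_map b (cspace_mfd {()}) (tm E) S \<and>
   (\<forall>c. proj E (S c) = pcurve i (c ())) \<and>
   (\<forall>c. c () \<noteq> 0 --> S c = fscale E (rpow (c ()) (- \<mu>)) (gact E (lam (\<beta> i) (c ())) e))}"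

definition hom :: "('m, 'n, 'e, 'z) toric_scheme =>
  ('m, 'n, 'e, 'z) toric_scheme => ('e => 'e) set" where
 "hom E F = {f. equivariant_morphism E F f \<and> reg_map b (tm E) (tm F) f}"

lemma UI_topspace: "I \<in> \<Sigma> ==> UI I \<subseteq> topspace Xtop"
 using openin_subset[OF openin_toric_open] .

lemma x0_topspace: "x0 \<in> topspace Xtop"
 using x0_open UI_topspace[OF empty_in] by blast

lemma part_over_mono: "U \<subseteq> V ==> part_over E U \<subseteq> part_over E V"
 by (auto simp: part_over_def)

lemma part_over_fiber: "e \<in> part_over E U ==> e \<in> part_over E {proj E e}"
 by (simp add: part_over_def)

section \<open>Trivializations with explicit weights\<close>

context
 fixes E :: "('m, 'n, 'e, 'z) toric_scheme" and r
 assumes E: "kly r E"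
begin

lemma kly_mfd: "reg_mfd b (tm E)" using E by (simp add: kly_def)
lemma kly_proj: "reg_map b (tm E) Xm (proj E)" using E by (simp add: kly_def)
lemma kly_fiber: "x \<in> topspace Xtop ==> cvector_space (fiber E x)" using E by (simp add: kly_def)
lemma kly_equivariant: "equivariant act E" using E by (simp add: kly_def)

lemma kly_proj_in: "e \<in> topspace (total E) ==> proj E e \<in> topspace Xtop"
 using reg_map_in_topspace[OF kly_proj] by simp

lemma kly_part_open: "openin Xtop U ==> openin (total E) (part_over E U)"
 using preim_open[of "tm E" Xm "proj E" U] reg_map_continuous[OF kly_proj] by (simp add: preim_def part_over_def)

lemma kly_ctriv: "I \<in> \<Sigma> ==> \<exists>\<Phi> \<alpha>. ctriv E r I \<Phi> \<alpha>"
proof -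
 assume "I \<in> \<Sigma>"
 then obtain \<Phi> c where \<Phi>: "triv E r (UI I) \<Phi>" and c: "\<forall>k<r. continuous_character (c k)"
  "\<forall>g\<in>torus. \<forall>e\<in>part_over E (UI I). \<forall>k<r. snd (\<Phi> (gact E g e)) k = c k g * snd (\<Phi> e) k"
  using E unfolding kly_def diagonalizes_def by blast
 have "\<forall>k<r. \<exists>\<alpha>. \<forall>g\<in>torus. c k g = chi \<alpha> g" using c(1) continuous_character_chi by blast
 then obtain \<alpha> where "\<And>k g. k < r ==> g \<in> torus ==> c k g = chi (\<alpha> k) g" by metis
 then have "ctriv E r I \<Phi> \<alpha>" using \<Phi> c(2) by (simp add: ctriv_def)
 then show ?thesis by blast
qed

lemma gact_total: "g \<in> torus ==> e \<in> topspace (total E) ==> gact E g e \<in> topspace (total E)"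
 and gact_one: "e \<in> topspace (total E) ==> gact E 1 e = e"
 and gact_mult: "g \<in> torus ==> h \<in> torus ==> e \<in> topspace (total E) ==> gact E (g * h) e = gact E g (gact E h e)"
 and gact_proj: "g \<in> torus ==> e \<in> topspace (total E) ==> proj E (gact E g e) = act g (proj E e)"
 using kly_equivariant by (simp_all add: equivariant_def)

lemma gact_part: "g \<in> torus ==> e \<in> part_over E (UI I) ==> gact E g e \<in> part_over E (UI I)"
 by (simp add: part_over_def gact_total gact_proj act_UI)

lemma fscale_part: "e \<in> part_over E {x} ==> fscale E c e \<in> part_over E {x}"
proof -
 assume e: "e \<in> part_over E {x}"
 then have "x \<in> topspace Xtop" using kly_proj_in by (auto simp: part_over_def)
 then interpret module C_ring "fiber E x" by (rule kly_fiber)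
 show ?thesis using smult_closed[of c e] e by simp
qed

context
 fixes I \<Phi> \<alpha>
 assumes I: "I \<in> \<Sigma>" and ct: "ctriv E r I \<Phi> \<alpha>"
begin

private abbreviation "U \<equiv> UI I"
private abbreviation "P \<equiv> part_over E (UI I)"
private abbreviation "\<Psi> \<equiv> inv_triv E I \<Phi>"

lemma triv_topspaces:
 "tspace (open_submfd (tm E) P) = P"
 "tspace (prod_mfd (open_submfd Xm U) (cspace_mfd {..<r})) = U \<times> carrier (cvec r)"
 using UI_topspace[OF I] by (auto simp: part_over_def)

lemma triv_bij: "bij_betw \<Phi> P (U \<times> carrier (cvec r))"
 using ct triv_topspaces by (simp add: ctriv_def triv_def reg_diffeo_def del: cvec_sel)

lemma triv_fst: "e \<in> P ==> fst (\<Phi> e) = proj E e"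
 using ct by (simp add: ctriv_def triv_def linear_over_def)

lemma triv_snd: "e \<in> P ==> snd (\<Phi> e) \<in> carrier (cvec r)"
 using bspec[OF bij_betwE[OF triv_bij], of e] by (simp add: mem_Times_iff del: cvec_sel)

lemma triv_eq: "e \<in> P ==> \<Phi> e = (proj E e, snd (\<Phi> e))"
 by (metis triv_fst prod.collapse)

lemma inv_triv: "p \<in> U ==> v \<in> carrier (cvec r) ==> \<Psi> (p, v) \<in> P"
 "p \<in> U ==> v \<in> carrier (cvec r) ==> \<Phi> (\<Psi> (p, v)) = (p, v)"
 using triv_bij unfolding inv_triv_def bij_betw_def by (auto intro: inv_into_into simp: f_inv_into_f simp del: cvec_sel)

lemma inv_triv_proj: "p \<in> U ==> v \<in> carrier (cvec r) ==> proj E (\<Psi> (p, v)) = p"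
 using triv_fst[OF inv_triv(1), of p v] inv_triv(2)[of p v] by simp

lemma inv_triv_triv: "e \<in> P ==> \<Psi> (proj E e, snd (\<Phi> e)) = e"
 using triv_bij triv_eq unfolding inv_triv_def bij_betw_def by (metis inv_into_f_f)

lemma triv_inj: "e \<in> P ==> e' \<in> P ==> proj E e = proj E e' ==> (\<And>k. k < r ==> snd (\<Phi> e) k = snd (\<Phi> e') k) ==> e = e'"
 using cvec_eqI[OF triv_snd triv_snd, of e e'] inv_triv_triv by metis

lemma triv_coordinates: "x \<in> U ==> coordinates (fiber E x) r (\<lambda>e. snd (\<Phi> e))"
proof (rule coordinates.intro)
 assume x: "x \<in> U"
 show "cvector_space (fiber E x)" using UI_topspace[OF I] x by (intro kly_fiber) auto
 show "clinear_map (fiber E x) (cvec r) (\<lambda>e. snd (\<Phi> e))"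
  using ct x by (simp add: ctriv_def triv_def linear_over_def)
 have sub: "part_over E {x} \<subseteq> P" using x by (intro part_over_mono) simp
 show "bij_betw (\<lambda>e. snd (\<Phi> e)) (carrier (fiber E x)) (carrier (cvec r))"
  unfolding bij_betw_def
 proof
  show "inj_on (\<lambda>e. snd (\<Phi> e)) (carrier (fiber E x))"
  proof (rule inj_onI)
   fix e e' assume *: "e \<in> carrier (fiber E x)" "e' \<in> carrier (fiber E x)" "snd (\<Phi> e) = snd (\<Phi> e')"
   then have "proj E e = x" "proj E e' = x" by (auto simp: part_over_def)
   then show "e = e'" using * sub by (intro triv_inj) auto
  qed
  show "(\<lambda>e. snd (\<Phi> e)) ` carrier (fiber E x) = carrier (cvec r)"
  proof
   show "carrier (cvec r) \<subseteq> (\<lambda>e. snd (\<Phi> e)) ` carrier (fiber E x)"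
   proof
    fix v assume v: "v \<in> carrier (cvec r)"
    have "\<Psi> (x, v) \<in> carrier (fiber E x)"
     using inv_triv(1)[OF x v] inv_triv_proj[OF x v] by (simp add: part_over_def)
    moreover have "v = snd (\<Phi> (\<Psi> (x, v)))" using inv_triv(2)[OF x v] by simp
    ultimately show "v \<in> (\<lambda>e. snd (\<Phi> e)) ` carrier (fiber E x)" by blast
   qed
  qed (use sub triv_snd in \<open>auto simp del: cvec_sel\<close>)
 qed
qed

lemma triv_scale_act:
 assumes "e \<in> P" "g \<in> torus" "k < r"
 shows "snd (\<Phi> (fscale E c (gact E g e))) k = c * chi (\<alpha> k) g * snd (\<Phi> e) k"
proof -
 have g: "gact E g e \<in> P" by (rule gact_part[OF assms(2,1)])
 then have x: "proj E (gact E g e) \<in> U" by (simp add: part_over_def)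
 interpret coordinates "fiber E (proj E (gact E g e))" r "\<lambda>e. snd (\<Phi> e)" by (rule triv_coordinates[OF x])
 have "snd (\<Phi> (fscale E c (gact E g e))) k = c * snd (\<Phi> (gact E g e)) k"
  using u_scale[of "gact E g e" k c] part_over_fiber[OF g] assms(3) by simp
 then show ?thesis using ct assms by (simp add: ctriv_def)
qed

lemma triv_open: "openin Xtop U" by (rule openin_toric_open[OF I])

lemma regular_triv_coord: "k < r ==> regular b (tm E) P (\<lambda>e. snd (\<Phi> e) k)"
proof -
 assume k: "k < r"
 have oP: "openin (mtop (tm E)) P" using kly_part_open[OF triv_open] by simp
 have oU: "openin (mtop Xm) U" using triv_open by simp
 have M: "reg_mfd b (open_submfd (tm E) P)" by (rule reg_mfd_open_submfd[OF kly_mfd oP])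
 have XU: "reg_mfd b (open_submfd Xm U)" by (rule reg_mfd_open_submfd[OF reg_mfd_X oU])
 have C: "reg_mfd b (cspace_mfd {..<r})" by (rule reg_mfd_cspace) simp
 have m: "reg_map b (open_submfd (tm E) P) (prod_mfd (open_submfd Xm U) (cspace_mfd {..<r})) \<Phi>"
  using ct by (simp add: ctriv_def triv_def reg_diffeo_def)
 have "reg_map b (open_submfd (tm E) P) (cspace_mfd {..<r}) (\<lambda>e. snd (\<Phi> e))"
  by (rule reg_map_compose[OF M reg_mfd_prod[OF XU C] C m reg_map_snd[OF XU C]])
 then have "regular b (open_submfd (tm E) P) P (\<lambda>e. snd (\<Phi> e) k)"
  using k unfolding reg_map_into_cspace[OF M finite_lessThan] triv_topspaces by blast
 then show ?thesis using regular_submfd_iff[OF kly_mfd oP subset_refl] by blast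
qed

text \<open>Maps into the total space are produced from a map to the base and regular fibre
  coordinates.\<close>

lemma reg_map_via_triv:
 assumes M: "reg_mfd b M" and p: "reg_map b M Xm p" "\<And>x. x \<in> tspace M ==> p x \<in> U"
  and v: "\<And>k. k < r ==> regular b M (tspace M) (v k)"
 shows "reg_map b M (tm E) (\<lambda>x. \<Psi> (p x, \<lambda>k\<in>{..<r}. v k x))"
proof -
 have oP: "openin (mtop (tm E)) P" using kly_part_open[OF triv_open] by simp
 have oU: "openin (mtop Xm) U" using triv_open by simp
 have MP: "reg_mfd b (open_submfd (tm E) P)" by (rule reg_mfd_open_submfd[OF kly_mfd oP])
 have XU: "reg_mfd b (open_submfd Xm U)" by (rule reg_mfd_open_submfd[OF reg_mfd_X oU])
 have C: "reg_mfd b (cspace_mfd {..<r})" by (rule reg_mfd_cspace) simp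
 have "reg_diffeo b (open_submfd (tm E) P) (prod_mfd (open_submfd Xm U) (cspace_mfd {..<r})) \<Phi>"
  using ct by (simp add: ctriv_def triv_def)
 then have "reg_map b (prod_mfd (open_submfd Xm U) (cspace_mfd {..<r})) (open_submfd (tm E) P) \<Psi>"
  unfolding reg_diffeo_def triv_topspaces inv_triv_def by blast
 then have inv: "reg_map b (prod_mfd (open_submfd Xm U) (cspace_mfd {..<r})) (tm E) \<Psi>"
  unfolding reg_map_into_submfd[OF reg_mfd_prod[OF XU C] kly_mfd oP] by blast
 have 1: "reg_map b M (open_submfd Xm U) p"
  unfolding reg_map_into_submfd[OF M reg_mfd_X oU] using p by blast
 have 2: "reg_map b M (cspace_mfd {..<r}) (\<lambda>x. \<lambda>k\<in>{..<r}. v k x)"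
  unfolding reg_map_into_cspace[OF M finite_lessThan]
 proof (intro conjI ballI)
  fix k assume "k \<in> {..<r}"
  then show "regular b M (tspace M) (\<lambda>x. (\<lambda>k\<in>{..<r}. v k x) k)" using v by simp
 qed auto
 show ?thesis
  by (rule reg_map_compose[OF M reg_mfd_prod[OF XU C] kly_mfd reg_map_pair[OF M XU C 1 2] inv])
qed

text \<open>Each nonzero coordinate of the defining curve is a multiple of a single power of
  \<open>t\<close>. Necessity is then the extension criterion for powers; sufficiency extends all
  coordinates at once. The criterion thus holds in every diagonalizing trivialization over
  \<open>U\<^sub>I\<close> with \<open>i \<in> I\<close>.\<close>

lemma fil_iff:
 assumes i: "i \<in> I" and e: "e \<in> part_over E {x0}"
 shows "e \<in> fil E i \<mu> \<longleftrightarrow> (\<forall>k<r. snd (\<Phi> e) k \<noteq> 0 --> ge_reg b (pairing (\<alpha> k) (\<beta> i)) \<mu>)"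
proof
 let ?C = "cspace_mfd {()}"
 have C: "reg_mfd b ?C" by (rule reg_mfd_cspace) simp
 have tC: "tspace ?C = UNIV" by (auto simp: PiE_def extensional_def)
 have eP: "e \<in> P" using e x0_open by (auto simp: part_over_def)
 have ci: "snd (\<Phi> (fscale E (rpow t (- \<mu>)) (gact E (lam (\<beta> i) t) e))) k
   = rpow t (pairing (\<alpha> k) (\<beta> i) - \<mu>) * snd (\<Phi> e) k" if "t \<noteq> 0" "k < r" for t k
  using triv_scale_act[OF eP lam_torus[OF that(1)] that(2)] rpow_add[OF that(1), of "pairing (\<alpha> k) (\<beta> i)" "- \<mu>"]
  by (simp add: chi_lam[OF that(1)] mult.commute)
 {
  assume "e \<in> fil E i \<mu>"
  then obtain S where S: "reg_map b ?C (tm E) S" "\<And>c. proj E (S c) = pcurve i (c ())"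
   "\<And>c. c () \<noteq> 0 ==> S c = fscale E (rpow (c ()) (- \<mu>)) (gact E (lam (\<beta> i) (c ())) e)"
   by (auto simp: fil_def)
  show "\<forall>k<r. snd (\<Phi> e) k \<noteq> 0 --> ge_reg b (pairing (\<alpha> k) (\<beta> i)) \<mu>"
  proof (intro allI impI)
   fix k assume k: "k < r" and nz: "snd (\<Phi> e) k \<noteq> 0"
   have "S c \<in> P" for c
    using reg_map_in_topspace[OF S(1)] tC S(2) pcurve_UI[OF i] by (simp add: part_over_def)
   then have "preim ?C S P = UNIV" using tC by (auto simp: preim_def)
   then have "regular b ?C UNIV (\<lambda>c. snd (\<Phi> (S c)) k)"
    using regular_pullback[OF C kly_mfd S(1) regular_triv_coord[OF k]] by simp
   moreover have "c = (\<lambda>_. c ())" for c :: "unit => complex" by (simp add: fun_eq_iff)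
   ultimately have "regular b ?C UNIV (\<lambda>c. (\<lambda>t. snd (\<Phi> (S (\<lambda>_. t))) k) (c ()))" by simp
   then have "ge_reg b (pairing (\<alpha> k) (\<beta> i) - \<mu>) 0"
    by (rule extension_imp_ge[OF _ nz]) (simp add: S(3) ci k)
   then show "ge_reg b (pairing (\<alpha> k) (\<beta> i)) \<mu>" using ge_reg_diff by blast
  qed
 }
 {
  assume ge: "\<forall>k<r. snd (\<Phi> e) k \<noteq> 0 --> ge_reg b (pairing (\<alpha> k) (\<beta> i)) \<mu>"
  \<comment> \<open>The formula already contains the extension to \<open>c () = 0\<close>: there
    \<open>rpow\<close> is 1 for exponent 0 and 0 otherwise. Zero coordinates put no condition on
    their exponent.\<close>
  define v where "v k c = rpow (c ()) (pairing (\<alpha> k) (\<beta> i) - \<mu>) * snd (\<Phi> e) k" for k and c :: "unit => complex"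
  define S where "S c = \<Psi> (pcurve i (c ()), \<lambda>k\<in>{..<r}. v k c)" for c
  have oC: "openin (mtop ?C) (tspace ?C)" by (rule openin_topspace)
  have "regular b ?C (tspace ?C) (v k)" if "k < r" for k
  proof (cases "snd (\<Phi> e) k = 0")
   case True
   then show ?thesis using regular_const[OF oC] by (simp add: v_def[abs_def])
  next
   case False
   then have "ge_reg b (pairing (\<alpha> k) (\<beta> i) - \<mu>) 0" using ge that ge_reg_diff by blast
   then have "regular b ?C (tspace ?C) (\<lambda>c. rpow (c ()) (pairing (\<alpha> k) (\<beta> i) - \<mu>))"
    using regular_cspace_coord[of "{()}" "()" b] by (intro regular_creg[OF C creg_rpow_ge]) auto
   then show ?thesis unfolding v_def[abs_def] by (intro regular_mult regular_const oC)
  qed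
  then have "reg_map b ?C (tm E) S"
   unfolding S_def by (intro reg_map_via_triv C reg_map_pcurve pcurve_UI i)
  moreover have vc: "(\<lambda>k\<in>{..<r}. v k c) \<in> carrier (cvec r)" for c by simp
  have "proj E (S c) = pcurve i (c ())" for c
   unfolding S_def by (rule inv_triv_proj[OF pcurve_UI[OF i] vc])
  moreover have "S c = fscale E (rpow (c ()) (- \<mu>)) (gact E (lam (\<beta> i) (c ())) e)" if c: "c () \<noteq> 0" for c
  proof -
   let ?f = "fscale E (rpow (c ()) (- \<mu>)) (gact E (lam (\<beta> i) (c ())) e)"
   have g: "gact E (lam (\<beta> i) (c ())) e \<in> P" by (rule gact_part[OF lam_torus[OF c] eP])
   have f: "?f \<in> part_over E {proj E (gact E (lam (\<beta> i) (c ())) e)}" by (rule fscale_part[OF part_over_fiber[OF g]])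
   have pf: "proj E ?f = pcurve i (c ())"
    using f gact_proj[OF lam_torus[OF c]] e pcurve_act[OF c] by (auto simp: part_over_def)
   show ?thesis
   proof (rule triv_inj)
    show "S c \<in> P" unfolding S_def by (rule inv_triv(1)[OF pcurve_UI[OF i] vc])
    show "?f \<in> P" using f g by (auto simp: part_over_def)
    show "proj E (S c) = proj E ?f" using pf \<open>\<And>c. proj E (S c) = pcurve i (c ())\<close> by simp
    show "snd (\<Phi> (S c)) k = snd (\<Phi> ?f) k" if "k < r" for k
     unfolding S_def inv_triv(2)[OF pcurve_UI[OF i] vc] using that ci[OF c that] by (simp add: v_def)
   qed
  qed
  ultimately show "e \<in> fil E i \<mu>" using e by (auto simp: fil_def)
 }
qed

end

end

section \<open>Morphisms and their restriction to the base fibre\<close>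

lemma morphism_props:
 assumes "kly r E" "equivariant_morphism E F f" "reg_map b (tm E) (tm F) f"
 shows "\<And>e. e \<in> part_over E U ==> f e \<in> part_over F U"
  "\<And>e. e \<in> topspace (total E) ==> f e \<in> topspace (total F)"
  "\<And>e. e \<in> topspace (total E) ==> proj F (f e) = proj E e"
  "\<And>e g. e \<in> topspace (total E) ==> g \<in> torus ==> f (gact E g e) = gact F g (f e)"
  "\<And>e c. e \<in> topspace (total E) ==> f (fscale E c e) = fscale F c (f e)"
proof -
 show t: "f e \<in> topspace (total F)" if "e \<in> topspace (total E)" for e
  using reg_map_in_topspace[OF assms(3)] that by simp
 show p: "proj F (f e) = proj E e" if "e \<in> topspace (total E)" for e
  using assms(2) that by (simp add: equivariant_morphism_def)
 show "f e \<in> part_over F U" if "e \<in> part_over E U" for e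
  using that t p by (simp add: part_over_def)
 show "f (gact E g e) = gact F g (f e)" if "e \<in> topspace (total E)" "g \<in> torus" for e g
  using assms(2) that by (simp add: equivariant_morphism_def)
 show "f (fscale E c e) = fscale F c (f e)" if e: "e \<in> topspace (total E)" for e c
 proof -
  have "clinear_map (fiber E (proj E e)) (fiber F (proj E e)) f"
   using assms(2) e by (simp add: equivariant_morphism_def)
  then show ?thesis using e by (simp add: clinear_map_def part_over_def)
 qed
qed

lemma hom_fil:
 assumes E: "kly r E" and F: "kly s F" and f: "f \<in> hom E F" and e: "e \<in> fil E i \<mu>"
 shows "f e \<in> fil F i \<mu>"
proof -
 have f': "equivariant_morphism E F f" "reg_map b (tm E) (tm F) f" using f by (auto simp: hom_def)
 note mp = morphism_props[OF E f']
 obtain S where S: "reg_map b (cspace_mfd {()}) (tm E) S" "\<And>c. proj E (S c) = pcurve i (c ())"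
  "\<And>c. c () \<noteq> 0 ==> S c = fscale E (rpow (c ()) (- \<mu>)) (gact E (lam (\<beta> i) (c ())) e)"
  and e0: "e \<in> part_over E {x0}"
  using e by (auto simp: fil_def)
 have et: "e \<in> topspace (total E)" using e0 by (simp add: part_over_def)
 have C: "reg_mfd b (cspace_mfd {()})" by (rule reg_mfd_cspace) simp
 have St: "S c \<in> topspace (total E)" for c
  using reg_map_in_topspace[OF S(1), of c] by (simp add: PiE_def extensional_def)
 have "reg_map b (cspace_mfd {()}) (tm F) (\<lambda>c. f (S c))"
  by (rule reg_map_compose[OF C kly_mfd[OF E] kly_mfd[OF F] S(1) f'(2)])
 moreover have "proj F (f (S c)) = pcurve i (c ())" for c using mp(3)[OF St] S(2) by simp
 moreover have "f (S c) = fscale F (rpow (c ()) (- \<mu>)) (gact F (lam (\<beta> i) (c ())) (f e))" if c: "c () \<noteq> 0" for c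
  using S(3)[of c] c mp(5)[OF gact_total[OF E lam_torus[OF c] et]] mp(4)[OF et lam_torus[OF c]] by simp
 ultimately show ?thesis using mp(1)[OF e0] by (auto simp: fil_def)
qed

text \<open>Both maps are evaluated along the section through \<open>e\<close> with constant
  coordinates. The differences of the coordinates of the values are continuous functions on
  \<open>U\<^sub>I\<close> that vanish on the open orbit, so \<open>toric_dense\<close>
  applies.\<close>

lemma agree_on_dense:
 assumes E: "kly r E" and F: "kly s F" and I: "I \<in> \<Sigma>"
  and f: "continuous_map (subtopology (total E) (part_over E (UI I))) (total F) f"
   "\<And>e. e \<in> part_over E (UI I) ==> proj F (f e) = proj E e"
  and f': "continuous_map (subtopology (total E) (part_over E (UI I))) (total F) f'"
   "\<And>e. e \<in> part_over E (UI I) ==> proj F (f' e) = proj E e"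
  and eq: "\<And>e. e \<in> part_over E (UI {}) ==> f e = f' e" and e: "e \<in> part_over E (UI I)"
 shows "f e = f' e"
proof -
 obtain \<Phi> \<alpha> where \<Phi>: "ctriv E r I \<Phi> \<alpha>" using kly_ctriv[OF E I] by blast
 obtain \<Phi>' \<delta> where \<Phi>': "ctriv F s I \<Phi>' \<delta>" using kly_ctriv[OF F I] by blast
 define v where "v = snd (\<Phi> e)"
 have v: "v \<in> carrier (cvec r)" unfolding v_def by (rule triv_snd[OF E I \<Phi> e])
 have oX: "openin (mtop Xm) (UI I)" using openin_toric_open[OF I] by simp
 have XU: "reg_mfd b (open_submfd Xm (UI I))" by (rule reg_mfd_open_submfd[OF reg_mfd_X oX])
 have tX: "tspace (open_submfd Xm (UI I)) = UI I" using UI_topspace[OF I] by auto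
 have "reg_map b (open_submfd Xm (UI I)) (tm E) (\<lambda>p. inv_triv E I \<Phi> (p, \<lambda>k\<in>{..<r}. v k))"
 proof (rule reg_map_via_triv[OF E I \<Phi> XU])
  show "reg_map b (open_submfd Xm (UI I)) Xm (\<lambda>p. p)"
   by (rule reg_map_from_submfd[OF reg_mfd_X reg_mfd_X oX reg_map_id[OF reg_mfd_X]])
  show "p \<in> UI I" if "p \<in> tspace (open_submfd Xm (UI I))" for p using that unfolding tX .
  show "regular b (open_submfd Xm (UI I)) (tspace (open_submfd Xm (UI I))) (\<lambda>p. v k)" for k
   by (rule regular_const[OF openin_topspace])
 qed
 moreover have vv: "(\<lambda>k\<in>{..<r}. v k) = v" using v by (auto simp: PiE_def extensional_def)
 ultimately have "continuous_map (subtopology Xtop (UI I)) (total E) (\<lambda>p. inv_triv E I \<Phi> (p, v))"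
  using reg_map_continuous by fastforce
 then have c: "continuous_map (subtopology Xtop (UI I)) (subtopology (total E) (part_over E (UI I))) (\<lambda>p. inv_triv E I \<Phi> (p, v))"
  using inv_triv(1)[OF E I \<Phi> _ v] by (auto simp: continuous_map_in_subtopology)
 have in_total: "g x \<in> topspace (total F)"
  if "continuous_map (subtopology (total E) (part_over E (UI I))) (total F) g" "x \<in> part_over E (UI I)" for g x
  by (rule subsetD[OF continuous_map_image_subset_topspace[OF that(1)]], rule imageI)
   (use that(2) in \<open>simp add: part_over_def\<close>)
 have cg: "continuous_map (subtopology Xtop (UI I)) euclidean (\<lambda>p. snd (\<Phi>' (g (inv_triv E I \<Phi> (p, v)))) k)"
  if g: "continuous_map (subtopology (total E) (part_over E (UI I))) (total F) g"
   "\<And>e. e \<in> part_over E (UI I) ==> proj F (g e) = proj E e" and k: "k < s" for g k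
 proof -
  have "continuous_map (subtopology (total E) (part_over E (UI I))) (subtopology (total F) (part_over F (UI I))) g"
   unfolding continuous_map_in_subtopology using g(1) in_total[OF g(1)] g(2) by (auto simp: part_over_def)
  from continuous_map_compose[OF continuous_map_compose[OF c this]
    regular_continuous[OF regular_triv_coord[OF F I \<Phi>' k], simplified]]
  show ?thesis by (simp add: o_def)
 qed
 have part: "f e \<in> part_over F (UI I)" "f' e \<in> part_over F (UI I)"
  using in_total[OF f(1) e] in_total[OF f'(1) e] f(2)[OF e] f'(2)[OF e] e by (simp_all add: part_over_def)
 have pe: "proj E e \<in> UI I" using e by (simp add: part_over_def)
 have ev: "inv_triv E I \<Phi> (proj E e, v) = e" unfolding v_def by (rule inv_triv_triv[OF E I \<Phi> e])
 show ?thesis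
 proof (rule triv_inj[OF F I \<Phi>' part])
  show "proj F (f e) = proj F (f' e)" using f(2)[OF e] f'(2)[OF e] by simp
  fix k assume k: "k < s"
  have "snd (\<Phi>' (f (inv_triv E I \<Phi> (proj E e, v)))) k - snd (\<Phi>' (f' (inv_triv E I \<Phi> (proj E e, v)))) k = 0"
  proof (rule toric_dense[OF I _ _ pe])
   show "continuous_map (subtopology Xtop (UI I)) euclidean
     (\<lambda>p. snd (\<Phi>' (f (inv_triv E I \<Phi> (p, v)))) k - snd (\<Phi>' (f' (inv_triv E I \<Phi> (p, v)))) k)"
    by (intro continuous_map_diff cg f f' k)
   fix p assume p: "p \<in> UI {}"
   then have pI: "p \<in> UI I" using toric_open_mono[of "{}" I \<beta>] by blast
   have "inv_triv E I \<Phi> (p, v) \<in> part_over E (UI {})"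
    using inv_triv(1)[OF E I \<Phi> pI v] inv_triv_proj[OF E I \<Phi> pI v] p by (simp add: part_over_def)
   then show "snd (\<Phi>' (f (inv_triv E I \<Phi> (p, v)))) k - snd (\<Phi>' (f' (inv_triv E I \<Phi> (p, v)))) k = 0"
    using eq by simp
  qed
  then show "snd (\<Phi>' (f e)) k = snd (\<Phi>' (f' e)) k" using ev by simp
 qed
qed

lemma over_open_orbit:
 assumes E: "kly r E" and e: "e \<in> part_over E (UI {})"
 shows "\<exists>g\<in>torus. \<exists>e0\<in>part_over E {x0}. e = gact E g e0"
proof -
 obtain g where g: "g \<in> torus" "proj E e = act g x0" using open_orbit e by (auto simp: part_over_def)
 let ?h = "\<chi> k. inverse (g $ k)"
 have h: "?h \<in> torus" "?h * g = 1" using torus_inverse[OF g(1)] by auto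
 have et: "e \<in> topspace (total E)" using e by (simp add: part_over_def)
 have x: "x0 \<in> range (ker_orbit \<beta>)" by (simp add: x0_def)
 have "proj E (gact E ?h e) = act ?h (act g x0)" using gact_proj[OF E h(1) et] g by simp
 also have "\<dots> = x0" using act_mult[OF h(1) g(1) x] act_one[OF x] h(2) by simp
 finally have "gact E ?h e \<in> part_over E {x0}" using gact_total[OF E h(1) et] by (simp add: part_over_def)
 moreover have "e = gact E g (gact E ?h e)"
  using gact_mult[OF E g(1) h(1) et] gact_one[OF E et] h(2) by (simp add: mult.commute)
 ultimately show ?thesis using g(1) by blast
qed

text \<open>Equivariance carries the equality from the base fibre to the open orbit, and continuity
  carries it to the whole bundle.\<close>

lemma hom_eqI:
 assumes E: "kly r E" and F: "kly s F" and f: "f \<in> hom E F" and f': "f' \<in> hom E F"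
  and eq: "\<And>e. e \<in> part_over E {x0} ==> f e = f' e"
 shows "f = f'"
proof (rule extensionalityI)
 have em: "equivariant_morphism E F f" "reg_map b (tm E) (tm F) f" "equivariant_morphism E F f'" "reg_map b (tm E) (tm F) f'"
  using f f' by (auto simp: hom_def)
 note mp = morphism_props[OF E em(1,2)] and mp' = morphism_props[OF E em(3,4)]
 show "f \<in> extensional (topspace (total E))" "f' \<in> extensional (topspace (total E))"
  using em by (auto simp: equivariant_morphism_def)
 fix e assume e: "e \<in> topspace (total E)"
 then obtain I where I: "I \<in> \<Sigma>" "proj E e \<in> UI I"
  using kly_proj_in[OF E] by (auto simp: topspace_toric_top')
 have c: "continuous_map (total E) (total F) f" "continuous_map (total E) (total F) f'"
  using reg_map_continuous[OF em(2)] reg_map_continuous[OF em(4)] by simp_all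
 show "f e = f' e"
 proof (rule agree_on_dense[OF E F I(1), where f = f and f' = f' and e = e])
  show "f e = f' e" if oe: "e \<in> part_over E (UI {})" for e
  proof -
   obtain g e0 where g: "g \<in> torus" "e0 \<in> part_over E {x0}" "e = gact E g e0" using over_open_orbit[OF E oe] by blast
   have "e0 \<in> topspace (total E)" using g(2) by (simp add: part_over_def)
   then show ?thesis using mp(4) mp'(4) g eq by simp
  qed
 qed (use c mp(3) mp'(3) e I in \<open>auto simp: part_over_def continuous_map_from_subtopology\<close>)
qed

section \<open>Extension of linear maps from the base fibre\<close>

text \<open>The linear map with matrix \<open>a\<close>, transported equivariantly from the base point to \<open>p\<close>.\<close>

definition tw :: "nat => nat => (nat => nat => complex) => (nat => rr ^ 'n) => (nat => rr ^ 'n) =>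
  (complex ^ 'm) set => (nat => complex) => nat => complex" where
 "tw r s a \<delta> \<alpha> p v = (\<lambda>k\<in>{..<s}. \<Sum>l<r. a k l * Xi \<beta> (\<delta> k - \<alpha> l) p * v l)"

lemma tw_C: "tw r s a \<delta> \<alpha> p v \<in> carrier (cvec s)" by (simp add: tw_def)

lemma tw_add: "tw r s a \<delta> \<alpha> p (\<lambda>k\<in>{..<r}. v k + w k) = (\<lambda>k\<in>{..<s}. tw r s a \<delta> \<alpha> p v k + tw r s a \<delta> \<alpha> p w k)"
 by (auto simp: tw_def distrib_left sum.distrib intro!: restrict_ext)

lemma tw_scale: "tw r s a \<delta> \<alpha> p (\<lambda>k\<in>{..<r}. c * v k) = (\<lambda>k\<in>{..<s}. c * tw r s a \<delta> \<alpha> p v k)"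
 by (auto simp: tw_def sum_distrib_left mult.left_commute intro!: restrict_ext)

lemma clinear_tw: "clinear_map (cvec r) (cvec s) (tw r s a \<delta> \<alpha> p)"
 using tw_C[of r s a \<delta> \<alpha> p] by (simp add: clinear_map_def tw_add tw_scale)

lemma tw_act:
 assumes g: "g \<in> torus" and p: "p \<in> range (ker_orbit \<beta>)"
 shows "tw r s a \<delta> \<alpha> (act g p) (\<lambda>k\<in>{..<r}. chi (\<alpha> k) g * v k) = (\<lambda>k\<in>{..<s}. chi (\<delta> k) g * tw r s a \<delta> \<alpha> p v k)"
proof (rule cvec_eqI[OF tw_C])
 fix k assume k: "k < s"
 have te: "a k l * Xi \<beta> (\<delta> k - \<alpha> l) (act g p) * (chi (\<alpha> l) g * v l)
   = chi (\<delta> k) g * (a k l * Xi \<beta> (\<delta> k - \<alpha> l) p * v l)" for l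
  using chi_nonzero[OF g, of "\<alpha> l"] by (simp add: Xi_act[OF g p] chi_diff[OF g])
 have "tw r s a \<delta> \<alpha> (act g p) (\<lambda>k\<in>{..<r}. chi (\<alpha> k) g * v k) k
   = (\<Sum>l<r. a k l * Xi \<beta> (\<delta> k - \<alpha> l) (act g p) * (chi (\<alpha> l) g * v l))"
  using k by (simp add: tw_def)
 also have "\<dots> = (\<lambda>k\<in>{..<s}. chi (\<delta> k) g * tw r s a \<delta> \<alpha> p v k) k"
  using k by (simp only: te) (simp add: tw_def sum_distrib_left)
 finally show "tw r s a \<delta> \<alpha> (act g p) (\<lambda>k\<in>{..<r}. chi (\<alpha> k) g * v k) k = (\<lambda>k\<in>{..<s}. chi (\<delta> k) g * tw r s a \<delta> \<alpha> p v k) k" .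
qed simp

text \<open>Exponents belonging to zero coefficients are unconstrained; such a power may fail to be
  regular, but its product with 0 is the zero function.\<close>

lemma regular_tw:
 assumes I: "I \<in> \<Sigma>" and M: "reg_mfd b M" and p: "reg_map b M Xm p" "\<And>x. x \<in> tspace M ==> p x \<in> UI I"
  and w: "\<And>l. l < r ==> regular b M (tspace M) (\<lambda>x. w x l)" and k: "k < s"
  and ge: "\<And>l i. l < r ==> i \<in> I ==> a k l \<noteq> 0 ==> ge_reg b (pairing (\<delta> k - \<alpha> l) (\<beta> i)) 0"
 shows "regular b M (tspace M) (\<lambda>x. tw r s a \<delta> \<alpha> (p x) (w x) k)"
proof -
 have pU: "preim M p (UI I) = tspace M" using p(2) by (auto simp: preim_def)
 have "regular b M (tspace M) (\<lambda>x. \<Sum>l<r. a k l * Xi \<beta> (\<delta> k - \<alpha> l) (p x) * w x l)"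
 proof (rule regular_sum[OF openin_topspace])
  fix l assume "l \<in> {..<r}"
  then have l: "l < r" by simp
  show "regular b M (tspace M) (\<lambda>x. a k l * Xi \<beta> (\<delta> k - \<alpha> l) (p x) * w x l)"
  proof (cases "a k l = 0")
   case True
   then show ?thesis using regular_const[OF openin_topspace, of b M 0] by simp
  next
   case False
   from regular_pullback[OF M reg_mfd_X p(1) regular_Xi[OF I ge[OF l _ False]]]
   have "regular b M (tspace M) (\<lambda>x. Xi \<beta> (\<delta> k - \<alpha> l) (p x))" unfolding pU .
   then show ?thesis by (intro regular_mult regular_const[OF openin_topspace] w[OF l])
  qed
 qed
 then show ?thesis using k by (simp add: tw_def)
qed

context
 fixes E F :: "('m, 'n, 'e, 'z) toric_scheme" and r s f0
 assumes E: "kly r E" and F: "kly s F" and f0: "clinear_map (fiber E x0) (fiber F x0) f0"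
  and fil: "\<And>i \<mu> e. e \<in> fil E i \<mu> ==> f0 e \<in> fil F i \<mu>"
begin

text \<open>The equivariant extension of \<open>f0\<close> over \<open>U\<^sub>I\<close>, in coordinates diagonalizing both bundles.\<close>

lemma local_extension:
 assumes I: "I \<in> \<Sigma>"
 shows "\<exists>f. reg_map b (open_submfd (tm E) (part_over E (UI I))) (tm F) f \<and>
  (\<forall>e\<in>part_over E (UI I). f e \<in> part_over F {proj E e}) \<and>
  (\<forall>x\<in>UI I. clinear_map (fiber E x) (fiber F x) f) \<and>
  (\<forall>e\<in>part_over E (UI I). \<forall>g\<in>torus. f (gact E g e) = gact F g (f e)) \<and>
  (\<forall>e\<in>part_over E {x0}. f e = f0 e)"
proof -
 obtain \<Phi> \<alpha> where \<Phi>: "ctriv E r I \<Phi> \<alpha>" using kly_ctriv[OF E I] by blast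
 obtain \<Phi>' \<delta> where \<Phi>': "ctriv F s I \<Phi>' \<delta>" using kly_ctriv[OF F I] by blast
 let ?P = "part_over E (UI I)"
 interpret c0: coordinates "fiber E x0" r "\<lambda>e. snd (\<Phi> e)" by (rule triv_coordinates[OF E I \<Phi> x0_open])
 interpret c0': coordinates "fiber F x0" s "\<lambda>e. snd (\<Phi>' e)" by (rule triv_coordinates[OF F I \<Phi>' x0_open])
 define K where "K = inv_into (carrier (fiber E x0)) (\<lambda>e. snd (\<Phi> e))"
 have K: "clinear_map (cvec r) (fiber E x0) K" unfolding K_def by (rule clinear_map_inverse[OF c0.M c0.u c0.bij])
 define L where "L v = snd (\<Phi>' (f0 (K v)))" for v
 have L: "clinear_map (cvec r) (cvec s) L"
  unfolding L_def by (rule clinear_map_compose[OF clinear_map_compose[OF K f0] c0'.u])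
 define a where "a k l = L (cunit r l) k" for k l
 have La: "L v k = (\<Sum>l<r. a k l * v l)" if "v \<in> carrier (cvec r)" "k < s" for v k
  unfolding a_def by (rule clinear_map_expand[OF L that])
 \<comment> \<open>The \<open>l\<close>-th basis vector lies in the filtration step given by its own
   weight. Its image under \<open>f0\<close> lies in the same step of \<open>F\<close>, and every
   nonzero coordinate \<open>a k l\<close> of the image then compares the weights.\<close>
 have ge: "ge_reg b (pairing (\<delta> k - \<alpha> l) (\<beta> i)) 0" if i: "i \<in> I" and kl: "k < s" "l < r" and nz: "a k l \<noteq> 0" for i k l
 proof -
  have Kl: "K (cunit r l) \<in> part_over E {x0}" "snd (\<Phi> (K (cunit r l))) = cunit r l"
   using c0.u_inv[OF cunit_carrier, of l] by (simp_all add: K_def)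
  have "K (cunit r l) \<in> fil E i (pairing (\<alpha> l) (\<beta> i))"
   unfolding fil_iff[OF E I \<Phi> i Kl(1)] Kl(2) by (auto simp: cunit_nth)
  then have "f0 (K (cunit r l)) \<in> fil F i (pairing (\<alpha> l) (\<beta> i))" by (rule fil)
  moreover have "f0 (K (cunit r l)) \<in> part_over F {x0}" using f0 Kl(1) by (auto simp: clinear_map_def)
  ultimately have "ge_reg b (pairing (\<delta> k) (\<beta> i)) (pairing (\<alpha> l) (\<beta> i))"
   using fil_iff[OF F I \<Phi>' i] kl nz by (simp add: a_def L_def)
  then show ?thesis using ge_reg_diff by (metis pairing_diff_left)
 qed
 define w where "w e = tw r s a \<delta> \<alpha> (proj E e) (snd (\<Phi> e))" for e
 define f where "f e = inv_triv F I \<Phi>' (proj E e, \<lambda>k\<in>{..<s}. w e k)" for e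
 have wc: "(\<lambda>k\<in>{..<s}. w e k) \<in> carrier (cvec s)" and wr: "(\<lambda>k\<in>{..<s}. w e k) = w e" for e
  by (auto simp: w_def tw_def intro!: restrict_ext)
 have fe: "f e \<in> part_over F {proj E e}" "f e \<in> part_over F (UI I)" "proj F (f e) = proj E e" "snd (\<Phi>' (f e)) = w e"
  if "e \<in> ?P" for e
 proof -
  have p: "proj E e \<in> UI I" using that by (simp add: part_over_def)
  show 1: "f e \<in> part_over F (UI I)" unfolding f_def by (rule inv_triv(1)[OF F I \<Phi>' p wc])
  show 2: "proj F (f e) = proj E e" unfolding f_def by (rule inv_triv_proj[OF F I \<Phi>' p wc])
  show "f e \<in> part_over F {proj E e}" using 1 2 by (simp add: part_over_def)
  show "snd (\<Phi>' (f e)) = w e" unfolding f_def inv_triv(2)[OF F I \<Phi>' p wc] by (simp add: wr)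
 qed
 have oP: "openin (mtop (tm E)) ?P" using kly_part_open[OF E openin_toric_open[OF I]] by simp
 have MP: "reg_mfd b (open_submfd (tm E) ?P)" by (rule reg_mfd_open_submfd[OF kly_mfd[OF E] oP])
 have tP: "tspace (open_submfd (tm E) ?P) = ?P" by (auto simp: part_over_def)
 have pr: "reg_map b (open_submfd (tm E) ?P) Xm (proj E)"
  by (rule reg_map_from_submfd[OF kly_mfd[OF E] reg_mfd_X oP kly_proj[OF E]])
 have pP: "proj E x \<in> UI I" if "x \<in> tspace (open_submfd (tm E) ?P)" for x
  using that unfolding tP by (simp add: part_over_def)
 have sn: "regular b (open_submfd (tm E) ?P) (tspace (open_submfd (tm E) ?P)) (\<lambda>e. snd (\<Phi> e) l)" if "l < r" for l
  unfolding tP regular_submfd_iff[OF kly_mfd[OF E] oP subset_refl] by (rule regular_triv_coord[OF E I \<Phi> that])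
 have "reg_map b (open_submfd (tm E) ?P) (tm F) f"
  unfolding f_def
 proof (rule reg_map_via_triv[OF F I \<Phi>' MP pr pP])
  show "regular b (open_submfd (tm E) ?P) (tspace (open_submfd (tm E) ?P)) (\<lambda>e. w e k)" if "k < s" for k
   unfolding w_def by (rule regular_tw[OF I MP pr pP sn that ge]) (use that in simp_all)
 qed
 moreover have "clinear_map (fiber E x) (fiber F x) f" if x: "x \<in> UI I" for x
 proof -
  interpret c: coordinates "fiber E x" r "\<lambda>e. snd (\<Phi> e)" by (rule triv_coordinates[OF E I \<Phi> x])
  interpret c': coordinates "fiber F x" s "\<lambda>e. snd (\<Phi>' e)" by (rule triv_coordinates[OF F I \<Phi>' x])
  show ?thesis
  proof (rule clinear_map_cong[OF c.M clinear_map_compose[OF clinear_map_compose[OF c.u clinear_tw]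
      clinear_map_inverse[OF c'.M c'.u c'.bij]]])
   fix e assume "e \<in> carrier (fiber E x)"
   then have e: "e \<in> ?P" "proj E e = x" using x by (auto simp: part_over_def)
   have "f e \<in> carrier (fiber F x)" using fe(1)[OF e(1)] e(2) by simp
   from c'.inv_u[OF this] show "inv_into (carrier (fiber F x)) (\<lambda>e. snd (\<Phi>' e)) (tw r s a \<delta> \<alpha> x (snd (\<Phi> e))) = f e"
    unfolding fe(4)[OF e(1)] w_def e(2) .
  qed
 qed
 moreover have "f (gact E g e) = gact F g (f e)" if e: "e \<in> ?P" and g: "g \<in> torus" for e g
 proof -
  have ge': "gact E g e \<in> ?P" by (rule gact_part[OF E g e])
  have et: "e \<in> topspace (total E)" "f e \<in> topspace (total F)" using e fe(2)[OF e] by (auto simp: part_over_def)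
  have pe: "proj E e \<in> range (ker_orbit \<beta>)" using e UI_range by (auto simp: part_over_def)
  have "snd (\<Phi> (gact E g e)) = (\<lambda>k\<in>{..<r}. chi (\<alpha> k) g * snd (\<Phi> e) k)"
   by (rule cvec_eqI[OF triv_snd[OF E I \<Phi> ge']]) (use \<Phi> e g in \<open>simp_all add: ctriv_def\<close>)
  then have wg: "w (gact E g e) = (\<lambda>k\<in>{..<s}. chi (\<delta> k) g * w e k)"
   using gact_proj[OF E g et(1)] tw_act[OF g pe] by (simp add: w_def)
  show ?thesis
  proof (rule triv_inj[OF F I \<Phi>' fe(2)[OF ge'] gact_part[OF F g fe(2)[OF e]]])
   show "proj F (f (gact E g e)) = proj F (gact F g (f e))"
    using fe(3)[OF ge'] fe(3)[OF e] gact_proj[OF E g et(1)] gact_proj[OF F g et(2)] by simp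
   show "snd (\<Phi>' (f (gact E g e))) k = snd (\<Phi>' (gact F g (f e))) k" if k: "k < s" for k
    using \<Phi>' fe(2)[OF e] g k fe(4)[OF ge'] fe(4)[OF e] wg by (simp add: ctriv_def)
  qed
 qed
 moreover have "f e = f0 e" if e: "e \<in> part_over E {x0}" for e
 proof -
  have eP: "e \<in> ?P" and pe: "proj E e = x0" using e x0_open by (auto simp: part_over_def)
  have f0e: "f0 e \<in> part_over F {x0}" using f0 e by (auto simp: clinear_map_def)
  show ?thesis
  proof (rule c0'.eqI)
   show "f e \<in> carrier (fiber F x0)" using fe(1)[OF eP] pe by simp
   show "f0 e \<in> carrier (fiber F x0)" using f0e by simp
   fix k assume k: "k < s"
   have "snd (\<Phi>' (f e)) k = (\<Sum>l<r. a k l * snd (\<Phi> e) l)" using fe(4)[OF eP] k by (simp add: w_def tw_def pe)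
   also have "\<dots> = L (snd (\<Phi> e)) k" by (rule La[OF triv_snd[OF E I \<Phi> eP] k, symmetric])
   also have "\<dots> = snd (\<Phi>' (f0 e)) k" using c0.inv_u[of e] e by (simp add: L_def K_def)
   finally show "snd (\<Phi>' (f e)) k = snd (\<Phi>' (f0 e)) k" .
  qed
 qed
 ultimately show ?thesis using fe(1) by (intro exI[of _ f]) simp
qed

text \<open>The local extensions agree at the base fibre, hence by equivariance over the open orbit,
  hence by density on overlaps; overlaps are again of the form \<open>U\<^sub>I\<close> because
  \<open>I \<inter> J\<close> is a simplex.\<close>

lemma hom_extension: "\<exists>f\<in>hom E F. \<forall>e\<in>part_over E {x0}. f e = f0 e"
proof -
 define Q where "Q I f \<longleftrightarrow> reg_map b (open_submfd (tm E) (part_over E (UI I))) (tm F) f \<and>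
  (\<forall>e\<in>part_over E (UI I). f e \<in> part_over F {proj E e}) \<and>
  (\<forall>x\<in>UI I. clinear_map (fiber E x) (fiber F x) f) \<and>
  (\<forall>e\<in>part_over E (UI I). \<forall>g\<in>torus. f (gact E g e) = gact F g (f e)) \<and>
  (\<forall>e\<in>part_over E {x0}. f e = f0 e)" for I f
 have "\<forall>I\<in>\<Sigma>. \<exists>f. Q I f" unfolding Q_def by (intro ballI local_extension)
 from bchoice[OF this] obtain f where Q: "\<And>I. I \<in> \<Sigma> ==> Q I (f I)" by blast
 have f: "\<And>I. I \<in> \<Sigma> ==> reg_map b (open_submfd (tm E) (part_over E (UI I))) (tm F) (f I)"
  "\<And>I e. I \<in> \<Sigma> ==> e \<in> part_over E (UI I) ==> f I e \<in> part_over F {proj E e}"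
  "\<And>I x. I \<in> \<Sigma> ==> x \<in> UI I ==> clinear_map (fiber E x) (fiber F x) (f I)"
  "\<And>I e g. I \<in> \<Sigma> ==> e \<in> part_over E (UI I) ==> g \<in> torus ==> f I (gact E g e) = gact F g (f I e)"
  "\<And>I e. I \<in> \<Sigma> ==> e \<in> part_over E {x0} ==> f I e = f0 e"
  using Q by (simp_all add: Q_def)
 have fc: "continuous_map (subtopology (total E) (part_over E (UI I))) (total F) (f I)" if "I \<in> \<Sigma>" for I
  using reg_map_continuous[OF f(1)[OF that]] by simp
 have fp: "proj F (f I e) = proj E e" if "I \<in> \<Sigma>" "e \<in> part_over E (UI I)" for I e
  using f(2)[OF that] by (simp add: part_over_def)
 have orb: "f I e = f J e" if IJ: "I \<in> \<Sigma>" "J \<in> \<Sigma>" and e: "e \<in> part_over E (UI {})" for I J e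
 proof -
  obtain g e0 where g: "g \<in> torus" "e0 \<in> part_over E {x0}" "e = gact E g e0" using over_open_orbit[OF E e] by blast
  have "e0 \<in> part_over E (UI K)" for K using g(2) x0_open by (auto simp: part_over_def)
  then show ?thesis using f(4,5) IJ g by simp
 qed
 have agree: "f I e = f J e" if IJ: "I \<in> \<Sigma>" "J \<in> \<Sigma>" and e: "e \<in> part_over E (UI I)" "e \<in> part_over E (UI J)" for I J e
 proof (rule agree_on_dense[OF E F subset_in[OF IJ(1), of "I \<inter> J"], where f = "f I" and f' = "f J" and e = e])
  have sub: "part_over E (UI (I \<inter> J)) \<subseteq> part_over E (UI I)" "part_over E (UI (I \<inter> J)) \<subseteq> part_over E (UI J)"
   by (auto intro!: part_over_mono toric_open_mono)
  show "continuous_map (subtopology (total E) (part_over E (UI (I \<inter> J)))) (total F) (f I)"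
   by (rule continuous_map_from_subtopology_mono[OF fc[OF IJ(1)] sub(1)])
  show "continuous_map (subtopology (total E) (part_over E (UI (I \<inter> J)))) (total F) (f J)"
   by (rule continuous_map_from_subtopology_mono[OF fc[OF IJ(2)] sub(2)])
  show "proj F (f I e) = proj E e" "proj F (f J e) = proj E e" if "e \<in> part_over E (UI (I \<inter> J))" for e
   using fp IJ sub that by blast+
  show "f I e = f J e" if "e \<in> part_over E (UI {})" for e by (rule orb[OF IJ that])
  show "e \<in> part_over E (UI (I \<inter> J))" using e toric_open_Int[of \<beta> I J] by (auto simp: part_over_def)
 qed simp
 define S where "S p = (SOME I. I \<in> \<Sigma> \<and> p \<in> UI I)" for p
 have S: "S p \<in> \<Sigma>" "p \<in> UI (S p)" if "p \<in> topspace Xtop" for p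
  using someI_ex[of "\<lambda>I. I \<in> \<Sigma> \<and> p \<in> UI I"] that unfolding S_def by (auto simp: topspace_toric_top')
 define h where "h = (\<lambda>e\<in>topspace (total E). f (S (proj E e)) e)"
 have hI: "h e = f I e" if I: "I \<in> \<Sigma>" and e: "e \<in> part_over E (UI I)" for I e
 proof -
  have et: "e \<in> topspace (total E)" using e by (simp add: part_over_def)
  note S' = S[OF kly_proj_in[OF E et]]
  have "e \<in> part_over E (UI (S (proj E e)))" using et S'(2) by (simp add: part_over_def)
  then show ?thesis using agree[OF S'(1) I] e et by (simp add: h_def)
 qed
 have ex: "\<exists>I\<in>\<Sigma>. e \<in> part_over E (UI I)" if "e \<in> topspace (total E)" for e
  using S[OF kly_proj_in[OF E that]] that by (auto simp: part_over_def)
 have "reg_map b (tm E) (tm F) h"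
 proof (rule reg_map_local[OF kly_mfd[OF E] kly_mfd[OF F]])
  fix e assume "e \<in> tspace (tm E)"
  then obtain I where I: "I \<in> \<Sigma>" "e \<in> part_over E (UI I)" using ex by auto
  have o: "openin (mtop (tm E)) (part_over E (UI I))" using kly_part_open[OF E openin_toric_open[OF I(1)]] by simp
  have "reg_map b (open_submfd (tm E) (part_over E (UI I))) (tm F) h"
   by (rule reg_map_cong[OF reg_mfd_open_submfd[OF kly_mfd[OF E] o] kly_mfd[OF F] f(1)[OF I(1)]])
    (use hI[OF I(1)] in \<open>auto simp: part_over_def\<close>)
  then show "\<exists>W. openin (mtop (tm E)) W \<and> e \<in> W \<and> reg_map b (open_submfd (tm E) W) (tm F) h"
   using o I(2) by blast
 qed
 moreover have "equivariant_morphism E F h"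
  unfolding equivariant_morphism_def
 proof (intro conjI ballI)
  show "h \<in> extensional (topspace (total E))" by (simp add: h_def)
  show "proj F (h e) = proj E e" if "e \<in> topspace (total E)" for e
   using ex[OF that] hI fp by metis
  show "h (gact E g e) = gact F g (h e)" if g: "g \<in> torus" and e: "e \<in> topspace (total E)" for g e
  proof -
   obtain I where I: "I \<in> \<Sigma>" "e \<in> part_over E (UI I)" using ex[OF e] by blast
   show ?thesis using hI[OF I] hI[OF I(1) gact_part[OF E g I(2)]] f(4)[OF I g] by simp
  qed
  show "clinear_map (fiber E x) (fiber F x) h" if "x \<in> proj E ` topspace (total E)" for x
  proof -
   have xt: "x \<in> topspace Xtop" using that kly_proj_in[OF E] by blast
   show ?thesis
    by (rule clinear_map_cong[OF kly_fiber[OF E xt] f(3)[OF S[OF xt]]])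
     (use hI[OF S(1)[OF xt]] S(2)[OF xt] in \<open>auto simp: part_over_def\<close>)
  qed
 qed
 moreover have "h e = f0 e" if "e \<in> part_over E {x0}" for e
  using hI[OF empty_in, of e] f(5)[OF empty_in that] that x0_open by (auto simp: part_over_def)
 ultimately show ?thesis by (auto simp: hom_def)
qed

end

end

section \<open>Equivalences from correspondences\<close>

text \<open>Every object of \<open>K\<close> has two lifts \<open>P A\<close> and \<open>Q A\<close>
  to linked pairs with the same component in \<open>D\<close>. Transporting the identity of that
  component gives the natural isomorphism. The lemma serves unit and counit, with the roles of
  \<open>C\<close> and \<open>D\<close> exchanged.\<close>

lemma transport_natural_iso:
 fixes C :: "('o, 'a) cat" and D :: "('p, 'b) cat" and K :: "('i, 'c) cat"
 assumes D: "is_category D" and bO: "\<And>w. w \<in> W ==> b w \<in> cobj D"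
  and S_hom: "\<And>w v g. w \<in> W ==> v \<in> W ==> g \<in> chom D (b w) (b v) ==> S w v g \<in> chom C (a w) (a v)"
  and S_id: "\<And>w. w \<in> W ==> S w w (cid D (b w)) = cid C (a w)"
  and S_comp: "\<And>w v x f g. w \<in> W ==> v \<in> W ==> x \<in> W ==> f \<in> chom D (b w) (b v) ==> g \<in> chom D (b v) (b x) ==>
    S w x (ccomp D (b w) (b v) (b x) g f) = ccomp C (a w) (a v) (a x) (S v x g) (S w v f)"
  and PQ: "\<And>A. A \<in> cobj K ==> P A \<in> W \<and> Q A \<in> W \<and> b (P A) = b (Q A) \<and> a (P A) = Fo A \<and> a (Q A) = Go A \<and>
    \<eta> A = S (P A) (Q A) (cid D (b (P A)))"
  and \<phi>: "\<And>A B f. A \<in> cobj K ==> B \<in> cobj K ==> f \<in> chom K A B ==> \<phi> A B f \<in> chom D (b (P A)) (b (P B)) \<and>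
    Fm A B f = S (P A) (P B) (\<phi> A B f) \<and> Gm A B f = S (Q A) (Q B) (\<phi> A B f)"
 shows "natural_iso K C Fo Fm Go Gm \<eta>"
 unfolding natural_iso_def is_iso_def
proof (intro conjI ballI)
 have idD: "cid D B \<in> chom D B B" if "B \<in> cobj D" for B using D that by (simp add: is_category_def)
 have unit: "ccomp D A A B f (cid D A) = f" "ccomp D A B B (cid D B) f = f"
  if "A \<in> cobj D" "B \<in> cobj D" "f \<in> chom D A B" for A B f using D that unfolding is_category_def by blast+
 {
  fix A assume A: "A \<in> cobj K"
  define w where "w = P A" define v where "v = Q A"
  have w: "w \<in> W" "v \<in> W" "b v = b w" "Fo A = a w" "Go A = a v" "\<eta> A = S w v (cid D (b w))"
   using PQ[OF A] by (simp_all add: w_def v_def)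
  note i = idD[OF bO[OF w(1)]] and u = unit(1)[OF bO[OF w(1)] bO[OF w(1)] idD[OF bO[OF w(1)]]]
  show "\<eta> A \<in> chom C (Fo A) (Go A)" using S_hom[OF w(1,2)] i w by simp
  show "\<exists>g\<in>chom C (Go A) (Fo A). ccomp C (Fo A) (Go A) (Fo A) g (\<eta> A) = cid C (Fo A) \<and>
    ccomp C (Go A) (Fo A) (Go A) (\<eta> A) g = cid C (Go A)"
  proof (intro bexI conjI)
   show "S v w (cid D (b w)) \<in> chom C (Go A) (Fo A)" using S_hom[OF w(2,1)] i w by simp
   show "ccomp C (Fo A) (Go A) (Fo A) (S v w (cid D (b w))) (\<eta> A) = cid C (Fo A)"
    using S_comp[OF w(1,2,1), of "cid D (b w)" "cid D (b w)"] i u S_id[OF w(1)] w by simp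
   show "ccomp C (Go A) (Fo A) (Go A) (\<eta> A) (S v w (cid D (b w))) = cid C (Go A)"
    using S_comp[OF w(2,1,2), of "cid D (b w)" "cid D (b w)"] i u S_id[OF w(2)] w by simp
  qed
 }
 fix A B f assume A: "A \<in> cobj K" and B: "B \<in> cobj K" and f: "f \<in> chom K A B"
 define w where "w = P A" define w' where "w' = Q A" define v where "v = P B" define v' where "v' = Q B"
 define h where "h = \<phi> A B f"
 have w: "w \<in> W" "w' \<in> W" "b w' = b w" "Fo A = a w" "Go A = a w'" "\<eta> A = S w w' (cid D (b w))"
  using PQ[OF A] by (simp_all add: w_def w'_def)
 have v: "v \<in> W" "v' \<in> W" "b v' = b v" "Fo B = a v" "Go B = a v'" "\<eta> B = S v v' (cid D (b v))"
  using PQ[OF B] by (simp_all add: v_def v'_def)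
 have h: "h \<in> chom D (b w) (b v)" "Fm A B f = S w v h" "Gm A B f = S w' v' h"
  using \<phi>[OF A B f] by (simp_all add: h_def w_def v_def w'_def v'_def)
 note bw = bO[OF w(1)] and bv = bO[OF v(1)]
 show "ccomp C (Fo A) (Fo B) (Go B) (\<eta> B) (Fm A B f) = ccomp C (Fo A) (Go A) (Go B) (Gm A B f) (\<eta> A)"
  using S_comp[OF w(1) v(1,2), of h "cid D (b v)"] S_comp[OF w(1,2) v(2), of "cid D (b w)" h]
   idD[OF bw] idD[OF bv] unit[OF bw bv h(1)] h w v by simp
qed

text \<open>A set \<open>W\<close> of linked pairs of objects with compatible bijections of the hom-sets, such that
 every object of either category belongs to a pair.  The functors choose a pair for each object.\<close>

lemma equivalent_categories_correspondence:
 fixes C :: "('o, 'a) cat" and D :: "('p, 'b) cat"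
  and W :: "'w set" and a :: "'w => 'o" and b :: "'w => 'p" and T :: "'w => 'w => 'a => 'b"
 assumes C: "is_category C" and D: "is_category D"
  and aW: "a ` W = cobj C" and bW: "b ` W = cobj D"
  and bij: "\<And>w v. w \<in> W ==> v \<in> W ==> bij_betw (T w v) (chom C (a w) (a v)) (chom D (b w) (b v))"
  and T_id: "\<And>w. w \<in> W ==> T w w (cid C (a w)) = cid D (b w)"
  and T_comp: "\<And>w v x f g. w \<in> W ==> v \<in> W ==> x \<in> W ==> f \<in> chom C (a w) (a v) ==> g \<in> chom C (a v) (a x) ==>
    T w x (ccomp C (a w) (a v) (a x) g f) = ccomp D (b w) (b v) (b x) (T v x g) (T w v f)"
 shows "equivalent_categories C D"
proof -
 define S where "S w v = inv_into (chom C (a w) (a v)) (T w v)" for w v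
 have aO: "a w \<in> cobj C" and bO: "b w \<in> cobj D" if "w \<in> W" for w using aW bW that by auto
 have T_hom: "T w v f \<in> chom D (b w) (b v)" if "w \<in> W" "v \<in> W" "f \<in> chom C (a w) (a v)" for w v f
  using bij_betwE[OF bij[OF that(1,2)]] that(3) by blast
 have S_hom: "S w v g \<in> chom C (a w) (a v)" and TS: "T w v (S w v g) = g"
  if "w \<in> W" "v \<in> W" "g \<in> chom D (b w) (b v)" for w v g
  unfolding S_def using bij_betw_imp_surj_on[OF bij[OF that(1,2)]] that(3) by (metis inv_into_into, metis f_inv_into_f)
 have ST: "S w v (T w v f) = f" if "w \<in> W" "v \<in> W" "f \<in> chom C (a w) (a v)" for w v f
  unfolding S_def by (rule inv_into_f_f[OF bij_betw_imp_inj_on[OF bij[OF that(1,2)]] that(3)])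
 have idC: "cid C (a w) \<in> chom C (a w) (a w)" if "w \<in> W" for w
  using C aO[OF that] by (simp add: is_category_def)
 have coC: "ccomp C (a w) (a v) (a x) g f \<in> chom C (a w) (a x)"
  if "w \<in> W" "v \<in> W" "x \<in> W" "f \<in> chom C (a w) (a v)" "g \<in> chom C (a v) (a x)" for w v x f g
  using C aO that unfolding is_category_def by blast
 have S_id: "S w w (cid D (b w)) = cid C (a w)" if "w \<in> W" for w
  using ST[OF that that idC[OF that]] T_id[OF that] by simp
 have S_comp: "S w x (ccomp D (b w) (b v) (b x) g f) = ccomp C (a w) (a v) (a x) (S v x g) (S w v f)"
  if "w \<in> W" "v \<in> W" "x \<in> W" "f \<in> chom D (b w) (b v)" "g \<in> chom D (b v) (b x)" for w v x f g
 proof -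
  note f' = S_hom[OF that(1,2,4)] and g' = S_hom[OF that(2,3,5)]
  show ?thesis
   using ST[OF that(1,3) coC[OF that(1-3) f' g']]
   unfolding T_comp[OF that(1-3) f' g'] TS[OF that(1,2,4)] TS[OF that(2,3,5)] .
 qed
 have "\<forall>A\<in>cobj C. \<exists>w. w \<in> W \<and> a w = A" unfolding aW[symmetric] by auto
 from bchoice[OF this] obtain x where x: "\<And>A. A \<in> cobj C ==> x A \<in> W" "\<And>A. A \<in> cobj C ==> a (x A) = A" by blast
 have "\<forall>B\<in>cobj D. \<exists>w. w \<in> W \<and> b w = B" unfolding bW[symmetric] by auto
 from bchoice[OF this] obtain y where y: "\<And>B. B \<in> cobj D ==> y B \<in> W" "\<And>B. B \<in> cobj D ==> b (y B) = B" by blast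
 define Fo where "Fo A = b (x A)" for A
 define Fm where "Fm A A' f = T (x A) (x A') f" for A A' f
 define Go where "Go B = a (y B)" for B
 define Gm where "Gm B B' g = S (y B) (y B') g" for B B' g
 have FoO: "Fo A \<in> cobj D" if "A \<in> cobj C" for A using bO x that by (simp add: Fo_def)
 have GoO: "Go B \<in> cobj C" if "B \<in> cobj D" for B using aO y that by (simp add: Go_def)
 have Fh: "Fm A B f \<in> chom D (Fo A) (Fo B)" if "A \<in> cobj C" "B \<in> cobj C" "f \<in> chom C A B" for A B f
  using T_hom[of "x A" "x B" f] x that by (simp add: Fm_def Fo_def)
 have Gh: "Gm A B f \<in> chom C (Go A) (Go B)" if "A \<in> cobj D" "B \<in> cobj D" "f \<in> chom D A B" for A B f
  using S_hom[of "y A" "y B" f] y that by (simp add: Gm_def Go_def)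
 have Fi: "Fm A A (cid C A) = cid D (Fo A)" if "A \<in> cobj C" for A
  using T_id[OF x(1)[OF that]] x(2)[OF that] by (simp add: Fm_def Fo_def)
 have Gi: "Gm B B (cid D B) = cid C (Go B)" if "B \<in> cobj D" for B
  using S_id[OF y(1)[OF that]] y(2)[OF that] by (simp add: Gm_def Go_def)
 have "is_functor C D Fo Fm"
  unfolding is_functor_def
  using FoO Fh Fi x T_comp[OF x(1) x(1) x(1)] by (auto simp: Fm_def Fo_def)
 moreover have "is_functor D C Go Gm"
  unfolding is_functor_def
  using GoO Gh Gi y S_comp[OF y(1) y(1) y(1)] by (auto simp: Gm_def Go_def)
 moreover have "natural_iso C C (\<lambda>A. A) (\<lambda>A B f. f) (\<lambda>A. Go (Fo A)) (\<lambda>A B f. Gm (Fo A) (Fo B) (Fm A B f))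
   (\<lambda>A. S (x A) (y (Fo A)) (cid D (Fo A)))"
 proof (rule transport_natural_iso[where W = W and b = b and S = S and a = a and P = x and Q = "\<lambda>A. y (Fo A)"
    and \<phi> = Fm, OF D bO S_hom S_id S_comp])
  show "x A \<in> W \<and> y (Fo A) \<in> W \<and> b (x A) = b (y (Fo A)) \<and> a (x A) = A \<and> a (y (Fo A)) = Go (Fo A) \<and>
    S (x A) (y (Fo A)) (cid D (Fo A)) = S (x A) (y (Fo A)) (cid D (b (x A)))" if "A \<in> cobj C" for A
   using x[OF that] y[OF FoO[OF that]] by (simp add: Fo_def Go_def)
  show "Fm A B f \<in> chom D (b (x A)) (b (x B)) \<and> f = S (x A) (x B) (Fm A B f) \<and>
    Gm (Fo A) (Fo B) (Fm A B f) = S (y (Fo A)) (y (Fo B)) (Fm A B f)"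
   if "A \<in> cobj C" "B \<in> cobj C" "f \<in> chom C A B" for A B f
   using Fh[OF that] ST[of "x A" "x B" f] x that by (simp add: Fm_def Gm_def Fo_def)
 qed
 moreover have "natural_iso D D (\<lambda>B. Fo (Go B)) (\<lambda>A B f. Fm (Go A) (Go B) (Gm A B f)) (\<lambda>A. A) (\<lambda>A B f. f)
   (\<lambda>B. T (x (Go B)) (y B) (cid C (Go B)))"
 proof (rule transport_natural_iso[where W = W and b = a and S = T and a = b and P = "\<lambda>B. x (Go B)" and Q = y
    and \<phi> = Gm, OF C aO T_hom T_id T_comp])
  show "x (Go B) \<in> W \<and> y B \<in> W \<and> a (x (Go B)) = a (y B) \<and> b (x (Go B)) = Fo (Go B) \<and> b (y B) = B \<and>
    T (x (Go B)) (y B) (cid C (Go B)) = T (x (Go B)) (y B) (cid C (a (x (Go B))))" if "B \<in> cobj D" for B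
   using x[OF GoO[OF that]] y[OF that] by (simp add: Fo_def Go_def)
  show "Gm A B f \<in> chom C (a (x (Go A))) (a (x (Go B))) \<and> Fm (Go A) (Go B) (Gm A B f) = T (x (Go A)) (x (Go B)) (Gm A B f) \<and>
    f = T (y A) (y B) (Gm A B f)" if "A \<in> cobj D" "B \<in> cobj D" "f \<in> chom D A B" for A B f
   using Gh[OF that] TS[of "y A" "y B" f] x[OF GoO] y that by (simp add: Fm_def Gm_def)
 qed
 ultimately show ?thesis
  unfolding equivalent_categories_def using C D by blast
qed

text \<open>Restricting composites to the carrier makes the unit and associativity laws equalities
  of functions; this serves bundles and filtered spaces alike.\<close>

lemma concrete_category:
 fixes Ob :: "'o set" and H :: "'o => 'o => ('a => 'a) set" and U :: "'o => 'a set"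
 assumes H: "\<And>A B f. A \<in> Ob ==> B \<in> Ob ==> f \<in> H A B ==> f \<in> extensional (U A) \<and> f ` U A \<subseteq> U B"
  and id: "\<And>A. A \<in> Ob ==> (\<lambda>x\<in>U A. x) \<in> H A A"
  and comp: "\<And>A B C f g. A \<in> Ob ==> B \<in> Ob ==> C \<in> Ob ==> f \<in> H A B ==> g \<in> H B C ==> compose (U A) g f \<in> H A C"
 shows "is_category \<lparr>cobj = Ob, chom = H, cid = (\<lambda>A. \<lambda>x\<in>U A. x), ccomp = (\<lambda>A B C g f. compose (U A) g f)\<rparr>"
 unfolding is_category_def cat.select_convs
proof (intro conjI ballI)
 fix A B f assume f: "A \<in> Ob" "B \<in> Ob" "f \<in> H A B"
 show "compose (U A) f (\<lambda>x\<in>U A. x) = f" "compose (U A) (\<lambda>x\<in>U B. x) f = f"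
  using H[OF f] by (auto simp: compose_def extensional_def fun_eq_iff)
 fix C D g h
 show "compose (U A) h (compose (U A) g f) = compose (U A) (compose (U B) h g) f"
  using H[OF f] by (auto simp: compose_def fun_eq_iff)
qed (simp_all add: id comp)

section \<open>Klyachko vector spaces in coordinates\<close>

lemma perp_class_eq:
 assumes "perp_class \<beta> I \<alpha> = perp_class \<beta> I \<alpha>'" "i \<in> I"
 shows "pairing \<alpha> (\<beta> i) = pairing \<alpha>' (\<beta> i)"
proof -
 have "\<alpha> + 0 \<in> perp_class \<beta> I \<alpha>" unfolding perp_class_def by (rule imageI) (simp add: perp_def)
 then obtain \<gamma> where "\<alpha> = \<alpha>' + \<gamma>" "\<gamma> \<in> perp \<beta> I" unfolding assms(1) by (auto simp: perp_class_def)
 then show ?thesis using assms(2) by (simp add: pairing_add_left perp_def)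
qed

lemma perp_class_mem:
 assumes i: "i \<in> I"
 shows "perp_class \<beta> I \<alpha> \<in> {perp_class \<beta> I \<alpha> | \<alpha>. ge (pairing \<alpha> (\<beta> i)) \<mu>} \<longleftrightarrow> ge (pairing \<alpha> (\<beta> i)) \<mu>"
proof
 assume "perp_class \<beta> I \<alpha> \<in> {perp_class \<beta> I \<alpha> | \<alpha>. ge (pairing \<alpha> (\<beta> i)) \<mu>}"
 then obtain \<alpha>' where "perp_class \<beta> I \<alpha> = perp_class \<beta> I \<alpha>'" "ge (pairing \<alpha>' (\<beta> i)) \<mu>" by blast
 then show "ge (pairing \<alpha> (\<beta> i)) \<mu>" using perp_class_eq[of \<beta> I \<alpha> \<alpha>' i] i by simp
qed blast

text \<open>A grading replaced by a basis with weights, adapted at once to all filtrations with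
  \<open>i \<in> I\<close>; this is the form in which Klyachko spaces are compared with
  trivializations.\<close>

definition kcoords :: "(rr => rr => bool) => ('m => rr ^ 'n) => ('m, 'v) kvs => nat => 'm set =>
  ('v => nat => complex) => (nat => rr ^ 'n) => bool" where
 "kcoords ge \<beta> B r I u \<alpha> \<longleftrightarrow> coordinates (kspace B) r u \<and>
   (\<forall>i\<in>I. \<forall>\<mu>. kfil B i \<mu> = coordinates.labelled (kspace B) r u (\<lambda>k. ge (pairing (\<alpha> k) (\<beta> i)) \<mu>))"

lemma klyachko_spaceI:
 assumes "{} \<in> \<Sigma>" "\<And>i. {i} \<in> \<Sigma>" and k: "\<And>I. I \<in> \<Sigma> ==> \<exists>r u \<alpha>. kcoords ge \<beta> B r I u \<alpha>"
 shows "klyachko_space ge \<Sigma> \<beta> B"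
 unfolding klyachko_space_def
proof (intro conjI allI ballI)
 obtain r u where u: "coordinates (kspace B) r u" using k[OF assms(1)] by (auto simp: kcoords_def)
 show "cvector_space (kspace B)" using u by (rule coordinates.M)
 show "finite_dim (kspace B)" using u by (rule coordinates.finite_dim)
 show "csubspace (kfil B i \<mu>) (kspace B)" for i \<mu>
 proof -
  obtain r u \<alpha> where k: "kcoords ge \<beta> B r {i} u \<alpha>" using k[OF assms(2)] by blast
  then interpret coordinates "kspace B" r u by (simp add: kcoords_def)
  show ?thesis using k labelled_submodule by (simp add: kcoords_def)
 qed
 fix I assume "I \<in> \<Sigma>"
 then obtain r u \<alpha> where k: "kcoords ge \<beta> B r I u \<alpha>" using k by blast
 then interpret coordinates "kspace B" r u by (simp add: kcoords_def)
 let ?G = "\<lambda>p. labelled (\<lambda>k. perp_class \<beta> I (\<alpha> k) = p)"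
 have "kfil B i \<mu> = sum_of_subspaces (kspace B) ?G {perp_class \<beta> I \<alpha> | \<alpha>. ge (pairing \<alpha> (\<beta> i)) \<mu>}"
  if i: "i \<in> I" for i \<mu>
 proof -
  have "sum_of_subspaces (kspace B) ?G {perp_class \<beta> I \<alpha> | \<alpha>. ge (pairing \<alpha> (\<beta> i)) \<mu>}
    = labelled (\<lambda>k. perp_class \<beta> I (\<alpha> k) \<in> {perp_class \<beta> I \<alpha> | \<alpha>. ge (pairing \<alpha> (\<beta> i)) \<mu>})"
   by (rule sum_of_labelled[where Q = "range (perp_class \<beta> I)"]) auto
  also have "(\<lambda>k. perp_class \<beta> I (\<alpha> k) \<in> {perp_class \<beta> I \<alpha> | \<alpha>. ge (pairing \<alpha> (\<beta> i)) \<mu>})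
    = (\<lambda>k. ge (pairing (\<alpha> k) (\<beta> i)) \<mu>)"
   by (simp only: perp_class_mem[OF i])
  also have "labelled \<dots> = kfil B i \<mu>" using k i by (simp add: kcoords_def)
  finally show ?thesis by simp
 qed
 moreover have "is_grading (kspace B) ?G (range (perp_class \<beta> I))" by (rule grading_by_labels) simp
 ultimately show "\<exists>G. is_grading (kspace B) G (range (perp_class \<beta> I)) \<and> (\<forall>i\<in>I. \<forall>\<mu>. kfil B i \<mu>
   = sum_of_subspaces (kspace B) G {perp_class \<beta> I \<alpha> | \<alpha>. ge (pairing \<alpha> (\<beta> i)) \<mu>})"
  by (intro exI[of _ ?G]) simp
qed

lemma coordinates_rank:
 assumes "coordinates M r u" "coordinates M s w" shows "r = s"
proof -
 interpret u: coordinates M r u by (rule assms(1))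
 interpret w: coordinates M s w by (rule assms(2))
 show ?thesis
 proof (rule cvec_iso_rank)
  show "clinear_map (cvec r) (cvec s) (\<lambda>x. w (inv_into (carrier M) u x))"
   by (rule clinear_map_compose[OF clinear_map_inverse[OF u.M u.u u.bij] w.u])
  show "clinear_map (cvec s) (cvec r) (\<lambda>x. u (inv_into (carrier M) w x))"
   by (rule clinear_map_compose[OF clinear_map_inverse[OF w.M w.u w.bij] u.u])
  show "u (inv_into (carrier M) w (w (inv_into (carrier M) u x))) = x" if "x \<in> carrier (cvec r)" for x
   using u.u_inv[OF that] w.inv_u by simp
  show "w (inv_into (carrier M) u (u (inv_into (carrier M) w x))) = x" if "x \<in> carrier (cvec s)" for x
   using w.u_inv[OF that] u.inv_u by simp
 qed
qed

text \<open>A weight \<open>\<alpha> k\<close> is any representative of the degree of the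
  \<open>k\<close>-th homogeneous basis vector; its pairings with \<open>\<beta> i\<close>,
  \<open>i \<in> I\<close>, depend only on the class.\<close>

lemma klyachko_space_coords:
 assumes B: "klyachko_space ge \<Sigma> \<beta> B" and I: "I \<in> \<Sigma>"
 shows "\<exists>r u \<alpha>. kcoords ge \<beta> B r I u \<alpha>"
proof -
 obtain G where G: "is_grading (kspace B) G (range (perp_class \<beta> I))"
  and fil: "\<And>i \<mu>. i \<in> I ==> kfil B i \<mu>
   = sum_of_subspaces (kspace B) G {perp_class \<beta> I \<alpha> | \<alpha>. ge (pairing \<alpha> (\<beta> i)) \<mu>}"
  using bspec[OF conjunct2[OF conjunct2[OF conjunct2[OF B[unfolded klyachko_space_def]]]] I] by (elim exE conjE) simp
 have M: "cvector_space (kspace B)" "finite_dim (kspace B)" using B by (simp_all add: klyachko_space_def)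
 obtain r u q where u: "coordinates (kspace B) r u" and q: "\<And>k. k < r ==> q k \<in> range (perp_class \<beta> I)"
  and s: "\<And>P. P \<subseteq> range (perp_class \<beta> I) ==>
   sum_of_subspaces (kspace B) G P = coordinates.labelled (kspace B) r u (\<lambda>k. q k \<in> P)"
  using homogeneous_coordinates[OF M G] by metis
 interpret coordinates "kspace B" r u by (rule u)
 have "\<exists>\<alpha>. q k = perp_class \<beta> I \<alpha>" if "k < r" for k using q[OF that] by blast
 then obtain \<alpha> where \<alpha>: "\<And>k. k < r ==> q k = perp_class \<beta> I (\<alpha> k)" by metis
 have "kfil B i \<mu> = labelled (\<lambda>k. ge (pairing (\<alpha> k) (\<beta> i)) \<mu>)" if i: "i \<in> I" for i \<mu>
 proof -
  have "kfil B i \<mu> = labelled (\<lambda>k. q k \<in> {perp_class \<beta> I \<alpha> | \<alpha>. ge (pairing \<alpha> (\<beta> i)) \<mu>})"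
   unfolding fil[OF i] by (rule s) auto
  also have "\<dots> = labelled (\<lambda>k. ge (pairing (\<alpha> k) (\<beta> i)) \<mu>)"
  proof -
   have "q k \<in> {perp_class \<beta> I \<alpha> | \<alpha>. ge (pairing \<alpha> (\<beta> i)) \<mu>} \<longleftrightarrow> ge (pairing (\<alpha> k) (\<beta> i)) \<mu>" if "k < r" for k
    unfolding \<alpha>[OF that] by (rule perp_class_mem[OF i])
   then show ?thesis by (auto simp: labelled_def)
  qed
  finally show ?thesis .
 qed
 then have "kcoords ge \<beta> B r I u \<alpha>" using coordinates_axioms by (simp add: kcoords_def)
 then show ?thesis by blast
qed

lemma klyachko_space_rank:
 assumes B: "klyachko_space ge \<Sigma> \<beta> B" and "{} \<in> \<Sigma>"
 shows "\<exists>r. \<forall>I\<in>\<Sigma>. \<exists>u \<alpha>. kcoords ge \<beta> B r I u \<alpha>"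
proof -
 obtain r u \<alpha> where r: "kcoords ge \<beta> B r {} u \<alpha>" using klyachko_space_coords[OF assms] by blast
 show ?thesis
 proof (rule exI[of _ r], rule ballI)
  fix I assume "I \<in> \<Sigma>"
  then obtain s w \<alpha>' where s: "kcoords ge \<beta> B s I w \<alpha>'" using klyachko_space_coords[OF B] by blast
  then have "s = r" using r by (intro coordinates_rank) (auto simp: kcoords_def)
  then show "\<exists>u \<alpha>. kcoords ge \<beta> B r I u \<alpha>" using s by blast
 qed
qed

text \<open>A fibre of a bundle has its vectors in the type of the total space; this produces an
  isomorphic copy in the type used for Klyachko spaces.\<close>

lemma coordinates_transport:
 fixes j :: "(nat => complex) => 'v"
 assumes j: "inj j" and w: "coordinates M r w"
 shows "\<exists>(N :: (complex, 'v) module) u. cvector_space N \<and> clinear_map M N u \<and> bij_betw u (carrier M) (carrier N)"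
proof -
 interpret coordinates M r w by (rule w)
 define N :: "(complex, 'v) module" where "N = \<lparr>carrier = j ` carrier (cvec r), mult = undefined, one = undefined,
   zero = j \<zero>\<^bsub>cvec r\<^esub>, add = (\<lambda>x y. j (inv_into UNIV j x \<oplus>\<^bsub>cvec r\<^esub> inv_into UNIV j y)),
   smult = (\<lambda>c x. j (c \<odot>\<^bsub>cvec r\<^esub> inv_into UNIV j x))\<rparr>"
 have i: "inv_into UNIV j (j x) = x" for x using j by simp
 have N: "carrier N = j ` carrier (cvec r)" "\<zero>\<^bsub>N\<^esub> = j (\<lambda>k\<in>{..<r}. 0)"
  "j x \<oplus>\<^bsub>N\<^esub> j y = j (\<lambda>k\<in>{..<r}. x k + y k)" "c \<odot>\<^bsub>N\<^esub> j x = j (\<lambda>k\<in>{..<r}. c * x k)" for x y c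
  by (simp_all add: N_def i)
 have "cvector_space N"
 proof (rule cvector_space_by_coords[where f = "inv_into UNIV j"])
  have "inv_into UNIV j ` j ` A = A" for A by (auto simp: i image_image)
  then show "bij_betw (inv_into UNIV j) (carrier N) (carrier (cvec r))"
   unfolding N(1) bij_betw_def by (simp add: i inj_on_def del: cvec_sel)
  show "\<zero>\<^bsub>N\<^esub> \<in> carrier N" unfolding N(1,2) by (rule imageI) (auto simp: PiE_def extensional_def)
  show "inv_into UNIV j \<zero>\<^bsub>N\<^esub> k = 0" if "k < r" for k using that by (simp add: N(2) i)
  fix x y assume "x \<in> carrier N" "y \<in> carrier N"
  then obtain x' y' where xy: "x = j x'" "y = j y'" unfolding N(1) by blast
  show "x \<oplus>\<^bsub>N\<^esub> y \<in> carrier N" unfolding N(1) xy N(3) by (rule imageI) (auto simp: PiE_def extensional_def)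
  show "inv_into UNIV j (x \<oplus>\<^bsub>N\<^esub> y) k = inv_into UNIV j x k + inv_into UNIV j y k" if "k < r" for k
   using that unfolding xy N(3) i by simp
 next
  fix c x assume "x \<in> carrier N"
  then obtain x' where x: "x = j x'" unfolding N(1) by blast
  show "c \<odot>\<^bsub>N\<^esub> x \<in> carrier N" unfolding N(1) x N(4) by (rule imageI) (auto simp: PiE_def extensional_def)
  show "inv_into UNIV j (c \<odot>\<^bsub>N\<^esub> x) k = c * inv_into UNIV j x k" if "k < r" for k
   using that unfolding x N(4) i by simp
 qed
 moreover have "clinear_map M N (\<lambda>x. j (w x))"
 proof -
  have a: "w (x \<oplus>\<^bsub>M\<^esub> y) = (\<lambda>k\<in>{..<r}. w x k + w y k)" if "x \<in> carrier M" "y \<in> carrier M" for x y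
   by (rule cvec_eqI[OF u_carrier]) (use that u_add in auto)
  have s: "w (c \<odot>\<^bsub>M\<^esub> x) = (\<lambda>k\<in>{..<r}. c * w x k)" if "x \<in> carrier M" for c x
   by (rule cvec_eqI[OF u_carrier]) (use that u_scale scale_closed in auto)
  show ?thesis unfolding clinear_map_def using a s u_carrier by (simp add: N del: cvec_sel)
 qed
 moreover have "bij_betw (\<lambda>x. j (w x)) (carrier M) (carrier N)"
  using bij_betw_trans[OF bij inj_on_imp_bij_betw[OF inj_on_subset[OF j subset_UNIV]]] by (simp add: N(1) o_def)
 ultimately show ?thesis by blast
qed

lemma klyachko_space_subset: "klyachko_space ge \<Sigma> \<beta> B ==> kfil B i \<mu> \<subseteq> carrier (kspace B)"
 using module.submoduleE(1)[of C_ring "kspace B" "kfil B i \<mu>"] by (simp add: klyachko_space_def)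

lemma is_category_KVS: "is_category (KVS ge \<Sigma> \<beta>)"
 unfolding KVS_def
proof (rule concrete_category; unfold mem_Collect_eq)
 fix A assume A: "klyachko_space ge \<Sigma> \<beta> A"
 then have M: "cvector_space (kspace A)" by (simp add: klyachko_space_def)
 note s = klyachko_space_subset[OF A]
 interpret module C_ring "kspace A" by (rule M)
 show "(\<lambda>x\<in>carrier (kspace A). x) \<in> extensional (carrier (kspace A)) \<and>
   clinear_map (kspace A) (kspace A) (\<lambda>x\<in>carrier (kspace A). x) \<and>
   (\<forall>i \<mu>. (\<lambda>x\<in>carrier (kspace A). x) ` kfil A i \<mu> \<subseteq> kfil A i \<mu>)"
  using s smult_closed by (auto simp: clinear_map_def)
 fix B D f g
 assume f: "f \<in> extensional (carrier (kspace A)) \<and> clinear_map (kspace A) (kspace B) f \<and> (\<forall>i \<mu>. f ` kfil A i \<mu> \<subseteq> kfil B i \<mu>)"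
 then show "f \<in> extensional (carrier (kspace A)) \<and> f ` carrier (kspace A) \<subseteq> carrier (kspace B)"
  by (auto simp: clinear_map_def)
 assume g: "g \<in> extensional (carrier (kspace B)) \<and> clinear_map (kspace B) (kspace D) g \<and> (\<forall>i \<mu>. g ` kfil B i \<mu> \<subseteq> kfil D i \<mu>)"
 have "clinear_map (kspace A) (kspace D) (compose (carrier (kspace A)) g f)"
  by (rule clinear_map_cong[OF M clinear_map_compose[of "kspace A" "kspace B" f "kspace D" g]])
   (use f g in \<open>auto simp: compose_def\<close>)
 moreover have "compose (carrier (kspace A)) g f ` kfil A i \<mu> \<subseteq> kfil D i \<mu>" for i \<mu>
 proof -
  have "compose (carrier (kspace A)) g f ` kfil A i \<mu> = g ` f ` kfil A i \<mu>"
   unfolding image_image by (rule image_cong) (use s in \<open>auto simp: compose_def\<close>)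
  also have "\<dots> \<subseteq> g ` kfil B i \<mu>" using f by (intro image_mono) simp
  finally show ?thesis using g by (metis subset_trans)
 qed
 ultimately show "compose (carrier (kspace A)) g f \<in> extensional (carrier (kspace A)) \<and>
   clinear_map (kspace A) (kspace D) (compose (carrier (kspace A)) g f) \<and>
   (\<forall>i \<mu>. compose (carrier (kspace A)) g f ` kfil A i \<mu> \<subseteq> kfil D i \<mu>)" by simp
qed

section \<open>Bundles compared with their filtered base fibres\<close>

context toric_bundles
begin

definition bcat :: "(('m, 'n, 'e, 'z) toric_scheme, 'e => 'e) cat" where
 "bcat = \<lparr>cobj = {E. \<exists>r. kly r E}, chom = hom, cid = (\<lambda>E. \<lambda>e\<in>topspace (total E). e),
   ccomp = (\<lambda>E F G g f. compose (topspace (total E)) g f)\<rparr>"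

lemma hom_id:
 assumes E: "kly r E" shows "(\<lambda>e\<in>topspace (total E). e) \<in> hom E E"
proof -
 have "clinear_map (fiber E x) (fiber E x) (\<lambda>e\<in>topspace (total E). e)" if "x \<in> proj E ` topspace (total E)" for x
 proof (rule clinear_map_cong[where f = "\<lambda>e. e"])
  show "cvector_space (fiber E x)" using that kly_proj_in[OF E] kly_fiber[OF E] by blast
  show "clinear_map (fiber E x) (fiber E x) (\<lambda>e. e)" by (simp add: clinear_map_def)
 qed (simp add: part_over_def)
 moreover have "reg_map b (tm E) (tm E) (\<lambda>e\<in>topspace (total E). e)"
  by (rule reg_map_cong[OF kly_mfd[OF E] kly_mfd[OF E] reg_map_id[OF kly_mfd[OF E]]]) simp
 ultimately show ?thesis using gact_total[OF E] by (simp add: hom_def equivariant_morphism_def)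
qed

lemma hom_compose:
 assumes E: "kly r E" and F: "kly s F" and G: "kly t G" and f: "f \<in> hom E F" and g: "g \<in> hom F G"
 shows "compose (topspace (total E)) g f \<in> hom E G"
proof -
 have fm: "equivariant_morphism E F f" "reg_map b (tm E) (tm F) f" using f by (simp_all add: hom_def)
 have gm: "equivariant_morphism F G g" "reg_map b (tm F) (tm G) g" using g by (simp_all add: hom_def)
 note fp = morphism_props[OF E fm] and gp = morphism_props[OF F gm]
 have "clinear_map (fiber E x) (fiber G x) (compose (topspace (total E)) g f)" if x: "x \<in> proj E ` topspace (total E)" for x
 proof (rule clinear_map_cong[OF _ clinear_map_compose])
  show "cvector_space (fiber E x)" using x kly_proj_in[OF E] kly_fiber[OF E] by blast
  show "clinear_map (fiber E x) (fiber F x) f" using fm(1) x unfolding equivariant_morphism_def by blast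
  obtain e where e: "e \<in> topspace (total E)" "x = proj E e" using x by blast
  have "x = proj F (f e)" "f e \<in> topspace (total F)" using fp(2,3)[OF e(1)] e(2) by simp_all
  then have "x \<in> proj F ` topspace (total F)" by blast
  then show "clinear_map (fiber F x) (fiber G x) g" using gm(1) unfolding equivariant_morphism_def by blast
 qed (simp add: part_over_def compose_def)
 moreover have "reg_map b (tm E) (tm G) (compose (topspace (total E)) g f)"
  by (rule reg_map_cong[OF kly_mfd[OF E] kly_mfd[OF G] reg_map_compose[OF kly_mfd[OF E] kly_mfd[OF F] kly_mfd[OF G] fm(2) gm(2)]])
   (simp add: compose_def)
 ultimately show ?thesis
  using fp(2-4) gp(3,4) gact_total[OF E] by (simp add: hom_def equivariant_morphism_def compose_def)
qed

lemma is_category_bcat: "is_category bcat"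
 unfolding bcat_def
proof (rule concrete_category; unfold mem_Collect_eq)
 fix E F f assume E: "\<exists>r. kly r E" and f: "f \<in> hom E F"
 have "f e \<in> topspace (total F)" if "e \<in> topspace (total E)" for e
  using E f morphism_props(2) that unfolding hom_def by blast
 moreover have "f \<in> extensional (topspace (total E))" using f by (simp add: hom_def equivariant_morphism_def)
 ultimately show "f \<in> extensional (topspace (total E)) \<and> f ` topspace (total E) \<subseteq> topspace (total F)" by blast
next
 show "(\<lambda>e\<in>topspace (total E). e) \<in> hom E E" if "\<exists>r. kly r E" for E using that hom_id by blast
 show "compose (topspace (total E)) g f \<in> hom E G"
  if "\<exists>r. kly r E" "\<exists>r. kly r F" "\<exists>r. kly r G" "f \<in> hom E F" "g \<in> hom F G" for E F G f g
  using that hom_compose by blast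
qed

text \<open>\<open>B\<close> is the filtered fibre of \<open>E\<close> over the base point, transported along \<open>u\<close>.\<close>

definition linked :: "('m, 'n, 'e, 'z) toric_scheme => ('m, 'v) kvs => ('e => 'v) => bool" where
 "linked E B u \<longleftrightarrow> (\<exists>r. kly r E) \<and> klyachko_space (ge_reg b) \<Sigma> \<beta> B \<and>
   clinear_map (fiber E x0) (kspace B) u \<and> bij_betw u (part_over E {x0}) (carrier (kspace B)) \<and>
   (\<forall>i \<mu>. kfil B i \<mu> = u ` fil E i \<mu>)"

lemma fil_subset: "fil E i \<mu> \<subseteq> part_over E {x0}" by (auto simp: fil_def)

text \<open>The coordinates of a trivialization over \<open>U\<^sub>I\<close> carry over to the copy
  of the fibre, and \<open>fil_iff\<close> is precisely the adaptedness demanded by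
  \<open>kcoords\<close>.\<close>

lemma ex_linked_space:
 fixes j :: "(nat => complex) => 'v"
 assumes j: "inj j" and E: "kly r E"
 shows "\<exists>(B :: ('m, 'v) kvs) u. linked E B u"
proof -
 obtain \<Phi> \<alpha> where "ctriv E r {} \<Phi> \<alpha>" using kly_ctriv[OF E empty_in] by blast
 then have "coordinates (fiber E x0) r (\<lambda>e. snd (\<Phi> e))" by (rule triv_coordinates[OF E empty_in _ x0_open])
 from coordinates_transport[OF j this] obtain N :: "(complex, 'v) module" and u where
  N: "cvector_space N" and u: "clinear_map (fiber E x0) N u" "bij_betw u (part_over E {x0}) (carrier N)" by auto
 define B where "B = \<lparr>kspace = N, kfil = (\<lambda>i \<mu>. u ` fil E i \<mu>)\<rparr>"
 let ?i = "inv_into (part_over E {x0}) u"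
 have fib: "cvector_space (fiber E x0)" by (rule kly_fiber[OF E x0_topspace])
 have iu: "?i (u e) = e" if "e \<in> part_over E {x0}" for e using u(2) that by (simp add: bij_betw_def)
 have ui: "?i x \<in> part_over E {x0}" "u (?i x) = x" if "x \<in> carrier N" for x
  using u(2) that by (auto simp: bij_betw_def inv_into_into f_inv_into_f)
 have ic: "clinear_map N (fiber E x0) ?i" "bij_betw ?i (carrier N) (part_over E {x0})"
  using clinear_map_inverse[OF fib u(1)] u(2) bij_betw_inv_into[OF u(2)] by simp_all
 have "klyachko_space (ge_reg b) \<Sigma> \<beta> B"
 proof (rule klyachko_spaceI[OF empty_in vertex_in])
  fix I assume I: "I \<in> \<Sigma>"
  obtain \<Phi> \<alpha> where ct: "ctriv E r I \<Phi> \<alpha>" using kly_ctriv[OF E I] by blast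
  have "coordinates (fiber E x0) r (\<lambda>e. snd (\<Phi> e))" by (rule triv_coordinates[OF E I ct x0_open])
  then interpret c: coordinates N r "\<lambda>x. snd (\<Phi> (?i x))"
   by (rule coordinates_compose[OF _ N ic(1)]) (use ic(2) in simp)
  have "u ` fil E i \<mu> = c.labelled (\<lambda>k. ge_reg b (pairing (\<alpha> k) (\<beta> i)) \<mu>)" if i: "i \<in> I" for i \<mu>
  proof
   show "u ` fil E i \<mu> \<subseteq> c.labelled (\<lambda>k. ge_reg b (pairing (\<alpha> k) (\<beta> i)) \<mu>)"
   proof
    fix x assume "x \<in> u ` fil E i \<mu>"
    then obtain e where e: "e \<in> fil E i \<mu>" "x = u e" by blast
    have "e \<in> part_over E {x0}" using e(1) fil_subset by blast
    then show "x \<in> c.labelled (\<lambda>k. ge_reg b (pairing (\<alpha> k) (\<beta> i)) \<mu>)"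
     using fil_iff[OF E I ct i] e bij_betwE[OF u(2)] by (simp add: c.labelled_def iu)
   qed
   show "c.labelled (\<lambda>k. ge_reg b (pairing (\<alpha> k) (\<beta> i)) \<mu>) \<subseteq> u ` fil E i \<mu>"
   proof
    fix x assume x: "x \<in> c.labelled (\<lambda>k. ge_reg b (pairing (\<alpha> k) (\<beta> i)) \<mu>)"
    then have xN: "x \<in> carrier N" by (simp add: c.labelled_def)
    have "?i x \<in> fil E i \<mu>" using fil_iff[OF E I ct i ui(1)[OF xN]] x by (simp add: c.labelled_def)
    then show "x \<in> u ` fil E i \<mu>" using ui(2)[OF xN] by force
   qed
  qed
  then have "kcoords (ge_reg b) \<beta> B r I (\<lambda>x. snd (\<Phi> (?i x))) \<alpha>"
   using c.coordinates_axioms by (simp add: kcoords_def B_def)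
  then show "\<exists>r u \<alpha>. kcoords (ge_reg b) \<beta> B r I u \<alpha>" by blast
 qed
 then have "linked E B u" using E u by (auto simp: linked_def B_def)
 then show ?thesis by blast
qed

definition transfer :: "('m, 'n, 'e, 'z) toric_scheme \<times> ('m, 'v) kvs \<times> ('e => 'v) =>
  ('m, 'n, 'e, 'z) toric_scheme \<times> ('m, 'v) kvs \<times> ('e => 'v) => ('e => 'e) => 'v => 'v" where
 "transfer = (\<lambda>(E, B, u) (F, C, t) f. \<lambda>x\<in>carrier (kspace B). t (f (inv_into (part_over E {x0}) u x)))"

context
 fixes E :: "('m, 'n, 'e, 'z) toric_scheme" and B :: "('m, 'v) kvs" and u
 assumes l: "linked E B u"
begin

lemma linked_kly: "\<exists>r. kly r E" and linked_space: "klyachko_space (ge_reg b) \<Sigma> \<beta> B"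
 and linked_linear: "clinear_map (fiber E x0) (kspace B) u"
 and linked_bij: "bij_betw u (part_over E {x0}) (carrier (kspace B))"
 and linked_fil: "kfil B i \<mu> = u ` fil E i \<mu>"
 using l by (simp_all add: linked_def)

lemma linked_inv: "e \<in> part_over E {x0} ==> inv_into (part_over E {x0}) u (u e) = e"
 using linked_bij by (simp add: bij_betw_def)

lemma linked_into: "e \<in> part_over E {x0} ==> u e \<in> carrier (kspace B)"
 using linked_bij by (auto simp: bij_betw_def)

lemma linked_surj: "x \<in> carrier (kspace B) ==> \<exists>e\<in>part_over E {x0}. x = u e"
 using linked_bij by (auto simp: bij_betw_def)

lemma transfer_u: "e \<in> part_over E {x0} ==> transfer (E, B, u) (F, C, t) f (u e) = t (f e)"
 using linked_inv linked_into by (simp add: transfer_def)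

lemma linked_inverse_linear: "clinear_map (kspace B) (fiber E x0) (inv_into (part_over E {x0}) u)"
proof -
 obtain r where "kly r E" using linked_kly by blast
 from clinear_map_inverse[OF kly_fiber[OF this x0_topspace] linked_linear] show ?thesis using linked_bij by simp
qed

end

lemma x0_in_proj: "e \<in> part_over E {x0} ==> x0 \<in> proj E ` topspace (total E)" 
 by (auto simp: part_over_def)

lemma hom_fiber_linear:
 assumes E: "kly r E" and f: "f \<in> hom E F" shows "clinear_map (fiber E x0) (fiber F x0) f"
proof -
 interpret module C_ring "fiber E x0" by (rule kly_fiber[OF E x0_topspace])
 have "fzero E x0 \<in> part_over E {x0}" using zero_closed by simp
 from x0_in_proj[OF this] show ?thesis using f unfolding hom_def equivariant_morphism_def by blast
qed

text \<open>Restriction to the base fibre lands in filtered maps by \<open>hom_fil\<close>, is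
  injective by \<open>hom_eqI\<close> and surjective by \<open>hom_extension\<close>.\<close>

lemma transfer_bij:
 assumes w: "linked E B u" and v: "linked F C t"
 shows "bij_betw (transfer (E, B, u) (F, C, t)) (hom E F) (chom (KVS (ge_reg b) \<Sigma> \<beta>) B C)"
proof -
 obtain r s where E: "kly r E" and F: "kly s F" using linked_kly[OF w] linked_kly[OF v] by blast
 have MB: "cvector_space (kspace B)" using linked_space[OF w] by (simp add: klyachko_space_def)
 let ?T = "transfer (E, B, u) (F, C, t)"
 have fe: "f e \<in> part_over F {x0}" if "f \<in> hom E F" "e \<in> part_over E {x0}" for f e
  using hom_fiber_linear[OF E that(1)] that(2) by (auto simp: clinear_map_def)
 have "?T f \<in> chom (KVS (ge_reg b) \<Sigma> \<beta>) B C" if f: "f \<in> hom E F" for f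
 proof -
  have "clinear_map (kspace B) (kspace C) (?T f)"
   by (rule clinear_map_cong[OF MB clinear_map_compose[OF clinear_map_compose[OF linked_inverse_linear[OF w]
      hom_fiber_linear[OF E f]] linked_linear[OF v]]]) (simp add: transfer_def)
  moreover have "?T f ` kfil B i \<mu> \<subseteq> kfil C i \<mu>" for i \<mu>
  proof
   fix y assume "y \<in> ?T f ` kfil B i \<mu>"
   then obtain e where e: "e \<in> fil E i \<mu>" "y = ?T f (u e)" unfolding linked_fil[OF w] by blast
   then have "y = t (f e)" using transfer_u[OF w, of e] fil_subset by blast
   then show "y \<in> kfil C i \<mu>" unfolding linked_fil[OF v] using hom_fil[OF E F f e(1)] by blast
  qed
  ultimately show ?thesis by (simp add: KVS_def transfer_def)
 qed
 moreover have "f = f'" if f: "f \<in> hom E F" "f' \<in> hom E F" and eq: "?T f = ?T f'" for f f'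
 proof (rule hom_eqI[OF E F f])
  fix e assume e: "e \<in> part_over E {x0}"
  have "t (f e) = t (f' e)" using eq transfer_u[OF w e] by metis
  then show "f e = f' e" using linked_inv[OF v] fe[OF f(1) e] fe[OF f(2) e] by metis
 qed
 moreover have "g \<in> ?T ` hom E F" if "g \<in> chom (KVS (ge_reg b) \<Sigma> \<beta>) B C" for g
 proof -
  have g: "g \<in> extensional (carrier (kspace B))" "clinear_map (kspace B) (kspace C) g"
   "\<And>i \<mu>. g ` kfil B i \<mu> \<subseteq> kfil C i \<mu>" using that by (simp_all add: KVS_def)
  let ?f0 = "\<lambda>e. inv_into (part_over F {x0}) t (g (u e))"
  have lin: "clinear_map (fiber E x0) (fiber F x0) ?f0"
   by (rule clinear_map_compose[OF clinear_map_compose[OF linked_linear[OF w] g(2)] linked_inverse_linear[OF v]])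
  have "?f0 e \<in> fil F i \<mu>" if e: "e \<in> fil E i \<mu>" for e i \<mu>
  proof -
   have "g (u e) \<in> kfil C i \<mu>" using g(3)[of i \<mu>] e linked_fil[OF w] by blast
   then obtain e' where e': "e' \<in> fil F i \<mu>" "g (u e) = t e'" unfolding linked_fil[OF v] by blast
   then have "?f0 e = e'" using linked_inv[OF v, of e'] fil_subset by auto
   then show ?thesis using e' by simp
  qed
  from bexE[OF hom_extension[OF E F lin this]]
  obtain f where f: "f \<in> hom E F" "\<And>e. e \<in> part_over E {x0} ==> f e = ?f0 e" by metis
  have "?T f x = g x" for x
  proof (cases "x \<in> carrier (kspace B)")
   case True
   then obtain e where e: "e \<in> part_over E {x0}" "x = u e" using linked_surj[OF w] by blast
   have "g x \<in> carrier (kspace C)" using g(2) True by (auto simp: clinear_map_def)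
   then obtain e' where e': "e' \<in> part_over F {x0}" "g x = t e'" using linked_surj[OF v] by blast
   have "f e = e'" using f(2)[OF e(1)] e(2) e' linked_inv[OF v] by simp
   then show ?thesis using transfer_u[OF w e(1)] e(2) e'(2) by simp
  next
   case False
   then show ?thesis using g(1) by (simp add: transfer_def extensional_def)
  qed
  then have "?T f = g" by blast
  then show ?thesis using f(1) by blast
 qed
 ultimately show ?thesis unfolding bij_betw_def inj_on_def by blast
qed

theorem bcat_equivalent_KVS:
 fixes j :: "(nat => complex) => 'v"
 assumes j: "inj j" and ex: "\<And>B :: ('m, 'v) kvs. klyachko_space (ge_reg b) \<Sigma> \<beta> B ==> \<exists>E u. linked E B u"
 shows "equivalent_categories bcat (KVS (ge_reg b) \<Sigma> \<beta> :: (('m, 'v) kvs, 'v => 'v) cat)"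
proof (rule equivalent_categories_correspondence[OF is_category_bcat is_category_KVS,
   where W = "{(E, B, u). linked E B u}" and a = fst and b = "\<lambda>w. fst (snd w)" and T = transfer])
 show "fst ` {(E, B :: ('m, 'v) kvs, u). linked E B u} = cobj bcat"
 proof
  show "fst ` {(E, B :: ('m, 'v) kvs, u). linked E B u} \<subseteq> cobj bcat" using linked_kly by (auto simp: bcat_def)
  show "cobj bcat \<subseteq> fst ` {(E, B :: ('m, 'v) kvs, u). linked E B u}"
  proof
   fix E assume "E \<in> cobj bcat"
   then obtain r where "kly r E" by (auto simp: bcat_def)
   then obtain B :: "('m, 'v) kvs" and u where "linked E B u" using ex_linked_space[OF j] by blast
   then show "E \<in> fst ` {(E, B :: ('m, 'v) kvs, u). linked E B u}" by force
  qed
 qed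
 show "(\<lambda>w. fst (snd w)) ` {(E, B :: ('m, 'v) kvs, u). linked E B u} = cobj (KVS (ge_reg b) \<Sigma> \<beta>)"
 proof
  show "(\<lambda>w. fst (snd w)) ` {(E, B :: ('m, 'v) kvs, u). linked E B u} \<subseteq> cobj (KVS (ge_reg b) \<Sigma> \<beta>)"
   using linked_space by (auto simp: KVS_def)
  show "cobj (KVS (ge_reg b) \<Sigma> \<beta>) \<subseteq> (\<lambda>w. fst (snd w)) ` {(E, B :: ('m, 'v) kvs, u). linked E B u}"
  proof
   fix B :: "('m, 'v) kvs" assume "B \<in> cobj (KVS (ge_reg b) \<Sigma> \<beta>)"
   then obtain E u where "linked E B u" using ex[of B] by (auto simp: KVS_def)
   then show "B \<in> (\<lambda>w. fst (snd w)) ` {(E, B :: ('m, 'v) kvs, u). linked E B u}" by force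
  qed
 qed
next
 fix w v assume w: "w \<in> {(E, B :: ('m, 'v) kvs, u). linked E B u}" and v: "v \<in> {(E, B :: ('m, 'v) kvs, u). linked E B u}"
 show "bij_betw (transfer w v) (chom bcat (fst w) (fst v)) (chom (KVS (ge_reg b) \<Sigma> \<beta>) (fst (snd w)) (fst (snd v)))"
  using w v transfer_bij by (auto simp: bcat_def)
next
 fix w assume "w \<in> {(E, B :: ('m, 'v) kvs, u). linked E B u}"
 then obtain E u and B :: "('m, 'v) kvs" where w: "w = (E, B, u)" "linked E B u" by auto
 have "transfer w w (cid bcat E) x = cid (KVS (ge_reg b) \<Sigma> \<beta>) B x" for x
 proof (cases "x \<in> carrier (kspace B)")
  case True
  then obtain e where e: "e \<in> part_over E {x0}" "x = u e" using linked_surj[OF w(2)] by blast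
  then have "e \<in> topspace (total E)" by (simp add: part_over_def)
  then show ?thesis using transfer_u[OF w(2) e(1)] True e(2) by (simp add: w(1) bcat_def KVS_def)
 qed (simp add: w(1) transfer_def KVS_def)
 then show "transfer w w (cid bcat (fst w)) = cid (KVS (ge_reg b) \<Sigma> \<beta>) (fst (snd w))" by (auto simp: w(1))
next
 fix w v x f g
 assume "w \<in> {(E, B :: ('m, 'v) kvs, u). linked E B u}" "v \<in> {(E, B :: ('m, 'v) kvs, u). linked E B u}"
  "x \<in> {(E, B :: ('m, 'v) kvs, u). linked E B u}"
  and f: "f \<in> chom bcat (fst w) (fst v)" and g: "g \<in> chom bcat (fst v) (fst x)"
 then obtain E u F t G s and B C D :: "('m, 'v) kvs" where w: "w = (E, B, u)" "linked E B u"
  and v: "v = (F, C, t)" "linked F C t" and x: "x = (G, D, s)" "linked G D s" by auto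
 have "transfer w x (compose (topspace (total E)) g f) y = compose (carrier (kspace B)) (transfer v x g) (transfer w v f) y" for y
 proof (cases "y \<in> carrier (kspace B)")
  case True
  then obtain e where e: "e \<in> part_over E {x0}" "y = u e" using linked_surj[OF w(2)] by blast
  obtain r where "kly r E" using linked_kly[OF w(2)] by blast
  moreover have "f \<in> hom E F" using f by (simp add: w(1) v(1) bcat_def)
  ultimately have "f e \<in> part_over F {x0}" using hom_fiber_linear e(1) by (fastforce simp: clinear_map_def)
  moreover have "e \<in> topspace (total E)" using e(1) by (simp add: part_over_def)
  ultimately show ?thesis
   using transfer_u[OF w(2) e(1)] transfer_u[OF v(2)] True by (simp add: w(1) v(1) x(1) e(2) compose_def)
 qed (simp add: w(1) x(1) transfer_def compose_def)
 then show "transfer w x (ccomp bcat (fst w) (fst v) (fst x) g f)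
   = ccomp (KVS (ge_reg b) \<Sigma> \<beta>) (fst (snd w)) (fst (snd v)) (fst (snd x)) (transfer v x g) (transfer w v f)"
  by (auto simp: bcat_def KVS_def w(1) v(1) x(1))
qed

end

section \<open>The bundle of a Klyachko vector space\<close>

text \<open>\<open>mk E A\<close> is the bundle \<open>E\<close> equipped with the atlas \<open>A\<close>; the injection \<open>j\<close> places the points
 \<open>(p, v)\<close> of the bundle in the universe \<open>'e\<close>.\<close>

locale space_bundle = toric_bundles \<Sigma> \<beta> b tm
 for \<Sigma> :: "'m::finite set set" and \<beta> :: "'m => rr ^ 'n" and b
  and tm :: "('m, 'n, 'e, 'z) toric_scheme => ('e, nat) mfd" +
 fixes mk :: "((complex ^ 'm) set, complex ^ 'n, 'e) eq_bundle => ('e, nat) atlas =>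
   ('m, 'n, 'e, 'z) toric_scheme"
  and j :: "(complex ^ 'm) set \<times> (nat => complex) => 'e"
  and B :: "('m, 'v) kvs" and r :: nat and u :: "'m set => 'v => nat => complex" and \<alpha> :: "'m set => nat => rr ^ 'n"
 assumes mk [simp]: "total (mk E A) = total E" "proj (mk E A) = proj E" "fzero (mk E A) = fzero E"
   "fadd (mk E A) = fadd E" "fscale (mk E A) = fscale E" "gact (mk E A) = gact E"
  and tm_mk: "tm (mk E A) = \<lparr>mtop = total E, matlas = (if b then A else {})\<rparr>"
  and j: "inj_on j (topspace (toric_top \<Sigma> \<beta>) \<times> UNIV)"
  and kc: "\<And>I. I \<in> \<Sigma> ==> kcoords (ge_reg b) \<beta> B r I (u I) (\<alpha> I)"
begin

abbreviation "X \<equiv> topspace Xtop"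
abbreviation "C \<equiv> carrier (cvec r)"

declare cvec_sel(1) [simp del] topspace_cspace [simp del]

lemma C_I [simp]: "(\<lambda>k\<in>{..<r}. f k) \<in> C" by (simp add: cvec_sel(1))

lemma C_eta: "v \<in> C ==> (\<lambda>k\<in>{..<r}. v k) = v"
 by (rule cvec_eqI[OF C_I]) auto

lemma topspace_C [simp]: "topspace (cspace {..<r}) = C" by (simp add: cvec_sel(1) topspace_cspace)

lemma co: "I \<in> \<Sigma> ==> coordinates (kspace B) r (u I)" using kc by (simp add: kcoords_def)

lemma kfil_iff: "I \<in> \<Sigma> ==> i \<in> I ==>
  x \<in> kfil B i \<mu> \<longleftrightarrow> x \<in> carrier (kspace B) \<and> (\<forall>k<r. u I x k \<noteq> 0 --> ge_reg b (pairing (\<alpha> I k) (\<beta> i)) \<mu>)"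
 using kc[of I] coordinates.labelled_def[OF co, of I] by (simp add: kcoords_def)

text \<open>The change of basis from the basis adapted to \<open>J\<close> to the one adapted to
  \<open>I\<close>; it is the transition function at the base point.\<close>

definition a :: "'m set => 'm set => nat => nat => complex" where
 "a I J k l = u I (inv_into (carrier (kspace B)) (u J) (cunit r l)) k"

lemma a_change:
 assumes I: "I \<in> \<Sigma>" and J: "J \<in> \<Sigma>" and x: "x \<in> carrier (kspace B)" and k: "k < r"
 shows "u I x k = (\<Sum>l<r. a I J k l * u J x l)"
proof -
 interpret J: coordinates "kspace B" r "u J" by (rule co[OF J])
 have "clinear_map (cvec r) (cvec r) (\<lambda>w. u I (inv_into (carrier (kspace B)) (u J) w))"
  by (rule clinear_map_compose[OF clinear_map_inverse[OF J.M J.u J.bij] coordinates.u[OF co[OF I]]])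
 from clinear_map_expand[OF this J.u_carrier[OF x] k] show ?thesis using J.inv_u[OF x] by (simp add: a_def)
qed

lemma basis_vector:
 assumes J: "J \<in> \<Sigma>"
 shows "inv_into (carrier (kspace B)) (u J) (cunit r l) \<in> carrier (kspace B)"
  "u J (inv_into (carrier (kspace B)) (u J) (cunit r l)) = cunit r l"
 using coordinates.u_inv[OF co[OF J] cunit_carrier] by blast+

lemma a_id: "I \<in> \<Sigma> ==> k < r ==> a I I k l = (if k = l then 1 else 0)"
 by (simp add: a_def basis_vector cunit_nth)

lemma a_comp:
 assumes I: "I \<in> \<Sigma>" and J: "J \<in> \<Sigma>" and K: "K \<in> \<Sigma>" and k: "k < r"
 shows "a I K k l = (\<Sum>m<r. a I J k m * a J K m l)"
 unfolding a_def[of I K] a_def[of J K] by (rule a_change[OF I J basis_vector(1)[OF K] k])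

text \<open>The \<open>l\<close>-th vector of the basis for \<open>J\<close> lies in the step of
  filtration \<open>i\<close> given by its weight. Read in the basis for \<open>I\<close>, this
  bounds the weights of its nonzero coordinates.\<close>

lemma a_ge:
 assumes I: "I \<in> \<Sigma>" and J: "J \<in> \<Sigma>" and i: "i \<in> I" "i \<in> J" and kl: "k < r" "l < r" and nz: "a I J k l \<noteq> 0"
 shows "ge_reg b (pairing (\<alpha> I k - \<alpha> J l) (\<beta> i)) 0"
proof -
 let ?x = "inv_into (carrier (kspace B)) (u J) (cunit r l)"
 have "?x \<in> kfil B i (pairing (\<alpha> J l) (\<beta> i))"
  unfolding kfil_iff[OF J i(2)] basis_vector(2)[OF J] using basis_vector(1)[OF J] by (simp add: cunit_nth)
 then have "ge_reg b (pairing (\<alpha> I k) (\<beta> i)) (pairing (\<alpha> J l) (\<beta> i))"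
  unfolding kfil_iff[OF I i(1)] using nz kl(1) by (simp add: a_def)
 then show ?thesis by (subst (asm) ge_reg_diff) (simp add: pairing_diff_left)
qed

abbreviation "tr I J \<equiv> tw r r (a I J) (\<alpha> I) (\<alpha> J)"
lemmas tr_C [simp] = tw_C[of r r]

lemma tr_id:
 assumes I: "I \<in> \<Sigma>" and v: "v \<in> C" shows "tr I I p v = v"
proof (rule cvec_eqI[OF tr_C v])
 fix k assume k: "k < r"
 have "a I I k l * Xi \<beta> (\<alpha> I k - \<alpha> I l) p * v l = (if k = l then v l else 0)" for l
  by (simp add: a_id[OF I k])
 then show "tr I I p v k = v k" using k by (simp add: tw_def)
qed

text \<open>The cocycle identity, also at points of divisors: wherever both coefficients are
  nonzero, \<open>a_ge\<close> makes both exponents nonnegative on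
  \<open>I \<inter> J \<inter> K\<close>, so the powers multiply even at vanishing coordinates. The
  coefficients multiply as change of basis matrices.\<close>

lemma tr_comp:
 assumes I: "I \<in> \<Sigma>" and J: "J \<in> \<Sigma>" and K: "K \<in> \<Sigma>" and p: "p \<in> UI I" "p \<in> UI J" "p \<in> UI K"
 shows "tr I J p (tr J K p v) = tr I K p v"
proof (rule cvec_eqI[OF tr_C tr_C])
 fix k assume k: "k < r"
 have p': "p \<in> UI (I \<inter> J \<inter> K)" using p toric_open_Int[of \<beta> I J] toric_open_Int[of \<beta> "I \<inter> J" K] by blast
 have te: "a I J k m * Xi \<beta> (\<alpha> I k - \<alpha> J m) p * (a J K m l * Xi \<beta> (\<alpha> J m - \<alpha> K l) p * v l)
   = a I J k m * a J K m l * (Xi \<beta> (\<alpha> I k - \<alpha> K l) p * v l)" if ml: "m < r" "l < r" for m l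
 proof (cases "a I J k m = 0 \<or> a J K m l = 0")
  case True
  then show ?thesis by auto
 next
  case False
  have "Xi \<beta> ((\<alpha> I k - \<alpha> J m) + (\<alpha> J m - \<alpha> K l)) p = Xi \<beta> (\<alpha> I k - \<alpha> J m) p * Xi \<beta> (\<alpha> J m - \<alpha> K l) p"
   by (rule Xi_add_ge[OF p', where b = b]) (use a_ge I J K k ml False in auto)
  then show ?thesis by (simp add: mult_ac)
 qed
 have "tr I J p (tr J K p v) k
   = (\<Sum>m<r. \<Sum>l<r. a I J k m * Xi \<beta> (\<alpha> I k - \<alpha> J m) p * (a J K m l * Xi \<beta> (\<alpha> J m - \<alpha> K l) p * v l))"
  using k by (simp add: tw_def sum_distrib_left)
 also have "\<dots> = (\<Sum>m<r. \<Sum>l<r. a I J k m * a J K m l * (Xi \<beta> (\<alpha> I k - \<alpha> K l) p * v l))"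
  using te by (intro sum.cong refl) simp
 also have "\<dots> = (\<Sum>l<r. (\<Sum>m<r. a I J k m * a J K m l) * (Xi \<beta> (\<alpha> I k - \<alpha> K l) p * v l))"
  by (subst sum.swap) (simp add: sum_distrib_right)
 also have "\<dots> = tr I K p v k" using k by (simp add: tw_def a_comp[OF I J K k] mult.assoc)
 finally show "tr I J p (tr J K p v) k = tr I K p v k" .
qed

section \<open>The total space and its local trivializations\<close>

definition S :: "(complex ^ 'm) set => 'm set" where "S p = (SOME I. I \<in> \<Sigma> \<and> p \<in> UI I)"

lemma S: "p \<in> X ==> S p \<in> \<Sigma>" "p \<in> X ==> p \<in> UI (S p)"
 using someI_ex[of "\<lambda>I. I \<in> \<Sigma> \<and> p \<in> UI I"] unfolding S_def by (auto simp: topspace_toric_top')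

lemma X_range: "p \<in> X ==> p \<in> range (ker_orbit \<beta>)" using S(2) UI_range by blast
lemma UI_X: "I \<in> \<Sigma> ==> p \<in> UI I ==> p \<in> X" using UI_topspace by blast
lemma act_X: "g \<in> torus ==> p \<in> X ==> act g p \<in> X" using S act_UI UI_X by blast

text \<open>In place of a quotient of a disjoint union, each vector over \<open>p\<close> is stored
  once, by its coordinates for the chosen simplex \<open>S p\<close>.\<close>

definition T :: "'e set" where "T = j ` (X \<times> C)"
definition pr :: "'e => (complex ^ 'm) set" where "pr e = fst (inv_into (X \<times> UNIV) j e)"
definition vc :: "'e => nat => complex" where "vc e = snd (inv_into (X \<times> UNIV) j e)"
definition TI :: "'m set => 'e set" where "TI I = {e \<in> T. pr e \<in> UI I}"
text \<open>Passage from the stored coordinates to those belonging to \<open>I\<close>;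
  \<open>ps I\<close> below is the way back.\<close>

definition \<Phi> :: "'m set => 'e => (complex ^ 'm) set \<times> (nat => complex)" where
 "\<Phi> I e = (pr e, tr I (S (pr e)) (pr e) (vc e))"
definition Y :: "'m set => ((complex ^ 'm) set \<times> (nat => complex), 'm + nat) mfd" where
 "Y I = prod_mfd (open_submfd Xm (UI I)) (cspace_mfd {..<r})"
definition ps :: "'m set => (complex ^ 'm) set \<times> (nat => complex) => 'e" where
 "ps I y = j (fst y, tr (S (fst y)) I (fst y) (snd y))"

lemma pr_j [simp]: "p \<in> X ==> pr (j (p, v)) = p" and vc_j [simp]: "p \<in> X ==> vc (j (p, v)) = v"
 using inv_into_f_f[OF j, of "(p, v)"] by (simp_all add: pr_def vc_def)

lemma j_T [simp]: "p \<in> X ==> v \<in> C ==> j (p, v) \<in> T" by (simp add: T_def)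

lemma T_cases: "e \<in> T ==> e = j (pr e, vc e) \<and> pr e \<in> X \<and> vc e \<in> C"
 unfolding T_def by auto

lemma \<Phi>_ps:
 assumes I: "I \<in> \<Sigma>" and K: "K \<in> \<Sigma>" and p: "p \<in> UI I" "p \<in> UI K"
 shows "\<Phi> K (ps I (p, w)) = (p, tr K I p w)"
 using tr_comp[OF K S(1) I p(2) S(2) p(1)] UI_X[OF I p(1)] by (simp add: \<Phi>_def ps_def)

lemma ps_\<Phi>:
 assumes I: "I \<in> \<Sigma>" and e: "e \<in> TI I" shows "ps I (\<Phi> I e) = e"
proof -
 have e': "e = j (pr e, vc e)" "pr e \<in> X" "vc e \<in> C" "pr e \<in> UI I" using e T_cases by (auto simp: TI_def)
 have "tr (S (pr e)) I (pr e) (tr I (S (pr e)) (pr e) (vc e)) = vc e"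
  using tr_comp[OF S(1) I S(1) S(2) _ S(2)] tr_id[OF S(1)] e' by simp
 then show ?thesis using e'(1) by (simp add: \<Phi>_def ps_def)
qed

lemma ps_TI: "I \<in> \<Sigma> ==> p \<in> UI I ==> ps I (p, w) \<in> TI I"
 using UI_X by (simp add: ps_def TI_def)

lemma pr_ps: "I \<in> \<Sigma> ==> p \<in> UI I ==> pr (ps I (p, w)) = p"
 using UI_X by (simp add: ps_def)

lemma inj_\<Phi>: "I \<in> \<Sigma> ==> inj_on (\<Phi> I) (TI I)"
 by (rule inj_on_inverseI[where g = "ps I"]) (rule ps_\<Phi>)

lemma \<Phi>_image:
 assumes I: "I \<in> \<Sigma>" shows "\<Phi> I ` {e \<in> TI I. pr e \<in> V} = (UI I \<inter> V) \<times> C"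
proof
 show "\<Phi> I ` {e \<in> TI I. pr e \<in> V} \<subseteq> (UI I \<inter> V) \<times> C" by (auto simp: \<Phi>_def TI_def)
 show "(UI I \<inter> V) \<times> C \<subseteq> \<Phi> I ` {e \<in> TI I. pr e \<in> V}"
 proof
  fix y assume "y \<in> (UI I \<inter> V) \<times> C"
  then obtain p w where y: "y = (p, w)" "p \<in> UI I" "p \<in> V" "w \<in> C" by blast
  have 1: "\<Phi> I (ps I (p, w)) = y" using \<Phi>_ps[OF I I y(2,2)] tr_id[OF I y(4)] y(1) by simp
  have 2: "ps I (p, w) \<in> {e \<in> TI I. pr e \<in> V}" using ps_TI[OF I y(2)] pr_ps[OF I y(2)] y(3) by simp
  show "y \<in> \<Phi> I ` {e \<in> TI I. pr e \<in> V}" using imageI[OF 2, of "\<Phi> I"] unfolding 1 .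
 qed
qed

lemma inv_\<Phi>: "I \<in> \<Sigma> ==> p \<in> UI I ==> w \<in> C ==> inv_into (TI I) (\<Phi> I) (p, w) = ps I (p, w)"
 by (rule inv_into_f_eq[OF inj_\<Phi> ps_TI]) (simp_all add: \<Phi>_ps tr_id)

lemma XU: "I \<in> \<Sigma> ==> reg_mfd b (open_submfd Xm (UI I))"
 using openin_toric_open by (intro reg_mfd_open_submfd reg_mfd_X) simp
lemma CM: "reg_mfd b (cspace_mfd {..<r})" by (rule reg_mfd_cspace) simp
lemma Y_mfd: "I \<in> \<Sigma> ==> reg_mfd b (Y I)" unfolding Y_def by (intro reg_mfd_prod XU CM)

lemma Y_topspace: "I \<in> \<Sigma> ==> tspace (Y I) = UI I \<times> C"
 using UI_topspace[of I] by (auto simp: Y_def)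

lemma TI_Int: "TI I \<inter> TI J = {e \<in> TI I. pr e \<in> UI J}" by (auto simp: TI_def)

lemma Y_overlap:
 assumes I: "I \<in> \<Sigma>" and J: "J \<in> \<Sigma>" shows "openin (mtop (Y I)) (\<Phi> I ` (TI I \<inter> TI J))"
proof -
 have "openin Xtop (UI I \<inter> UI J)" by (intro openin_Int openin_toric_open I J)
 then have "openin (subtopology Xtop (UI I)) (UI I \<inter> UI J)"
  unfolding openin_open_subtopology[OF openin_toric_open[OF I]] by blast
 moreover have "openin (cspace {..<r}) C" using openin_topspace[of "cspace {..<r}"] by simp
 ultimately show ?thesis unfolding TI_Int \<Phi>_image[OF I] Y_def by (simp add: openin_prod_Times_iff)
qed

lemma reg_map_into_Y:
 assumes I: "I \<in> \<Sigma>" and M: "reg_mfd b M" and p: "reg_map b M Xm p" "\<And>x. x \<in> tspace M ==> p x \<in> UI I"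
  and w: "\<And>k. k < r ==> regular b M (tspace M) (\<lambda>x. w x k)" "\<And>x. w x \<in> C"
 shows "reg_map b M (Y I) (\<lambda>x. (p x, w x))"
 unfolding Y_def
proof (rule reg_map_pair[OF M XU[OF I] CM])
 show "reg_map b M (open_submfd Xm (UI I)) p"
  using reg_map_into_submfd[OF M reg_mfd_X, of "UI I" p] openin_toric_open[OF I] p by auto
 show "reg_map b M (cspace_mfd {..<r}) w"
  unfolding reg_map_into_cspace[OF M finite_lessThan] using w by auto
qed

lemma reg_map_from_Y:
 assumes I: "I \<in> \<Sigma>" and M: "reg_mfd b M" and f: "reg_map b M (Y I) f"
 shows "reg_map b M Xm (\<lambda>x. fst (f x))" "k < r ==> regular b M (tspace M) (\<lambda>x. snd (f x) k)"
proof -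
 have 1: "reg_map b M (open_submfd Xm (UI I)) (\<lambda>x. fst (f x))"
  by (rule reg_map_compose[OF M Y_mfd[OF I] XU[OF I] f]) (unfold Y_def, rule reg_map_fst[OF XU[OF I] CM])
 then show "reg_map b M Xm (\<lambda>x. fst (f x))"
  using reg_map_into_submfd[OF M reg_mfd_X, of "UI I"] openin_toric_open[OF I] by auto
 have "reg_map b M (cspace_mfd {..<r}) (\<lambda>x. snd (f x))"
  by (rule reg_map_compose[OF M Y_mfd[OF I] CM f]) (unfold Y_def, rule reg_map_snd[OF XU[OF I] CM])
 then show "k < r ==> regular b M (tspace M) (\<lambda>x. snd (f x) k)"
  unfolding reg_map_into_cspace[OF M finite_lessThan] by blast
qed

lemma Y_trans:
 assumes I: "I \<in> \<Sigma>" and J: "J \<in> \<Sigma>"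
 shows "reg_map b (open_submfd (Y I) (\<Phi> I ` (TI I \<inter> TI J))) (Y J) (\<lambda>y. \<Phi> J (inv_into (TI I) (\<Phi> I) y))"
proof -
 let ?O = "\<Phi> I ` (TI I \<inter> TI J)" let ?M = "open_submfd (Y I) ?O"
 have O: "?O = (UI I \<inter> UI J) \<times> C" unfolding TI_Int by (rule \<Phi>_image[OF I])
 have M: "reg_mfd b ?M" by (rule reg_mfd_open_submfd[OF Y_mfd[OF I] Y_overlap[OF I J]])
 have tM: "tspace ?M = (UI I \<inter> UI J) \<times> C" using Y_topspace[OF I] O by auto
 have id: "reg_map b ?M (Y I) (\<lambda>y. y)"
  by (rule reg_map_from_submfd[OF Y_mfd[OF I] Y_mfd[OF I] Y_overlap[OF I J] reg_map_id[OF Y_mfd[OF I]]])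
 note f = reg_map_from_Y(1)[OF I M id] and s = reg_map_from_Y(2)[OF I M id]
 have "reg_map b ?M (Y J) (\<lambda>y. (fst y, tr J I (fst y) (snd y)))"
 proof (rule reg_map_into_Y[OF J M f])
  show "fst y \<in> UI J" if "y \<in> tspace ?M" for y using that unfolding tM by auto
  show "regular b ?M (tspace ?M) (\<lambda>y. tr J I (fst y) (snd y) k)" if "k < r" for k
  \<comment> \<open>Regularity is used over the simplex \<open>I \<inter> J\<close>: only for its
    vertices are both bases adapted to the filtration.\<close>
  proof (rule regular_tw[OF subset_in[OF I, of "I \<inter> J"] M f _ s that])
   show "fst y \<in> UI (I \<inter> J)" if "y \<in> tspace ?M" for y
    using that unfolding tM toric_open_Int[symmetric] by auto
  qed (use a_ge I J that in auto)
 qed simp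
 then show ?thesis
 proof (rule reg_map_cong[OF M Y_mfd[OF J]])
  fix y assume "y \<in> tspace ?M"
  then obtain p w where y: "y = (p, w)" "p \<in> UI I" "p \<in> UI J" "w \<in> C" unfolding tM by blast
  show "(fst y, tr J I (fst y) (snd y)) = \<Phi> J (inv_into (TI I) (\<Phi> I) y)"
   using inv_\<Phi>[OF I y(2,4)] \<Phi>_ps[OF I J y(2,3)] y(1) by simp
 qed
qed

lemma gluing: "gluing b \<Sigma> T TI \<Phi> Y"
proof (rule gluing.intro)
 show "T = (\<Union>I\<in>\<Sigma>. TI I)"
 proof
  show "T \<subseteq> (\<Union>I\<in>\<Sigma>. TI I)"
  proof
   fix e assume e: "e \<in> T"
   then have "pr e \<in> X" using T_cases by blast
   then show "e \<in> (\<Union>I\<in>\<Sigma>. TI I)" using S e by (auto simp: TI_def)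
  qed
 qed (auto simp: TI_def)
 show "\<Phi> I ` TI I = tspace (Y I)" if "I \<in> \<Sigma>" for I
  using \<Phi>_image[OF that, of UNIV] Y_topspace[OF that] by simp
qed (rule inj_\<Phi> Y_overlap Y_mfd Y_trans; assumption)+

end

section \<open>Vector space structure and torus action on the glued bundle\<close>

context space_bundle
begin

lemma continuous_character_of_chi: "continuous_character (chi \<nu>)"
proof -
 have "continuous_map (top_of_set torus) euclidean (chi \<nu>)"
  using regular_continuous[OF regular_chi[of False \<nu>]] by (simp add: subtopology_subtopology)
 then show ?thesis by (simp add: continuous_character_def chi_nonzero chi_mult)
qed

sublocale gl: gluing b \<Sigma> T TI \<Phi> Y by (rule gluing)

text \<open>Addition and scaling act on stored coordinates, since all trivializations are fibrewise
  linear. The torus acts by the characters of the simplex of the source point, and the result is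
  converted to the coordinates stored at the image point.\<close>

definition E :: "('m, 'n, 'e, 'z) toric_scheme" where
 "E = mk \<lparr>total = gl.gtop, proj = pr, fzero = (\<lambda>p. j (p, \<lambda>k\<in>{..<r}. 0)),
   fadd = (\<lambda>e e'. j (pr e, \<lambda>k\<in>{..<r}. vc e k + vc e' k)), fscale = (\<lambda>c e. j (pr e, \<lambda>k\<in>{..<r}. c * vc e k)),
   gact = (\<lambda>g e. j (act g (pr e), tr (S (act g (pr e))) (S (pr e)) (act g (pr e))
    (\<lambda>k\<in>{..<r}. chi (\<alpha> (S (pr e)) k) g * vc e k)))\<rparr> gl.gatlas"

lemma E_sel [simp]: "total E = gl.gtop" "proj E = pr" "fzero E p = j (p, \<lambda>k\<in>{..<r}. 0)"
 "fadd E e e' = j (pr e, \<lambda>k\<in>{..<r}. vc e k + vc e' k)" "fscale E c e = j (pr e, \<lambda>k\<in>{..<r}. c * vc e k)"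
 by (simp_all add: E_def)

lemma gact_E: "gact E g e = j (act g (pr e), tr (S (act g (pr e))) (S (pr e)) (act g (pr e))
    (\<lambda>k\<in>{..<r}. chi (\<alpha> (S (pr e)) k) g * vc e k))"
 by (simp add: E_def)

lemma tm_E: "tm E = gl.G"
 unfolding E_def tm_mk gl.G_def by simp

lemma part_TI: "part_over E (UI I) = TI I"
 by (simp add: part_over_def TI_def gl.topspace_gtop)

lemma part_fiber: "e \<in> part_over E {p} \<longleftrightarrow> p \<in> X \<and> (\<exists>v\<in>C. e = j (p, v))"
proof
 assume "e \<in> part_over E {p}"
 then have "e \<in> T" "pr e = p" by (auto simp: part_over_def gl.topspace_gtop)
 then show "p \<in> X \<and> (\<exists>v\<in>C. e = j (p, v))" using T_cases by blast
next
 assume "p \<in> X \<and> (\<exists>v\<in>C. e = j (p, v))"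
 then show "e \<in> part_over E {p}" by (auto simp: part_over_def gl.topspace_gtop)
qed

lemma fiber_module: "p \<in> X ==> cvector_space (fiber E p)"
proof (rule cvector_space_by_coords[where f = vc and r = r])
 assume p: "p \<in> X"
 show "bij_betw vc (carrier (fiber E p)) C"
 proof (rule bij_betw_imageI)
  show "inj_on vc (carrier (fiber E p))" using p by (auto simp: inj_on_def part_fiber)
  show "vc ` carrier (fiber E p) = C"
  proof
   show "vc ` carrier (fiber E p) \<subseteq> C" using p by (auto simp: part_fiber)
   show "C \<subseteq> vc ` carrier (fiber E p)"
   proof
    fix v assume "v \<in> C"
    then have "j (p, v) \<in> carrier (fiber E p)" using p by (auto simp: part_fiber)
    from imageI[OF this, of vc] show "v \<in> vc ` carrier (fiber E p)" using p by simp
   qed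
  qed
 qed
 show "\<zero>\<^bsub>fiber E p\<^esub> \<in> carrier (fiber E p)" using p by (auto simp: part_fiber)
 show "vc \<zero>\<^bsub>fiber E p\<^esub> k = 0" if "k < r" for k using p that by simp
 show "x \<oplus>\<^bsub>fiber E p\<^esub> y \<in> carrier (fiber E p)" if "x \<in> carrier (fiber E p)" "y \<in> carrier (fiber E p)" for x y
  using p that by (auto simp: part_fiber)
 show "vc (x \<oplus>\<^bsub>fiber E p\<^esub> y) k = vc x k + vc y k"
  if "x \<in> carrier (fiber E p)" "y \<in> carrier (fiber E p)" "k < r" for x y k
  using p that by (auto simp: part_fiber)
 show "c \<odot>\<^bsub>fiber E p\<^esub> x \<in> carrier (fiber E p)" if "x \<in> carrier (fiber E p)" for c x
  using p that by (auto simp: part_fiber)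
 show "vc (c \<odot>\<^bsub>fiber E p\<^esub> x) k = c * vc x k" if "x \<in> carrier (fiber E p)" "k < r" for c x k
  using p that by (auto simp: part_fiber)
qed

lemma triv_\<Phi>:
 assumes I: "I \<in> \<Sigma>" shows "triv E r (UI I) (\<Phi> I)"
proof -
 have "linear_over E r (UI I) (\<Phi> I)"
  unfolding linear_over_def
 proof (intro conjI ballI)
  show "fst (\<Phi> I e) = proj E e" for e by (simp add: \<Phi>_def)
  fix x assume "x \<in> UI I"
  then have x: "x \<in> X" by (rule UI_X[OF I])
  show "clinear_map (fiber E x) (cvec r) (\<lambda>e. snd (\<Phi> I e))"
   unfolding clinear_map_def using x by (auto simp: part_fiber \<Phi>_def tw_add tw_scale cvec_sel(2-))
 qed
 then show ?thesis using gl.reg_diffeo_\<Phi>[OF I] unfolding triv_def tm_E part_TI Y_def by blast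
qed

text \<open>The dependence on the chosen simplices cancels by the cocycle identity;
  \<open>tw_act\<close> then exchanges the characters of \<open>S (pr e)\<close> for those of
  \<open>I\<close>.\<close>

lemma \<Phi>_gact:
 assumes I: "I \<in> \<Sigma>" and e: "e \<in> TI I" and g: "g \<in> torus"
 shows "\<Phi> I (gact E g e) = (act g (pr e), \<lambda>k\<in>{..<r}. chi (\<alpha> I k) g * snd (\<Phi> I e) k)"
proof -
 have p: "pr e \<in> X" "pr e \<in> UI I" using e T_cases by (auto simp: TI_def)
 have q: "act g (pr e) \<in> X" "act g (pr e) \<in> UI I" "act g (pr e) \<in> UI (S (pr e))"
  using act_X[OF g p(1)] act_UI[OF g] p S by blast+
 let ?p = "pr e" and ?q = "act g (pr e)"
 let ?w = "\<lambda>k\<in>{..<r}. chi (\<alpha> (S ?p) k) g * vc e k"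
 have "\<Phi> I (gact E g e) = (?q, tr I (S ?q) ?q (tr (S ?q) (S ?p) ?q ?w))"
  by (simp only: gact_E \<Phi>_def pr_j[OF q(1)] vc_j[OF q(1)])
 also have "\<dots> = (?q, tr I (S ?p) ?q ?w)"
  by (simp only: tr_comp[OF I S(1)[OF q(1)] S(1)[OF p(1)] q(2) S(2)[OF q(1)] q(3)])
 also have "\<dots> = (?q, \<lambda>k\<in>{..<r}. chi (\<alpha> I k) g * snd (\<Phi> I e) k)"
  by (simp only: tw_act[OF g X_range[OF p(1)]] \<Phi>_def snd_conv)
 finally show ?thesis .
qed

lemma gact_TI:
 assumes I: "I \<in> \<Sigma>" and e: "e \<in> TI I" and g: "g \<in> torus" shows "gact E g e \<in> TI I" "pr (gact E g e) = act g (pr e)"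
proof -
 have p: "pr e \<in> X" "pr e \<in> UI I" using e T_cases by (auto simp: TI_def)
 have q: "act g (pr e) \<in> X" "act g (pr e) \<in> UI I" using act_X[OF g p(1)] act_UI[OF g p(2)] by blast+
 then show "gact E g e \<in> TI I" "pr (gact E g e) = act g (pr e)" by (simp_all add: gact_E TI_def)
qed

lemma TI_S: "e \<in> T ==> S (pr e) \<in> \<Sigma>" "e \<in> T ==> e \<in> TI (S (pr e))"
 using T_cases S by (auto simp: TI_def)

lemma \<Phi>_inj: "I \<in> \<Sigma> ==> e \<in> TI I ==> e' \<in> TI I ==> \<Phi> I e = \<Phi> I e' ==> e = e'"
 using inj_\<Phi> by (auto simp: inj_on_def)

lemma equivariant_E: "equivariant act E"
 unfolding equivariant_def
proof (intro conjI ballI)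
 fix g :: "complex ^ 'n" and e assume g: "g \<in> torus" and "e \<in> topspace (total E)"
 then have e: "e \<in> T" by (simp add: gl.topspace_gtop)
 note S' = TI_S[OF e]
 show "gact E g e \<in> topspace (total E)" "proj E (gact E g e) = act g (proj E e)"
  using gact_TI[OF S' g] by (simp_all add: gl.topspace_gtop TI_def)
next
 fix e assume "e \<in> topspace (total E)"
 then have e: "e \<in> T" by (simp add: gl.topspace_gtop)
 note S' = TI_S[OF e]
 have o: "(1 :: complex ^ 'n) \<in> torus" by (simp add: torus_def)
 have p: "pr e \<in> X" using T_cases[OF e] by blast
 show "gact E 1 e = e"
 proof (rule \<Phi>_inj[OF S'(1) gact_TI(1)[OF S' o] S'(2)])
  show "\<Phi> (S (pr e)) (gact E 1 e) = \<Phi> (S (pr e)) e"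
   unfolding \<Phi>_gact[OF S' o] using act_one[OF X_range[OF p]] by (simp add: \<Phi>_def C_eta)
 qed
next
 fix g h :: "complex ^ 'n" and e assume g: "g \<in> torus" and h: "h \<in> torus" and "e \<in> topspace (total E)"
 then have e: "e \<in> T" by (simp add: gl.topspace_gtop)
 note S' = TI_S[OF e]
 have gh: "g * h \<in> torus" using g h by (simp add: torus_def)
 have p: "pr e \<in> X" using T_cases[OF e] by blast
 note h' = gact_TI[OF S' h]
 show "gact E (g * h) e = gact E g (gact E h e)"
 proof (rule \<Phi>_inj[OF S'(1) gact_TI(1)[OF S' gh] gact_TI(1)[OF S'(1) h'(1) g]])
  show "\<Phi> (S (pr e)) (gact E (g * h) e) = \<Phi> (S (pr e)) (gact E g (gact E h e))"
   unfolding \<Phi>_gact[OF S' gh] \<Phi>_gact[OF S'(1) h'(1) g] \<Phi>_gact[OF S' h] h'(2)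
   using act_mult[OF g h X_range[OF p]] by (auto simp: chi_mult mult.assoc intro!: restrict_ext)
 qed
next
 fix g :: "complex ^ 'n" and p assume g: "g \<in> torus" and "p \<in> proj E ` topspace (total E)"
 then have p: "p \<in> X" using T_cases by (auto simp: gl.topspace_gtop)
 have q: "act g p \<in> X" by (rule act_X[OF g p])
 have 1: "(\<lambda>k\<in>{..<r}. chi (\<alpha> (S p) k) g * (\<lambda>k\<in>{..<r}. v k + w k) k)
   = (\<lambda>k\<in>{..<r}. (\<lambda>k\<in>{..<r}. chi (\<alpha> (S p) k) g * v k) k + (\<lambda>k\<in>{..<r}. chi (\<alpha> (S p) k) g * w k) k)" for v w
  by (rule restrict_ext) (simp add: distrib_left)
 have 2: "(\<lambda>k\<in>{..<r}. chi (\<alpha> (S p) k) g * (\<lambda>k\<in>{..<r}. c * v k) k)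
   = (\<lambda>k\<in>{..<r}. c * (\<lambda>k\<in>{..<r}. chi (\<alpha> (S p) k) g * v k) k)" for c v
  by (rule restrict_ext) simp
 show "clinear_map (fiber E p) (fiber E (act g p)) (gact E g)"
  unfolding clinear_map_def
 proof (intro conjI ballI allI funcsetI)
  show "gact E g e \<in> carrier (fiber E (act g p))" if "e \<in> carrier (fiber E p)" for e
   using that p q by (auto simp: part_fiber gact_E)
  show "gact E g (e \<oplus>\<^bsub>fiber E p\<^esub> e') = gact E g e \<oplus>\<^bsub>fiber E (act g p)\<^esub> gact E g e'"
   if ee: "e \<in> carrier (fiber E p)" "e' \<in> carrier (fiber E p)" for e e'
  proof -
   obtain v w where "e = j (p, v)" "e' = j (p, w)" using ee by (auto simp: part_fiber)
   then show ?thesis using p q by (simp only: fiber_sel E_sel gact_E pr_j vc_j 1 tw_add)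
  qed
  show "gact E g (c \<odot>\<^bsub>fiber E p\<^esub> e) = c \<odot>\<^bsub>fiber E (act g p)\<^esub> gact E g e"
   if ee: "e \<in> carrier (fiber E p)" for c e
  proof -
   obtain v where "e = j (p, v)" using ee by (auto simp: part_fiber)
   then show ?thesis using p q by (simp only: fiber_sel E_sel gact_E pr_j vc_j 2 tw_scale)
  qed
 qed
qed

lemma G_TI: "I \<in> \<Sigma> ==> reg_mfd b (open_submfd gl.G (TI I))"
 using gl.TI_open by (intro reg_mfd_open_submfd gl.reg_mfd_G) simp

lemma topspace_G_TI: "I \<in> \<Sigma> ==> tspace (open_submfd gl.G (TI I)) = TI I"
 using openin_subset[OF gl.TI_open] by auto

lemma reg_map_\<Phi>: "I \<in> \<Sigma> ==> reg_map b (open_submfd gl.G (TI I)) (Y I) (\<Phi> I)"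
 using gl.reg_diffeo_\<Phi> by (simp add: reg_diffeo_def)

lemma reg_map_inv_\<Phi>:
 assumes I: "I \<in> \<Sigma>" shows "reg_map b (Y I) gl.G (inv_into (TI I) (\<Phi> I))"
proof -
 have "reg_map b (Y I) (open_submfd gl.G (TI I)) (inv_into (TI I) (\<Phi> I))"
  using gl.reg_diffeo_\<Phi>[OF I] unfolding reg_diffeo_def topspace_G_TI[OF I] by blast
 then show ?thesis
  using reg_map_into_submfd[OF Y_mfd[OF I] gl.reg_mfd_G, of "TI I"] gl.TI_open[OF I] by auto
qed

lemma reg_map_pr: "reg_map b gl.G Xm pr"
proof (rule reg_map_local[OF gl.reg_mfd_G reg_mfd_X])
 fix e assume "e \<in> tspace gl.G"
 then have "e \<in> T" by (simp add: gl.topspace_gtop)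
 note S' = TI_S[OF this]
 have "reg_map b (open_submfd gl.G (TI (S (pr e)))) Xm pr"
  using reg_map_from_Y(1)[OF S'(1) G_TI[OF S'(1)] reg_map_\<Phi>[OF S'(1)]] by (simp add: \<Phi>_def)
 then show "\<exists>W. openin (mtop gl.G) W \<and> e \<in> W \<and> reg_map b (open_submfd gl.G W) Xm pr"
  using S' gl.TI_open by auto
qed

text \<open>Over \<open>U\<^sub>I\<close> the action in coordinates is the action on the base
  together with multiplication by characters, and both are already known to be regular.\<close>

lemma reg_map_gact: "reg_map b (prod_mfd (vec_mfd (torus :: (complex ^ 'n) set)) gl.G) gl.G (\<lambda>(g, e). gact E g e)"
proof -
 let ?t = "vec_mfd (torus :: (complex ^ 'n) set)"
 have t: "reg_mfd b ?t" by (rule reg_mfd_vec[OF open_torus])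
 have P: "reg_mfd b (prod_mfd ?t gl.G)" by (rule reg_mfd_prod[OF t gl.reg_mfd_G])
 show ?thesis
 proof (rule reg_map_local[OF P gl.reg_mfd_G])
  fix x assume "x \<in> tspace (prod_mfd ?t gl.G)"
  then obtain g0 e0 where x: "x = (g0, e0)" "g0 \<in> torus" "e0 \<in> T" by (auto simp: gl.topspace_gtop)
  define I where "I = S (pr e0)"
  have I: "I \<in> \<Sigma>" "e0 \<in> TI I" using TI_S[OF x(3)] by (simp_all add: I_def)
  let ?W = "torus \<times> TI I" let ?M = "open_submfd (prod_mfd ?t gl.G) ?W"
  have W: "openin (mtop (prod_mfd ?t gl.G)) ?W"
   using gl.TI_open[OF I(1)] openin_topspace[of "top_of_set torus"] by (simp add: openin_prod_Times_iff)
  have M: "reg_mfd b ?M" by (rule reg_mfd_open_submfd[OF P W])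
  have tM: "tspace ?M = ?W" using openin_subset[OF W] by auto
  have f: "reg_map b ?M ?t fst"
   by (rule reg_map_from_submfd[OF P t W reg_map_fst[OF t gl.reg_mfd_G]])
  have s: "reg_map b ?M gl.G snd"
   by (rule reg_map_from_submfd[OF P gl.reg_mfd_G W reg_map_snd[OF t gl.reg_mfd_G]])
  have oTI: "openin (mtop gl.G) (TI I)" using gl.TI_open[OF I(1)] by simp
  have "snd ` tspace ?M \<subseteq> TI I" unfolding tM by auto
  then have "reg_map b ?M (open_submfd gl.G (TI I)) snd"
   unfolding reg_map_into_submfd[OF M gl.reg_mfd_G oTI] using s by blast
  from reg_map_compose[OF M G_TI[OF I(1)] Y_mfd[OF I(1)] this reg_map_\<Phi>[OF I(1)]]
  have \<Phi>s: "reg_map b ?M (Y I) (\<lambda>x. \<Phi> I (snd x))" .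
  have pr: "reg_map b ?M Xm (\<lambda>x. pr (snd x))"
   by (rule reg_map_compose[OF M gl.reg_mfd_G reg_mfd_X s reg_map_pr])
  have "reg_map b ?M Xm (\<lambda>x. act (fst (fst x, pr (snd x))) (snd (fst x, pr (snd x))))"
   by (rule reg_map_compose[OF M reg_mfd_prod[OF t reg_mfd_X] reg_mfd_X reg_map_pair[OF M t reg_mfd_X f pr] reg_map_act])
  then have ac: "reg_map b ?M Xm (\<lambda>x. act (fst x) (pr (snd x)))" by simp
  let ?w = "\<lambda>x. \<lambda>k\<in>{..<r}. chi (\<alpha> I k) (fst x) * snd (\<Phi> I (snd x)) k"
  have "reg_map b ?M (Y I) (\<lambda>x. (act (fst x) (pr (snd x)), ?w x))"
  proof (rule reg_map_into_Y[OF I(1) M ac])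
   show "act (fst x) (pr (snd x)) \<in> UI I" if "x \<in> tspace ?M" for x
    using that unfolding tM by (auto simp: TI_def intro: act_UI)
   show "regular b ?M (tspace ?M) (\<lambda>x. ?w x k)" if k: "k < r" for k
   proof -
    have "preim ?M fst torus = tspace ?M" unfolding preim_def tM by auto
    then have "regular b ?M (tspace ?M) (\<lambda>x. chi (\<alpha> I k) (fst x))"
     using regular_pullback[OF M t f regular_chi] by metis
    from regular_mult[OF this reg_map_from_Y(2)[OF I(1) M \<Phi>s k]] show ?thesis using k by simp
   qed
  qed simp
  from reg_map_compose[OF M Y_mfd[OF I(1)] gl.reg_mfd_G this reg_map_inv_\<Phi>[OF I(1)]]
  have "reg_map b ?M gl.G (\<lambda>x. inv_into (TI I) (\<Phi> I) (act (fst x) (pr (snd x)), ?w x))" .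
  then have "reg_map b ?M gl.G (\<lambda>(g, e). gact E g e)"
  proof (rule reg_map_cong[OF M gl.reg_mfd_G])
   fix x assume "x \<in> tspace ?M"
   then obtain g e where x: "x = (g, e)" "g \<in> torus" "e \<in> TI I" unfolding tM by blast
   show "inv_into (TI I) (\<Phi> I) (act (fst x) (pr (snd x)), ?w x) = (\<lambda>(g, e). gact E g e) x"
    using gl.inv_\<Phi>[OF I(1) gact_TI(1)[OF I(1) x(3,2)]] \<Phi>_gact[OF I(1) x(3,2)] x(1) by simp
  qed
  then show "\<exists>W. openin (mtop (prod_mfd ?t gl.G)) W \<and> x \<in> W \<and> reg_map b (open_submfd (prod_mfd ?t gl.G) W) gl.G (\<lambda>(g, e). gact E g e)"
   using W x I(2) by blast
 qed
qed

lemma kly_E: "kly r E"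
 unfolding kly_def tm_E E_sel
proof (intro conjI ballI)
 show "reg_mfd b gl.G" by (rule gl.reg_mfd_G)
 show "reg_map b gl.G Xm pr" by (rule reg_map_pr)
 show "cvector_space (fiber E x)" if "x \<in> X" for x by (rule fiber_module[OF that])
 show "\<exists>U \<Phi>. openin Xtop U \<and> x \<in> U \<and> triv E r U \<Phi>" if "x \<in> X" for x
  by (intro exI[of _ "UI (S x)"] exI[of _ "\<Phi> (S x)"] conjI openin_toric_open triv_\<Phi> S that)
 show "equivariant act E" by (rule equivariant_E)
 show "reg_map b (prod_mfd (vec_mfd torus) gl.G) gl.G (\<lambda>(g, e). gact E g e)" by (rule reg_map_gact)
 fix I assume I: "I \<in> \<Sigma>"
 have "diagonalizes E r (UI I) (\<Phi> I)"
  unfolding diagonalizes_def part_TI using \<Phi>_gact[OF I]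
  by (intro exI[of _ "\<lambda>k. chi (\<alpha> I k)"]) (simp add: continuous_character_of_chi)
 then show "\<exists>\<Phi>. triv E r (UI I) \<Phi> \<and> diagonalizes E r (UI I) \<Phi>" using triv_\<Phi>[OF I] by blast
qed

lemma ctriv_E: "I \<in> \<Sigma> ==> ctriv E r I (\<Phi> I) (\<alpha> I)"
 unfolding ctriv_def part_TI by (simp add: triv_\<Phi> \<Phi>_gact)

lemma ex_linked: "\<exists>E t. linked E B t"
proof -
 have S0: "S x0 \<in> \<Sigma>" by (rule S(1)[OF x0_topspace])
 interpret c: coordinates "kspace B" r "u (S x0)" by (rule co[OF S0])
 define i where "i = inv_into (carrier (kspace B)) (u (S x0))"
 define t where "t e = i (vc e)" for e
 have tj: "t (j (x0, v)) = i v" for v using x0_topspace by (simp add: t_def)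
 have f0: "e \<in> part_over E {x0} \<longleftrightarrow> (\<exists>v\<in>C. e = j (x0, v))" for e using part_fiber x0_topspace by simp
 have ii: "i v \<in> carrier (kspace B)" "u (S x0) (i v) = v" if "v \<in> C" for v
  using c.u_inv[OF that] by (simp_all add: i_def)
 have lin: "clinear_map (cvec r) (kspace B) i" unfolding i_def by (rule clinear_map_inverse[OF c.M c.u c.bij])
 have "clinear_map (fiber E x0) (cvec r) vc"
  unfolding clinear_map_def using x0_topspace by (auto simp: part_fiber cvec_sel(2-))
 from clinear_map_compose[OF this lin] have "clinear_map (fiber E x0) (kspace B) t" unfolding t_def[abs_def] .
 moreover have "bij_betw t (part_over E {x0}) (carrier (kspace B))"
 proof (rule bij_betw_imageI)
  show "inj_on t (part_over E {x0})"
  proof (rule inj_onI)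
   fix e e' assume "e \<in> part_over E {x0}" "e' \<in> part_over E {x0}" "t e = t e'"
   then obtain v w where "v \<in> C" "e = j (x0, v)" "w \<in> C" "e' = j (x0, w)" "i v = i w" using f0 tj by auto
   then show "e = e'" using ii(2) by metis
  qed
  show "t ` part_over E {x0} = carrier (kspace B)"
  proof
   show "t ` part_over E {x0} \<subseteq> carrier (kspace B)" using f0 tj ii(1) by auto
   show "carrier (kspace B) \<subseteq> t ` part_over E {x0}"
   proof
    fix x assume x: "x \<in> carrier (kspace B)"
    have "j (x0, u (S x0) x) \<in> part_over E {x0}" using f0 c.u_carrier[OF x] by blast
    moreover have "t (j (x0, u (S x0) x)) = x" using tj c.inv_u[OF x] by (simp add: i_def)
    ultimately show "x \<in> t ` part_over E {x0}" by force
   qed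
  qed
 qed
 moreover have "kfil B k \<mu> = t ` fil E k \<mu>" for k \<mu>
 proof -
  have iff: "e \<in> fil E k \<mu> \<longleftrightarrow> t e \<in> kfil B k \<mu>" if e: "e \<in> part_over E {x0}" for e
  proof -
   obtain v where v: "v \<in> C" "e = j (x0, v)" using e f0 by blast
   \<comment> \<open>At the base point every \<open>Xi\<close> equals 1, so the trivialization over
     the star of the vertex \<open>k\<close> reduces to the constant change of basis.\<close>
   have "snd (\<Phi> {k} e) l = u {k} (i v) l" if l: "l < r" for l
    using a_change[OF vertex_in S0 ii(1)[OF v(1)] l] v l x0_topspace by (simp add: \<Phi>_def tw_def ii(2))
   then show ?thesis
    unfolding fil_iff[OF kly_E vertex_in ctriv_E[OF vertex_in] singletonI e] kfil_iff[OF vertex_in singletonI]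
    using v tj ii(1) by simp
  qed
  show ?thesis
  proof
   show "t ` fil E k \<mu> \<subseteq> kfil B k \<mu>" using iff fil_subset by blast
   show "kfil B k \<mu> \<subseteq> t ` fil E k \<mu>"
   proof
    fix x assume x: "x \<in> kfil B k \<mu>"
    then have "x \<in> carrier (kspace B)" using kfil_iff[OF vertex_in singletonI] by blast
    then obtain e where e: "e \<in> part_over E {x0}" "x = t e"
     using \<open>bij_betw t (part_over E {x0}) (carrier (kspace B))\<close> by (auto simp: bij_betw_def)
    then show "x \<in> t ` fil E k \<mu>" using iff x by blast
   qed
  qed
 qed
 moreover have "klyachko_space (ge_reg b) \<Sigma> \<beta> B"
  using kc by (intro klyachko_spaceI empty_in vertex_in) blast
 ultimately show ?thesis using kly_E unfolding linked_def by blast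
qed

end

section \<open>The equivalences\<close>

lemma inj_complex_into_nat_set: "\<exists>c :: complex => nat set. inj c"
proof -
 obtain f :: "real => nat set" where f: "inj f"
  using nat_sets_eqpoll_reals eqpoll_sym unfolding eqpoll_def by (metis bij_betw_imp_inj_on)
 have "inj (\<lambda>z. sum_encode ` (f (Re z) <+> f (Im z)))"
 proof (rule injI)
  fix z w assume "sum_encode ` (f (Re z) <+> f (Im z)) = sum_encode ` (f (Re w) <+> f (Im w))"
  then have 1: "f (Re z) <+> f (Im z) = f (Re w) <+> f (Im w)" using inj_sum_encode by (simp add: inj_image_eq_iff)
  have "Inl -` (A <+> A') = A" "Inr -` (A <+> A') = A'" for A A' :: "nat set" by auto
  then have "f (Re z) = f (Re w)" "f (Im z) = f (Im w)" using 1 by metis+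
  then show "z = w" using f by (simp add: inj_def complex_eq_iff)
 qed
 then show ?thesis by blast
qed

text \<open>Complex numbers are coded by sets of naturals, a sequence of such sets by one set
  through pairing, and sets of naturals by reals: the continuum absorbs countable powers.\<close>

lemma inj_sequences_into_complex: "\<exists>c :: (nat => complex) => complex. inj c"
proof -
 obtain c :: "complex => nat set" where c: "inj c" using inj_complex_into_nat_set by blast
 obtain h :: "nat set => real" where h: "inj h"
  using nat_sets_eqpoll_reals unfolding eqpoll_def by (metis bij_betw_imp_inj_on)
 have "inj (\<lambda>w. complex_of_real (h (prod_encode ` (SIGMA n:UNIV. c (w n)))))"
 proof (rule injI)
  fix v w assume "complex_of_real (h (prod_encode ` (SIGMA n:UNIV. c (v n)))) = complex_of_real (h (prod_encode ` (SIGMA n:UNIV. c (w n))))"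
  then have 1: "(SIGMA n:UNIV. c (v n)) = (SIGMA n:UNIV. c (w n))"
   using h inj_prod_encode by (simp add: inj_eq inj_image_eq_iff)
  have "c (v n) = c (w n)" for n
  proof -
   have "Pair n -` (SIGMA n:UNIV. c (v n)) = c (v n)" for v by auto
   then show ?thesis using 1 by metis
  qed
  then show "v = w" using c by (simp add: inj_def fun_eq_iff)
 qed
 then show ?thesis by blast
qed

lemma inj_points_into_complex: "\<exists>c :: (complex ^ 'm::finite) \<times> (nat => complex) => complex. inj c"
proof -
 obtain c :: "(nat => complex) => complex" where c: "inj c" using inj_sequences_into_complex by blast
 define d :: "(complex ^ 'm) \<times> (nat => complex) => complex" where
  "d x = c (\<lambda>n. if n = 0 then c (\<lambda>k. fst x $ from_nat k) else snd x (n - 1))" for x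
 have "inj d"
 proof (rule injI)
  fix x y assume "d x = d y"
  then have eq: "(\<lambda>n. if n = 0 then c (\<lambda>k. fst x $ from_nat k) else snd x (n - 1))
    = (\<lambda>n. if n = 0 then c (\<lambda>k. fst y $ from_nat k) else snd y (n - 1))"
   using c by (simp add: d_def inj_eq)
  have "(\<lambda>k. fst x $ from_nat k) = (\<lambda>k. fst y $ from_nat k)"
   using fun_cong[OF eq, of 0] c by (simp add: inj_eq)
  then have "fst x $ i = fst y $ i" for i using fun_cong[of _ _ "to_nat i"] by fastforce
  moreover have "snd x n = snd y n" for n using fun_cong[OF eq, of "Suc n"] by simp
  ultimately show "x = y" by (simp add: prod_eq_iff vec_eq_iff fun_eq_iff)
 qed
 then show ?thesis by blast
qed

lemma (in toric_bundles) bcat_equivalence: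
 fixes jv :: "complex => 'v" and je :: "complex => 'e"
  and mk :: "((complex ^ 'm) set, complex ^ 'n, 'e) eq_bundle => ('e, nat) atlas =>
   ('m, 'n, 'e, 'z) toric_scheme"
 assumes jv: "inj jv" and je: "inj je"
  and mk: "\<And>E A. total (mk E A) = total E" "\<And>E A. proj (mk E A) = proj E" "\<And>E A. fzero (mk E A) = fzero E"
   "\<And>E A. fadd (mk E A) = fadd E" "\<And>E A. fscale (mk E A) = fscale E" "\<And>E A. gact (mk E A) = gact E"
   "\<And>E A. tm (mk E A) = \<lparr>mtop = total E, matlas = (if b then A else {})\<rparr>"
 shows "equivalent_categories bcat (KVS (ge_reg b) \<Sigma> \<beta> :: (('m, 'v) kvs, 'v => 'v) cat)"
proof -
 obtain c :: "(nat => complex) => complex" where c: "inj c" using inj_sequences_into_complex by blast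
 obtain d :: "(complex ^ 'm) \<times> (nat => complex) => complex" where d: "inj d" using inj_points_into_complex by blast
 \<comment> \<open>A point of the toric manifold is an orbit, and the type of all sets of vectors is
   too large for \<open>'e\<close>. One representative determines the orbit, so the encoding is
   injective on actual points, which is why \<open>space_bundle\<close> asks for injectivity only
   there.\<close>
 define j where "j y = je (d (SOME z. z \<in> fst y, snd y))" for y
 have "inj (\<lambda>w. jv (c w))" using inj_compose[OF jv c] by (simp add: o_def)
 then show ?thesis
 proof (rule bcat_equivalent_KVS)
  fix B :: "('m, 'v) kvs" assume "klyachko_space (ge_reg b) \<Sigma> \<beta> B"
  then obtain r where "\<forall>I\<in>\<Sigma>. \<exists>u \<alpha>. kcoords (ge_reg b) \<beta> B r I u \<alpha>"
   using klyachko_space_rank empty_in by blast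
  then have "\<forall>I\<in>\<Sigma>. \<exists>x. kcoords (ge_reg b) \<beta> B r I (fst x) (snd x)" by simp
  from bchoice[OF this] obtain x where x: "\<And>I. I \<in> \<Sigma> ==> kcoords (ge_reg b) \<beta> B r I (fst (x I)) (snd (x I))" by blast
  interpret space_bundle \<Sigma> \<beta> b tm mk j B r "\<lambda>I. fst (x I)" "\<lambda>I. snd (x I)"
  proof (rule space_bundle.intro[OF toric_bundles_axioms], rule space_bundle_axioms.intro)
   show "inj_on j (topspace Xtop \<times> UNIV)"
   proof (rule inj_onI)
    fix y y' assume y: "y \<in> topspace Xtop \<times> UNIV" "y' \<in> topspace Xtop \<times> UNIV" "j y = j y'"
    have 1: "(SOME z. z \<in> fst y) = (SOME z. z \<in> fst y')" "snd y = snd y'"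
     using y(3) je d by (simp_all add: j_def inj_eq)
    have "fst y = ker_orbit \<beta> (SOME z. z \<in> fst y)" if y: "y \<in> topspace Xtop \<times> (UNIV :: (nat => complex) set)" for y
    proof -
     obtain z where z: "fst y = ker_orbit \<beta> z" using y by (auto simp: topspace_toric_top)
     have "(SOME z. z \<in> fst y) \<in> fst y" using ker_orbit_self unfolding z by (rule someI)
     then show ?thesis using ker_orbit_mem unfolding z by blast
    qed
    then have "fst y = fst y'" using y(1,2) 1(1) by metis
    then show "y = y'" using 1(2) by (simp add: prod_eq_iff)
   qed
  qed (use mk x in auto)
  show "\<exists>E u. linked E B u" by (rule ex_linked)
 qed
qed

text \<open>Objects are confined to the types \<open>'e\<close> and \<open>'v\<close>. The two
  injections provide room of the size of the continuum, enough for a bundle realizing any given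
  space and for a copy of the base fibre of any given bundle.\<close>

theorem theorem1p2:
  fixes \<Sigma> :: "'m::finite set set" and \<beta> :: "'m \<Rightarrow> rr ^ 'n"
  assumes fan: "nonsingular_fan \<Sigma> \<beta>"
    and universe_e: "\<exists>j :: complex \<Rightarrow> 'e. inj j"
    and universe_v: "\<exists>j :: complex \<Rightarrow> 'v. inj j"
  shows "equivalent_categories
           (TKVB \<Sigma> \<beta> :: (('m, 'n, 'e) toric_bundle, 'e \<Rightarrow> 'e) cat)
           (TKVS \<Sigma> \<beta> :: (('m, 'v) kvs, 'v \<Rightarrow> 'v) cat) \<and>
         equivalent_categories
           (SKVB \<Sigma> \<beta> :: (('m, 'n, 'e) smooth_toric_bundle, 'e \<Rightarrow> 'e) cat)
           (SKVS \<Sigma> \<beta> :: (('m, 'v) kvs, 'v \<Rightarrow> 'v) cat)"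
proof
 obtain je :: "complex => 'e" where je: "inj je" using universe_e by blast
 obtain jv :: "complex => 'v" where jv: "inj jv" using universe_v by blast
 interpret toric \<Sigma> \<beta> by (rule toric.intro[OF fan])
 show "equivalent_categories (TKVB \<Sigma> \<beta> :: (('m, 'n, 'e) toric_bundle, 'e => 'e) cat)
   (TKVS \<Sigma> \<beta> :: (('m, 'v) kvs, 'v => 'v) cat)"
 proof -
  \<comment> \<open>A topological bundle carries no atlas; for \<open>b = False\<close> only the
    topology of \<open>tm E\<close> is consulted, so an empty atlas stands in.\<close>
  define tm :: "('m, 'n, 'e) toric_bundle => ('e, nat) mfd" where "tm E = \<lparr>mtop = total E, matlas = {}\<rparr>" for E
  interpret t: toric_bundles \<Sigma> \<beta> False tm by standard (simp add: tm_def)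
  have triv: "t.triv E r U \<Phi> \<longleftrightarrow> top_trivialization (toric_top \<Sigma> \<beta>) E r U \<Phi>" for E r U \<Phi>
   by (simp add: t.triv_def top_trivialization_def reg_diffeo_False)
  have "t.kly r E \<longleftrightarrow> top_klyachko_bundle \<Sigma> \<beta> r E" for r E
   by (simp add: t.kly_def triv top_klyachko_bundle_def top_vector_bundle_def reg_map_def reg_mfd_def conj_assoc)
  moreover have "t.hom E F = {f. equivariant_morphism E F f \<and> continuous_map (total E) (total F) f}" for E F
   by (simp add: t.hom_def reg_map_def)
  ultimately have "t.bcat = TKVB \<Sigma> \<beta>" by (simp add: t.bcat_def TKVB_def fun_eq_iff)
  moreover have "equivalent_categories t.bcat (KVS (ge_reg False) \<Sigma> \<beta> :: (('m, 'v) kvs, 'v => 'v) cat)"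
   by (rule t.bcat_equivalence[OF jv je, where mk = "\<lambda>E A. E"]) (simp_all add: tm_def)
  ultimately show ?thesis by (simp add: TKVS_def ge_reg_def)
 qed
 show "equivalent_categories (SKVB \<Sigma> \<beta> :: (('m, 'n, 'e) smooth_toric_bundle, 'e => 'e) cat)
   (SKVS \<Sigma> \<beta> :: (('m, 'v) kvs, 'v => 'v) cat)"
 proof -
  interpret s: toric_bundles \<Sigma> \<beta> True "total_mfd :: ('m, 'n, 'e) smooth_toric_bundle => ('e, nat) mfd"
   by standard (simp add: total_mfd_def)
  have triv: "s.triv E r U \<Phi> \<longleftrightarrow> smooth_trivialization (toric_mfd \<Sigma> \<beta>) E r U \<Phi>" for E r U \<Phi>
   by (simp add: s.triv_def smooth_trivialization_def reg_diffeo_True)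
  have "s.kly r E \<longleftrightarrow> smooth_klyachko_bundle \<Sigma> \<beta> r E" for r E
   by (simp add: s.kly_def triv smooth_klyachko_bundle_def smooth_vector_bundle_def reg_map_def reg_mfd_def torus_mfd_vec conj_assoc)
  moreover have "s.hom E F = {f. equivariant_morphism E F f \<and> smooth_map (total_mfd E) (total_mfd F) f}" for E F
   by (simp add: s.hom_def reg_map_def)
  ultimately have "s.bcat = SKVB \<Sigma> \<beta>" by (simp add: s.bcat_def SKVB_def fun_eq_iff)
  moreover have "equivalent_categories s.bcat (KVS (ge_reg True) \<Sigma> \<beta> :: (('m, 'v) kvs, 'v => 'v) cat)"
   by (rule s.bcat_equivalence[OF jv je, where mk = "\<lambda>E A. \<lparr>total = total E, proj = proj E, fzero = fzero E,
      fadd = fadd E, fscale = fscale E, gact = gact E, batlas = A\<rparr>"]) (simp_all add: total_mfd_def)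
  ultimately show ?thesis by (simp add: SKVS_def ge_reg_def)
 qed
qed

end
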